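(* Let $(A,\mathfrak m)$ and $(B,\mathfrak n)$ be two commutative Noetherian local algebras over a field $\Bbbk$ such that $A\otimes_\Bbbk B$ is Noetherian. Suppose that $\Bbbk$ is the common residue field of both $A$ and $B$, and that either $A$ or $B$ is algebraic over $\Bbbk$. Let $L$ and $N$ be nonzero finitely generated modules over $A$ and $B$, respectively, and let $\mathfrak M=\mathfrak m\otimes_\Bbbk B+A\otimes_\Bbbk\mathfrak n$. Then $$\operatorname{f}_{\mathfrak M}(L\otimes_\Bbbk N)=\min\{\operatorname{depth}_A L+\operatorname{f}_{\mathfrak n}(N),\ \operatorname{f}_{\mathfrak m}(L)+\operatorname{depth}_B N\}.$$
   Context: Under these hypotheses $A\otimes_\Bbbk B$ is a local ring with unique maximal ideal $\mathfrak M$. For a Noetherian ring $R$, an ideal $\mathfrak a$ and a finitely generated $R$-module $M$, the finiteness dimension is $\operatorname{f}_{\mathfrak a}(M)=\inf\{i\geq 0: H^i_{\mathfrak a}(M)\text{ is not finitely generated}\}$, where $H^i_{\mathfrak a}$ is local cohomology and $\inf\emptyset=+\infty$. *)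

theory Defs
  imports
    "HOL-Algebra.Module"
    "HOL-Algebra.QuotRing"
    "HOL-Algebra.Ideal_Product"
    "HOL-Algebra.Ring_Divisibility"
    "HOL-Algebra.Free_Abelian_Groups"
    "HOL-Algebra.Finite_Extensions"
    "HOL-Library.Extended_Nat"
begin

section \<open>Modules\<close>

text \<open>
  The type \<^typ>\<open>('a, 'b) module\<close> extends the record type of rings, but the fields \<^const>\<open>monoid.mult\<close> and
  \<^const>\<open>monoid.one\<close> of a module carry no meaning; they are \<^const>\<open>undefined\<close> in the modules constructed below.
\<close>

definition mod_hom ::
  "('a, 'r) ring_scheme \<Rightarrow> ('a, 'm, 'x) module_scheme \<Rightarrow> ('a, 'n, 'y) module_scheme \<Rightarrow> ('m \<Rightarrow> 'n) set"
  where "mod_hom R M N =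
    {f \<in> hom (add_monoid M) (add_monoid N).
       \<forall>r \<in> carrier R. \<forall>x \<in> carrier M. f (r \<odot>\<^bsub>M\<^esub> x) = r \<odot>\<^bsub>N\<^esub> f x}"

definition gen_submodule ::
  "('a, 'r) ring_scheme \<Rightarrow> ('a, 'm, 'x) module_scheme \<Rightarrow> 'm set \<Rightarrow> 'm set"
  where "gen_submodule R M S = \<Inter>{H. submodule H R M \<and> S \<subseteq> H}"

definition fin_gen_module :: "('a, 'r) ring_scheme \<Rightarrow> ('a, 'm, 'x) module_scheme \<Rightarrow> bool"
  where "fin_gen_module R M \<longleftrightarrow>
    module R M \<and> (\<exists>S \<subseteq> carrier M. finite S \<and> gen_submodule R M S = carrier M)"

definition quot_module :: "('a, 'm, 'x) module_scheme \<Rightarrow> 'm set \<Rightarrow> ('a, 'm set) module"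
  where "quot_module M H =
    \<lparr>carrier = a_rcosets\<^bsub>M\<^esub> H, monoid.mult = undefined, monoid.one = undefined,
     ring.zero = H, ring.add = set_add M,
     smult = (\<lambda>r P. \<Union>x\<in>P. H +>\<^bsub>M\<^esub> (r \<odot>\<^bsub>M\<^esub> x))\<rparr>"

text \<open>An \<open>A\<close>-module, where \<open>A\<close> is a \<open>K\<close>-algebra, viewed as a \<open>K\<close>-module.\<close>

definition restrict_scalars ::
  "('k, 'a, 'x) module_scheme \<Rightarrow> ('a, 'm, 'y) module_scheme \<Rightarrow> ('k, 'm) module"
  where "restrict_scalars A M =
    \<lparr>carrier = carrier M, monoid.mult = undefined, monoid.one = undefined,
     ring.zero = \<zero>\<^bsub>M\<^esub>, ring.add = ring.add M,
     smult = (\<lambda>c x. (c \<odot>\<^bsub>A\<^esub> \<one>\<^bsub>A\<^esub>) \<odot>\<^bsub>M\<^esub> x)\<rparr>"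


section \<open>Tensor products over a commutative ring\<close>

text \<open>
  \<open>P \<otimes>\<^sub>K Q\<close> is the free abelian group on \<open>P \<times> Q\<close> modulo the subgroup generated by the relations of
  biadditivity and \<open>K\<close>-balancedness. Its elements are cosets of that subgroup.
\<close>

abbreviation tensor_free ::
  "('k, 'x, 'xx) module_scheme \<Rightarrow> ('k, 'y, 'yy) module_scheme \<Rightarrow> ('x \<times> 'y \<Rightarrow>\<^sub>0 int) monoid"
  where "tensor_free P Q \<equiv> free_Abelian_group (carrier P \<times> carrier Q)"

definition tensor_relators ::
  "('k, 'r) ring_scheme \<Rightarrow> ('k, 'x, 'xx) module_scheme \<Rightarrow> ('k, 'y, 'yy) module_scheme \<Rightarrow>
   ('x \<times> 'y \<Rightarrow>\<^sub>0 int) set"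
  where "tensor_relators K P Q =
    {frag_of (x \<oplus>\<^bsub>P\<^esub> x', y) - frag_of (x, y) - frag_of (x', y) | x x' y.
       x \<in> carrier P \<and> x' \<in> carrier P \<and> y \<in> carrier Q} \<union>
    {frag_of (x, y \<oplus>\<^bsub>Q\<^esub> y') - frag_of (x, y) - frag_of (x, y') | x y y'.
       x \<in> carrier P \<and> y \<in> carrier Q \<and> y' \<in> carrier Q} \<union>
    {frag_of (c \<odot>\<^bsub>P\<^esub> x, y) - frag_of (x, c \<odot>\<^bsub>Q\<^esub> y) | c x y.
       c \<in> carrier K \<and> x \<in> carrier P \<and> y \<in> carrier Q}"

definition tensor_null ::
  "('k, 'r) ring_scheme \<Rightarrow> ('k, 'x, 'xx) module_scheme \<Rightarrow> ('k, 'y, 'yy) module_scheme \<Rightarrow>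
   ('x \<times> 'y \<Rightarrow>\<^sub>0 int) set"
  where "tensor_null K P Q = generate (tensor_free P Q) (tensor_relators K P Q)"

definition tensor_group ::
  "('k, 'r) ring_scheme \<Rightarrow> ('k, 'x, 'xx) module_scheme \<Rightarrow> ('k, 'y, 'yy) module_scheme \<Rightarrow>
   ('x \<times> 'y \<Rightarrow>\<^sub>0 int) set monoid"
  where "tensor_group K P Q = tensor_free P Q Mod tensor_null K P Q"

definition tensor_class ::
  "('k, 'r) ring_scheme \<Rightarrow> ('k, 'x, 'xx) module_scheme \<Rightarrow> ('k, 'y, 'yy) module_scheme \<Rightarrow>
   ('x \<times> 'y \<Rightarrow>\<^sub>0 int) \<Rightarrow> ('x \<times> 'y \<Rightarrow>\<^sub>0 int) set"
  where "tensor_class K P Q u = tensor_null K P Q #>\<^bsub>tensor_free P Q\<^esub> u"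

text \<open>
  The biadditive extension of \<open>(a \<otimes> b, x \<otimes> y) \<mapsto> f a x \<otimes> g b y\<close>. With \<open>f\<close>, \<open>g\<close> the multiplications of two
  algebras this gives the product of their tensor product; with \<open>f\<close>, \<open>g\<close> the actions on two modules
  it gives the action of the tensor product ring.
\<close>

definition frag_biextend ::
  "('a \<Rightarrow> 'x \<Rightarrow> 'z) \<Rightarrow> ('b \<Rightarrow> 'y \<Rightarrow> 'w) \<Rightarrow> ('a \<times> 'b \<Rightarrow>\<^sub>0 int) \<Rightarrow> ('x \<times> 'y \<Rightarrow>\<^sub>0 int) \<Rightarrow> ('z \<times> 'w \<Rightarrow>\<^sub>0 int)"
  where "frag_biextend f g u v =
    frag_extend (\<lambda>(a, b). frag_extend (\<lambda>(x, y). frag_of (f a x, g b y)) v) u"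

definition tensor_ring ::
  "('k, 'r) ring_scheme \<Rightarrow> ('k, 'a, 'x) module_scheme \<Rightarrow> ('k, 'b, 'y) module_scheme \<Rightarrow>
   ('a \<times> 'b \<Rightarrow>\<^sub>0 int) set ring"
  where "tensor_ring K A B =
    \<lparr>carrier = carrier (tensor_group K A B),
     monoid.mult = (\<lambda>U V. \<Union>u\<in>U. \<Union>v\<in>V. tensor_class K A B (frag_biextend (monoid.mult A) (monoid.mult B) u v)),
     monoid.one = tensor_class K A B (frag_of (\<one>\<^bsub>A\<^esub>, \<one>\<^bsub>B\<^esub>)),
     ring.zero = \<one>\<^bsub>tensor_group K A B\<^esub>,
     ring.add = monoid.mult (tensor_group K A B)\<rparr>"

text \<open>\<open>L \<otimes>\<^sub>K N\<close> as a module over \<open>A \<otimes>\<^sub>K B\<close>, for an \<open>A\<close>-module \<open>L\<close> and a \<open>B\<close>-module \<open>N\<close>.\<close>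

definition tensor_module ::
  "('k, 'r) ring_scheme \<Rightarrow> ('k, 'a, 'x) module_scheme \<Rightarrow> ('k, 'b, 'y) module_scheme \<Rightarrow>
   ('a, 'l, 'v) module_scheme \<Rightarrow> ('b, 'n, 'w) module_scheme \<Rightarrow>
   (('a \<times> 'b \<Rightarrow>\<^sub>0 int) set, ('l \<times> 'n \<Rightarrow>\<^sub>0 int) set) module"
  where "tensor_module K A B L N =
    (let L' = restrict_scalars A L; N' = restrict_scalars B N; T = tensor_group K L' N' in
     \<lparr>carrier = carrier T, monoid.mult = undefined, monoid.one = undefined,
      ring.zero = \<one>\<^bsub>T\<^esub>, ring.add = monoid.mult T,
      smult = (\<lambda>U V. \<Union>u\<in>U. \<Union>v\<in>V. tensor_class K L' N' (frag_biextend (smult L) (smult N) u v))\<rparr>)"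

text \<open>
  The image of \<open>S \<otimes> T\<close> in \<open>A \<otimes>\<^sub>K B\<close> for \<open>K\<close>-submodules \<open>S\<close> of \<open>A\<close> and \<open>T\<close> of \<open>B\<close>; if \<open>K\<close> is a field,
  \<open>S \<otimes> T\<close> embeds into \<open>A \<otimes>\<^sub>K B\<close> with this image.
\<close>

definition tensor_image ::
  "('k, 'r) ring_scheme \<Rightarrow> ('k, 'a, 'x) module_scheme \<Rightarrow> ('k, 'b, 'y) module_scheme \<Rightarrow>
   'a set \<Rightarrow> 'b set \<Rightarrow> ('a \<times> 'b \<Rightarrow>\<^sub>0 int) set set"
  where "tensor_image K A B S T =
    generate (tensor_group K A B) {tensor_class K A B (frag_of (s, t)) | s t. s \<in> S \<and> t \<in> T}"


section \<open>Local algebras\<close>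

definition local_ring :: "('a, 'r) ring_scheme \<Rightarrow> 'a set \<Rightarrow> bool"
  where "local_ring R m \<longleftrightarrow> cring R \<and> maximalideal m R \<and> (\<forall>J. maximalideal J R \<longrightarrow> J = m)"

definition residue_field_is ::
  "('k, 'r) ring_scheme \<Rightarrow> ('k, 'a, 'x) module_scheme \<Rightarrow> 'a set \<Rightarrow> bool"
  where "residue_field_is K A m \<longleftrightarrow>
    (\<lambda>c. m +>\<^bsub>A\<^esub> (c \<odot>\<^bsub>A\<^esub> \<one>\<^bsub>A\<^esub>)) \<in> ring_iso K (A Quot m)"

text \<open>
  Here \<open>ring.algebraic A S x\<close> is used with \<open>S\<close> the image of \<open>K\<close> in \<open>A\<close>, a copy of \<open>K\<close> if \<open>K\<close> is a field
  and \<open>A\<close> is nonzero; it does not require \<open>A\<close> to be a domain.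
\<close>

definition algebraic_algebra :: "('k, 'r) ring_scheme \<Rightarrow> ('k, 'a, 'x) module_scheme \<Rightarrow> bool"
  where "algebraic_algebra K A \<longleftrightarrow>
    (\<forall>x \<in> carrier A. \<not> ring.transcendental A ((\<lambda>c. c \<odot>\<^bsub>A\<^esub> \<one>\<^bsub>A\<^esub>) ` carrier K) x)"


section \<open>Depth\<close>

definition seq_submodule ::
  "('a, 'r) ring_scheme \<Rightarrow> ('a, 'm, 'x) module_scheme \<Rightarrow> 'a list \<Rightarrow> 'm set"
  where "seq_submodule R M xs =
    gen_submodule R M {r \<odot>\<^bsub>M\<^esub> y | r y. r \<in> set xs \<and> y \<in> carrier M}"

definition regular_sequence ::
  "('a, 'r) ring_scheme \<Rightarrow> ('a, 'm, 'x) module_scheme \<Rightarrow> 'a list \<Rightarrow> bool"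
  where "regular_sequence R M xs \<longleftrightarrow>
    set xs \<subseteq> carrier R \<and>
    (\<forall>i < length xs. let Q = quot_module M (seq_submodule R M (take i xs)) in
       \<forall>z \<in> carrier Q. xs ! i \<odot>\<^bsub>Q\<^esub> z = \<zero>\<^bsub>Q\<^esub> \<longrightarrow> z = \<zero>\<^bsub>Q\<^esub>) \<and>
    seq_submodule R M xs \<noteq> carrier M"

definition depth ::
  "('a, 'r) ring_scheme \<Rightarrow> 'a set \<Rightarrow> ('a, 'm, 'x) module_scheme \<Rightarrow> enat"
  where "depth R m M = Sup {enat (length xs) | xs. set xs \<subseteq> m \<and> regular_sequence R M xs}"


section \<open>Local cohomology\<close>

text \<open>
  The extension property is required for all modules whose carrier lies in the type of \<open>R\<close>.
  Among these are the ideals of \<open>R\<close> and \<open>R\<close> itself, so by Baer's criterion \<open>E\<close> then has the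
  extension property for modules of any size.
\<close>

definition injective_module :: "('a, 'r) ring_scheme \<Rightarrow> ('a, 'm, 'x) module_scheme \<Rightarrow> bool"
  where "injective_module R E \<longleftrightarrow>
    module R E \<and>
    (\<forall>(P :: ('a, 'a) module) (Q :: ('a, 'a) module) i f.
       module R P \<and> module R Q \<and> i \<in> mod_hom R P Q \<and> inj_on i (carrier P) \<and> f \<in> mod_hom R P E \<longrightarrow>
       (\<exists>g \<in> mod_hom R Q E. \<forall>x \<in> carrier P. g (i x) = f x))"

definition injective_resolution ::
  "('a, 'r) ring_scheme \<Rightarrow> ('a, 'm, 'x) module_scheme \<Rightarrow> ('m \<Rightarrow> 'e) \<Rightarrow>
   (nat \<Rightarrow> ('a, 'e, 'y) module_scheme) \<Rightarrow> (nat \<Rightarrow> 'e \<Rightarrow> 'e) \<Rightarrow> bool"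
  where "injective_resolution R M \<eta> E d \<longleftrightarrow>
    (\<forall>n. injective_module R (E n)) \<and>
    \<eta> \<in> mod_hom R M (E 0) \<and> (\<forall>n. d n \<in> mod_hom R (E n) (E (Suc n))) \<and>
    inj_on \<eta> (carrier M) \<and>
    \<eta> ` carrier M = a_kernel (E 0) (E 1) (d 0) \<and>
    (\<forall>n. d n ` carrier (E n) = a_kernel (E (Suc n)) (E (Suc (Suc n))) (d (Suc n)))"

text \<open>
  A choice of injective resolution. Over a Noetherian ring \<open>R\<close> every module \<open>M\<close> has an injective
  resolution by modules of cardinality at most \<open>max {|R|, |M|, \<aleph>\<^sub>0}\<close>, so one exists with all carriers in
  the type \<^typ>\<open>('a + 'm + nat) list\<close>.
\<close>

definition chosen_resolution ::
  "('a, 'r) ring_scheme \<Rightarrow> ('a, 'm, 'x) module_scheme \<Rightarrow>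
   (nat \<Rightarrow> ('a, ('a + 'm + nat) list) module) \<times>
   (nat \<Rightarrow> ('a + 'm + nat) list \<Rightarrow> ('a + 'm + nat) list)"
  where "chosen_resolution R M = (SOME (E, d). \<exists>\<eta>. injective_resolution R M \<eta> E d)"

definition torsion ::
  "('a, 'r) ring_scheme \<Rightarrow> 'a set \<Rightarrow> ('a, 'm, 'x) module_scheme \<Rightarrow> 'm set"
  where "torsion R I M =
    {x \<in> carrier M. \<exists>n::nat. \<forall>r \<in> I [^]\<^bsub>ideals_set R\<^esub> n. r \<odot>\<^bsub>M\<^esub> x = \<zero>\<^bsub>M\<^esub>}"

text \<open>The \<open>i\<close>-th right derived functor of \<^const>\<open>torsion\<close>, computed on the chosen resolution.\<close>

definition local_cohomology ::
  "('a, 'r) ring_scheme \<Rightarrow> 'a set \<Rightarrow> ('a, 'm, 'x) module_scheme \<Rightarrow> nat \<Rightarrow>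
   ('a, ('a + 'm + nat) list set) module"
  where "local_cohomology R I M i =
    (let (E, d) = chosen_resolution R M;
         Z = {x \<in> torsion R I (E i). d i x = \<zero>\<^bsub>E (Suc i)\<^esub>};
         C = (case i of 0 \<Rightarrow> {\<zero>\<^bsub>E 0\<^esub>} | Suc j \<Rightarrow> d j ` torsion R I (E j))
     in quot_module ((E i)\<lparr>carrier := Z\<rparr>) C)"

definition finiteness_dim ::
  "('a, 'r) ring_scheme \<Rightarrow> 'a set \<Rightarrow> ('a, 'm, 'x) module_scheme \<Rightarrow> enat"
  where "finiteness_dim R I M =
    Inf {enat i | i. \<not> fin_gen_module R (local_cohomology R I M i)}"

end

(* Over A, B and T = A \<otimes> B the residue field is K, so a torsion module is finitely generated iff it is
   finite-dimensional over K; hence f and depth are the first degrees in which the local cohomology is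
   infinite-dimensional, respectively nonzero. For injective resolutions E of L and F of N the tensor
   complex of E and F resolves L \<otimes> N by modules on which T-torsion can be computed although they need not be
   injective, and its torsion part is the tensor complex of the torsion parts. Splitting all complexes over
   the field K gives the Kuenneth formula: H^n(L \<otimes> N) is infinite-dimensional iff for some p + q = n one of
   H^p(L), H^q(N) is infinite-dimensional and the other one is nonzero.

   The modules that compute torsion are those that are "good" for a list z_1, ..., z_r of generators of the
   maximal ideal: if P is the part of the module that is torsion for z_1, ..., z_(j-1), then P = z_j P + (the
   z_j-torsion of P). On exact complexes of such modules torsion is exact, by induction on j. *)
theory Submission
 imports Defs
begin

text \<open>The resolution behind \<open>local_cohomology\<close> is an arbitrary choice in a fixed
  type. A resolution must be shown to exist in exactly that type, since otherwise
  \<open>SOME\<close> says nothing, and every computation must be carried from a convenient complex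
  to the chosen one. One comparison does this in two places: for the tensor complex, and for the
  cone of multiplication by a regular element, which replaces the long exact sequence in the depth
  theorem. The mapping cones involved need not consist of injective modules, hence the exactness of
  torsion on good modules. The maximal ideal of the tensor ring is generated by elements
  \<open>x \<otimes> 1\<close> and \<open>1 \<otimes> y\<close>, each acting on one factor; this is
  why a condition tested generator by generator passes to tensor products. After one translation no
  cohomology module is formed any more: pairs of cocycles and boundaries are compared through
  \<open>fdq\<close> (finite generation) and \<open>van\<close> (vanishing). The minimum arises
  because the degrees in question form a union of two sets of sums \<open>p + q\<close>.\<close>

abbreviation (input) plus_in (\<open>_ +[_] _\<close> [65, 0, 66] 65) where "x +[M] y \<equiv> x \<oplus>\<^bsub>M\<^esub> y"
abbreviation (input) minus_in (\<open>_ -[_] _\<close> [65, 0, 66] 65) where "x -[M] y \<equiv> x \<ominus>\<^bsub>M\<^esub> y"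
abbreviation (input) uminus_in (\<open>-[_] _\<close> [0, 81] 80) where "-[M] x \<equiv> \<ominus>\<^bsub>M\<^esub> x"
abbreviation (input) smult_in (\<open>_ *[_] _\<close> [70, 0, 71] 70) where "r *[M] x \<equiv> r \<odot>\<^bsub>M\<^esub> x"
abbreviation (input) mult_in (\<open>_ \<otimes>[_] _\<close> [70, 0, 71] 70) where "x \<otimes>[R] y \<equiv> x \<otimes>\<^bsub>R\<^esub> y"
abbreviation (input) zero_in (\<open>0[_]\<close>) where "0[M] \<equiv> \<zero>\<^bsub>M\<^esub>"
abbreviation (input) one_in (\<open>1[_]\<close>) where "1[R] \<equiv> \<one>\<^bsub>R\<^esub>"

section \<open>Elementary rules for abelian groups, modules and submodules\<close>

lemma (in abelian_group) minus_eq_iff: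
 "a : carrier G ==> b : carrier G ==> c : carrier G ==> a \<ominus> b = c \<longleftrightarrow> a = c \<oplus> b"
 by (metis a_assoc a_inv_closed l_neg minus_eq r_neg r_zero)

lemma (in abelian_group) minus_self [simp]: "a : carrier G ==> a \<ominus> a = \<zero>"
 by (simp add: minus_eq r_neg)

lemma (in abelian_group) minus_zero_right [simp]: "a : carrier G ==> a \<ominus> \<zero> = a"
 using minus_eq_iff[of a \<zero> a] by simp

lemma (in abelian_group) minus_add_minus:
 "a : carrier G ==> b : carrier G ==> c : carrier G ==> d : carrier G ==>
  (a \<oplus> b) \<ominus> (c \<oplus> d) = (a \<ominus> c) \<oplus> (b \<ominus> d)"
 by (simp add: minus_eq minus_add a_ac)

lemma (in abelian_group) minus_eq_zero_iff:
 "a : carrier G ==> b : carrier G ==> a \<ominus> b = \<zero> \<longleftrightarrow> a = b"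
 using minus_eq_iff[of a b \<zero>] by simp

lemma (in abelian_group) minus_add_cancel:
 "a : carrier G ==> b : carrier G ==> (a \<ominus> b) \<oplus> b = a"
 using minus_eq_iff[of a b "a \<ominus> b"] by simp

lemma (in abelian_group) add_minus_cancel:
 "a : carrier G ==> b : carrier G ==> (a \<oplus> b) \<ominus> b = a"
 using minus_eq_iff[of "a \<oplus> b" b a] by simp

lemma (in abelian_group) add_minus_swap:
 "a : carrier G ==> b : carrier G ==> a \<oplus> (b \<ominus> a) = b"
 using minus_add_cancel[of b a] by (simp add: a_comm)

lemma (in module) smult_minus:
 "a : carrier R ==> x : carrier M ==> y : carrier M ==>
  a *[M] (x -[M] y) = a *[M] x -[M] a *[M] y"
 by (simp add: a_minus_def smult_r_distr smult_r_minus)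

lemma (in module) smult_commute:
 "a : carrier R ==> b : carrier R ==> x : carrier M ==>
  a *[M] (b *[M] x) = b *[M] (a *[M] x)"
 by (metis R.m_comm smult_assoc1)

lemma (in module) neg_smult: "x : carrier M ==> (\<ominus> \<one>) *[M] x = -[M] x"
 by (simp add: smult_l_minus)

lemma (in module) submoduleI':
 assumes "H <= carrier M" "0[M] : H" "!!a b. a : H ==> b : H ==> a +[M] b : H"
  and "!!a x. a : carrier R ==> x : H ==> a *[M] x : H"
 shows "submodule H R M"
proof (rule submoduleI)
 fix a assume "a : H"
 then show "-[M] a : H"
  using assms(1) assms(4)[of "\<ominus> \<one>" a] neg_smult[of a] by auto
qed (use assms in auto)

lemma (in module) sub_zero: "submodule H R M ==> 0[M] : H"
 using subgroup.one_closed[of H "add_monoid M"] unfolding submodule_def by auto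

lemma (in module) submodule_minus_closed:
 "submodule H R M ==> a : H ==> b : H ==> a -[M] b : H"
 by (simp add: a_minus_def submoduleE)

lemma (in module) restrict_module: "submodule H R M ==> module R (M\<lparr>carrier := H\<rparr>)"
 using submodule.submodule_is_module module_axioms by blast

lemma (in module) submodule_zero: "submodule {0[M]} R M"
 by (rule submoduleI') auto

lemma (in module) restrict_minus:
 assumes "submodule H R M" "a : H" "b : H"
 shows "a -[M\<lparr>carrier := H\<rparr>] b = a -[M] b"
proof -
 interpret N: module R "M\<lparr>carrier := H\<rparr>" by (rule restrict_module[OF assms(1)])
 have c: "H <= carrier M" "a -[M] b : H" using assms submoduleE(1) submodule_minus_closed by blast+
 then have "(a -[M] b) +[M\<lparr>carrier := H\<rparr>] b = a"
  using assms by (simp add: M.minus_add_cancel subset_eq)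
 then show ?thesis using N.minus_eq_iff[of a b "a -[M] b"] assms c by simp
qed

lemma (in module) submodule_restrict_iff:
 assumes "submodule H R M"
 shows "submodule H' R (M\<lparr>carrier := H\<rparr>) \<longleftrightarrow> submodule H' R M \<and> H' <= H"
proof -
 interpret N: module R "M\<lparr>carrier := H\<rparr>" by (rule restrict_module[OF assms])
 show ?thesis
 proof (intro iffI conjI)
  assume H': "submodule H' R (M\<lparr>carrier := H\<rparr>)"
  show "H' <= H" using N.submoduleE(1)[OF H'] by simp
  then show "submodule H' R M"
   using N.submoduleE[OF H'] N.sub_zero[OF H'] submoduleE(1)[OF assms]
   by (intro submoduleI') auto
 next
  assume H': "submodule H' R M \<and> H' <= H"
  then show "submodule H' R (M\<lparr>carrier := H\<rparr>)"
   using submoduleE[of H'] sub_zero by (intro N.submoduleI') auto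
 qed
qed

text \<open>The elements of \<open>M\<close> with property \<open>P\<close> form a submodule
  containing \<open>S\<close>.\<close>

lemma gen_submodule_induct:
 assumes x: "x : gen_submodule R M S" and M: "module R M" and S: "S <= carrier M"
  and "P 0[M]" "!!s. s : S ==> P s"
  and "!!x y. x : carrier M ==> y : carrier M ==> P x ==> P y ==> P (x +[M] y)"
  and "!!r x. r : carrier R ==> x : carrier M ==> P x ==> P (r *[M] x)"
 shows "P x"
proof -
 interpret module R M by fact
 have "submodule {x : carrier M. P x} R M" using assms by (intro submoduleI') auto
 then show ?thesis using x S assms(5) unfolding gen_submodule_def by blast
qed

context module
begin

lemma gen_sub: "S <= carrier M ==> submodule (gen_submodule R M S) R M"
 unfolding gen_submodule_def
proof (rule submoduleI', goal_cases)
 case 1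
 then show ?case using carrier_is_submodule by blast
qed (auto simp: sub_zero submoduleE(4,5))

lemma gen_incl: "S <= gen_submodule R M S"
 unfolding gen_submodule_def by blast

lemma gen_submodule_minimal: "submodule H R M ==> S <= H ==> gen_submodule R M S <= H"
 unfolding gen_submodule_def by blast

lemma gen_submodule_mono: "S <= T ==> gen_submodule R M S <= gen_submodule R M T"
 unfolding gen_submodule_def by blast

lemma gen_submodule_carrier: "S <= carrier M ==> gen_submodule R M S <= carrier M"
 using gen_submodule_minimal carrier_is_submodule by blast

end

section \<open>Module homomorphisms, their kernels and images\<close>

lemma mod_homI:
 assumes "!!x. x : carrier M ==> f x : carrier N"
  and "!!x y. x : carrier M ==> y : carrier M ==> f (x +[M] y) = f x +[N] f y"
  and "!!r x. r : carrier R ==> x : carrier M ==> f (r *[M] x) = r *[N] f x"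
 shows "f : mod_hom R M N"
 using assms by (auto simp: mod_hom_def hom_def)

lemma mod_homD:
 assumes "f : mod_hom R M N"
 shows "!!x. x : carrier M ==> f x : carrier N"
  and "!!x y. x : carrier M ==> y : carrier M ==> f (x +[M] y) = f x +[N] f y"
  and "!!r x. r : carrier R ==> x : carrier M ==> f (r *[M] x) = r *[N] f x"
 using assms by (auto simp: mod_hom_def hom_def)

lemma mod_hom_zero:
 assumes "f : mod_hom R M N" "module R M" "module R N"
 shows "f 0[M] = 0[N]"
proof -
 interpret M: module R M by fact
 interpret N: module R N by fact
 have "f (0[R] *[M] 0[M]) = 0[R] *[N] f 0[M]" by (rule mod_homD(3)[OF assms(1)]) simp_all
 then show ?thesis using mod_homD(1)[OF assms(1)] by simp
qed

lemma mod_hom_minus: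
 assumes f: "f : mod_hom R M N" and "module R M" "module R N" and x: "x : carrier M" "y : carrier M"
 shows "f (x -[M] y) = f x -[N] f y"
proof -
 interpret M: module R M by fact
 interpret N: module R N by fact
 have "f (x -[M] y) +[N] f y = f x"
  using mod_homD(2)[OF f, of "x -[M] y" y] x by (simp add: M.minus_add_cancel)
 then show ?thesis
  using N.M.minus_eq_iff[of "f x" "f y" "f (x -[M] y)"] mod_homD(1)[OF f] x by simp
qed

lemma mod_hom_compose:
 "f : mod_hom R M N ==> g : mod_hom R N P ==> (%x. g (f x)) : mod_hom R M P"
 by (auto simp: mod_hom_def hom_def Pi_def)

lemma mod_hom_corestrict:
 "f : mod_hom R M N ==> f ` carrier M <= U ==> f : mod_hom R M (N\<lparr>carrier := U\<rparr>)"
 by (auto simp: mod_hom_def hom_def Pi_def)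

lemma mod_hom_expand:
 "f : mod_hom R M (N\<lparr>carrier := U\<rparr>) ==> U <= carrier N ==> f : mod_hom R M N"
 by (auto simp: mod_hom_def hom_def Pi_def)

lemma mod_hom_gen_submodule:
 assumes f: "f : mod_hom R M N" and M: "module R M" and N: "module R N"
  and S: "S <= carrier M" and x: "x : gen_submodule R M S"
 shows "f x : gen_submodule R N (f ` S)"
proof -
 interpret M: module R M by fact
 interpret N: module R N by fact
 have fS: "f ` S <= carrier N" using mod_homD(1)[OF f] S by auto
 have sub: "submodule (gen_submodule R N (f ` S)) R N" by (rule N.gen_sub[OF fS])
 show ?thesis
 proof (rule gen_submodule_induct[OF x M S, of "%x. f x : gen_submodule R N (f ` S)"], goal_cases)
  case 1 then show ?case using mod_hom_zero[OF f M N] N.sub_zero[OF sub] by simp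
 next
  case (2 s) then show ?case using N.gen_incl by blast
 next
  case (3 x y) then show ?case using mod_homD(2)[OF f] N.submoduleE(5)[OF sub] by simp
 next
  case (4 r x) then show ?case using mod_homD(3)[OF f] N.submoduleE(4)[OF sub] by simp
 qed
qed

lemma submodule_mod_hom_kernel:
 assumes f: "f : mod_hom R M N" and M: "module R M" and N: "module R N"
 shows "submodule {x : carrier M. f x = 0[N]} R M"
proof -
 interpret M: module R M by fact
 interpret N: module R N by fact
 show ?thesis using mod_homD[OF f] mod_hom_zero[OF f M N] by (intro M.submoduleI') auto
qed

lemma submodule_mod_hom_image:
 assumes f: "f : mod_hom R M N" and M: "module R M" and N: "module R N" and H: "submodule H R M"
 shows "submodule (f ` H) R N"
proof -
 interpret M: module R M by fact
 interpret N: module R N by fact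
 have c: "H <= carrier M" using M.submoduleE(1)[OF H] .
 show ?thesis
 proof (rule N.submoduleI')
  show "f ` H <= carrier N" using mod_homD(1)[OF f] c by auto
  show "0[N] : f ` H" using mod_hom_zero[OF f M N] M.sub_zero[OF H] by force
  show "a +[N] b : f ` H" if ab: "a : f ` H" "b : f ` H" for a b
  proof -
   obtain x y where "x : H" "y : H" "a = f x" "b = f y" using ab by blast
   then have "a +[N] b = f (x +[M] y)" "x +[M] y : H"
    using mod_homD(2)[OF f, of x y] M.submoduleE(5)[OF H] c by (auto simp: subset_eq)
   then show ?thesis by blast
  qed
  show "a *[N] y : f ` H" if ay: "a : carrier R" "y : f ` H" for a y
  proof -
   obtain x where "x : H" "y = f x" using ay by blast
   then have "a *[N] y = f (a *[M] x)" "a *[M] x : H"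
    using mod_homD(3)[OF f, of a x] M.submoduleE(4)[OF H] c ay by (auto simp: subset_eq)
   then show ?thesis by blast
  qed
 qed
qed

section \<open>Products of two modules, and the ring as a module over itself\<close>

definition prod_mod :: "('a, 'm, 'x) module_scheme => ('a, 'n, 'y) module_scheme => ('a, 'm \<times> 'n) module"
 where "prod_mod M N = \<lparr>carrier = carrier M \<times> carrier N, monoid.mult = undefined, monoid.one = undefined,
  ring.zero = (0[M], 0[N]), ring.add = (%p q. (fst p +[M] fst q, snd p +[N] snd q)),
  smult = (%r p. (r *[M] fst p, r *[N] snd p))\<rparr>"

lemma prod_mod_simps [simp]:
 "carrier (prod_mod M N) = carrier M \<times> carrier N" "0[prod_mod M N] = (0[M], 0[N])"
 "p +[prod_mod M N] q = (fst p +[M] fst q, snd p +[N] snd q)"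
 "r *[prod_mod M N] p = (r *[M] fst p, r *[N] snd p)"
 by (simp_all add: prod_mod_def)

lemma prod_mod_module:
 assumes "module R M" "module R N"
 shows "module R (prod_mod M N)"
proof -
 interpret M: module R M by fact
 interpret N: module R N by fact
 show ?thesis
 proof (rule moduleI)
  show "abelian_group (prod_mod M N)"
  proof (rule abelian_groupI)
   fix x assume "x : carrier (prod_mod M N)"
   then show "\<exists>y\<in>carrier (prod_mod M N). y +[prod_mod M N] x = 0[prod_mod M N]"
    by (intro bexI[of _ "(-[M] fst x, -[N] snd x)"]) (auto simp: M.M.l_neg N.M.l_neg)
  qed (auto simp: M.M.a_ac N.M.a_ac)
 qed (auto simp: M.is_cring M.smult_l_distr N.smult_l_distr M.smult_r_distr N.smult_r_distr M.smult_assoc1 N.smult_assoc1)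
qed

text \<open>The action of \<open>R\<close> on itself needs a record of its own, because the field
  \<open>mult\<close> of a module carries no meaning. Ideals become submodules of this module, so
  facts about submodules serve for both.\<close>

definition ring_mod :: "('a, 'r) ring_scheme => ('a, 'a) module"
 where "ring_mod R = \<lparr>carrier = carrier R, monoid.mult = undefined, monoid.one = undefined,
  ring.zero = 0[R], ring.add = ring.add R, smult = monoid.mult R\<rparr>"

lemma ring_mod_simps [simp]:
 "carrier (ring_mod R) = carrier R" "0[ring_mod R] = 0[R]" "x +[ring_mod R] y = x +[R] y"
 "x *[ring_mod R] y = x \<otimes>[R] y"
 by (simp_all add: ring_mod_def)

lemma ring_mod_module:
 assumes "cring R" shows "module R (ring_mod R)"
proof -
 interpret cring R by fact
 have "\<exists>y\<in>carrier R. y +[R] x = 0[R]" if "x : carrier R" for x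
  using l_neg[OF that] that by blast
 then show ?thesis
  by (intro moduleI abelian_groupI) (auto simp: is_cring a_ac m_ac l_distr r_distr)
qed

lemma ideal_iff_submodule:
 fixes R (structure)
 assumes "cring R" shows "ideal J R \<longleftrightarrow> submodule J R (ring_mod R)"
proof -
 interpret cring R by fact
 interpret M: module R "ring_mod R" by (rule ring_mod_module[OF assms])
 show ?thesis
 proof
  assume J: "ideal J R"
  then interpret J: ideal J R .
  show "submodule J R (ring_mod R)"
   using J.a_subset by (intro M.submoduleI') (auto simp: J.I_l_closed)
 next
  assume J: "submodule J R (ring_mod R)"
  have "subgroup J (add_monoid R)"
  proof (rule add.subgroupI)
   show "J <= carrier R" using M.submoduleE(1)[OF J] by simp
   show "J \<noteq> {}" using M.sub_zero[OF J] by auto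
   show "\<ominus> a : J" if "a : J" for a
   proof -
    have "a : carrier R" using M.submoduleE(1)[OF J] that by auto
    then show ?thesis using M.submoduleE(4)[OF J, of "\<ominus> \<one>" a] that by (simp add: l_minus)
   qed
  qed (use M.submoduleE(5)[OF J] in auto)
  then show "ideal J R"
  proof (rule idealI[OF ring_axioms])
   show "x \<otimes> a : J" if "a : J" "x : carrier R" for a x
    using M.submoduleE(4)[OF J, of x a] that by simp
   then show "a \<otimes> x : J" if "a : J" "x : carrier R" for a x
    using M.submoduleE(1)[OF J] m_comm[of a x] that by auto
  qed
 qed
qed

section \<open>Baer's criterion, and linear algebra over a field\<close>

text \<open>Baer's test for injectivity. It mentions only ideals of \<open>R\<close>, so it gives
  extensions along modules of any type, whereas \<open>injective_module\<close> quantifies over one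
  fixed type.\<close>

definition baer :: "('a, 'r) ring_scheme => ('a, 'm, 'x) module_scheme => bool"
 where "baer R E \<longleftrightarrow> (\<forall>J f. ideal J R \<and> f : mod_hom R (ring_mod R\<lparr>carrier := J\<rparr>) E -->
  (\<exists>y\<in>carrier E. \<forall>r\<in>J. f r = r *[E] y))"

lemma (in abelian_group) add_add_swap:
 "a : carrier G ==> b : carrier G ==> c : carrier G ==> d : carrier G ==>
  (a \<oplus> b) \<oplus> (c \<oplus> d) = (a \<oplus> c) \<oplus> (b \<oplus> d)"
 by (simp add: a_ac)

lemma prod_mod_minus:
 assumes "module R M" "module R N" "p : carrier (prod_mod M N)" "q : carrier (prod_mod M N)"
 shows "p -[prod_mod M N] q = (fst p -[M] fst q, snd p -[N] snd q)"
proof -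
 interpret M: module R M by fact
 interpret N: module R N by fact
 interpret P: module R "prod_mod M N" by (rule prod_mod_module[OF assms(1,2)])
 have "(fst p -[M] fst q, snd p -[N] snd q) +[prod_mod M N] q = p"
  using assms(3,4) by (auto simp: M.M.minus_add_cancel N.M.minus_add_cancel)
 then show ?thesis
  using P.M.minus_eq_iff[of p q "(fst p -[M] fst q, snd p -[N] snd q)"] assms(3,4) by auto
qed

text \<open>Baer's criterion: a maximal graph of a partial extension of \<open>f\<close> is total.\<close>

lemma baer_extension:
 assumes Q: "module R Q" and E: "module R E" and B: "baer R E" and H: "submodule H R Q"
  and f: "f : mod_hom R (Q\<lparr>carrier := H\<rparr>) E"
 shows "\<exists>g\<in>mod_hom R Q E. \<forall>x\<in>H. g x = f x"
proof -
 interpret Q: module R Q by fact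
 interpret E: module R E by fact
 let ?P = "prod_mod Q E"
 interpret P: module R ?P by (rule prod_mod_module[OF Q E])
 have HQ: "H <= carrier Q" by (rule Q.submoduleE(1)[OF H])
 note Hc = Q.submoduleE(4,5)[OF H] Q.sub_zero[OF H]
 \<comment> \<open>The last clause makes \<open>G\<close> single valued: the difference of two pairs
   with equal first component has first component zero and lies in \<open>G\<close>.\<close>
 define good where "good G \<longleftrightarrow> submodule G R ?P \<and> (\<forall>x\<in>H. (x, f x) : G) \<and>
  (\<forall>y. (0[Q], y) : G --> y = 0[E])" for G
 have f0: "f 0[Q] = 0[E]" using mod_hom_zero[OF f Q.restrict_module[OF H] E] by simp
 have f': "!!x. x : H ==> f x : carrier E" "!!x y. x : H ==> y : H ==> f (x +[Q] y) = f x +[E] f y"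
  "!!r x. r : carrier R ==> x : H ==> f (r *[Q] x) = r *[E] f x"
  using mod_homD[OF f] by auto
 have "\<exists>G\<in>Collect good. \<forall>Xa\<in>Collect good. G <= Xa --> Xa = G"
 proof (rule subset_Zorn_nonempty)
  have "submodule ((%x. (x, f x)) ` H) R ?P"
  proof (rule P.submoduleI')
   show "(%x. (x, f x)) ` H <= carrier ?P" using HQ f'(1) by auto
   show "0[?P] : (%x. (x, f x)) ` H" using f0 Hc(3) by force
   show "a +[?P] b : (%x. (x, f x)) ` H" if "a : (%x. (x, f x)) ` H" "b : (%x. (x, f x)) ` H" for a b
    using that f'(2) Hc(2) by (auto simp: image_iff)
   show "a *[?P] b : (%x. (x, f x)) ` H" if "a : carrier R" "b : (%x. (x, f x)) ` H" for a b
    using that f'(3) Hc(1) by (auto simp: image_iff)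
  qed
  then have "good ((%x. (x, f x)) ` H)" unfolding good_def using f0 by auto
  then show "Collect good \<noteq> {}" by blast
 next
  fix \<C> assume ne: "\<C> \<noteq> {}" and ch: "subset.chain (Collect good) \<C>"
  have g: "!!Xa. Xa : \<C> ==> good Xa" and tot: "!!Xa Y. Xa : \<C> ==> Y : \<C> ==> Xa <= Y \<or> Y <= Xa"
   using ch unfolding subset_chain_def by auto
  have s: "!!Xa. Xa : \<C> ==> submodule Xa R ?P" using g unfolding good_def by blast
  have "submodule (\<Union>\<C>) R ?P"
  proof (rule P.submoduleI')
   show "\<Union>\<C> <= carrier ?P" using s P.submoduleE(1) by blast
   show "0[?P] : \<Union>\<C>" using s P.sub_zero ne by blast
   show "a +[?P] b : \<Union>\<C>" if ab: "a : \<Union>\<C>" "b : \<Union>\<C>" for a b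
   proof -
    obtain Xa Y where "Xa : \<C>" "Y : \<C>" "a : Xa" "b : Y" using ab by blast
    then obtain Z where "Z : \<C>" "a : Z" "b : Z" using tot by blast
    then show ?thesis using P.submoduleE(5)[OF s] by blast
   qed
   show "a *[?P] b : \<Union>\<C>" if "a : carrier R" "b : \<Union>\<C>" for a b
    using that s P.submoduleE(4) by blast
  qed
  moreover have "\<forall>x\<in>H. (x, f x) : \<Union>\<C>" using ne g unfolding good_def by blast
  moreover have "\<forall>y. (0[Q], y) : \<Union>\<C> --> y = 0[E]" using g unfolding good_def by blast
  ultimately show "\<Union>\<C> : Collect good" unfolding good_def by blast
 qed
 then obtain G where G: "good G" and mx: "!!Xa. good Xa ==> G <= Xa ==> Xa = G" by blast
 have sG: "submodule G R ?P" and fG: "!!x. x : H ==> (x, f x) : G"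
  and zG: "!!y. (0[Q], y) : G ==> y = 0[E]" using G unfolding good_def by auto
 have GP: "!!q y. (q, y) : G ==> q : carrier Q \<and> y : carrier E" using P.submoduleE(1)[OF sG] by auto
 have Gadd: "!!q y q' y'. (q, y) : G ==> (q', y') : G ==> (q +[Q] q', y +[E] y') : G"
  using P.submoduleE(5)[OF sG] by fastforce
 have Gsm: "!!r q y. r : carrier R ==> (q, y) : G ==> (r *[Q] q, r *[E] y) : G"
  using P.submoduleE(4)[OF sG] by fastforce
 have uniq: "y = y'" if "(q, y) : G" "(q, y') : G" for q y y'
 proof -
  have "(q, y) -[?P] (q, y') : G" using P.submodule_minus_closed[OF sG] that by blast
  then have "(q -[Q] q, y -[E] y') : G" using prod_mod_minus[OF Q E, of "(q,y)" "(q,y')"] GP that by simp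
  then have "y -[E] y' = 0[E]" using zG GP that by simp
  then show ?thesis using E.M.minus_eq_zero_iff GP that by blast
 qed
 have dom: "\<exists>y. (q, y) : G" if q: "q : carrier Q" for q
 proof (rule ccontr)
  assume no: "\<nexists>y. (q, y) : G"
  \<comment> \<open>\<open>J\<close> consists of the \<open>r\<close> that carry \<open>q\<close>
    into the domain of \<open>G\<close>, and \<open>F\<close> is the value of \<open>G\<close> at
    \<open>r q\<close>. Baer's property makes \<open>F\<close> multiplication by some
    \<open>y0\<close>; this \<open>y0\<close> is the value that the larger graph \<open>G'\<close>
    assigns to \<open>q\<close>.\<close>
  define J where "J = {r : carrier R. \<exists>y. (r *[Q] q, y) : G}"
  define F where "F r = (SOME y. (r *[Q] q, y) : G)" for r
  have F: "(r *[Q] q, F r) : G" if "r : J" for r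
   using that someI_ex[of "%y. (r *[Q] q, y) : G"] unfolding J_def F_def by blast
  have Feq: "F r = y" if "(r *[Q] q, y) : G" "r : carrier R" for r y
   using F[of r] that uniq unfolding J_def by blast
  have "submodule J R (ring_mod R)"
  proof -
   interpret RM: module R "ring_mod R" by (rule ring_mod_module[OF Q.is_cring])
   show ?thesis
   proof (rule RM.submoduleI')
    show "0[ring_mod R] : J" unfolding J_def using P.sub_zero[OF sG] q by auto
   next
    fix a b assume "a : J" "b : J"
    then show "a +[ring_mod R] b : J" unfolding J_def using Gadd q by (auto simp: Q.smult_l_distr; blast)
   next
    fix a x assume "a : carrier R" "x : J"
    then show "a *[ring_mod R] x : J" unfolding J_def using Gsm q by (fastforce simp: Q.smult_assoc1)
   qed (auto simp: J_def)
  qed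
  then have J: "ideal J R" using ideal_iff_submodule[OF Q.is_cring] by blast
  have JR: "!!r. r : J ==> r : carrier R" unfolding J_def by blast
  have "F : mod_hom R (ring_mod R\<lparr>carrier := J\<rparr>) E"
  proof (rule mod_homI)
   fix x y assume "x : carrier (ring_mod R\<lparr>carrier := J\<rparr>)" "y : carrier (ring_mod R\<lparr>carrier := J\<rparr>)"
   then have x: "x : J" "y : J" by auto
   then show "F (x +[ring_mod R\<lparr>carrier := J\<rparr>] y) = F x +[E] F y"
    using Gadd[OF F F, OF x] JR q by (auto intro!: Feq simp: Q.smult_l_distr)
  next
   fix r x assume r: "r : carrier R" and "x : carrier (ring_mod R\<lparr>carrier := J\<rparr>)"
   then have x: "x : J" by auto
   then show "F (r *[ring_mod R\<lparr>carrier := J\<rparr>] x) = r *[E] F x"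
    using Gsm[OF r F, OF x] JR q r by (auto intro!: Feq simp: Q.smult_assoc1)
  qed (use F GP in auto)
  then obtain y0 where y0: "y0 : carrier E" and Fy: "!!r. r : J ==> F r = r *[E] y0"
   using B J unfolding baer_def by blast
  define G' where "G' = {(h +[Q] r *[Q] q, y +[E] r *[E] y0) | h y r. (h, y) : G \<and> r : carrier R}"
  have G'I: "(h, y) : G ==> r : carrier R ==> a = h +[Q] r *[Q] q ==> b = y +[E] r *[E] y0 ==> (a, b) : G'"
   for h y r a b unfolding G'_def by blast
  have zG0: "(0[Q], 0[E]) : G" using P.sub_zero[OF sG] by simp
  have GG': "G <= G'"
  proof
   fix p assume "p : G"
   then show "p : G'" using G'I[of "fst p" "snd p" "0[R]" "fst p" "snd p"] q y0 GP[of "fst p" "snd p"] by auto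
  qed
  have "submodule G' R ?P"
  proof (rule P.submoduleI')
   show "G' <= carrier ?P" unfolding G'_def using GP q y0 by auto
   show "0[?P] : G'" using GG' P.sub_zero[OF sG] by blast
  next
   fix a b assume "a : G'" "b : G'"
   then obtain h y r h' y' r' where *: "(h, y) : G" "r : carrier R" "(h', y') : G" "r' : carrier R"
    "a = (h +[Q] r *[Q] q, y +[E] r *[E] y0)" "b = (h' +[Q] r' *[Q] q, y' +[E] r' *[E] y0)"
    unfolding G'_def by blast
   have "fst a +[Q] fst b = (h +[Q] h') +[Q] (r +[R] r') *[Q] q"
    "snd a +[E] snd b = (y +[E] y') +[E] (r +[R] r') *[E] y0"
    unfolding *(5,6) fst_conv snd_conv using GP[OF *(1)] GP[OF *(3)] q y0 *(2,4)
    by (simp_all only: Q.smult_l_distr E.smult_l_distr Q.M.add_add_swap E.M.add_add_swap Q.smult_closed E.smult_closed)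
   then show "a +[?P] b : G'"
    unfolding prod_mod_simps using G'I[OF Gadd[OF *(1,3)]] *(2,4) by simp
  next
   fix s a assume s: "s : carrier R" "a : G'"
   then obtain h y r where *: "(h, y) : G" "r : carrier R" "a = (h +[Q] r *[Q] q, y +[E] r *[E] y0)"
    unfolding G'_def by blast
   have "s *[Q] fst a = s *[Q] h +[Q] (s \<otimes>[R] r) *[Q] q"
    "s *[E] snd a = s *[E] y +[E] (s \<otimes>[R] r) *[E] y0"
    unfolding *(3) fst_conv snd_conv using GP[OF *(1)] q y0 *(2) s(1)
    by (simp_all only: Q.smult_r_distr E.smult_r_distr Q.smult_assoc1 E.smult_assoc1 Q.smult_closed E.smult_closed)
   then show "s *[?P] a : G'"
    unfolding prod_mod_simps using G'I[OF Gsm[OF s(1) *(1)]] *(2) s(1) by simp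
  qed
  moreover have "\<forall>x\<in>H. (x, f x) : G'" using fG GG' by blast
  moreover have "z = 0[E]" if z: "(0[Q], z) : G'" for z
  proof -
   obtain h y r where hyr: "(h, y) : G" "r : carrier R"
    "(0[Q], z) = (h +[Q] r *[Q] q, y +[E] r *[E] y0)"
    using z unfolding G'_def by blast
   then have *: "(h, y) : G" "r : carrier R" "h +[Q] r *[Q] q = 0[Q]" "z = y +[E] r *[E] y0"
    by auto
   note c = GP[OF *(1)]
   \<comment> \<open>A pair of \<open>G'\<close> over zero has \<open>r q = - h\<close> with
     \<open>h\<close> in the domain of \<open>G\<close>. Hence \<open>r\<close> lies in
     \<open>J\<close>, and the value \<open>r y0\<close> at \<open>r q\<close> must be
     \<open>- y\<close>.\<close>
   have "r *[Q] q = (-[R] 1[R]) *[Q] h"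
    using Q.M.minus_equality[of "r *[Q] q" h] *(2,3) c q by (simp add: Q.neg_smult Q.M.a_comm)
   then have "(r *[Q] q, (-[R] 1[R]) *[E] y) : G" using Gsm[OF _ *(1), of "-[R] 1[R]"] by simp
   then have "r : J" "F r = (-[R] 1[R]) *[E] y" using Feq *(2) unfolding J_def by auto
   then have "r *[E] y0 = -[E] y" using Fy c by (simp add: E.neg_smult)
   then show ?thesis using *(4) c by (simp add: E.M.r_neg)
  qed
  ultimately have "good G'" unfolding good_def by blast
  then have "G' = G" using mx GG' by blast
  moreover have "(q, y0) : G'" using G'I[OF zG0, of "1[R]" q y0] q y0 by simp
  ultimately show False using no by blast
 qed
 define g where "g q = (SOME y. (q, y) : G)" for q
 have g: "(q, g q) : G" if "q : carrier Q" for q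
  using someI_ex[OF dom[OF that]] unfolding g_def .
 have "g : mod_hom R Q E"
 proof (rule mod_homI)
  show "g x : carrier E" if "x : carrier Q" for x using g that GP by blast
  show "g (x +[Q] y) = g x +[E] g y" if "x : carrier Q" "y : carrier Q" for x y
   using uniq[OF g Gadd[OF g g]] that by simp
  show "g (r *[Q] x) = r *[E] g x" if "r : carrier R" "x : carrier Q" for r x
   using uniq[OF g Gsm[OF _ g]] that by simp
 qed
 moreover have "g x = f x" if "x : H" for x using uniq[OF g fG] that HQ by blast
 ultimately show ?thesis by blast
qed

text \<open>The only ideals of a field are the zero ideal and the whole field. Every vector space is
  thus injective, and this replaces bases in all the linear algebra below.\<close>

lemma field_baer:
 assumes "field K" "module K V"
 shows "baer K V"
 unfolding baer_def
proof (intro allI impI)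
 fix J f assume Jf: "ideal J K \<and> f : mod_hom K (ring_mod K\<lparr>carrier := J\<rparr>) V"
 interpret K: field K by fact
 interpret V: module K V by fact
 have J: "ideal J K" using Jf by blast
 have f: "f : mod_hom K (ring_mod K\<lparr>carrier := J\<rparr>) V" using Jf by blast
 have RM: "module K (ring_mod K)" by (rule ring_mod_module[OF K.is_cring])
 have sJ: "submodule J K (ring_mod K)" using J ideal_iff_submodule[OF K.is_cring] by blast
 have "J = {0[K]} \<or> J = carrier K" using K.all_ideals J by blast
 then show "\<exists>y\<in>carrier V. \<forall>r\<in>J. f r = r *[V] y"
 proof
  assume "J = {0[K]}"
  then show ?thesis
   using mod_hom_zero[OF f module.restrict_module[OF RM sJ] \<open>module K V\<close>] by (intro bexI[of _ "0[V]"]) auto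
 next
  assume J: "J = carrier K"
  have "f r = r *[V] f 1[K]" if "r : carrier K" for r
   using mod_homD(3)[OF f, of r "1[K]"] that J by simp
  moreover have "f 1[K] : carrier V" using mod_homD(1)[OF f, of "1[K]"] J by simp
  ultimately show ?thesis using J by blast
 qed
qed

text \<open>The extension is made into the subspace \<open>U\<close>, which is itself a vector space
  and so has Baer's property; this keeps the values in \<open>U\<close>.\<close>

lemma linear_extension:
 assumes "field K" "module K V" "module K W" "submodule H K V" "submodule U K W"
  and "f : mod_hom K (V\<lparr>carrier := H\<rparr>) W" "f ` H <= U"
 shows "\<exists>g\<in>mod_hom K V W. g ` carrier V <= U \<and> (\<forall>x\<in>H. g x = f x)"
proof -
 interpret W: module K W by fact
 have U: "module K (W\<lparr>carrier := U\<rparr>)" by (rule W.restrict_module) fact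
 have "f : mod_hom K (V\<lparr>carrier := H\<rparr>) (W\<lparr>carrier := U\<rparr>)" using assms by (intro mod_hom_corestrict) auto
 then obtain g where "g : mod_hom K V (W\<lparr>carrier := U\<rparr>)" "\<forall>x\<in>H. g x = f x"
  using baer_extension[OF assms(2) U field_baer[OF assms(1) U] assms(4)] by blast
 moreover have "U <= carrier W" using W.submoduleE(1) assms by blast
 ultimately show ?thesis using mod_hom_expand[of g K V U W] mod_homD(1)[of g K V "W\<lparr>carrier := U\<rparr>"] by auto
qed

lemma linear_projection:
 assumes "field K" "module K V" "submodule H K V"
 shows "\<exists>p\<in>mod_hom K V V. p ` carrier V <= H \<and> (\<forall>x\<in>H. p x = x)"
proof -
 interpret V: module K V by fact
 have "(%x. x) : mod_hom K (V\<lparr>carrier := H\<rparr>) V"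
  using V.submoduleE(1)[OF assms(3)] by (intro mod_homI) auto
 from linear_extension[OF assms(1,2,2,3,3) this] show ?thesis by auto
qed

text \<open>A projection \<open>p\<close> onto the kernel of \<open>f\<close> in \<open>Xa\<close>
  makes \<open>x - p x\<close> depend on \<open>f x\<close> alone. This defines \<open>s\<close> on
  the image of \<open>Xa\<close>, and \<open>s\<close> extends to all of \<open>W\<close> with
  values in \<open>Xa\<close>. So \<open>x = p x + s (f x)\<close> on \<open>Xa\<close>.\<close>

lemma linear_splitting:
 assumes K: "field K" and V: "module K V" and W: "module K W" and f: "f : mod_hom K V W" and Xa: "submodule Xa K V"
 shows "\<exists>p s. p : mod_hom K V V \<and> s : mod_hom K W V \<and> (\<forall>x\<in>carrier V. p x : Xa \<and> f (p x) = 0[W]) \<and>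
  (\<forall>x\<in>Xa. f x = 0[W] --> p x = x) \<and> (\<forall>w\<in>carrier W. s w : Xa) \<and> (\<forall>x\<in>Xa. s (f x) = x -[V] p x)"
proof -
 interpret V: module K V by fact
 interpret W: module K W by fact
 have XV: "Xa <= carrier V" by (rule V.submoduleE(1)[OF Xa])
 let ?Z = "{x : Xa. f x = 0[W]}"
 have Z: "submodule ?Z K V"
  using V.submoduleE[OF Xa] V.sub_zero[OF Xa] mod_homD[OF f] mod_hom_zero[OF f V W]
  by (intro V.submoduleI') (auto simp: subset_eq)
 obtain p where p: "p : mod_hom K V V" "p ` carrier V <= ?Z" "!!x. x : ?Z ==> p x = x"
  using linear_projection[OF K V Z] by blast
 note p' = mod_homD[OF p(1)]
 \<comment> \<open>The value at \<open>w\<close> uses some preimage \<open>x\<close> of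
   \<open>w\<close> in \<open>Xa\<close>; \<open>key\<close> shows that every preimage gives the
   same value.\<close>
 define g where "g w = (let x = SOME x. x : Xa \<and> f x = w in x -[V] p x)" for w
 have pz: "p : mod_hom K V V" by (rule p(1))
 have key: "g (f x) = x -[V] p x" if x: "x : Xa" for x
 proof -
  define y where "y = (SOME y. y : Xa \<and> f y = f x)"
  have "y : Xa \<and> f y = f x" unfolding y_def by (rule someI[of _ x]) (use x in auto)
  then have y: "y : Xa" "f y = f x" by auto
  have c: "x : carrier V" "y : carrier V" "p x : carrier V" "p y : carrier V" "f x : carrier W"
   using x y XV p'(1) mod_homD(1)[OF f] by auto
  have "f (x -[V] y) = 0[W]" using mod_hom_minus[OF f V W c(1,2)] y c by simp
  then have "p (x -[V] y) = x -[V] y" using p(3) V.submodule_minus_closed[OF Xa x y(1)] by blast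
  then have e: "p x -[V] p y = x -[V] y" using mod_hom_minus[OF p(1) V V c(1,2)] by simp
  have "y -[V] p y = x -[V] p x"
  proof -
   have "x = (p x -[V] p y) +[V] y" using e c by (simp add: V.M.minus_add_cancel)
   then have "x -[V] p x = ((p x -[V] p y) +[V] y) -[V] p x" by simp
   also have "\<dots> = y -[V] p y"
    using c by (simp add: V.M.minus_eq V.M.a_ac V.M.r_neg1 V.M.r_neg2)
   finally show ?thesis by simp
  qed
  then show ?thesis unfolding g_def Let_def y_def[symmetric] .
 qed
 have fX: "submodule (f ` Xa) K W" by (rule submodule_mod_hom_image[OF f V W Xa])
 have gX: "g w : Xa" if w: "w : f ` Xa" for w
 proof -
  obtain x where x: "x : Xa" "w = f x" using w by blast
  have "p x : Xa" using p(2) x XV by auto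
  then show ?thesis using x key[of x] V.submodule_minus_closed[OF Xa] by simp
 qed
 have gm: "g : mod_hom K (W\<lparr>carrier := f ` Xa\<rparr>) V"
 proof (rule mod_homI)
  fix w assume "w : carrier (W\<lparr>carrier := f ` Xa\<rparr>)"
  then show "g w : carrier V" using gX XV by auto
 next
  fix w w' assume "w : carrier (W\<lparr>carrier := f ` Xa\<rparr>)" "w' : carrier (W\<lparr>carrier := f ` Xa\<rparr>)"
  then obtain x x' where x: "x : Xa" "w = f x" "x' : Xa" "w' = f x'" by auto
  have c: "x : carrier V" "x' : carrier V" "p x : carrier V" "p x' : carrier V" using x XV p'(1) by auto
  have "w +[W] w' = f (x +[V] x')" using x mod_homD(2)[OF f] c by simp
  then show "g (w +[W\<lparr>carrier := f ` Xa\<rparr>] w') = g w +[V] g w'"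
   using key[of "x +[V] x'"] key[of x] key[of x'] V.submoduleE(5)[OF Xa] x c p'(2) by (simp add: V.M.minus_add_minus)
 next
  fix r w assume r: "r : carrier K" and "w : carrier (W\<lparr>carrier := f ` Xa\<rparr>)"
  then obtain x where x: "x : Xa" "w = f x" by auto
  have c: "x : carrier V" "p x : carrier V" using x XV p'(1) by auto
  have "r *[W] w = f (r *[V] x)" using x mod_homD(3)[OF f] c r by simp
  then show "g (r *[W\<lparr>carrier := f ` Xa\<rparr>] w) = r *[V] g w"
   using key[of "r *[V] x"] key[of x] V.submoduleE(4)[OF Xa] x c p'(3) r by (simp add: V.smult_minus)
 qed
 have gX': "g ` (f ` Xa) <= Xa" using gX by (auto simp del: image_image)
 from linear_extension[OF K W V fX Xa gm gX']
 obtain s where s: "s : mod_hom K W V" "s ` carrier W <= Xa" "\<forall>w\<in>f ` Xa. s w = g w"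
  by (elim bexE conjE)
 have "s (f x) = x -[V] p x" if "x : Xa" for x
  using bspec[OF s(3), of "f x"] key[OF that] that by simp
 moreover have "p x : Xa \<and> f (p x) = 0[W]" if "x : carrier V" for x using p(2) that by blast
 moreover have "s w : Xa" if "w : carrier W" for w using s(2) that by blast
 ultimately show ?thesis using p(1) p(3) s(1) by blast
qed

text \<open>An ideal of \<open>R\<close> and \<open>R\<close> itself are modules whose carriers lie
  in the type of \<open>R\<close>, so the restricted quantifier in \<open>injective_module\<close>
  covers Baer's test.\<close>

lemma injective_imp_baer:
 assumes E: "injective_module R E"
 shows "baer R E"
 unfolding baer_def
proof (intro allI impI)
 interpret E: module R E using E unfolding injective_module_def by blast
 fix J f assume Jf: "ideal J R \<and> f : mod_hom R (ring_mod R\<lparr>carrier := J\<rparr>) E"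
 have RM: "module R (ring_mod R)" by (rule ring_mod_module[OF E.is_cring])
 have sJ: "submodule J R (ring_mod R)" using Jf ideal_iff_submodule[OF E.is_cring] by blast
 have JR: "J <= carrier R" using module.submoduleE(1)[OF RM sJ] by simp
 have i: "(%x. x) : mod_hom R (ring_mod R\<lparr>carrier := J\<rparr>) (ring_mod R)"
  using JR by (intro mod_homI) auto
 have "\<exists>g\<in>mod_hom R (ring_mod R) E. \<forall>x\<in>carrier (ring_mod R\<lparr>carrier := J\<rparr>). g x = f x"
  using E[unfolded injective_module_def, THEN conjunct2, rule_format,
    of "ring_mod R\<lparr>carrier := J\<rparr>" "ring_mod R" "%x. x" f]
   module.restrict_module[OF RM sJ] RM i Jf by auto
 then obtain g where g: "g : mod_hom R (ring_mod R) E" "!!x. x : J ==> g x = f x" by auto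
 have "f r = r *[E] g 1[R]" if "r : J" for r
  using g(2)[OF that] mod_homD(3)[OF g(1), of r "1[R]"] that JR by auto
 then show "\<exists>y\<in>carrier E. \<forall>r\<in>J. f r = r *[E] y" using mod_homD(1)[OF g(1), of "1[R]"] by auto
qed

lemma baer_extension_mono:
 assumes P: "module R P" and Q: "module R Q" and E: "module R E" and B: "baer R E"
  and i: "i : mod_hom R P Q" and inj: "inj_on i (carrier P)" and f: "f : mod_hom R P E"
 shows "\<exists>g\<in>mod_hom R Q E. \<forall>x\<in>carrier P. g (i x) = f x"
proof -
 interpret P: module R P by fact
 interpret Q: module R Q by fact
 let ?j = "inv_into (carrier P) i"
 have j: "!!x. x : carrier P ==> ?j (i x) = x" using inj by (rule inv_into_f_f)
 have "(%q. f (?j q)) : mod_hom R (Q\<lparr>carrier := i ` carrier P\<rparr>) E"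
 proof (rule mod_homI)
  fix x y assume "x : carrier (Q\<lparr>carrier := i ` carrier P\<rparr>)" "y : carrier (Q\<lparr>carrier := i ` carrier P\<rparr>)"
  then obtain a b where ab: "a : carrier P" "x = i a" "b : carrier P" "y = i b" by auto
  have "x +[Q] y = i (a +[P] b)" using mod_homD(2)[OF i] ab by simp
  then show "f (?j (x +[Q\<lparr>carrier := i ` carrier P\<rparr>] y)) = f (?j x) +[E] f (?j y)"
   using j[of "a +[P] b"] j[of a] j[of b] ab mod_homD(2)[OF f] by simp
 next
  fix r x assume r: "r : carrier R" and "x : carrier (Q\<lparr>carrier := i ` carrier P\<rparr>)"
  then obtain a where ab: "a : carrier P" "x = i a" by auto
  have "r *[Q] x = i (r *[P] a)" using mod_homD(3)[OF i] ab r by simp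
  then show "f (?j (r *[Q\<lparr>carrier := i ` carrier P\<rparr>] x)) = r *[E] f (?j x)"
   using j[of "r *[P] a"] j[of a] ab mod_homD(3)[OF f] r by simp
 qed (use j mod_homD(1)[OF f] in auto)
 moreover have "submodule (i ` carrier P) R Q"
  by (rule submodule_mod_hom_image[OF i P Q P.carrier_is_submodule])
 ultimately obtain g where "g : mod_hom R Q E" "!!x. x : i ` carrier P ==> g x = f (?j x)"
  using baer_extension[OF Q E B] by blast
 then show ?thesis using j by (intro bexI[of _ g]) auto
qed

lemma baer_imp_injective:
 "module R E ==> baer R E ==> injective_module R E"
 unfolding injective_module_def using baer_extension_mono by blast

section \<open>Quotients, restriction of scalars and transport of structure\<close>

lemma quot_module_simps [simp]:
 "carrier (quot_module M H) = a_rcosets\<^bsub>M\<^esub> H" "0[quot_module M H] = H"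
 "Xa +[quot_module M H] Y = Xa <+>\<^bsub>M\<^esub> Y"
 "r *[quot_module M H] Xa = (\<Union>x\<in>Xa. H +>\<^bsub>M\<^esub> (r *[M] x))"
 by (simp_all add: quot_module_def)

lemma (in module) quot_module_props:
 assumes H: "submodule H R M"
 shows quot_module_module: "module R (quot_module M H)"
  and quot_proj_hom: "(%x. H +>\<^bsub>M\<^esub> x) : mod_hom R M (quot_module M H)"
  and quot_proj_surj: "(%x. H +>\<^bsub>M\<^esub> x) ` carrier M = carrier (quot_module M H)"
  and quot_proj_kernel: "!!x. x : carrier M ==> H +>\<^bsub>M\<^esub> x = H \<longleftrightarrow> x : H"
proof -
 have sg: "subgroup H (add_monoid M)" using H unfolding submodule_def by blast
 interpret S: abelian_subgroup H M
  by (rule abelian_subgroupI2[OF M.a_comm_group sg])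
 let ?Q = "quot_module M H" and ?c = "%x. H +>\<^bsub>M\<^esub> x"
 have HM: "H <= carrier M" by (rule submoduleE(1)[OF H])
 show surj: "?c ` carrier M = carrier ?Q" by (auto simp: A_RCOSETS_def')
 have add: "?c x +[?Q] ?c y = ?c (x +[M] y)" if "x : carrier M" "y : carrier M" for x y
  using S.a_rcos_sum that by simp
 have eqI: "?c y = ?c x" if "y : ?c x" "x : carrier M" for x y
  using S.a_repr_independence'[OF that] by simp
 have elem: "\<exists>h\<in>H. y = h +[M] x" if "y : ?c x" for x y using that by (auto simp: a_r_coset_def')
 have sm: "r *[?Q] ?c x = ?c (r *[M] x)" if r: "r : carrier R" "x : carrier M" for r x
 proof -
  have "?c (r *[M] y) = ?c (r *[M] x)" if y: "y : ?c x" for y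
  proof -
   obtain h where h: "h : H" "y = h +[M] x" using elem[OF y] by blast
   have "r *[M] y = r *[M] h +[M] r *[M] x" using h HM r by (auto simp: smult_r_distr)
   then have "r *[M] y : ?c (r *[M] x)" using submoduleE(4)[OF H r(1) h(1)] by (auto simp: a_r_coset_def')
   then show ?thesis using eqI r by simp
  qed
  moreover have "x : ?c x" using S.a_rcos_self r by blast
  ultimately show ?thesis unfolding quot_module_simps by blast
 qed
 show hom: "?c : mod_hom R M ?Q"
  by (rule mod_homI) (use surj add sm in auto)
 show ker: "?c x = H \<longleftrightarrow> x : H" if "x : carrier M" for x
  using S.a_rcos_const S.a_rcos_self that by blast
 have c0: "?c 0[M] = 0[?Q]" using ker sub_zero[OF H] by simp
 have ex: "\<exists>x\<in>carrier M. Xa = ?c x" if "Xa : carrier ?Q" for Xa using surj that by blast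
 have cc: "!!x. x : carrier M ==> ?c x : carrier ?Q" using surj by blast
 note calc = add sm M.a_closed smult_closed R.a_closed R.m_closed R.one_closed smult_one M.zero_closed
 show "module R ?Q"
 proof (rule moduleI)
  show "abelian_group ?Q"
  proof (rule abelian_groupI)
   fix Xa Y assume "Xa : carrier ?Q" "Y : carrier ?Q"
   then obtain x y where xy: "x : carrier M" "y : carrier M" "Xa = ?c x" "Y = ?c y"
   using ex[of Xa] ex[of Y] by blast
   show "Xa +[?Q] Y : carrier ?Q" unfolding xy(3,4) add[OF xy(1,2)] using cc xy by simp
   show "Xa +[?Q] Y = Y +[?Q] Xa"
    unfolding xy(3,4) add[OF xy(1,2)] add[OF xy(2,1)] using xy by (simp only: M.a_comm)
  next
   show "0[?Q] : carrier ?Q" unfolding c0[symmetric] by (rule cc) simp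
  next
   fix Xa Y Z assume "Xa : carrier ?Q" "Y : carrier ?Q" "Z : carrier ?Q"
   then have XYZ: "Xa : carrier ?Q" "Y : carrier ?Q" "Z : carrier ?Q" .
   obtain x where x: "x : carrier M" "Xa = ?c x" using ex[OF XYZ(1)] by (elim bexE)
   obtain y where y: "y : carrier M" "Y = ?c y" using ex[OF XYZ(2)] by (elim bexE)
   obtain z where z: "z : carrier M" "Z = ?c z" using ex[OF XYZ(3)] by (elim bexE)
   note xy = x(1) y(1) z(1) x(2) y(2) z(2)
   show "Xa +[?Q] Y +[?Q] Z = Xa +[?Q] (Y +[?Q] Z)"
    unfolding xy(4-6) using xy(1-3) by (simp only: calc M.a_assoc)
  next
   fix Xa assume "Xa : carrier ?Q"
   then obtain x where x: "x : carrier M" "Xa = ?c x" using ex by blast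
   show "0[?Q] +[?Q] Xa = Xa"
    unfolding x(2) c0[symmetric] using x(1) by (simp only: calc M.l_zero)
   have "?c (-[M] x) +[?Q] Xa = 0[?Q]"
    unfolding x(2) c0[symmetric] using x(1) by (simp only: calc M.l_neg M.a_inv_closed)
   then show "\<exists>Y\<in>carrier ?Q. Y +[?Q] Xa = 0[?Q]" using cc[of "-[M] x"] x(1) by blast
  qed
 next
  fix a b Xa assume a: "a : carrier R" "b : carrier R" and "Xa : carrier ?Q"
  then obtain x where x: "x : carrier M" "Xa = ?c x" using ex by blast
  show "(a \<oplus> b) *[?Q] Xa = a *[?Q] Xa +[?Q] b *[?Q] Xa"
   unfolding x(2) using a x(1) by (simp only: calc smult_l_distr)
  show "a \<otimes> b *[?Q] Xa = a *[?Q] (b *[?Q] Xa)"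
   unfolding x(2) using a x(1) by (simp only: calc smult_assoc1)
 next
  fix a Xa Y assume a: "a : carrier R" and "Xa : carrier ?Q" "Y : carrier ?Q"
  then obtain x y where xy: "x : carrier M" "y : carrier M" "Xa = ?c x" "Y = ?c y"
   using ex[of Xa] ex[of Y] by blast
  show "a *[?Q] (Xa +[?Q] Y) = a *[?Q] Xa +[?Q] a *[?Q] Y"
   unfolding xy(3,4) using a xy(1,2) by (simp only: calc smult_r_distr)
 next
  fix Xa assume "Xa : carrier ?Q"
  then obtain x where x: "x : carrier M" "Xa = ?c x" using ex by blast
  show "\<one> *[?Q] Xa = Xa" unfolding x(2) using x(1) by (simp only: calc)
 next
  fix a Xa assume a: "a : carrier R" and "Xa : carrier ?Q"
  then obtain x where x: "x : carrier M" "Xa = ?c x" using ex by blast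
  show "a *[?Q] Xa : carrier ?Q" unfolding x(2) sm[OF a x(1)] using cc a x(1) by simp
 qed (rule is_cring)
qed

text \<open>Scalars are restricted along a map \<open>\<iota>\<close> instead of through the action
  of an algebra, because the tensor product ring is a bare ring record that carries no action of
  \<open>K\<close>.\<close>

definition kmod :: "('k => 'a) => ('a, 'm, 'x) module_scheme => ('k, 'm) module"
 where "kmod \<iota> M = \<lparr>carrier = carrier M, monoid.mult = undefined, monoid.one = undefined,
  ring.zero = 0[M], ring.add = ring.add M, smult = (%c x. \<iota> c *[M] x)\<rparr>"

lemma kmod_simps [simp]:
 "carrier (kmod \<iota> M) = carrier M" "0[kmod \<iota> M] = 0[M]" "x +[kmod \<iota> M] y = x +[M] y"
 "c *[kmod \<iota> M] x = \<iota> c *[M] x" "kmod \<iota> (M\<lparr>carrier := H\<rparr>) = (kmod \<iota> M)\<lparr>carrier := H\<rparr>"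
 by (simp_all add: kmod_def)

lemma kmod_minus [simp]: "x -[kmod \<iota> M] y = x -[M] y"
 by (simp add: a_minus_def a_inv_def m_inv_def kmod_def)

lemma kmod_module:
 assumes "cring K" "\<iota> : ring_hom K R" "module R M"
 shows "module K (kmod \<iota> M)"
proof -
 interpret M: module R M by fact
 note h = ring_hom_closed[OF assms(2)] ring_hom_add[OF assms(2)] ring_hom_mult[OF assms(2)] ring_hom_one[OF assms(2)]
 show ?thesis
 proof (rule moduleI)
  show "abelian_group (kmod \<iota> M)"
  proof (rule abelian_groupI)
   fix x assume "x : carrier (kmod \<iota> M)"
   then show "\<exists>y\<in>carrier (kmod \<iota> M). y +[kmod \<iota> M] x = 0[kmod \<iota> M]"
    using M.M.l_neg[of x] by (intro bexI[of _ "-[M] x"]) simp_all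
  qed (simp_all add: M.M.a_ac)
 qed (simp_all add: h assms(1) M.smult_l_distr M.smult_r_distr M.smult_assoc1)
qed

lemma mod_hom_kmod:
 "f : mod_hom R M N ==> \<iota> : ring_hom K R ==> f : mod_hom K (kmod \<iota> M) (kmod \<iota> N)"
 by (rule mod_homI) (simp_all add: mod_homD ring_hom_closed)

lemma submodule_kmod:
 assumes "cring K" "\<iota> : ring_hom K R" "module R M" "submodule H R M"
 shows "submodule H K (kmod \<iota> M)"
proof -
 interpret M: module R M by fact
 interpret N: module K "kmod \<iota> M" by (rule kmod_module[OF assms(1-3)])
 show ?thesis
  using M.submoduleE(1,4,5)[OF assms(4)] M.sub_zero[OF assms(4)] ring_hom_closed[OF assms(2)]
  by (intro N.submoduleI') simp_all
qed

text \<open>Moves a module along an injection. It brings modules built from functions or cosets back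
  into the type in which resolutions are chosen.\<close>

definition transport :: "('m => 'n) => ('a, 'm, 'x) module_scheme => ('a, 'n) module"
 where "transport j M = \<lparr>carrier = j ` carrier M, monoid.mult = undefined, monoid.one = undefined,
  ring.zero = j 0[M],
  ring.add = (%x y. j (inv_into (carrier M) j x +[M] inv_into (carrier M) j y)),
  smult = (%r x. j (r *[M] inv_into (carrier M) j x))\<rparr>"

lemma transport_simps [simp]:
 "carrier (transport j M) = j ` carrier M" "0[transport j M] = j 0[M]"
 "x +[transport j M] y = j (inv_into (carrier M) j x +[M] inv_into (carrier M) j y)"
 "r *[transport j M] x = j (r *[M] inv_into (carrier M) j x)"
 by (simp_all add: transport_def)

lemma transport_props:
 assumes M: "module R M" and j: "inj_on j (carrier M)"
 shows transport_module: "module R (transport j M)"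
  and transport_hom: "j : mod_hom R M (transport j M)"
  and transport_inv_hom: "inv_into (carrier M) j : mod_hom R (transport j M) M"
proof -
 interpret M: module R M by fact
 note inv = inv_into_f_f[OF j]
 show hom: "j : mod_hom R M (transport j M)"
  by (rule mod_homI) (simp_all add: inv)
 show "inv_into (carrier M) j : mod_hom R (transport j M) M"
  by (rule mod_homI) (auto simp: inv)
 show "module R (transport j M)"
 proof (rule moduleI)
  show "abelian_group (transport j M)"
  proof (rule abelian_groupI)
   fix x assume "x : carrier (transport j M)"
   then obtain a where "a : carrier M" "x = j a" by auto
   then show "\<exists>y\<in>carrier (transport j M). y +[transport j M] x = 0[transport j M]"
    by (intro bexI[of _ "j (-[M] a)"]) (simp_all add: inv M.M.l_neg)
  qed (auto simp: inv M.M.a_ac)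
 qed (auto simp: inv M.is_cring M.smult_l_distr M.smult_r_distr M.smult_assoc1)
qed

text \<open>\<open>N\<close> is a retract of \<open>M\<close> through \<open>f\<close> and
  \<open>g\<close>, and a retract of an injective module is injective: solve in \<open>M\<close>,
  then apply \<open>f\<close>.\<close>

lemma baer_iso:
 assumes "f : mod_hom R M N" "g : mod_hom R N M" "!!x. x : carrier N ==> f (g x) = x" and B: "baer R M"
  and R: "cring R"
 shows "baer R N"
 unfolding baer_def
proof (intro allI impI)
 fix J h assume Jh: "ideal J R \<and> h : mod_hom R (ring_mod R\<lparr>carrier := J\<rparr>) N"
 then have J: "ideal J R" and h: "h : mod_hom R (ring_mod R\<lparr>carrier := J\<rparr>) N" by auto
 have gh: "(%x. g (h x)) : mod_hom R (ring_mod R\<lparr>carrier := J\<rparr>) M" by (rule mod_hom_compose[OF h assms(2)])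
 have "\<exists>y\<in>carrier M. \<forall>r\<in>J. g (h r) = r *[M] y"
  by (rule mp[OF spec[OF spec[OF B[unfolded baer_def]]] conjI[OF J gh]])
 then obtain y where y: "y : carrier M" "\<forall>r\<in>J. g (h r) = r *[M] y" by (elim bexE)
 have JR: "J <= carrier R" using ideal.Icarr[OF J] by blast
 have "h r = r *[N] f y" if r: "r : J" for r
 proof -
  have "h r : carrier N" using r mod_homD(1)[OF h, of r] by simp
  from assms(3)[OF this] bspec[OF y(2) r] have "h r = f (r *[M] y)" by (rule_tac sym) simp
  then show ?thesis using mod_homD(3)[OF assms(1), of r y] y(1) r JR by auto
 qed
 then show "\<exists>y\<in>carrier N. \<forall>r\<in>J. h r = r *[N] y" using mod_homD(1)[OF assms(1) y(1)] by blast
qed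

section \<open>Coinduced modules and injective modules of bounded size\<close>

text \<open>This is the coinduced module Hom(R, M) over \<open>K\<close>. Its elements are
  extensional, so that homomorphisms agreeing on \<open>R\<close> are equal as functions.\<close>

definition coind :: "('k, 's) ring_scheme => ('k => 'a) => ('a, 'r) ring_scheme => ('a, 'm, 'x) module_scheme => ('a, 'a => 'm) module"
 where "coind K \<iota> R M = \<lparr>carrier = mod_hom K (kmod \<iota> (ring_mod R)) (kmod \<iota> M) \<inter> extensional (carrier R),
  monoid.mult = undefined, monoid.one = undefined,
  ring.zero = (\<lambda>r\<in>carrier R. 0[M]), ring.add = (%g h. \<lambda>r\<in>carrier R. g r +[M] h r),
  smult = (%s g. \<lambda>r\<in>carrier R. g (s \<otimes>[R] r))\<rparr>"

lemma coind_simps [simp]: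
 "0[coind K \<iota> R M] = (\<lambda>r\<in>carrier R. 0[M])"
 "g +[coind K \<iota> R M] h = (\<lambda>r\<in>carrier R. g r +[M] h r)"
 "s *[coind K \<iota> R M] g = (\<lambda>r\<in>carrier R. g (s \<otimes>[R] r))"
 by (simp_all add: coind_def)

lemma coind_carrier:
 "g : carrier (coind K \<iota> R M) \<longleftrightarrow> g : extensional (carrier R) \<and> (\<forall>r\<in>carrier R. g r : carrier M) \<and>
  (\<forall>r\<in>carrier R. \<forall>s\<in>carrier R. g (r +[R] s) = g r +[M] g s) \<and>
  (\<forall>c\<in>carrier K. \<forall>r\<in>carrier R. g (\<iota> c \<otimes>[R] r) = \<iota> c *[M] g r)"
 by (auto simp: coind_def mod_hom_def hom_def Pi_def)

lemma coind_module:
 assumes "\<iota> : ring_hom K R" "module R M"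
 shows "module R (coind K \<iota> R M)"
proof -
 interpret M: module R M by fact
 let ?C = "coind K \<iota> R M"
 note \<iota> = ring_hom_closed[OF assms(1)]
 have D: "g : extensional (carrier R)" "!!r. r : carrier R ==> g r : carrier M"
  "!!r s. r : carrier R ==> s : carrier R ==> g (r +[R] s) = g r +[M] g s"
  "!!c r. c : carrier K ==> r : carrier R ==> g (\<iota> c \<otimes>[R] r) = \<iota> c *[M] g r"
  if "g : carrier ?C" for g
  using that[unfolded coind_carrier] by blast+
 have add: "g +[?C] h : carrier ?C" if "g : carrier ?C" "h : carrier ?C" for g h
  unfolding coind_carrier using D[OF that(1)] D[OF that(2)]
  by (auto simp: \<iota> M.smult_r_distr M.M.add_add_swap)
 have zero: "0[?C] : carrier ?C" unfolding coind_carrier by (auto simp: \<iota>)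
 have neg: "(\<lambda>r\<in>carrier R. -[M] g r) : carrier ?C" if "g : carrier ?C" for g
  unfolding coind_carrier using D[OF that]
  by (auto simp: \<iota> M.smult_r_minus M.M.minus_add M.M.a_comm)
 have sm: "s *[?C] g : carrier ?C" if s: "s : carrier R" and "g : carrier ?C" for g s
 proof -
  have "s \<otimes>[R] (\<iota> c \<otimes>[R] r) = \<iota> c \<otimes>[R] (s \<otimes>[R] r)" if "c : carrier K" "r : carrier R" for c r
   using s that \<iota> by (simp add: M.m_lcomm)
  then show ?thesis unfolding coind_carrier using D[OF that(2)] s by (auto simp: \<iota> M.r_distr)
 qed
 show ?thesis
 proof (rule moduleI)
  show "abelian_group ?C"
  proof (rule abelian_groupI)
   fix g assume g: "g : carrier ?C"
   show "\<exists>h\<in>carrier ?C. h +[?C] g = 0[?C]"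
    by (rule bexI[OF _ neg[OF g]]) (use D(2)[OF g] in \<open>auto simp: M.M.l_neg restrict_def\<close>)
   show "0[?C] +[?C] g = g"
    by (rule extensionalityI[of _ "carrier R"]) (use D(1,2)[OF g] in auto)
  next
   fix f g h assume f: "f : carrier ?C" and g: "g : carrier ?C" and h: "h : carrier ?C"
   show "f +[?C] g +[?C] h = f +[?C] (g +[?C] h)"
    using D(2)[OF f] D(2)[OF g] D(2)[OF h] by (auto simp: restrict_def M.M.a_assoc)
   show "f +[?C] g = g +[?C] f"
    using D(2)[OF f] D(2)[OF g] by (auto simp: restrict_def M.M.a_comm)
  qed (use add zero in auto)
 next
  fix a g assume a: "a : carrier R" and g: "g : carrier ?C"
  show "a *[?C] g : carrier ?C" using sm[OF a g] .
 next
  fix a b g assume a: "a : carrier R" "b : carrier R" and g: "g : carrier ?C"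
  show "(a +[R] b) *[?C] g = a *[?C] g +[?C] b *[?C] g"
   using a D(3)[OF g] by (auto simp: restrict_def M.l_distr)
  show "a \<otimes>[R] b *[?C] g = a *[?C] (b *[?C] g)"
  proof -
   have "a \<otimes>[R] b \<otimes>[R] r = b \<otimes>[R] (a \<otimes>[R] r)" if "r : carrier R" for r
    using a that by (metis M.m_assoc M.m_comm)
   then show ?thesis using a by (auto simp: restrict_def)
  qed
 next
  fix a g h assume a: "a : carrier R" and g: "g : carrier ?C" "h : carrier ?C"
  show "a *[?C] (g +[?C] h) = a *[?C] g +[?C] a *[?C] h"
   using a by (auto simp: restrict_def)
 next
  fix g assume g: "g : carrier ?C"
  show "1[R] *[?C] g = g"
   by (rule extensionalityI[of _ "carrier R"]) (use D(1)[OF g] in auto)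
 qed (rule M.is_cring)
qed

text \<open>Evaluation at 1 turns an \<open>R\<close>-homomorphism from \<open>J\<close> into the
  coinduced module into a \<open>K\<close>-linear map from \<open>J\<close> to \<open>M\<close>.
  That map extends to \<open>R\<close> since \<open>K\<close> is a field, and the extension is the
  required element \<open>y\<close>.\<close>

lemma coind_baer:
 assumes K: "field K" and \<iota>: "\<iota> : ring_hom K R" and M: "module R M"
 shows "baer R (coind K \<iota> R M)"
 unfolding baer_def
proof (intro allI impI)
 interpret M: module R M by fact
 interpret K: field K by fact
 let ?C = "coind K \<iota> R M"
 fix J f assume Jf: "ideal J R \<and> f : mod_hom R (ring_mod R\<lparr>carrier := J\<rparr>) ?C"
 then have J: "ideal J R" and f: "f : mod_hom R (ring_mod R\<lparr>carrier := J\<rparr>) ?C" by auto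
 have RM: "module R (ring_mod R)" by (rule ring_mod_module[OF M.is_cring])
 have sJ: "submodule J R (ring_mod R)" using J ideal_iff_submodule[OF M.is_cring] by blast
 have JR: "J <= carrier R" using module.submoduleE(1)[OF RM sJ] by simp
 note f' = mod_homD[OF f, simplified]
 have kR: "module K (kmod \<iota> (ring_mod R))" by (rule kmod_module[OF K.is_cring \<iota> RM])
 have kM: "module K (kmod \<iota> M)" by (rule kmod_module[OF K.is_cring \<iota> M])
 have skJ: "submodule J K (kmod \<iota> (ring_mod R))" by (rule submodule_kmod[OF K.is_cring \<iota> RM sJ])
 have "(%r. f r 1[R]) : mod_hom K (kmod \<iota> (ring_mod R)\<lparr>carrier := J\<rparr>) (kmod \<iota> M)"
 proof (rule mod_homI, goal_cases)
  case (1 x)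
  then show ?case using f'(1)[of x] coind_carrier[of "f x" K \<iota> R M] by simp
 next
  case (2 x y)
  then show ?case using f'(2)[of x y] by simp
 next
  case (3 c x)
  then have cx: "\<iota> c : carrier R" "x : J" "x : carrier R" using ring_hom_closed[OF \<iota>] JR by auto
  have "f (\<iota> c \<otimes>[R] x) 1[R] = f x (\<iota> c \<otimes>[R] 1[R])" using f'(3)[OF cx(1,2)] by simp
  also have "\<dots> = \<iota> c *[M] f x 1[R]"
   using f'(1)[OF cx(2)] 3(1) M.one_closed unfolding coind_carrier by blast
  finally show ?case by simp
 qed
 from baer_extension[OF kR kM field_baer[OF K kM] skJ this]
 obtain h where h: "h : mod_hom K (kmod \<iota> (ring_mod R)) (kmod \<iota> M)" "\<forall>r\<in>J. h r = f r 1[R]" by (elim bexE)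
 define y where "y = restrict h (carrier R)"
 have y: "y : carrier ?C"
  unfolding coind_carrier y_def using mod_homD[OF h(1)] ring_hom_closed[OF \<iota>] by simp
 have "f r = r *[?C] y" if r: "r : J" for r
 proof (rule extensionalityI[of _ "carrier R"])
  show "f r : extensional (carrier R)" using f'(1)[OF r] coind_carrier by blast
  show "r *[?C] y : extensional (carrier R)" by simp
  fix s assume s: "s : carrier R"
  have "s \<otimes>[R] r : J" using ideal.I_l_closed[OF J r s] .
  then have "y (s \<otimes>[R] r) = f (s \<otimes>[R] r) 1[R]" unfolding y_def using h(2) JR by auto
  also have "\<dots> = f r s" using f'(3)[OF s r] s by simp
  finally show "f r s = (r *[?C] y) s" using s r JR M.m_comm[of r s] by auto
 qed
 then show "\<exists>y\<in>carrier ?C. \<forall>r\<in>J. f r = r *[?C] y" using y by blast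
qed

text \<open>An operation has a name \<open>p\<close> and finitely many arguments, so each element of
  the closure is the value of a finite term.\<close>

inductive_set opclo :: "('w => 'e) => ('w => 'e list => 'e) => 'e set" for g op where
 base: "g w : opclo g op"
| step: "(!!e. e : set es ==> e : opclo g op) ==> op p es : opclo g op"

datatype 'w optree = Leaf 'w | Node 'w "'w optree list"

primrec tree_val :: "('w => 'e) => ('w => 'e list => 'e) => 'w optree => 'e" where
 "tree_val g op (Leaf w) = g w"
| "tree_val g op (Node p ts) = op p (map (tree_val g op) ts)"

text \<open>The entry \<open>[]\<close> after \<open>p\<close> makes the coded list of a node have
  length at least two, so that it differs from the list \<open>[w]\<close> of a leaf even when the
  node has no children.\<close>

primrec tree_code :: "('u list list => 'u list) => 'u list optree => 'u list" where
 "tree_code enc (Leaf w) = enc [w]"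
| "tree_code enc (Node p ts) = enc (p # [] # map (tree_code enc) ts)"

lemma tree_code_inj:
 assumes "inj enc" shows "tree_code enc t = tree_code enc t' ==> t = t'"
proof (induction t arbitrary: t')
 case (Leaf w)
 then show ?case using assms by (cases t') (auto simp: inj_eq)
next
 case (Node p ts)
 show ?case
 proof (cases t')
  case (Node p' ts')
  then have "p = p'" "map (tree_code enc) ts = map (tree_code enc) ts'"
   using Node.prems assms by (auto simp: inj_eq)
  moreover have "ts = ts'"
   by (rule list.inj_map_strong[OF _ \<open>map (tree_code enc) ts = map (tree_code enc) ts'\<close>]) (use Node.IH in blast)
  ultimately show ?thesis using Node by simp
 qed (use Node.prems assms in \<open>auto simp: inj_eq\<close>)
qed

text \<open>Each element is the value of a term, and terms embed into lists because over an infinite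
  alphabet lists of lists are no more numerous than lists. The bound is independent of the size of
  \<open>'e\<close>, which will be a function type.\<close>

lemma opclo_small:
 fixes g :: "'u list => 'e"
 assumes "infinite (UNIV :: 'u set)"
 shows "\<exists>j :: 'e => 'u list. inj_on j (opclo g op)"
proof -
 have "infinite (UNIV :: 'u list set)" by (rule infinite_UNIV_listI)
 then have "|lists (UNIV :: 'u list set)| =o |UNIV :: 'u list set|" by (rule card_of_lists_infinite)
 then obtain enc :: "'u list list => 'u list" where "bij_betw enc (lists UNIV) UNIV"
  unfolding card_of_ordIso[symmetric] by blast
 then have enc: "inj enc" by (simp add: bij_betw_def)
 have ex: "\<exists>t. tree_val g op t = e" if "e : opclo g op" for e
  using that
 proof induction
  case (base w)
  show ?case by (rule exI[of _ "Leaf w"]) simp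
 next
  case (step es p)
  obtain f where f: "!!e. e : set es ==> tree_val g op (f e) = e" using step(2) by metis
  have "map (tree_val g op) (map f es) = es" using f by (simp add: map_idI)
  then show ?case by (intro exI[of _ "Node p (map f es)"]) (simp del: map_map)
 qed
 define j where "j e = tree_code enc (SOME t. tree_val g op t = e)" for e
 have "inj_on j (opclo g op)"
 proof (rule inj_onI)
  fix x y assume xy: "x : opclo g op" "y : opclo g op" "j x = j y"
  have "(SOME t. tree_val g op t = x) = (SOME t. tree_val g op t = y)"
   by (rule tree_code_inj[OF enc]) (rule xy(3)[unfolded j_def])
  from arg_cong[OF this, of "tree_val g op"] show "x = y"
   unfolding someI_ex[OF ex[OF xy(1)]] someI_ex[OF ex[OF xy(2)]] .
 qed
 then show ?thesis by blast
qed

text \<open>The small injective module is the closure of \<open>M\<close> in \<open>Hom\<^sub>K(R, M)\<close> under the module operations and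
 under chosen solutions \<open>y\<close> of finite systems \<open>r\<^sub>i y = e\<^sub>i\<close>; the latter suffice as ideals are finitely generated.\<close>

lemma small_injective_embedding:
 fixes M :: "('a, 'u list, 'x) module_scheme" and cd :: "'a => 'u"
 assumes K: "field K" and \<iota>: "\<iota> : ring_hom K R" and N: "noetherian_ring R" and M: "module R M"
  and inf: "infinite (UNIV :: 'u set)" and cd: "inj cd" and tag: "tag \<notin> range cd"
 shows "\<exists>(E :: ('a, 'u list) module) i. module R E \<and> baer R E \<and> i : mod_hom R M E \<and> inj_on i (carrier M)"
proof -
 interpret M: module R M by fact
 let ?C = "coind K \<iota> R M"
 have Cm: "module R ?C" by (rule coind_module[OF \<iota> M])
 interpret C: module R ?C by (rule Cm)
 define emb where "emb x = (\<lambda>r\<in>carrier R. r *[M] x)" for x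
 define g where "g w = (if w : carrier M then emb w else 0[?C])" for w
 \<comment> \<open>\<open>sol\<close> picks a solution of a finite linear system in the coinduced
   module, if there is one. \<open>clip\<close> replaces meaningless values by zero, so that every
   operation stays in the carrier.\<close>
 define sol where "sol rs es = (SOME y. y : carrier ?C \<and> (\<forall>i<length rs. rs ! i *[?C] y = es ! i))" for rs es
 define clip where "clip v = (if v : carrier ?C then v else 0[?C])" for v
 \<comment> \<open>Names of operations: the empty word means addition; a word starting with
   \<open>tag\<close>, a letter that codes no ring element, means solving the system whose
   coefficients are coded by the rest; any other word means multiplication by the ring element coded
   by its first letter.\<close>
 define op where "op p es = clip (if p = [] then es ! 0 +[?C] es ! 1
   else if hd p = tag then sol (map (inv_into UNIV cd) (tl p)) es else inv_into UNIV cd (hd p) *[?C] es ! 0)" for p es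
 define H where "H = opclo g op"
 have emb_c: "emb x : carrier ?C" if "x : carrier M" for x
  unfolding coind_carrier emb_def using that ring_hom_closed[OF \<iota>]
  by (auto simp: M.smult_l_distr M.smult_assoc1)
 have emb_hom: "emb : mod_hom R M ?C"
  by (rule mod_homI)
   (auto simp: emb_c, auto simp: emb_def restrict_def M.smult_r_distr M.smult_assoc1 M.smult_commute fun_eq_iff)
 have gc: "g w : carrier ?C" for w unfolding g_def using emb_c C.M.zero_closed by presburger
 have clip: "clip v : carrier ?C" for v unfolding clip_def using C.M.zero_closed by presburger
 have HC: "H <= carrier ?C"
 proof
  fix e assume "e : H"
  then show "e : carrier ?C" unfolding H_def by induction (use gc clip op_def in auto)
 qed
 have embH: "emb x : H" if "x : carrier M" for x
  using opclo.base[of g x op] that unfolding H_def g_def by simp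
 have opH: "op p es : H" if "set es <= H" for p es
  using that unfolding H_def by (intro opclo.step) blast
 have H: "submodule H R ?C"
 proof (rule C.submoduleI'[OF HC])
  show "0[?C] : H" using embH[of "0[M]"] mod_hom_zero[OF emb_hom M Cm] by simp
  show "a +[?C] b : H" if ab: "a : H" "b : H" for a b
  proof -
   have "a +[?C] b : carrier ?C" using ab HC by (intro C.M.a_closed) auto
   then have "op [] [a, b] = a +[?C] b" unfolding op_def clip_def by simp
   then show ?thesis using opH[of "[a,b]" "[]"] ab by simp
  qed
  show "r *[?C] b : H" if rb: "r : carrier R" "b : H" for r b
  proof -
   have "r *[?C] b : carrier ?C" using rb HC by (intro C.smult_closed) auto
   moreover have "cd r \<noteq> tag" using tag by blast
   ultimately have "op [cd r] [b] = r *[?C] b" unfolding op_def clip_def by (simp add: inv_f_f[OF cd])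
   then show ?thesis using opH[of "[b]" "[cd r]"] rb by simp
  qed
 qed
 let ?H = "?C\<lparr>carrier := H\<rparr>"
 have Hm: "module R ?H" by (rule C.restrict_module[OF H])
 have "baer R ?H"
  unfolding baer_def
 proof (intro allI impI)
  fix J f assume Jf: "ideal J R \<and> f : mod_hom R (ring_mod R\<lparr>carrier := J\<rparr>) ?H"
  then have J: "ideal J R" and f: "f : mod_hom R (ring_mod R\<lparr>carrier := J\<rparr>) ?H" by auto
  have sJ: "submodule J R (ring_mod R)" using J ideal_iff_submodule[OF M.is_cring] by blast
  have RM: "module R (ring_mod R)" by (rule ring_mod_module[OF M.is_cring])
  have JR: "J <= carrier R" using module.submoduleE(1)[OF RM sJ] by simp
  have f': "f : mod_hom R (ring_mod R\<lparr>carrier := J\<rparr>) ?C" by (rule mod_hom_expand[OF f HC])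
  obtain y where y: "y : carrier ?C" "\<forall>r\<in>J. f r = r *[?C] y"
   using coind_baer[OF K \<iota> M] J f' unfolding baer_def by blast
  obtain A where A: "A <= carrier R" "finite A" "J = Idl\<^bsub>R\<^esub> A"
   using noetherian_ring.finetely_gen[OF N J] by blast
  obtain rs where rs: "set rs = A" using finite_list[OF A(2)] by blast
  have AJ: "A <= J" using M.genideal_self[OF A(1)] A(3) by simp
  define es where "es = map f rs"
  define y' where "y' = sol rs es"
  have "y' : carrier ?C \<and> (\<forall>i<length rs. rs ! i *[?C] y' = es ! i)"
   unfolding y'_def sol_def
  proof (rule someI[of _ y], intro conjI allI impI)
   fix i assume i: "i < length rs"
   then have "rs ! i : J" using rs AJ by auto
   then show "rs ! i *[?C] y = es ! i" using y(2) i unfolding es_def by simp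
  qed (rule y(1))
  then have y': "y' : carrier ?C" "!!i. i < length rs ==> rs ! i *[?C] y' = f (rs ! i)"
   unfolding es_def by auto
  have "set es <= H" unfolding es_def using rs AJ mod_homD(1)[OF f] by auto
  then have "op (tag # map cd rs) es : H" by (rule opH)
  moreover have "map (inv_into UNIV cd) (map cd rs) = rs" by (simp add: inv_f_f[OF cd] comp_def map_idI)
  then have "op (tag # map cd rs) es = y'"
   unfolding op_def clip_def y'_def[symmetric] using y'(1) by (simp add: y'_def[symmetric])
  ultimately have y'H: "y' : H" by simp
  \<comment> \<open>\<open>y'\<close> solves the equation at the generators of \<open>J\<close>; the
    elements at which it does so form an ideal, hence they are all of \<open>J\<close>.\<close>
  let ?I = "{r : J. f r = r *[?C] y'}"
  have "submodule ?I R (ring_mod R)"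
  proof -
   interpret RM: module R "ring_mod R" by (rule RM)
   have f0: "f 0[R] = 0[?C]" using mod_hom_zero[OF f' RM.restrict_module[OF sJ] Cm] by simp
   show ?thesis
   proof (rule RM.submoduleI', goal_cases)
    case 1 then show ?case using JR by auto
   next
    case 2 then show ?case using RM.sub_zero[OF sJ] f0 C.smult_l_null[OF y'(1)] by (simp del: coind_simps)
   next
    case (3 a b)
    then have "a : carrier R" "b : carrier R" using JR by auto
    then show ?case using 3 mod_homD(2)[OF f', of a b] RM.submoduleE(5)[OF sJ, of a b] C.smult_l_distr[OF _ _ y'(1), of a b]
     by (simp del: coind_simps)
   next
    case (4 a b)
    then have "b : carrier R" using JR by auto
    then show ?case using 4 mod_homD(3)[OF f', of a b] RM.submoduleE(4)[OF sJ, of a b] C.smult_assoc1[OF _ _ y'(1), of a b]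
     by (simp del: coind_simps)
   qed
  qed
  then have "ideal ?I R" using ideal_iff_submodule[OF M.is_cring] by blast
  moreover have "A <= ?I"
  proof
   fix r assume "r : A"
   then obtain i where "i < length rs" "r = rs ! i" using rs by (metis in_set_conv_nth)
   then show "r : ?I" using y'(2)[of i] \<open>r : A\<close> AJ by auto
  qed
  ultimately have "J <= ?I" using M.genideal_minimal A(3) by blast
  then have "\<forall>r\<in>J. f r = r *[?H] y'" by auto
  then show "\<exists>y\<in>carrier ?H. \<forall>r\<in>J. f r = r *[?H] y" using y'H by auto
 qed
 moreover obtain j :: "_ => 'u list" where j: "inj_on j (carrier ?H)"
  using opclo_small[OF inf, of g op] unfolding H_def[symmetric] by auto
 ultimately have B: "baer R (transport j ?H)"
  using baer_iso[OF transport_hom[OF Hm j] transport_inv_hom[OF Hm j] _ _ M.is_cring]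
  by (simp add: f_inv_into_f)
 have eH: "emb : mod_hom R M ?H" using emb_hom embH by (intro mod_hom_corestrict) auto
 have emb_inj: "inj_on emb (carrier M)"
 proof (rule inj_onI)
  fix x y assume xy: "x : carrier M" "y : carrier M" "emb x = emb y"
  from fun_cong[OF xy(3), of "1[R]"] show "x = y" using xy(1,2) unfolding emb_def by simp
 qed
 have "(%x. j (emb x)) : mod_hom R M (transport j ?H)"
  by (rule mod_hom_compose[OF eH transport_hom[OF Hm j]])
 moreover have "inj_on (%x. j (emb x)) (carrier M)"
  using comp_inj_on[OF emb_inj, of j] inj_on_subset[OF j, of "emb ` carrier M"] embH by (auto simp: comp_def)
 ultimately show ?thesis using B transport_module[OF Hm j] by blast
qed

section \<open>Existence of injective resolutions in the prescribed type\<close>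

text \<open>A choice of representatives is injective on cosets, so the quotient can be transported
  back into the type of \<open>M\<close> and the construction can be iterated.\<close>

lemma small_quotient:
 fixes M :: "('a, 'm, 'x) module_scheme"
 assumes M: "module R M" and H: "submodule H R M"
 shows "\<exists>(Q :: ('a, 'm) module) p. module R Q \<and> p : mod_hom R M Q \<and> p ` carrier M = carrier Q \<and>
  (\<forall>x\<in>carrier M. p x = 0[Q] \<longleftrightarrow> x : H)"
proof -
 interpret M: module R M by fact
 let ?c = "%x. H +>\<^bsub>M\<^esub> x" and ?Q = "quot_module M H"
 let ?j = "inv_into (carrier M) ?c"
 have Q: "module R ?Q" by (rule M.quot_module_module[OF H])
 interpret Q: module R ?Q by (rule Q)
 have surj: "?c ` carrier M = carrier ?Q" by (rule M.quot_proj_surj[OF H])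
 have j: "inj_on ?j (carrier ?Q)" unfolding surj[symmetric] by (rule inj_on_inv_into) simp
 let ?p = "%x. ?j (?c x)"
 have p: "?p : mod_hom R M (transport ?j ?Q)"
  by (rule mod_hom_compose[OF M.quot_proj_hom[OF H] transport_hom[OF Q j]])
 have "?p ` carrier M = carrier (transport ?j ?Q)"
  unfolding transport_simps(1) surj[symmetric] by (rule image_image[symmetric])
 moreover have "?p x = 0[transport ?j ?Q] \<longleftrightarrow> x : H" if x: "x : carrier M" for x
 proof -
  have "?c x : carrier ?Q" using surj x by blast
  then have "?p x = ?j 0[?Q] \<longleftrightarrow> ?c x = 0[?Q]" using inj_on_eq_iff[OF j _ Q.M.zero_closed] by blast
  then show ?thesis using M.quot_proj_kernel[OF H x] by simp
 qed
 ultimately show ?thesis using transport_module[OF Q j] p by blast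
qed

lemma injective_resolution_iff:
 "injective_resolution R M \<eta> E d \<longleftrightarrow>
  (\<forall>n. injective_module R (E n)) \<and> \<eta> : mod_hom R M (E 0) \<and> (\<forall>n. d n : mod_hom R (E n) (E (Suc n))) \<and>
  inj_on \<eta> (carrier M) \<and> \<eta> ` carrier M = {x : carrier (E 0). d 0 x = 0[E 1]} \<and>
  (\<forall>n. d n ` carrier (E n) = {x : carrier (E (Suc n)). d (Suc n) x = 0[E (Suc (Suc n))]})"
 unfolding injective_resolution_def a_kernel_def kernel_def by simp

text \<open>The type is the one over which \<open>chosen_resolution\<close> chooses. Its alphabet
  has letters for the elements of \<open>R\<close> and of \<open>M\<close>; the summand
  \<open>nat\<close> makes it infinite and supplies the letter that marks linear systems.\<close>

theorem injective_resolution_exists: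
 fixes M :: "('a, 'm, 'x) module_scheme"
 assumes K: "field K" and \<iota>: "\<iota> : ring_hom K R" and N: "noetherian_ring R" and M: "module R M"
 shows "\<exists>(E :: nat => ('a, ('a + 'm + nat) list) module) d \<eta>. injective_resolution R M \<eta> E d"
proof -
 \<comment> \<open>One step of the construction: \<open>i\<close> embeds \<open>U\<close> into an
   injective module \<open>E\<close>, and \<open>p\<close> maps \<open>E\<close> onto a module
   \<open>Q\<close> with kernel the image of \<open>U\<close>. The next step embeds
   \<open>Q\<close>.\<close>
 define P where "P U q \<longleftrightarrow> (case q of (E, i, Q, p) =>
   module R E \<and> baer R E \<and> i : mod_hom R U E \<and> inj_on i (carrier U) \<and> module R Q \<and>
   p : mod_hom R E Q \<and> p ` carrier E = carrier Q \<and> (\<forall>x\<in>carrier E. p x = 0[Q] \<longleftrightarrow> x : i ` carrier U))"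
  for U :: "('a, ('a + 'm + nat) list) module" and q :: "('a, ('a + 'm + nat) list) module \<times> _ \<times> ('a, ('a + 'm + nat) list) module \<times> _"
 have inf: "infinite (UNIV :: ('a + 'm + nat) set)"
 proof
  assume "finite (UNIV :: ('a + 'm + nat) set)"
  moreover have "inj (%n :: nat. Inr (Inr n) :: 'a + 'm + nat)" by (simp add: inj_def)
  ultimately show False using finite_imageD[of "%n :: nat. Inr (Inr n) :: 'a + 'm + nat" UNIV]
   finite_subset[of "range (%n :: nat. Inr (Inr n) :: 'a + 'm + nat)" UNIV] by simp
 qed
 have "\<exists>q. P U q" if U: "module R U" for U :: "('a, ('a + 'm + nat) list) module"
 proof -
  have cd: "inj (Inl :: 'a => 'a + 'm + nat)" by (simp add: inj_def)
  have tag: "Inr (Inr 0) \<notin> range (Inl :: 'a => 'a + 'm + nat)" by auto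
  obtain E :: "('a, ('a + 'm + nat) list) module" and i where E: "module R E" "baer R E" "i : mod_hom R U E" "inj_on i (carrier U)"
   using small_injective_embedding[OF K \<iota> N U inf cd tag] by blast
  have "submodule (i ` carrier U) R E"
   by (rule submodule_mod_hom_image[OF E(3) U E(1) module.carrier_is_submodule[OF U]])
  from small_quotient[OF E(1) this]
  obtain Q :: "('a, ('a + 'm + nat) list) module" and p where "module R Q" "p : mod_hom R E Q" "p ` carrier E = carrier Q"
   "\<forall>x\<in>carrier E. p x = 0[Q] \<longleftrightarrow> x : i ` carrier U" by (elim exE conjE)
  then have "P U (E, i, Q, p)" unfolding P_def using E by simp
  then show ?thesis by blast
 qed
 then have "\<exists>q. module R U --> P U q" for U :: "('a, ('a + 'm + nat) list) module" by blast
 then obtain q where q: "!!U. module R U ==> P U (q U)" by metis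
 define Ef where "Ef U = fst (q U)" for U
 define i where "i U = fst (snd (q U))" for U
 define Q where "Q U = fst (snd (snd (q U)))" for U
 define p where "p U = snd (snd (snd (q U)))" for U
 have PD: "module R (Ef U)" "baer R (Ef U)" "i U : mod_hom R U (Ef U)" "inj_on (i U) (carrier U)" "module R (Q U)"
   "p U : mod_hom R (Ef U) (Q U)" "p U ` carrier (Ef U) = carrier (Q U)"
   "!!x. x : carrier (Ef U) ==> p U x = 0[Q U] \<longleftrightarrow> x : i U ` carrier U" if "module R U" for U
  using q[OF that] unfolding P_def Ef_def i_def Q_def p_def by (auto split: prod.splits)
 \<comment> \<open>\<open>M\<close> is first copied into the target type as words of one
   letter.\<close>
 let ?j = "%x :: 'm. [Inr (Inl x)] :: ('a + 'm + nat) list"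
 have j: "inj_on ?j (carrier M)" by (simp add: inj_on_def)
 \<comment> \<open>\<open>S n\<close> is the n-th cosyzygy. The differential of the resolution is
   the projection onto the next cosyzygy followed by its embedding.\<close>
 define S where "S n = (Q ^^ n) (transport ?j M)" for n
 have S0: "S 0 = transport ?j M" and SS: "!!n. S (Suc n) = Q (S n)" unfolding S_def by auto
 have S: "module R (S n)" for n
  by (induction n) (simp_all add: S0 SS PD transport_module[OF M j])
 define E where "E n = Ef (S n)" for n
 define d where "d n x = i (S (Suc n)) (p (S n) x)" for n x
 define \<eta> where "\<eta> x = i (S 0) (?j x)" for x
 note P' = PD[OF S]
 have zi: "i (S n) 0[S n] = 0[E n]" for n unfolding E_def by (rule mod_hom_zero[OF P'(3) S P'(1)])
 have dz: "d n x = 0[E (Suc n)] \<longleftrightarrow> x : i (S n) ` carrier (S n)" if x: "x : carrier (E n)" for n x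
 proof -
  have c: "p (S n) x : carrier (S (Suc n))" using mod_homD(1)[OF P'(6)[of n]] x unfolding SS E_def by blast
  have z: "0[S (Suc n)] : carrier (S (Suc n))"
   using S[of "Suc n"] by (meson abelian_group.axioms(1) abelian_monoid.zero_closed module.axioms(2))
  have "d n x = i (S (Suc n)) 0[S (Suc n)] \<longleftrightarrow> p (S n) x = 0[S (Suc n)]"
   unfolding d_def by (rule inj_on_eq_iff[OF P'(4) c z])
  then show ?thesis using P'(8)[of x n] x zi[of "Suc n"] unfolding E_def SS by simp
 qed
 have dim: "d n ` carrier (E n) = i (S (Suc n)) ` carrier (S (Suc n))" for n
 proof -
  have "d n ` carrier (E n) = i (S (Suc n)) ` (p (S n) ` carrier (E n))" unfolding d_def image_image ..
  then show ?thesis using P'(7)[of n] unfolding E_def SS by simp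
 qed
 have iE: "i (S n) ` carrier (S n) <= carrier (E n)" for n using mod_homD(1)[OF P'(3)[of n]] unfolding E_def by blast
 have "injective_resolution R M \<eta> E d"
  unfolding injective_resolution_iff
 proof (intro conjI allI)
  show "injective_module R (E n)" for n unfolding E_def by (rule baer_imp_injective[OF P'(1,2)])
  show "\<eta> : mod_hom R M (E 0)"
   unfolding \<eta>_def[abs_def] E_def by (rule mod_hom_compose[OF transport_hom[OF M j, folded S0] P'(3)])
  show "d n : mod_hom R (E n) (E (Suc n))" for n
   unfolding d_def[abs_def] E_def by (rule mod_hom_compose[OF P'(6)[of n, folded SS] P'(3)])
  show "inj_on \<eta> (carrier M)"
   unfolding \<eta>_def using comp_inj_on[OF j, of "i (S 0)"] P'(4)[of 0] by (simp add: S0 comp_def)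
  have "\<eta> ` carrier M = i (S 0) ` carrier (S 0)" unfolding \<eta>_def S0 transport_simps image_image ..
  then show "\<eta> ` carrier M = {x : carrier (E 0). d 0 x = 0[E 1]}" using dz[of _ 0] iE[of 0] by auto
  show "d n ` carrier (E n) = {x : carrier (E (Suc n)). d (Suc n) x = 0[E (Suc (Suc n))]}" for n
   unfolding dim using dz[of _ "Suc n"] iE[of "Suc n"] by auto
 qed
 then show ?thesis by blast
qed

lemma chosen_resolution_injective:
 fixes M :: "('a, 'm, 'x) module_scheme"
 assumes "field K" "\<iota> : ring_hom K R" "noetherian_ring R" "module R M" "chosen_resolution R M = (E, d)"
 shows "\<exists>\<eta>. injective_resolution R M \<eta> E d"
proof -
 have "\<exists>Ed :: (nat => ('a, ('a + 'm + nat) list) module) \<times> _. (case Ed of (E, d) => \<exists>\<eta>. injective_resolution R M \<eta> E d)"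
  using injective_resolution_exists[OF assms(1-4)] by auto
 from someI_ex[OF this] show ?thesis using assms(5) unfolding chosen_resolution_def by simp
qed

lemma hom_factor:
 assumes A: "module R A" and B: "module R B" and E: "module R E"
  and f: "f : mod_hom R A B" and g: "g : mod_hom R A E"
  and ker: "!!a. a : carrier A ==> f a = 0[B] ==> g a = 0[E]"
 shows "\<exists>h\<in>mod_hom R (B\<lparr>carrier := f ` carrier A\<rparr>) E. \<forall>a\<in>carrier A. h (f a) = g a"
proof -
 interpret A: module R A by fact
 interpret B: module R B by fact
 interpret E: module R E by fact
 define h where "h y = g (SOME a. a : carrier A \<and> f a = y)" for y
 have h: "h (f a) = g a" if a: "a : carrier A" for a
 proof -
  define a' where "a' = (SOME a'. a' : carrier A \<and> f a' = f a)"
  have "a' : carrier A \<and> f a' = f a" unfolding a'_def by (rule someI[of _ a]) (use a in simp)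
  then have a': "a' : carrier A" "f a' = f a" by auto
  have "f (a' -[A] a) = 0[B]"
   using mod_hom_minus[OF f A B a'(1) a] a'(2) mod_homD(1)[OF f a] by simp
  then have "g a' -[E] g a = 0[E]"
   using ker[of "a' -[A] a"] mod_hom_minus[OF g A E a'(1) a] a a'(1) by simp
  then show ?thesis
   unfolding h_def a'_def[symmetric] using E.M.minus_eq_zero_iff mod_homD(1)[OF g] a a'(1) by blast
 qed
 have hh: "h : mod_hom R (B\<lparr>carrier := f ` carrier A\<rparr>) E"
 proof (rule mod_homI)
  fix x y assume "x : carrier (B\<lparr>carrier := f ` carrier A\<rparr>)" "y : carrier (B\<lparr>carrier := f ` carrier A\<rparr>)"
  then obtain a c where ac: "a : carrier A" "x = f a" "c : carrier A" "y = f c" by auto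
  have "x +[B] y = f (a +[A] c)" using mod_homD(2)[OF f ac(1,3)] ac(2,4) by simp
  then show "h (x +[B\<lparr>carrier := f ` carrier A\<rparr>] y) = h x +[E] h y"
   using h[of "a +[A] c"] h[of a] h[of c] ac mod_homD(2)[OF g ac(1,3)] by simp
 next
  fix r x assume r: "r : carrier R" and "x : carrier (B\<lparr>carrier := f ` carrier A\<rparr>)"
  then obtain a where a: "a : carrier A" "x = f a" by auto
  have "r *[B] x = f (r *[A] a)" using mod_homD(3)[OF f r a(1)] a(2) by simp
  then show "h (r *[B\<lparr>carrier := f ` carrier A\<rparr>] x) = r *[E] h x"
   using h[of "r *[A] a"] h[of a] a r mod_homD(3)[OF g r a(1)] by simp
 qed (use h mod_homD(1)[OF g] in auto)
 then show ?thesis using h by blast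
qed

text \<open>The map \<open>g\<close> factors through the image of \<open>f\<close> by the kernel
  condition, and from the image it extends to \<open>B\<close> by Baer's property.\<close>

lemma baer_factor:
 assumes A: "module R A" and B: "module R B" and E: "module R E" and b: "baer R E"
  and f: "f : mod_hom R A B" and g: "g : mod_hom R A E"
  and ker: "!!a. a : carrier A ==> f a = 0[B] ==> g a = 0[E]"
 shows "\<exists>h\<in>mod_hom R B E. \<forall>a\<in>carrier A. h (f a) = g a"
proof -
 have "\<exists>h\<in>mod_hom R (B\<lparr>carrier := f ` carrier A\<rparr>) E. \<forall>a\<in>carrier A. h (f a) = g a"
  by (rule hom_factor[OF A B E f g ker])
 then obtain h where hh: "h : mod_hom R (B\<lparr>carrier := f ` carrier A\<rparr>) E" and h: "\<forall>a\<in>carrier A. h (f a) = g a"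
  by (elim bexE)
 have "submodule (f ` carrier A) R B"
  by (rule submodule_mod_hom_image[OF f A B module.carrier_is_submodule[OF A]])
 from baer_extension[OF B E b this hh]
 obtain k where "k : mod_hom R B E" "\<forall>x\<in>f ` carrier A. k x = h x" by (elim bexE)
 then show ?thesis using h by (intro bexI[of _ k]) auto
qed

section \<open>Torsion with respect to a list, and good modules\<close>

text \<open>Torsion is described by a list of elements and not by an ideal, so that elements can be
  added one at a time. For generators of an ideal it agrees with \<open>torsion\<close>; see
  \<open>torsion_eq_tors\<close>.\<close>

definition tors :: "('a, 'r) ring_scheme => 'a list => ('a, 'm, 'x) module_scheme => 'm set"
 where "tors R zs M = {x : carrier M. \<forall>z\<in>set zs. \<exists>k::nat. (z [^]\<^bsub>R\<^esub> k) *[M] x = 0[M]}"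

lemma tors_carrier: "x : tors R zs M ==> x : carrier M"
 by (simp add: tors_def)

lemma tors_Nil [simp]: "tors R [] M = carrier M"
 by (simp add: tors_def)

lemma tors_append: "tors R (xs @ ys) M = tors R xs M \<inter> tors R ys M"
 by (auto simp: tors_def)

lemma tors_restrict [simp]: "H <= carrier M ==> tors R zs (M\<lparr>carrier := H\<rparr>) = tors R zs M \<inter> H"
 by (auto simp: tors_def)

context module
begin

lemma pow_kill_mono:
 assumes "z : carrier R" "x : carrier M" "(z [^] (k::nat)) *[M] x = 0[M]" "k \<le> l"
 shows "(z [^] l) *[M] x = 0[M]"
proof -
 have "z [^] l = z [^] (l - k) \<otimes> z [^] k" using assms(1,4) by (simp add: R.nat_pow_mult)
 then show ?thesis using assms by (simp add: smult_assoc1)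
qed

lemma pow_Suc_smult:
 "z : carrier R ==> x : carrier M ==> (z [^] Suc n) *[M] x = (z [^] n) *[M] (z *[M] x)"
 by (simp add: smult_assoc1)

lemma pow_add_smult:
 "z : carrier R ==> x : carrier M ==> (z [^] (n + m :: nat)) *[M] x = (z [^] n) *[M] ((z [^] m) *[M] x)"
 by (simp add: R.nat_pow_mult[symmetric] smult_assoc1)

lemma tors_submodule:
 assumes "set zs <= carrier R"
 shows "submodule (tors R zs M) R M"
proof (rule submoduleI', goal_cases)
 case 1 show ?case by (auto simp: tors_def)
next
 case 2 show ?case using assms by (auto simp: tors_def)
next
 case (3 a b)
 have c: "a : carrier M" "b : carrier M" using 3 by (auto intro: tors_carrier)
 have "\<exists>k::nat. (z [^] k) *[M] (a +[M] b) = 0[M]" if z: "z : set zs" for z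
 proof -
  have zR: "z : carrier R" using z assms by blast
  obtain k l :: nat where kl: "(z [^] k) *[M] a = 0[M]" "(z [^] l) *[M] b = 0[M]" using 3 z unfolding tors_def by blast
  have "(z [^] (max k l)) *[M] a = 0[M]" "(z [^] (max k l)) *[M] b = 0[M]"
   by (rule pow_kill_mono[OF zR c(1) kl(1)], simp, rule pow_kill_mono[OF zR c(2) kl(2)], simp)
  then show ?thesis using c zR by (intro exI[of _ "max k l"]) (simp add: smult_r_distr)
 qed
 then show ?case using c by (simp add: tors_def)
next
 case (4 r x)
 have c: "x : carrier M" using 4 by (auto intro: tors_carrier)
 have "\<exists>k::nat. (z [^] k) *[M] (r *[M] x) = 0[M]" if z: "z : set zs" for z
 proof -
  have zR: "z : carrier R" using z assms by blast
  obtain k :: nat where k: "(z [^] k) *[M] x = 0[M]" using 4 z unfolding tors_def by blast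
  have "(z [^] k) *[M] (r *[M] x) = r *[M] ((z [^] k) *[M] x)" by (rule smult_commute) (use 4 c zR in auto)
  then show ?thesis using k 4 by auto
 qed
 then show ?case using c 4 by (simp add: tors_def)
qed

end

lemma tors_mod_hom:
 assumes f: "f : mod_hom R M N" and M: "module R M" and N: "module R N" and zs: "set zs <= carrier R" and x: "x : tors R zs M"
 shows "f x : tors R zs N"
proof -
 interpret M: module R M by fact
 interpret N: module R N by fact
 have "\<exists>k::nat. (z [^]\<^bsub>R\<^esub> k) *[N] f x = 0[N]" if z: "z : set zs" for z
 proof -
  obtain k :: nat where k: "(z [^]\<^bsub>R\<^esub> k) *[M] x = 0[M]" using x z unfolding tors_def by blast
  have "z [^]\<^bsub>R\<^esub> k : carrier R" using zs z by auto
  then have "(z [^]\<^bsub>R\<^esub> k) *[N] f x = f ((z [^]\<^bsub>R\<^esub> k) *[M] x)" using mod_homD(3)[OF f] tors_carrier[OF x] by simp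
  then show ?thesis using k mod_hom_zero[OF f M N] by auto
 qed
 then show ?thesis using mod_homD(1)[OF f] tors_carrier[OF x] by (simp add: tors_def)
qed

lemma tors_prod_mod:
 assumes M: "module R M" and N: "module R N" and zs: "set zs <= carrier R"
 shows "tors R zs (prod_mod M N) = tors R zs M \<times> tors R zs N"
proof
 interpret M: module R M by fact
 interpret N: module R N by fact
 show "tors R zs (prod_mod M N) <= tors R zs M \<times> tors R zs N"
  by (auto simp: tors_def) blast+
 show "tors R zs M \<times> tors R zs N <= tors R zs (prod_mod M N)"
 proof
  fix p assume p: "p : tors R zs M \<times> tors R zs N"
  have c: "fst p : carrier M" "snd p : carrier N" using p by (auto intro: tors_carrier)
  have "\<exists>k::nat. (z [^]\<^bsub>R\<^esub> k) *[prod_mod M N] p = 0[prod_mod M N]" if z: "z : set zs" for z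
  proof -
   have zR: "z : carrier R" using z zs by blast
   obtain k l :: nat where kl: "(z [^]\<^bsub>R\<^esub> k) *[M] fst p = 0[M]" "(z [^]\<^bsub>R\<^esub> l) *[N] snd p = 0[N]"
    using p z unfolding tors_def mem_Times_iff by blast
   have "(z [^]\<^bsub>R\<^esub> (max k l)) *[M] fst p = 0[M]" "(z [^]\<^bsub>R\<^esub> (max k l)) *[N] snd p = 0[N]"
    by (rule M.pow_kill_mono[OF zR c(1) kl(1)], simp, rule N.pow_kill_mono[OF zR c(2) kl(2)], simp)
   then show ?thesis by auto
  qed
  then show "p : tors R zs (prod_mod M N)" using c unfolding tors_def by (auto simp: mem_Times_iff)
 qed
qed

definition ann_ideal :: "('a, 'r) ring_scheme => ('a, 'm, 'x) module_scheme => 'm => 'a set"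
 where "ann_ideal R M x = {r : carrier R. r *[M] x = 0[M]}"

lemma (in module) smult_hom: "x : carrier M ==> (%r. r *[M] x) : mod_hom R (ring_mod R) M"
 by (rule mod_homI) (simp_all add: smult_l_distr smult_assoc1)

lemma (in module) ann_ideal_ideal:
 assumes "x : carrier M" shows "ideal (ann_ideal R M x) R"
 using submodule_mod_hom_kernel[OF smult_hom[OF assms] ring_mod_module[OF is_cring] module_axioms]
 unfolding ideal_iff_submodule[OF is_cring] ann_ideal_def by simp

text \<open>Let \<open>P\<close> be the torsion for the elements \<open>ps\<close> before
  \<open>z\<close>. The condition says that the localization map from \<open>P\<close> to
  \<open>P_z\<close> is onto, that is, the first cohomology of the Cech complex of \<open>z\<close>
  on \<open>P\<close> vanishes. It depends on the order of the list.\<close>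

definition good_for :: "('a, 'r) ring_scheme => 'a list => ('a, 'm, 'x) module_scheme => bool"
 where "good_for R zs M \<longleftrightarrow> (\<forall>ps z qs. zs = ps @ z # qs -->
  (\<forall>x\<in>tors R ps M. \<exists>y\<in>tors R ps M. \<exists>k::nat. (z [^]\<^bsub>R\<^esub> k) *[M] (x -[M] z *[M] y) = 0[M]))"

lemma good_forD:
 "good_for R zs M ==> zs = ps @ z # qs ==> x : tors R ps M ==>
  \<exists>y\<in>tors R ps M. \<exists>k::nat. (z [^]\<^bsub>R\<^esub> k) *[M] (x -[M] z *[M] y) = 0[M]"
 unfolding good_for_def by blast

text \<open>If \<open>y\<close> works for the n-th power and \<open>y'\<close> is obtained from
  \<open>y\<close> by one more division, then \<open>x - z^(n+1) y'\<close> is the sum of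
  \<open>x - z^n y\<close> and \<open>z^n (y - z y')\<close>, both killed by a power of
  \<open>z\<close>.\<close>

lemma good_for_pow:
 assumes M: "module R M" and zs: "set zs <= carrier R" and g: "good_for R zs M" and e: "zs = ps @ z # qs"
  and x: "x : tors R ps M"
 shows "\<exists>y\<in>tors R ps M. \<exists>k::nat. (z [^]\<^bsub>R\<^esub> k) *[M] (x -[M] (z [^]\<^bsub>R\<^esub> (n::nat)) *[M] y) = 0[M]"
proof (induction n)
 interpret M: module R M by fact
 case 0
 show ?case using x tors_carrier[OF x] by (intro bexI[OF _ x] exI[of _ 0]) simp
next
 interpret M: module R M by fact
 case (Suc n)
 have z: "z : carrier R" using zs e by simp
 obtain y and k :: nat where y: "y : tors R ps M" "(z [^]\<^bsub>R\<^esub> k) *[M] (x -[M] (z [^]\<^bsub>R\<^esub> n) *[M] y) = 0[M]"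
  using Suc by (elim bexE exE)
 obtain y' and k' :: nat where y': "y' : tors R ps M" "(z [^]\<^bsub>R\<^esub> k') *[M] (y -[M] z *[M] y') = 0[M]"
  using good_forD[OF g e y(1)] by (elim bexE exE)
 have c: "x : carrier M" "y : carrier M" "y' : carrier M" using x y(1) y'(1) by (auto intro: tors_carrier)
 let ?zn = "z [^]\<^bsub>R\<^esub> n" and ?m = "max k k'"
 have zn: "?zn : carrier R" "z [^]\<^bsub>R\<^esub> ?m : carrier R" using z by auto
 have d: "x -[M] ?zn *[M] y : carrier M" "y -[M] z *[M] y' : carrier M" using c z zn by auto
 have "x -[M] (z [^]\<^bsub>R\<^esub> Suc n) *[M] y' = (x -[M] ?zn *[M] y) +[M] ?zn *[M] (y -[M] z *[M] y')"
 proof -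
  have "(x -[M] ?zn *[M] y) +[M] (?zn *[M] y -[M] ?zn *[M] (z *[M] y')) = x -[M] ?zn *[M] (z *[M] y')"
   using c z zn by (simp add: M.M.minus_eq M.M.a_assoc M.M.r_neg1)
  then show ?thesis using c z zn by (simp only: M.pow_Suc_smult M.smult_minus M.smult_closed)
 qed
 moreover have "(z [^]\<^bsub>R\<^esub> ?m) *[M] (x -[M] ?zn *[M] y) = 0[M]"
  by (rule M.pow_kill_mono[OF z d(1) y(2)]) simp
 moreover have "(z [^]\<^bsub>R\<^esub> ?m) *[M] (?zn *[M] (y -[M] z *[M] y')) = 0[M]"
 proof -
  have "(z [^]\<^bsub>R\<^esub> ?m) *[M] (y -[M] z *[M] y') = 0[M]" by (rule M.pow_kill_mono[OF z d(2) y'(2)]) simp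
  then show ?thesis using M.smult_commute[OF zn(2,1) d(2)] zn by simp
 qed
 ultimately have "(z [^]\<^bsub>R\<^esub> ?m) *[M] (x -[M] (z [^]\<^bsub>R\<^esub> Suc n) *[M] y') = 0[M]"
  using zn d by (simp add: M.smult_r_distr)
 then show ?case using y'(1) by blast
qed

text \<open>With \<open>J = Ann(x)\<close> and \<open>n\<close> such that \<open>(J : z\<^sup>n\<^sup>+\<^sup>1) = (J : z\<^sup>n)\<close>, the map
 \<open>z\<^sup>n\<^sup>+\<^sup>1 r + a \<mapsto> z\<^sup>n r x\<close> on \<open>(z\<^sup>n\<^sup>+\<^sup>1) + J\<close> is well defined; its value at \<open>1\<close> after extension is \<open>y\<close>.\<close>

lemma baer_good_for:
 assumes N: "noetherian_ring R" and E: "module R E" and b: "baer R E" and zs: "set zs <= carrier R"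
 shows "good_for R zs E"
 unfolding good_for_def
proof (intro allI impI ballI)
 interpret E: module R E by fact
 interpret N: noetherian_ring R by fact
 fix ps z qs x assume e: "zs = ps @ z # qs" and x: "x : tors R ps E"
 have z: "z : carrier R" using zs e by simp
 have xc: "x : carrier E" by (rule tors_carrier[OF x])
 let ?J = "ann_ideal R E x"
 have J: "ideal ?J R" by (rule E.ann_ideal_ideal[OF xc])
 have RM: "module R (ring_mod R)" by (rule ring_mod_module[OF E.is_cring])
 interpret RM: module R "ring_mod R" by (rule RM)
 have sJ: "submodule ?J R (ring_mod R)" using J ideal_iff_submodule[OF E.is_cring] by blast
 define A where "A n = ann_ideal R E ((z [^]\<^bsub>R\<^esub> n) *[E] x)" for n :: nat
 have idA: "ideal (A n) R" for n unfolding A_def using E.ann_ideal_ideal z xc by simp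
 have AS: "A n <= A (Suc n)" for n
 proof
  fix r assume r: "r : A n"
  then have rc: "r : carrier R" "r *[E] ((z [^]\<^bsub>R\<^esub> n) *[E] x) = 0[E]" unfolding A_def ann_ideal_def by auto
  have "(z [^]\<^bsub>R\<^esub> Suc n) *[E] x = z *[E] ((z [^]\<^bsub>R\<^esub> n) *[E] x)"
   using z xc by (simp add: E.smult_assoc1 E.smult_commute)
  then have "r *[E] ((z [^]\<^bsub>R\<^esub> Suc n) *[E] x) = z *[E] (r *[E] ((z [^]\<^bsub>R\<^esub> n) *[E] x))"
   using E.smult_commute[of r z] rc(1) z xc by simp
  then show "r : A (Suc n)" unfolding A_def ann_ideal_def using rc z by simp
 qed
 have mono: "A n <= A m" if "n \<le> m" for n m using AS that by (rule lift_Suc_mono_le)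
 have "\<Union>(range A) : range A"
 proof (rule N.ideal_chain_is_trivial)
  show "range A \<noteq> {}" by simp
  show "subset.chain {I. ideal I R} (range A)"
   unfolding subset_chain_def using idA mono nat_le_linear by blast
 qed
 then obtain n where "\<Union>(range A) = A n" by blast
 then have stab: "A (Suc n) <= A n" by blast
 let ?z1 = "z [^]\<^bsub>R\<^esub> Suc n" and ?zn = "z [^]\<^bsub>R\<^esub> n"
 have zc: "?z1 : carrier R" "?zn : carrier R" using z by auto
 \<comment> \<open>The ideal generated by \<open>?z1\<close> and \<open>?J\<close> enters as the
   image of a map from the product of \<open>R\<close> and \<open>?J\<close>. That the desired map
   on it is well defined thereby becomes the kernel condition of \<open>baer_factor\<close>.\<close>
 let ?P = "prod_mod (ring_mod R) (ring_mod R\<lparr>carrier := ?J\<rparr>)"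
 have JR: "?J <= carrier R" unfolding ann_ideal_def by blast
 have RJ: "module R (ring_mod R\<lparr>carrier := ?J\<rparr>)" by (rule RM.restrict_module[OF sJ])
 have P: "module R ?P" by (rule prod_mod_module[OF RM RJ])
 have f: "(%p. ?z1 \<otimes>[R] fst p +[R] snd p) : mod_hom R ?P (ring_mod R)"
 proof (rule mod_homI)
  fix p assume "p : carrier ?P"
  then show "?z1 \<otimes>[R] fst p +[R] snd p : carrier (ring_mod R)" using zc JR by auto
 next
  fix p q assume "p : carrier ?P" "q : carrier ?P"
  then have "fst p : carrier R" "snd p : carrier R" "fst q : carrier R" "snd q : carrier R" using JR by auto
  then show "?z1 \<otimes>[R] fst (p +[?P] q) +[R] snd (p +[?P] q) =
    (?z1 \<otimes>[R] fst p +[R] snd p) +[ring_mod R] (?z1 \<otimes>[R] fst q +[R] snd q)"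
   using zc(1) by (simp add: E.R.add_add_swap E.r_distr del: E.nat_pow_Suc)
 next
  fix r p assume "p : carrier ?P" and r: "r : carrier R"
  then have "fst p : carrier R" "snd p : carrier R" using JR by auto
  then show "?z1 \<otimes>[R] fst (r *[?P] p) +[R] snd (r *[?P] p) = r *[ring_mod R] (?z1 \<otimes>[R] fst p +[R] snd p)"
   using zc(1) r by (simp add: E.r_distr E.m_lcomm del: E.nat_pow_Suc)
 qed
 have "fst : mod_hom R ?P (ring_mod R)" by (rule mod_homI) auto
 from mod_hom_compose[OF this E.smult_hom, of "?zn *[E] x"]
 have g: "(%p. fst p *[E] (?zn *[E] x)) : mod_hom R ?P E" using zc xc by simp
 have ker: "fst p *[E] (?zn *[E] x) = 0[E]"
  if p: "p : carrier ?P" and z0: "?z1 \<otimes>[R] fst p +[R] snd p = 0[ring_mod R]" for p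
 proof -
  have c: "fst p : carrier R" "snd p : carrier R" "snd p *[E] x = 0[E]" using p unfolding ann_ideal_def by auto
  have "(?z1 \<otimes>[R] fst p +[R] snd p) *[E] x = 0[E]" using z0 xc by simp
  then have "(?z1 \<otimes>[R] fst p) *[E] x = 0[E]" using c zc(1) xc by (simp add: E.smult_l_distr del: E.nat_pow_Suc)
  then have "fst p *[E] (?z1 *[E] x) = 0[E]"
   using c zc(1) xc by (simp add: E.smult_assoc1 E.smult_commute[of "fst p"] del: E.nat_pow_Suc)
  then have "fst p : A (Suc n)" unfolding A_def ann_ideal_def using c by simp
  then show ?thesis using stab unfolding A_def ann_ideal_def by blast
 qed
 have "\<exists>h\<in>mod_hom R (ring_mod R) E.
   \<forall>p\<in>carrier ?P. h (?z1 \<otimes>[R] fst p +[R] snd p) = fst p *[E] (?zn *[E] x)"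
  by (rule baer_factor[OF P RM E b f g]) (rule ker)
 then obtain h where h: "h : mod_hom R (ring_mod R) E"
  "\<forall>p\<in>carrier ?P. h (?z1 \<otimes>[R] fst p +[R] snd p) = fst p *[E] (?zn *[E] x)" by (elim bexE)
 define y where "y = h 1[R]"
 have yc: "y : carrier E" unfolding y_def using mod_homD(1)[OF h(1)] by simp
 have hr: "h r = r *[E] y" if "r : carrier R" for r
  unfolding y_def using mod_homD(3)[OF h(1), of r "1[R]"] that by simp
 have J0: "0[R] : ?J" using RM.sub_zero[OF sJ] by simp
 have Jy: "a *[E] y = 0[E]" if a: "a : ?J" for a
 proof -
  have "(0[R], a) : carrier ?P" using a by simp
  from bspec[OF h(2) this] show ?thesis using hr[of a] a JR zc(1) zc(2) xc by (auto simp del: E.nat_pow_Suc)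
 qed
 have "(1[R], 0[R]) : carrier ?P" using J0 by simp
 from bspec[OF h(2) this] have zy: "?z1 *[E] y = ?zn *[E] x" using hr[of ?z1] zc xc by (simp del: E.nat_pow_Suc)
 \<comment> \<open>\<open>y\<close> is killed by \<open>?J\<close>, and \<open>?J\<close> contains a
   power of each element of \<open>ps\<close> because \<open>x\<close> is torsion for
   \<open>ps\<close>.\<close>
 have "y : tors R ps E"
 proof -
  have "\<exists>k::nat. (p [^]\<^bsub>R\<^esub> k) *[E] y = 0[E]" if p: "p : set ps" for p
  proof -
   obtain k :: nat where "(p [^]\<^bsub>R\<^esub> k) *[E] x = 0[E]" using x p unfolding tors_def by blast
   then have "p [^]\<^bsub>R\<^esub> k : ?J" unfolding ann_ideal_def using p e zs by auto
   then show ?thesis using Jy by blast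
  qed
  then show ?thesis unfolding tors_def using yc by blast
 qed
 moreover have "?zn *[E] (x -[E] z *[E] y) = 0[E]"
  using zy z zc xc yc by (simp add: E.smult_minus E.smult_assoc1)
 ultimately show "\<exists>y\<in>tors R ps E. \<exists>k::nat. (z [^]\<^bsub>R\<^esub> k) *[E] (x -[E] z *[E] y) = 0[E]" by blast
qed

lemma good_for_prod_mod:
 assumes M: "module R M" and N: "module R N" and zs: "set zs <= carrier R" and "good_for R zs M" "good_for R zs N"
 shows "good_for R zs (prod_mod M N)"
 unfolding good_for_def
proof (intro allI impI ballI)
 interpret M: module R M by fact
 interpret N: module R N by fact
 fix ps z qs x assume e: "zs = ps @ z # qs" and x: "x : tors R ps (prod_mod M N)"
 have z: "z : carrier R" and ps: "set ps <= carrier R" using zs e by auto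
 have x': "fst x : tors R ps M" "snd x : tors R ps N" using x unfolding tors_prod_mod[OF M N ps] by auto
 obtain y1 and k1 :: nat where 1: "y1 : tors R ps M" "(z [^]\<^bsub>R\<^esub> k1) *[M] (fst x -[M] z *[M] y1) = 0[M]"
  using good_forD[OF assms(4) e x'(1)] by (elim bexE exE)
 obtain y2 and k2 :: nat where 2: "y2 : tors R ps N" "(z [^]\<^bsub>R\<^esub> k2) *[N] (snd x -[N] z *[N] y2) = 0[N]"
  using good_forD[OF assms(5) e x'(2)] by (elim bexE exE)
 have c: "y1 : carrier M" "y2 : carrier N" "fst x : carrier M" "snd x : carrier N" using 1 2 x' by (auto intro: tors_carrier)
 have d: "fst x -[M] z *[M] y1 : carrier M" "snd x -[N] z *[N] y2 : carrier N" using c z by auto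
 have "(z [^]\<^bsub>R\<^esub> (max k1 k2)) *[M] (fst x -[M] z *[M] y1) = 0[M]"
  by (rule M.pow_kill_mono[OF z d(1) 1(2)]) simp
 moreover have "(z [^]\<^bsub>R\<^esub> (max k1 k2)) *[N] (snd x -[N] z *[N] y2) = 0[N]"
  by (rule N.pow_kill_mono[OF z d(2) 2(2)]) simp
 moreover have "x -[prod_mod M N] z *[prod_mod M N] (y1, y2) = (fst x -[M] z *[M] y1, snd x -[N] z *[N] y2)"
  using prod_mod_minus[OF M N, of x "z *[prod_mod M N] (y1, y2)"] c z by (simp add: mem_Times_iff)
 ultimately show "\<exists>y\<in>tors R ps (prod_mod M N). \<exists>k::nat.
   (z [^]\<^bsub>R\<^esub> k) *[prod_mod M N] (x -[prod_mod M N] z *[prod_mod M N] y) = 0[prod_mod M N]"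
  using 1(1) 2(1) unfolding tors_prod_mod[OF M N ps]
  by (intro bexI[of _ "(y1, y2)"] exI[of _ "max k1 k2"]) auto
qed

lemma (in module) good_for_zero:
 assumes "set zs <= carrier R" shows "good_for R zs (M\<lparr>carrier := {0[M]}\<rparr>)"
 unfolding good_for_def
proof (intro allI impI ballI)
 fix ps z qs x assume e: "zs = ps @ z # qs" and x: "x : tors R ps (M\<lparr>carrier := {0[M]}\<rparr>)"
 then have "x = 0[M]" "z : carrier R" using assms by auto
 then show "\<exists>y\<in>tors R ps (M\<lparr>carrier := {0[M]}\<rparr>). \<exists>k::nat.
   (z [^] k) *[M\<lparr>carrier := {0[M]}\<rparr>] (x -[M\<lparr>carrier := {0[M]}\<rparr>] z *[M\<lparr>carrier := {0[M]}\<rparr>] y) = 0[M\<lparr>carrier := {0[M]}\<rparr>]"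
  using x restrict_minus[OF submodule_zero, of "0[M]" "0[M]"] by (intro bexI[of _ x] exI[of _ 0]) simp_all
qed

section \<open>Exactness of torsion on exact complexes of good modules\<close>

definition cplx :: "('a, 'r) ring_scheme => (nat => ('a, 'm, 'x) module_scheme) => (nat => 'm => 'm) => bool"
 where "cplx R U d \<longleftrightarrow> (\<forall>n. module R (U n) \<and> d n : mod_hom R (U n) (U (Suc n)) \<and>
  (\<forall>x\<in>carrier (U n). d (Suc n) (d n x) = 0[U (Suc (Suc n))]))"

text \<open>Exact in every degree, including degree 0, where the kernel of \<open>d 0\<close> is
  trivial. Mapping cones are exact in this sense.\<close>

definition exact_on :: "(nat => ('a, 'm, 'x) module_scheme) => (nat => 'm => 'm) => (nat => 'm set) => bool"
 where "exact_on U d G \<longleftrightarrow> (\<forall>u\<in>G 0. d 0 u = 0[U 1] --> u = 0[U 0]) \<and>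
  (\<forall>n. \<forall>u\<in>G (Suc n). d (Suc n) u = 0[U (Suc (Suc n))] --> (\<exists>v\<in>G n. d n v = u))"

text \<open>A preimage \<open>v\<close> of the cocycle \<open>u\<close> is only torsion for
  \<open>ps\<close>. If \<open>z^k\<close> kills \<open>u\<close>, then \<open>z^k v\<close> is a
  cocycle, say \<open>d w\<close>. By goodness \<open>w\<close> is \<open>z^k w'\<close> up to an
  element killed by a power of \<open>z\<close>; then \<open>v - d w'\<close> is still a preimage of
  \<open>u\<close>, and a power of \<open>z\<close> kills it.\<close>

lemma tors_exact_step:
 assumes c: "cplx R U d" and zs: "set zs <= carrier R" and e: "zs = ps @ z # qs" and g: "!!n. good_for R zs (U n)"
  and ex: "exact_on U d (%n. tors R ps (U n))"
 shows "exact_on U d (%n. tors R (ps @ [z]) (U n))"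
 unfolding exact_on_def
proof (intro conjI ballI allI impI)
 fix u assume "u : tors R (ps @ [z]) (U 0)" "d 0 u = 0[U 1]"
 then show "u = 0[U 0]" using ex unfolding exact_on_def tors_append by blast
next
 fix n u assume u: "u : tors R (ps @ [z]) (U (Suc n))" and du: "d (Suc n) u = 0[U (Suc (Suc n))]"
 have mU: "module R (U n)" and d: "d n : mod_hom R (U n) (U (Suc n))"
  and dd: "!!x. x : carrier (U n) ==> d (Suc n) (d n x) = 0[U (Suc (Suc n))]" for n
  using c unfolding cplx_def by auto
 interpret U0: module R "U n" by (rule mU)
 interpret U1: module R "U (Suc n)" by (rule mU)
 have z: "z : carrier R" and ps: "set ps <= carrier R" using zs e by auto
 have "u : tors R ps (U (Suc n))" using u unfolding tors_append by blast
 then obtain v where v: "v : tors R ps (U n)" "d n v = u" using ex du unfolding exact_on_def by blast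
 obtain k :: nat where k: "(z [^]\<^bsub>R\<^esub> k) *[U (Suc n)] u = 0[U (Suc n)]" using u unfolding tors_append tors_def by auto
 let ?zk = "z [^]\<^bsub>R\<^esub> k"
 have zk: "?zk : carrier R" using z by simp
 have vc: "v : carrier (U n)" by (rule tors_carrier[OF v(1)])
 have zv: "?zk *[U n] v : tors R ps (U n)" using U0.submoduleE(4)[OF U0.tors_submodule[OF ps] zk v(1)] .
 have dzv: "d n (?zk *[U n] v) = 0[U (Suc n)]" using mod_homD(3)[OF d zk vc] v(2) k by simp
 show "\<exists>v\<in>tors R (ps @ [z]) (U n). d n v = u"
 proof (cases n)
  case 0
  then have "?zk *[U n] v = 0[U n]" using ex zv dzv unfolding exact_on_def by auto
  then have "v : tors R (ps @ [z]) (U n)" using v(1) unfolding tors_append by (auto simp: tors_def)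
  then show ?thesis using v(2) by blast
 next
  case (Suc m)
  interpret Um: module R "U m" by (rule mU)
  obtain w where w: "w : tors R ps (U m)" "d m w = ?zk *[U n] v"
   using ex zv dzv unfolding exact_on_def Suc by blast
  obtain w' and l :: nat where w': "w' : tors R ps (U m)" "(z [^]\<^bsub>R\<^esub> l) *[U m] (w -[U m] ?zk *[U m] w') = 0[U m]"
   using good_for_pow[OF mU zs g e w(1), of k] by (elim bexE exE)
  have wc: "w : carrier (U m)" "w' : carrier (U m)" using w(1) w'(1) by (auto intro: tors_carrier)
  have dm: "d m : mod_hom R (U m) (U n)" using d[of m] Suc by simp
  have dw': "d m w' : carrier (U n)" using mod_homD(1)[OF dm wc(2)] .
  let ?v = "v -[U n] d m w'"
  have v': "?v : tors R ps (U n)"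
   by (rule U0.submodule_minus_closed[OF U0.tors_submodule[OF ps] v(1) tors_mod_hom[OF dm mU mU ps w'(1)]])
  have "d n (d m w') = 0[U (Suc n)]" using dd[OF wc(2)] Suc by simp
  then have "d n ?v = u"
   using mod_hom_minus[OF d mU mU vc dw'] v(2) mod_homD(1)[OF d vc] by simp
  moreover have "?zk *[U n] ?v = d m (w -[U m] ?zk *[U m] w')"
   using mod_hom_minus[OF dm mU mU wc(1), of "?zk *[U m] w'"] mod_homD(3)[OF dm zk wc(2)] w(2) wc(2) zk vc dw'
   by (simp add: U0.smult_minus)
  then have "(z [^]\<^bsub>R\<^esub> (l + k)) *[U n] ?v = d m ((z [^]\<^bsub>R\<^esub> l) *[U m] (w -[U m] ?zk *[U m] w'))"
   using U0.pow_add_smult[OF z tors_carrier[OF v'], of l k] mod_homD(3)[OF dm, of "z [^]\<^bsub>R\<^esub> l"] z zk wc by simp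
  then have "(z [^]\<^bsub>R\<^esub> (l + k)) *[U n] ?v = 0[U n]" using w'(2) mod_hom_zero[OF dm mU mU] by simp
  then have "?v : tors R (ps @ [z]) (U n)" using v' unfolding tors_append by (auto simp: tors_def)
  ultimately show ?thesis by (intro bexI[of _ ?v])
 qed
qed

lemma tors_exact:
 assumes c: "cplx R U d" and zs: "set zs <= carrier R" and g: "!!n. good_for R zs (U n)"
  and ex: "exact_on U d (%n. carrier (U n))"
 shows "exact_on U d (%n. tors R zs (U n))"
proof -
 have "zs = ps @ qs ==> exact_on U d (%n. tors R ps (U n))" for ps qs
 proof (induction ps arbitrary: qs rule: rev_induct)
  case Nil
  then show ?case using ex by simp
 next
  case (snoc z ps)
  then show ?case using tors_exact_step[OF c zs _ g, of ps z qs] by simp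
 qed
 then show ?thesis by simp
qed

section \<open>Comparison of a complex with an injective resolution\<close>

definition bdry :: "(nat => ('a, 'm, 'x) module_scheme) => (nat => 'm => 'm) => (nat => 'm set) => nat => 'm set"
 where "bdry E d G n = (case n of 0 => {0[E 0]} | Suc m => d m ` G m)"

lemma bdry_simps [simp]: "bdry E d G 0 = {0[E 0]}" "bdry E d G (Suc n) = d n ` G n"
 by (simp_all add: bdry_def)

lemma cplxD:
 assumes "cplx R U d"
 shows "module R (U n)" "d n : mod_hom R (U n) (U (Suc n))"
  "x : carrier (U n) ==> d (Suc n) (d n x) = 0[U (Suc (Suc n))]"
 using assms by (auto simp: cplx_def)

text \<open>A chain map \<open>\<phi>\<close> into an injective resolution is built by extension; its mapping cone is an exact
 complex of good modules, so its torsion subcomplex is exact as well.\<close>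

lemma comparison_map:
 assumes cU: "cplx R U d"
  and ex2: "!!n u. u : carrier (U (Suc (Suc n))) ==> d (Suc (Suc n)) u = 0[U (Suc (Suc (Suc n)))] ==>
   \<exists>v\<in>carrier (U (Suc n)). d (Suc n) v = u"
  and cI: "cplx R I e" and bI: "!!n. baer R (I n)"
  and \<theta>: "\<theta> : mod_hom R (U (Suc 0)\<lparr>carrier := {x : carrier (U (Suc 0)). d (Suc 0) x = 0[U (Suc (Suc 0))]}\<rparr>) (I 0)"
  and \<theta>z: "!!x. x : carrier (U (Suc 0)) ==> d (Suc 0) x = 0[U (Suc (Suc 0))] ==> e 0 (\<theta> x) = 0[I (Suc 0)]"
 shows "\<exists>\<phi>. (\<forall>n. \<phi> n : mod_hom R (U (Suc n)) (I n)) \<and>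
  (\<forall>n. \<forall>x\<in>carrier (U (Suc n)). \<phi> (Suc n) (d (Suc n) x) = e n (\<phi> n x)) \<and>
  (\<forall>x\<in>carrier (U (Suc 0)). d (Suc 0) x = 0[U (Suc (Suc 0))] --> \<phi> 0 x = \<theta> x)"
proof -
 note mU = cplxD(1)[OF cU] and dU = cplxD(2)[OF cU] and ddU = cplxD(3)[OF cU]
 note mI = cplxD(1)[OF cI] and dI = cplxD(2)[OF cI] and ddI = cplxD(3)[OF cI]
 \<comment> \<open>The middle clause is what the next extension requires: \<open>e n\<close> after
   \<open>f\<close> vanishes on the kernel of the differential, so it factors through that
   differential and then extends. The last clause fixes the start \<open>\<theta>\<close>.\<close>
 define P where "P n f \<longleftrightarrow> f : mod_hom R (U (Suc n)) (I n) \<and>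
  (\<forall>x\<in>carrier (U (Suc n)). d (Suc n) x = 0[U (Suc (Suc n))] --> e n (f x) = 0[I (Suc n)]) \<and>
  (n = 0 --> (\<forall>x\<in>carrier (U (Suc 0)). d (Suc 0) x = 0[U (Suc (Suc 0))] --> f x = \<theta> x))" for n f
 define Q where "Q n f f' \<longleftrightarrow> (\<forall>x\<in>carrier (U (Suc n)). f' (d (Suc n) x) = e n (f x))" for n f f'
 have "\<exists>\<phi>. \<forall>n. P n (\<phi> n) \<and> Q n (\<phi> n) (\<phi> (Suc n))"
 proof (rule dependent_nat_choice)
  have "submodule {x : carrier (U (Suc 0)). d (Suc 0) x = 0[U (Suc (Suc 0))]} R (U (Suc 0))"
   using submodule_mod_hom_kernel[OF dU mU mU, of "Suc 0"] .
  from baer_extension[OF mU mI bI this \<theta>]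
  obtain f where f: "f : mod_hom R (U (Suc 0)) (I 0)" "\<forall>x\<in>{x : carrier (U (Suc 0)). d (Suc 0) x = 0[U (Suc (Suc 0))]}. f x = \<theta> x"
   by (elim bexE)
  then show "\<exists>f. P 0 f" unfolding P_def using \<theta>z by (intro exI[of _ f]) simp
 next
  fix f n assume Pn: "P n f"
  then have f: "f : mod_hom R (U (Suc n)) (I n)" unfolding P_def by blast
  have fz: "e n (f x) = 0[I (Suc n)]" if "x : carrier (U (Suc n))" "d (Suc n) x = 0[U (Suc (Suc n))]" for x
   using Pn that unfolding P_def by blast
  from baer_factor[OF mU mU mI bI dU mod_hom_compose[OF f dI] fz]
  obtain f' where f': "f' : mod_hom R (U (Suc (Suc n))) (I (Suc n))"
   "\<forall>a\<in>carrier (U (Suc n)). f' (d (Suc n) a) = e n (f a)" by auto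
  have "e (Suc n) (f' x) = 0[I (Suc (Suc n))]"
   if x: "x : carrier (U (Suc (Suc n)))" "d (Suc (Suc n)) x = 0[U (Suc (Suc (Suc n)))]" for x
  proof -
   obtain v where v: "v : carrier (U (Suc n))" "d (Suc n) v = x" using ex2[OF x] by (elim bexE)
   then have "f' x = e n (f v)" using f'(2) by blast
   then show ?thesis using ddI[OF mod_homD(1)[OF f v(1)]] by simp
  qed
  then show "\<exists>f'. P (Suc n) f' \<and> Q n f f'" unfolding P_def Q_def using f' by (intro exI[of _ f']) simp
 qed
 then obtain \<phi> where \<phi>: "!!n. P n (\<phi> n)" "!!n. Q n (\<phi> n) (\<phi> (Suc n))" by blast
 show ?thesis
 proof (intro exI[of _ \<phi>] conjI allI)
  show "\<phi> n : mod_hom R (U (Suc n)) (I n)" for n using \<phi>(1) unfolding P_def by blast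
  show "\<forall>x\<in>carrier (U (Suc n)). \<phi> (Suc n) (d (Suc n) x) = e n (\<phi> n x)" for n using \<phi>(2) unfolding Q_def by blast
  show "\<forall>x\<in>carrier (U (Suc 0)). d (Suc 0) x = 0[U (Suc (Suc 0))] --> \<phi> 0 x = \<theta> x" using \<phi>(1) unfolding P_def by blast
 qed
qed

text \<open>\<open>U\<close> is indexed one place higher than \<open>I\<close>: its only cohomology
  sits in degree 1, and \<open>\<theta>\<close> identifies it with the kernel of \<open>e 0\<close>.
  The cone of the resulting map is exact, so its torsion part is exact too. Read off for the
  elements \<open>(0, i)\<close> and \<open>(c, i)\<close>, this says that \<open>\<phi>\<close> is
  onto and injective on the cohomology of the torsion parts.\<close>

lemma comparison:
 assumes N: "noetherian_ring R" and zs: "set zs <= carrier R"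
  and cU: "cplx R U d" and gU: "!!n. good_for R zs (U n)"
  and ex0: "!!u. u : carrier (U 0) ==> d 0 u = 0[U (Suc 0)] ==> u = 0[U 0]"
  and ex2: "!!n u. u : carrier (U (Suc (Suc n))) ==> d (Suc (Suc n)) u = 0[U (Suc (Suc (Suc n)))] ==>
   \<exists>v\<in>carrier (U (Suc n)). d (Suc n) v = u"
  and cI: "cplx R I e" and bI: "!!n. baer R (I n)"
  and exact: "!!n i. i : carrier (I (Suc n)) ==> e (Suc n) i = 0[I (Suc (Suc n))] ==> \<exists>j\<in>carrier (I n). e n j = i"
  and \<theta>: "\<theta> : mod_hom R (U (Suc 0)\<lparr>carrier := {x : carrier (U (Suc 0)). d (Suc 0) x = 0[U (Suc (Suc 0))]}\<rparr>) (I 0)"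
  and \<theta>ker: "!!x. x : carrier (U (Suc 0)) ==> d (Suc 0) x = 0[U (Suc (Suc 0))] ==> \<theta> x = 0[I 0] \<longleftrightarrow> x : d 0 ` carrier (U 0)"
  and \<theta>im: "\<theta> ` {x : carrier (U (Suc 0)). d (Suc 0) x = 0[U (Suc (Suc 0))]} = {i : carrier (I 0). e 0 i = 0[I (Suc 0)]}"
 shows "\<exists>\<phi>. (\<forall>n. \<phi> n : mod_hom R (U (Suc n)) (I n)) \<and>
  (\<forall>n. \<forall>c\<in>tors R zs (U (Suc n)). d (Suc n) c = 0[U (Suc (Suc n))] --> e n (\<phi> n c) = 0[I (Suc n)]) \<and>
  (\<forall>n. \<forall>c\<in>tors R zs (U n). \<phi> n (d n c) : bdry I e (%n. tors R zs (I n)) n) \<and>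
  (\<forall>n. \<forall>i\<in>tors R zs (I n). e n i = 0[I (Suc n)] -->
   (\<exists>c\<in>tors R zs (U (Suc n)). d (Suc n) c = 0[U (Suc (Suc n))] \<and> \<phi> n c -[I n] i : bdry I e (%n. tors R zs (I n)) n)) \<and>
  (\<forall>n. \<forall>c\<in>tors R zs (U (Suc n)). d (Suc n) c = 0[U (Suc (Suc n))] -->
   \<phi> n c : bdry I e (%n. tors R zs (I n)) n --> c : d n ` tors R zs (U n))"
proof -
 note mU = cplxD(1)[OF cU] and dU = cplxD(2)[OF cU] and ddU = cplxD(3)[OF cU]
 note mI = cplxD(1)[OF cI] and dI = cplxD(2)[OF cI] and ddI = cplxD(3)[OF cI]
 have zU: "0[U n] : carrier (U n)" for n
 proof - interpret module R "U n" by (rule mU) show ?thesis by (rule M.zero_closed) qed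
 have zI: "0[I n] : carrier (I n)" for n
 proof - interpret module R "I n" by (rule mI) show ?thesis by (rule M.zero_closed) qed
 have mIs: "x -[I n] x = 0[I n]" if "x : carrier (I n)" for n x
 proof - interpret module R "I n" by (rule mI) show ?thesis using that by (rule M.minus_self) qed
 have mI0: "x -[I n] 0[I n] = x" if "x : carrier (I n)" for n x
 proof - interpret module R "I n" by (rule mI) show ?thesis using that by (rule M.minus_zero_right) qed
 have mIz: "x = y" if "x -[I n] y = 0[I n]" "x : carrier (I n)" "y : carrier (I n)" for n x y
 proof - interpret module R "I n" by (rule mI) show ?thesis using that M.minus_eq_zero_iff by blast qed
 have mIc: "x -[I n] y : carrier (I n)" if "x : carrier (I n)" "y : carrier (I n)" for n x y
 proof - interpret module R "I n" by (rule mI) show ?thesis using that by (rule M.minus_closed) qed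
 have \<theta>z: "e 0 (\<theta> x) = 0[I (Suc 0)]" if "x : carrier (U (Suc 0))" "d (Suc 0) x = 0[U (Suc (Suc 0))]" for x
  using \<theta>im that by blast
 have "\<exists>\<phi>. (\<forall>n. \<phi> n : mod_hom R (U (Suc n)) (I n)) \<and>
  (\<forall>n. \<forall>x\<in>carrier (U (Suc n)). \<phi> (Suc n) (d (Suc n) x) = e n (\<phi> n x)) \<and>
  (\<forall>x\<in>carrier (U (Suc 0)). d (Suc 0) x = 0[U (Suc (Suc 0))] --> \<phi> 0 x = \<theta> x)"
  by (rule comparison_map[OF cU ex2 cI bI \<theta> \<theta>z])
 then obtain \<phi> where \<phi>a: "\<forall>n. \<phi> n : mod_hom R (U (Suc n)) (I n)"
  "\<forall>n. \<forall>x\<in>carrier (U (Suc n)). \<phi> (Suc n) (d (Suc n) x) = e n (\<phi> n x)"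
  "\<forall>x\<in>carrier (U (Suc 0)). d (Suc 0) x = 0[U (Suc (Suc 0))] --> \<phi> 0 x = \<theta> x" by (elim exE conjE)
 have \<phi>: "!!n. \<phi> n : mod_hom R (U (Suc n)) (I n)" using \<phi>a(1) by blast
 have \<phi>d: "!!n x. x : carrier (U (Suc n)) ==> \<phi> (Suc n) (d (Suc n) x) = e n (\<phi> n x)" using \<phi>a(2) by blast
 have \<phi>0: "!!x. x : carrier (U (Suc 0)) ==> d (Suc 0) x = 0[U (Suc (Suc 0))] ==> \<phi> 0 x = \<theta> x" using \<phi>a(3) by blast
 have \<phi>c: "!!n x. x : carrier (U (Suc n)) ==> \<phi> n x : carrier (I n)" using mod_homD(1)[OF \<phi>] .
 have ec: "!!n x. x : carrier (I n) ==> e n x : carrier (I (Suc n))" using mod_homD(1)[OF dI] .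
 have dc: "!!n x. x : carrier (U n) ==> d n x : carrier (U (Suc n))" using mod_homD(1)[OF dU] .
 have \<phi>z: "!!n. \<phi> n 0[U (Suc n)] = 0[I n]" by (rule mod_hom_zero[OF \<phi> mU mI])
 have ez: "!!n. e n 0[I n] = 0[I (Suc n)]" by (rule mod_hom_zero[OF dI mI mI])
 have dz: "!!n. d n 0[U n] = 0[U (Suc n)]" by (rule mod_hom_zero[OF dU mU mU])
 have \<phi>0d: "\<phi> 0 (d 0 x) = 0[I 0]" if x: "x : carrier (U 0)" for x
 proof -
  have "d 0 x : carrier (U (Suc 0))" "d (Suc 0) (d 0 x) = 0[U (Suc (Suc 0))]"
   using dc[OF x] ddU[OF x] by simp_all
  then show ?thesis using \<phi>0 \<theta>ker x by simp
 qed
 let ?Z = "I 0\<lparr>carrier := {0[I 0]}\<rparr>"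
 have mZ: "module R ?Z" by (rule module.restrict_module[OF mI module.submodule_zero[OF mI]])
 \<comment> \<open>Degree \<open>n\<close> of the mapping cone is \<open>U n\<close> times
   \<open>I (n - 2)\<close>: one shift belongs to the cone, the other to the indexing of
   \<open>U\<close>. Zero modules fill the two places below.\<close>
 define J where "J n = (case n of 0 => ?Z | Suc m => (case m of 0 => ?Z | Suc m' => I m'))" for n
 have J: "J 0 = ?Z" "J (Suc 0) = ?Z" "!!n. J (Suc (Suc n)) = I n" unfolding J_def by simp_all
 define C where "C n = prod_mod (U n) (J n)" for n
 \<comment> \<open>The differential of the cone sends \<open>(u, i)\<close> to
   \<open>(d u, \<phi> u - e i)\<close>, wherever these terms exist.\<close>
 define D where "D n p = (d n (fst p), (case n of 0 => 0[I 0] | Suc m => (case m of 0 => \<phi> 0 (fst p)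
   | Suc m' => \<phi> (Suc m') (fst p) -[I (Suc m')] e m' (snd p))))" for n p
 have D: "!!p. D 0 p = (d 0 (fst p), 0[I 0])" "!!p. D (Suc 0) p = (d (Suc 0) (fst p), \<phi> 0 (fst p))"
  "!!n p. D (Suc (Suc n)) p = (d (Suc (Suc n)) (fst p), \<phi> (Suc n) (fst p) -[I (Suc n)] e n (snd p))"
  unfolding D_def by simp_all
 have n3: "n = 0 \<or> n = Suc 0 \<or> (\<exists>m. n = Suc (Suc m))" for n :: nat by (cases n; cases "n - 1") auto
 have mJ: "module R (J n)" for n using n3[of n] J mZ mI by auto
 have mC: "module R (C n)" for n unfolding C_def by (rule prod_mod_module[OF mU mJ])
 have sub_hom: "(%p. \<phi> (Suc n) (fst p) -[I (Suc n)] e n (snd p)) : mod_hom R (prod_mod (U (Suc (Suc n))) (I n)) (I (Suc n))" for n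
 proof (rule mod_homI)
  interpret I: module R "I (Suc n)" by (rule mI)
  fix p q assume "p : carrier (prod_mod (U (Suc (Suc n))) (I n))" "q : carrier (prod_mod (U (Suc (Suc n))) (I n))"
  then have c: "fst p : carrier (U (Suc (Suc n)))" "snd p : carrier (I n)"
   "fst q : carrier (U (Suc (Suc n)))" "snd q : carrier (I n)" by auto
  show "\<phi> (Suc n) (fst p) -[I (Suc n)] e n (snd p) : carrier (I (Suc n))" using c \<phi>c ec mIc by blast
  show "\<phi> (Suc n) (fst (p +[prod_mod (U (Suc (Suc n))) (I n)] q)) -[I (Suc n)] e n (snd (p +[prod_mod (U (Suc (Suc n))) (I n)] q)) =
    (\<phi> (Suc n) (fst p) -[I (Suc n)] e n (snd p)) +[I (Suc n)] (\<phi> (Suc n) (fst q) -[I (Suc n)] e n (snd q))"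
   using c mod_homD(2)[OF \<phi> c(1,3)] mod_homD(2)[OF dI c(2,4)] by (simp add: I.M.minus_add_minus \<phi>c ec)
 next
  interpret I: module R "I (Suc n)" by (rule mI)
  fix r p assume r: "r : carrier R" and "p : carrier (prod_mod (U (Suc (Suc n))) (I n))"
  then have c: "fst p : carrier (U (Suc (Suc n)))" "snd p : carrier (I n)" by auto
  show "\<phi> (Suc n) (fst (r *[prod_mod (U (Suc (Suc n))) (I n)] p)) -[I (Suc n)] e n (snd (r *[prod_mod (U (Suc (Suc n))) (I n)] p)) =
    r *[I (Suc n)] (\<phi> (Suc n) (fst p) -[I (Suc n)] e n (snd p))"
   using c r mod_homD(3)[OF \<phi> r c(1)] mod_homD(3)[OF dI r c(2)] by (simp add: I.smult_minus \<phi>c ec)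
 qed
 have pair: "(%p. (f p, g p)) : mod_hom R M (prod_mod A B)" if "f : mod_hom R M A" "g : mod_hom R M B"
  for f g and M :: "('a, 'c \<times> 'e) module" and A :: "('a, 'c, 'd) module_scheme" and B :: "('a, 'e, 'f) module_scheme"
  by (rule mod_homI) (use mod_homD[OF that(1)] mod_homD[OF that(2)] in auto)
 have fst: "fst : mod_hom R (prod_mod A B) A"
  for A :: "('a, 'c, 'd) module_scheme" and B :: "('a, 'e, 'f) module_scheme" by (rule mod_homI) auto
 have DC: "D n : mod_hom R (C n) (C (Suc n))" for n
 proof -
  have d1: "(%p. d n (fst p)) : mod_hom R (C n) (U (Suc n))"
   unfolding C_def by (rule mod_hom_compose[OF fst dU])
  consider "n = 0" | "n = Suc 0" | m where "n = Suc (Suc m)" using n3[of n] by blast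
  then show ?thesis
  proof cases
   case 1
   interpret Z: module R "I 0" by (rule mI)
   have "(%p. 0[I 0]) : mod_hom R (C n) ?Z" by (rule mod_homI) auto
   from pair[OF d1[unfolded C_def] this[unfolded C_def]] show ?thesis unfolding C_def 1 J D[abs_def] by simp
  next
   case 2
   have "(%p. \<phi> 0 (fst p)) : mod_hom R (C n) (I 0)" unfolding C_def 2 by (rule mod_hom_compose[OF fst \<phi>])
   from pair[OF d1[unfolded C_def] this[unfolded C_def]] show ?thesis unfolding C_def 2 J D[abs_def] by simp
  next
   case 3
   from pair[OF d1[unfolded C_def 3 J] sub_hom] show ?thesis unfolding C_def 3 J D[abs_def] .
  qed
 qed
 have DD: "D (Suc n) (D n p) = 0[C (Suc (Suc n))]" if p: "p : carrier (C n)" for n p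
 proof -
  have f: "fst p : carrier (U n)" using p unfolding C_def by auto
  consider "n = 0" | "n = Suc 0" | m where "n = Suc (Suc m)" using n3[of n] by blast
  then show ?thesis
  proof cases
   case 1
   then show ?thesis unfolding C_def 1 J D using ddU[of "fst p" 0] \<phi>0d[of "fst p"] f 1 by simp
  next
   case 2
   then show ?thesis unfolding C_def 2 J D using ddU[of "fst p" "Suc 0"] \<phi>d[of "fst p" 0] f mIs[OF ec[OF \<phi>c[of "fst p" 0]]] 2 by simp
  next
   case 3
   have s: "snd p : carrier (I m)" using p unfolding C_def 3 J by auto
   have f': "fst p : carrier (U (Suc (Suc m)))" using f 3 by simp
   have "e (Suc m) (\<phi> (Suc m) (fst p) -[I (Suc m)] e m (snd p)) = e (Suc m) (\<phi> (Suc m) (fst p))"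
    using mod_hom_minus[OF dI mI mI \<phi>c[OF f'] ec[OF s]] ddI[OF s] mI0[OF ec[OF \<phi>c[OF f']]] by simp
   then show ?thesis unfolding C_def 3 J D using ddU[OF f'] \<phi>d[OF f'] mIs[OF ec[OF \<phi>c[OF f']]] by simp
  qed
 qed
 have cC: "cplx R C D" unfolding cplx_def using mC DC DD by blast
 have gI: "good_for R zs (I n)" for n by (rule baer_good_for[OF N mI bI zs])
 have gZ: "good_for R zs ?Z" by (rule module.good_for_zero[OF mI zs])
 have gJ: "good_for R zs (J n)" for n using n3[of n] J gZ gI by auto
 have gC: "good_for R zs (C n)" for n unfolding C_def by (rule good_for_prod_mod[OF mU mJ zs gU gJ])
 have exC: "exact_on C D (%n. carrier (C n))"
  unfolding exact_on_def
 proof (intro conjI ballI allI impI)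
  fix u assume u: "u : carrier (C 0)" and Du: "D 0 u = 0[C 1]"
  then show "u = 0[C 0]" using ex0[of "fst u"] unfolding C_def D by (auto simp: J)
 next
  fix n u assume u: "u : carrier (C (Suc n))" and Du: "D (Suc n) u = 0[C (Suc (Suc n))]"
  have f: "fst u : carrier (U (Suc n))" using u unfolding C_def by auto
  consider "n = 0" | "n = Suc 0" | m where "n = Suc (Suc m)" using n3[of n] by blast
  then show "\<exists>v\<in>carrier (C n). D n v = u"
  proof cases
   case 1
   have u': "fst u : carrier (U (Suc 0))" "snd u = 0[I 0]" "d (Suc 0) (fst u) = 0[U (Suc (Suc 0))]" "\<phi> 0 (fst u) = 0[I 0]"
    using u Du unfolding C_def 1 J D by auto
   then have "\<theta> (fst u) = 0[I 0]" using \<phi>0 by simp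
   then obtain v where "v : carrier (U 0)" "fst u = d 0 v" using \<theta>ker u' by blast
   then show ?thesis unfolding C_def 1 J D using u'(2) by (intro bexI[of _ "(v, 0[I 0])"]) (auto simp: J prod_eq_iff)
  next
   \<comment> \<open>Here the difference of \<open>\<phi> 0 c\<close> and the given element lies in
     the kernel of \<open>e 0\<close>, which is not reached by a differential of \<open>I\<close>.
     It is in the image of \<open>\<theta>\<close>, so \<open>c\<close> is corrected by a cocycle
     \<open>w\<close> of \<open>U\<close>.\<close>
   case 2
   have u': "fst u : carrier (U (Suc (Suc 0)))" "snd u : carrier (I 0)" "d (Suc (Suc 0)) (fst u) = 0[U (Suc (Suc (Suc 0)))]"
    "\<phi> (Suc 0) (fst u) -[I (Suc 0)] e 0 (snd u) = 0[I (Suc 0)]"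
    using u Du unfolding C_def 2 J D by auto
   obtain c where c: "c : carrier (U (Suc 0))" "d (Suc 0) c = fst u"
    using ex2[of "fst u" 0] u' by auto
   have cc: "\<phi> 0 c : carrier (I 0)" using \<phi>c[of c 0] c(1) by simp
   have "\<phi> (Suc 0) (fst u) = e 0 (snd u)"
    using mIz[OF u'(4)] \<phi>c[of "fst u" "Suc 0"] u' ec[of "snd u" 0] by simp
   then have "e 0 (\<phi> 0 c) = e 0 (snd u)" using \<phi>d[of c 0] c by simp
   then have "e 0 (\<phi> 0 c -[I 0] snd u) = 0[I (Suc 0)]"
    using mod_hom_minus[OF dI mI mI cc u'(2)] mIs[OF ec[OF u'(2)]] by simp
   then have "\<phi> 0 c -[I 0] snd u : \<theta> ` {x : carrier (U (Suc 0)). d (Suc 0) x = 0[U (Suc (Suc 0))]}"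
    unfolding \<theta>im using mIc[OF cc u'(2)] by simp
   then obtain w where w: "w : carrier (U (Suc 0))" "d (Suc 0) w = 0[U (Suc (Suc 0))]" "\<phi> 0 c -[I 0] snd u = \<phi> 0 w" using \<phi>0 by auto
   interpret U1: module R "U (Suc 0)" by (rule mU)
   interpret U2: module R "U (Suc (Suc 0))" by (rule mU)
   interpret I0: module R "I 0" by (rule mI)
   have d1: "d (Suc 0) : mod_hom R (U (Suc 0)) (U (Suc (Suc 0)))" using dU[of "Suc 0"] .
   have p0: "\<phi> 0 : mod_hom R (U (Suc 0)) (I 0)" using \<phi>[of 0] by simp
   have "d (Suc 0) (c -[U (Suc 0)] w) = fst u" using mod_hom_minus[OF d1 mU mU c(1) w(1)] c(2) w(2) u'(1) by simp
   moreover have "\<phi> 0 (c -[U (Suc 0)] w) = snd u"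
   proof -
    have "\<phi> 0 (c -[U (Suc 0)] w) = \<phi> 0 c -[I 0] (\<phi> 0 c -[I 0] snd u)"
     using mod_hom_minus[OF p0 mU mI c(1) w(1)] w(3) by simp
    also have "\<dots> = snd u"
     using I0.M.minus_eq_iff[of "\<phi> 0 c" "\<phi> 0 c -[I 0] snd u" "snd u"] I0.M.add_minus_swap[of "snd u" "\<phi> 0 c"] cc u'(2) by simp
    finally show ?thesis .
   qed
   moreover have "c -[U (Suc 0)] w : carrier (U (Suc 0))" by (rule U1.M.minus_closed[OF c(1) w(1)])
   ultimately show ?thesis unfolding C_def 2 J D
    by (intro bexI[of _ "(c -[U (Suc 0)] w, 0[I 0])"]) (auto simp: J prod_eq_iff)
  next
   case 3
   have u': "fst u : carrier (U (Suc (Suc (Suc m))))" "snd u : carrier (I (Suc m))"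
    "d (Suc (Suc (Suc m))) (fst u) = 0[U (Suc (Suc (Suc (Suc m))))]"
    "\<phi> (Suc (Suc m)) (fst u) -[I (Suc (Suc m))] e (Suc m) (snd u) = 0[I (Suc (Suc m))]"
    using u Du unfolding C_def 3 J D by auto
   obtain c where c: "c : carrier (U (Suc (Suc m)))" "d (Suc (Suc m)) c = fst u"
    using ex2[OF u'(1,3)] by (elim bexE)
   have cc: "\<phi> (Suc m) c : carrier (I (Suc m))" using \<phi>c[OF c(1)] .
   have "\<phi> (Suc (Suc m)) (fst u) = e (Suc m) (snd u)" using mIz[OF u'(4)] \<phi>c[OF u'(1)] ec[OF u'(2)] by simp
   then have "e (Suc m) (\<phi> (Suc m) c) = e (Suc m) (snd u)" using \<phi>d[OF c(1)] c(2) by simp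
   then have eh: "e (Suc m) (\<phi> (Suc m) c -[I (Suc m)] snd u) = 0[I (Suc (Suc m))]"
    using mod_hom_minus[OF dI mI mI cc u'(2)] mIs[OF ec[OF u'(2)]] by simp
   obtain j where j: "j : carrier (I m)" "e m j = \<phi> (Suc m) c -[I (Suc m)] snd u"
    using exact[OF mIc[OF cc u'(2)] eh] by (elim bexE)
   interpret I1: module R "I (Suc m)" by (rule mI)
   have "\<phi> (Suc m) c -[I (Suc m)] e m j = snd u"
    unfolding j(2) using I1.M.minus_eq_iff[of "\<phi> (Suc m) c" "\<phi> (Suc m) c -[I (Suc m)] snd u" "snd u"]
     I1.M.add_minus_swap[of "snd u" "\<phi> (Suc m) c"] cc u'(2) by simp
   then show ?thesis unfolding C_def 3 J D
    using c j(1) by (intro bexI[of _ "(c, j)"]) (auto simp: prod_eq_iff)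
  qed
 qed
 have tex: "exact_on C D (%n. tors R zs (C n))" by (rule tors_exact[OF cC zs gC exC])
 have TC: "tors R zs (C n) = tors R zs (U n) \<times> tors R zs (J n)" for n
  unfolding C_def by (rule tors_prod_mod[OF mU mJ zs])
 have tex': "\<exists>v. fst v : tors R zs (U n) \<and> snd v : tors R zs (J n) \<and> D n v = u"
  if h: "fst u : tors R zs (U (Suc n))" "snd u : tors R zs (J (Suc n))" "D (Suc n) u = 0[C (Suc (Suc n))]" for n u
 proof -
  have "u : tors R zs (C (Suc n))" unfolding TC using h by (simp add: mem_Times_iff)
  then obtain v where "v : tors R zs (C n)" "D n v = u" using tex h(3) unfolding exact_on_def by blast
  then show ?thesis unfolding TC by (intro exI[of _ v]) (simp add: mem_Times_iff)
 qed
 have tz: "0[M] : tors R zs M" if "module R M" for M :: "('a, 'z, 'zz) module_scheme"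
  using module.sub_zero[OF that module.tors_submodule[OF that zs]] .
 have tzJ: "0[I 0] : tors R zs ?Z" using tz[OF mZ] by simp
 show ?thesis
 proof (intro exI[of _ \<phi>] conjI allI ballI impI)
  show "\<phi> n : mod_hom R (U (Suc n)) (I n)" for n by (rule \<phi>)
 next
  fix n c assume "c : tors R zs (U (Suc n))" "d (Suc n) c = 0[U (Suc (Suc n))]"
  then show "e n (\<phi> n c) = 0[I (Suc n)]" using \<phi>d[of c n] \<phi>z[of "Suc n"] tors_carrier by metis
 next
  fix n c assume c: "c : tors R zs (U n)"
  show "\<phi> n (d n c) : bdry I e (%n. tors R zs (I n)) n"
  proof (cases n)
   case 0
   then show ?thesis using \<phi>0d c tors_carrier[of c R zs "U 0"] by simp
  next
   case (Suc m)
   have "c : tors R zs (U (Suc m))" using c Suc by simp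
   then have "\<phi> n (d n c) = e m (\<phi> m c)" "\<phi> m c : tors R zs (I m)"
    using \<phi>d[of c m] tors_carrier[of c R zs "U (Suc m)"] tors_mod_hom[OF \<phi> mU mI zs] Suc by auto
   then show ?thesis using Suc by simp
  qed
 next
  fix n i assume i: "i : tors R zs (I n)" and ei: "e n i = 0[I (Suc n)]"
  have ic: "i : carrier (I n)" using i by (rule tors_carrier)
  \<comment> \<open>\<open>(0, i)\<close> is a cocycle of the cone. A torsion preimage
    \<open>(c, j)\<close> satisfies \<open>d c = 0\<close> and \<open>\<phi> c - e j = i\<close>, so
    the class of \<open>c\<close> maps to the class of \<open>i\<close>.\<close>
  have "D (Suc (Suc n)) (0[U (Suc (Suc n))], i) = 0[C (Suc (Suc (Suc n)))]"
   unfolding C_def D J using dz \<phi>z ei mIs[OF zI] by simp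
  then obtain v where v: "fst v : tors R zs (U (Suc n))" "snd v : tors R zs (J (Suc n))"
   "D (Suc n) v = (0[U (Suc (Suc n))], i)"
   using tex'[of "(0[U (Suc (Suc n))], i)" "Suc n"] tz[OF mU] i J by auto
  have fc: "\<phi> n (fst v) : carrier (I n)" using \<phi>c tors_carrier[OF v(1)] by blast
  have "\<phi> n (fst v) -[I n] i : bdry I e (%n. tors R zs (I n)) n \<and> d (Suc n) (fst v) = 0[U (Suc (Suc n))]"
  proof (cases n)
   case 0
   then show ?thesis using v(3) unfolding 0 D using mIs[of i 0] ic 0 by auto
  next
   case (Suc m)
   have s: "snd v : tors R zs (I m)" using v(2) unfolding Suc J .
   have sc: "e m (snd v) : carrier (I (Suc m))" using ec tors_carrier[OF s] by blast
   have v3: "d (Suc n) (fst v) = 0[U (Suc (Suc n))]" "\<phi> (Suc m) (fst v) -[I (Suc m)] e m (snd v) = i"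
    using v(3) unfolding Suc D by auto
   interpret I1: module R "I (Suc m)" by (rule mI)
   have fc': "\<phi> (Suc m) (fst v) : carrier (I (Suc m))" using fc Suc by simp
   have "\<phi> (Suc m) (fst v) -[I (Suc m)] i = e m (snd v)"
    unfolding v3(2)[symmetric] using fc' sc
     I1.M.minus_eq_iff[of "\<phi> (Suc m) (fst v)" "\<phi> (Suc m) (fst v) -[I (Suc m)] e m (snd v)" "e m (snd v)"]
     I1.M.add_minus_swap[of "e m (snd v)" "\<phi> (Suc m) (fst v)"] by simp
   then show ?thesis using v3(1) s unfolding Suc by simp
  qed
  then show "\<exists>c\<in>tors R zs (U (Suc n)). d (Suc n) c = 0[U (Suc (Suc n))] \<and>
    \<phi> n c -[I n] i : bdry I e (%n. tors R zs (I n)) n" using v(1) by blast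
 next
  fix n c assume c: "c : tors R zs (U (Suc n))" and dc0: "d (Suc n) c = 0[U (Suc (Suc n))]"
   and b: "\<phi> n c : bdry I e (%n. tors R zs (I n)) n"
  \<comment> \<open>If \<open>\<phi> c = e i\<close>, then \<open>(c, i)\<close> is a cocycle of the
    cone, and the first component of a torsion preimage is a torsion element with boundary
    \<open>c\<close>. In degree 0 the only boundary is zero and \<open>i\<close> is taken to be
    zero.\<close>
  have "\<exists>i. i : tors R zs (J (Suc n)) \<and> D (Suc n) (c, i) = 0[C (Suc (Suc n))]"
  proof (cases n)
   case 0
   then show ?thesis using b dc0 tzJ unfolding 0 C_def J D by (intro exI[of _ "0[I 0]"]) auto
  next
   case (Suc m)
   then obtain i where i: "i : tors R zs (I m)" "\<phi> (Suc m) c = e m i" using b by auto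
   then show ?thesis using dc0 mIs[OF ec[OF tors_carrier[OF i(1)]]] unfolding Suc C_def J D
    by (intro exI[of _ i]) auto
  qed
  then obtain i where "i : tors R zs (J (Suc n))" "D (Suc n) (c, i) = 0[C (Suc (Suc n))]" by blast
  then obtain v where "fst v : tors R zs (U n)" "D n v = (c, i)" using tex'[of "(c, i)" n] c by auto
  moreover from this(2) have "d n (fst v) = c" unfolding D_def by simp
  ultimately show "c : d n ` tors R zs (U n)" by blast
 qed
qed

section \<open>Finite generation and vanishing of subquotients\<close>

text \<open>Finite generation of \<open>Z / B\<close> without the quotient. Subquotients of
  different complexes can so be compared by maps between the ambient modules.\<close>

definition fdq :: "('k, 'r) ring_scheme => ('k, 'm, 'x) module_scheme => 'm set => 'm set => bool"
 where "fdq K V Z B \<longleftrightarrow> (\<exists>S. finite S \<and> S <= Z \<and> Z <= gen_submodule K V (S \<union> B))"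

lemma fdq_onto:
 assumes V: "module K V" and W: "module K W" and f: "f : mod_hom K V W"
  and ZV: "Z <= carrier V" and BV: "B <= carrier V" and Z': "Z' <= carrier W" and B': "submodule B' K W"
  and fZ: "f ` Z <= Z'" and fB: "f ` B <= B'"
  and surj: "!!z'. z' : Z' ==> \<exists>z\<in>Z. f z -[W] z' : B'" and fd: "fdq K V Z B"
 shows "fdq K W Z' B'"
proof -
 interpret V: module K V by fact
 interpret W: module K W by fact
 obtain S where S: "finite S" "S <= Z" "Z <= gen_submodule K V (S \<union> B)" using fd unfolding fdq_def by blast
 have c: "f ` S \<union> B' <= carrier W" using S(2) fZ Z' W.submoduleE(1)[OF B'] by blast
 let ?G = "gen_submodule K W (f ` S \<union> B')"
 have G: "submodule ?G K W" by (rule W.gen_sub[OF c])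
 have "Z' <= ?G"
 proof
  fix z' assume z': "z' : Z'"
  obtain z where z: "z : Z" "f z -[W] z' : B'" using surj[OF z'] by blast
  have SB: "S \<union> B <= carrier V" using S(2) ZV BV by blast
  have "f z : gen_submodule K W (f ` (S \<union> B))"
   by (rule mod_hom_gen_submodule[OF f V W SB]) (use S(3) z in blast)
  then have fz: "f z : ?G" using W.gen_submodule_mono[of "f ` (S \<union> B)" "f ` S \<union> B'"] fB by blast
  have "f z -[W] z' : ?G" using z(2) W.gen_incl[of "f ` S \<union> B'"] by blast
  then have "f z -[W] (f z -[W] z') : ?G" by (rule W.submodule_minus_closed[OF G fz])
  moreover have "f z -[W] (f z -[W] z') = z'"
   using W.M.minus_eq_iff[of "f z" "f z -[W] z'" z'] W.M.add_minus_swap[of z' "f z"] z' z fZ Z' by auto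
  ultimately show "z' : ?G" by simp
 qed
 then show ?thesis unfolding fdq_def using S fZ by (intro exI[of _ "f ` S"]) blast
qed

text \<open>Lifts of generators of \<open>Z' / B'\<close> generate \<open>Z / B\<close>: modulo
  \<open>B'\<close> their span reaches every \<open>f z\<close>, and injectivity modulo boundaries
  places the difference of the two elements of \<open>Z\<close> in \<open>B\<close>.\<close>

lemma fdq_back:
 assumes V: "module K V" and W: "module K W" and f: "f : mod_hom K V W"
  and Z: "submodule Z K V" and B: "submodule B K V" "B <= Z" and Z': "Z' <= carrier W" and B': "submodule B' K W"
  and fZ: "f ` Z <= Z'"
  and inj: "!!z. z : Z ==> f z : B' ==> z : B"
  and surj: "!!z'. z' : Z' ==> \<exists>z\<in>Z. f z -[W] z' : B'" and fd: "fdq K W Z' B'"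
 shows "fdq K V Z B"
proof -
 interpret V: module K V by fact
 interpret W: module K W by fact
 obtain S' where S': "finite S'" "S' <= Z'" "Z' <= gen_submodule K W (S' \<union> B')" using fd unfolding fdq_def by blast
 obtain g where g: "!!z'. z' : Z' ==> g z' : Z \<and> f (g z') -[W] z' : B'" using surj by metis
 have ZV: "Z <= carrier V" by (rule V.submoduleE(1)[OF Z])
 let ?S = "g ` S'"
 have SZ: "?S <= Z" using g S'(2) by blast
 have SB: "?S \<union> B <= carrier V" using SZ ZV B(2) by blast
 let ?G = "gen_submodule K V (?S \<union> B)"
 have G: "submodule ?G K V" by (rule V.gen_sub[OF SB])
 have GZ: "?G <= Z" by (rule V.gen_submodule_minimal[OF Z]) (use SZ B(2) in blast)
 have fc: "f z : carrier W" if "z : carrier V" for z using mod_homD(1)[OF f that] .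
 have cW: "S' \<union> B' <= carrier W" using S'(2) Z' W.submoduleE(1)[OF B'] by blast
 have B'c: "B' <= carrier W" by (rule W.submoduleE(1)[OF B'])
 have key: "\<exists>z0\<in>?G. f z0 -[W] w : B'" if w: "w : gen_submodule K W (S' \<union> B')" for w
 proof (rule gen_submodule_induct[OF w W cW], goal_cases)
  case 1
  show ?case using V.sub_zero[OF G] mod_hom_zero[OF f V W] W.sub_zero[OF B']
   by (intro bexI[of _ "0[V]"]) auto
 next
  case (2 s)
  show ?case
  proof (cases "s : S'")
   case True
   then have "g s : ?G" using V.gen_incl[of "?S \<union> B"] by blast
   then show ?thesis using g True S'(2) by blast
  next
   case False
   then have s: "s : B'" using 2 by blast
   then have "0[W] -[W] s : B'" using W.submodule_minus_closed[OF B' W.sub_zero[OF B']] by blast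
   then show ?thesis using V.sub_zero[OF G] mod_hom_zero[OF f V W]
    by (intro bexI[of _ "0[V]"]) simp_all
  qed
 next
  case (3 x y)
  then obtain a b where ab: "a : ?G" "f a -[W] x : B'" "b : ?G" "f b -[W] y : B'" by (elim bexE)
  have c: "a : carrier V" "b : carrier V" using ab GZ ZV by auto
  have "f (a +[V] b) -[W] (x +[W] y) = (f a -[W] x) +[W] (f b -[W] y)"
   unfolding mod_homD(2)[OF f c] by (rule W.M.minus_add_minus[OF fc[OF c(1)] fc[OF c(2)] 3(1,2)])
  then show ?case using V.submoduleE(5)[OF G ab(1,3)] W.submoduleE(5)[OF B' ab(2,4)] by (intro bexI[of _ "a +[V] b"]) simp_all
 next
  case (4 r x)
  then obtain a where a: "a : ?G" "f a -[W] x : B'" by (elim bexE)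
  have c: "a : carrier V" using a GZ ZV by auto
  have "f (r *[V] a) -[W] (r *[W] x) = r *[W] (f a -[W] x)"
   unfolding mod_homD(3)[OF f 4(1) c] by (rule W.smult_minus[OF 4(1) fc[OF c] 4(2), symmetric])
  then show ?case using V.submoduleE(4)[OF G 4(1) a(1)] W.submoduleE(4)[OF B' 4(1) a(2)] by (intro bexI[of _ "r *[V] a"]) simp_all
 qed
 have "Z <= ?G"
 proof
  fix z assume z: "z : Z"
  then have zc: "z : carrier V" using ZV by blast
  obtain z0 where z0: "z0 : ?G" "f z0 -[W] f z : B'" using key[of "f z"] S'(3) fZ z by blast
  have z0c: "z0 : carrier V" "z0 : Z" using z0 GZ ZV by auto
  have "f (z0 -[V] z) : B'" using z0(2) mod_hom_minus[OF f V W z0c(1) zc] by simp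
  then have "z0 -[V] z : B" using inj V.submodule_minus_closed[OF Z z0c(2) z] by blast
  then have "z0 -[V] z : ?G" using V.gen_incl[of "?S \<union> B"] by blast
  then have "z0 -[V] (z0 -[V] z) : ?G" by (rule V.submodule_minus_closed[OF G z0(1)])
  moreover have "z0 -[V] (z0 -[V] z) = z"
   using V.M.minus_eq_iff[of z0 "z0 -[V] z" z] V.M.add_minus_swap[of z z0] zc z0c by simp
  ultimately show "z : ?G" by simp
 qed
 then show ?thesis unfolding fdq_def using S'(1) SZ by (intro exI[of _ ?S]) blast
qed

lemma fdq_iff:
 assumes V: "module K V" and W: "module K W" and f: "f : mod_hom K V W"
  and Z: "submodule Z K V" and B: "submodule B K V" "B <= Z" and Z': "Z' <= carrier W" and B': "submodule B' K W"
  and fZ: "f ` Z <= Z'" and fB: "f ` B <= B'"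
  and inj: "!!z. z : Z ==> f z : B' ==> z : B"
  and surj: "!!z'. z' : Z' ==> \<exists>z\<in>Z. f z -[W] z' : B'"
 shows "fdq K V Z B \<longleftrightarrow> fdq K W Z' B'"
proof
 have ZV: "Z <= carrier V" "B <= carrier V" using module.submoduleE(1)[OF V] Z B by auto
 show "fdq K V Z B ==> fdq K W Z' B'" by (rule fdq_onto[OF V W f ZV Z' B' fZ fB surj])
 show "fdq K W Z' B' ==> fdq K V Z B" by (rule fdq_back[OF V W f Z B Z' B' fZ inj surj])
qed

lemma vanish_iff:
 assumes W: "module K W" and B': "submodule B' K W" and fZ: "f ` Z <= Z'" and fB: "f ` B <= B'" and Z': "Z' <= carrier W"
  and inj: "!!z. z : Z ==> f z : B' ==> z : B"
  and surj: "!!z'. z' : Z' ==> \<exists>z\<in>Z. f z -[W] z' : B'"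
 shows "Z <= B \<longleftrightarrow> Z' <= B'"
proof
 interpret W: module K W by fact
 assume ZB: "Z <= B"
 show "Z' <= B'"
 proof
  fix z' assume z': "z' : Z'"
  obtain z where z: "z : Z" "f z -[W] z' : B'" using surj[OF z'] by blast
  have fz: "f z : B'" using z(1) ZB fB by blast
  have "f z -[W] (f z -[W] z') : B'" by (rule W.submodule_minus_closed[OF B' fz z(2)])
  moreover have "f z -[W] (f z -[W] z') = z'"
   using W.M.minus_eq_iff[of "f z" "f z -[W] z'" z'] W.M.add_minus_swap[of z' "f z"] z' fz Z' W.submoduleE(1)[OF B'] by auto
  ultimately show "z' : B'" by simp
 qed
next
 assume "Z' <= B'"
 then show "Z <= B" using inj fZ by blast
qed

lemma fin_gen_quot_iff:
 assumes N: "module R N" and Z: "submodule Z R N" and B: "submodule B R N" and BZ: "B <= Z"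
 shows "fin_gen_module R (quot_module (N\<lparr>carrier := Z\<rparr>) B) \<longleftrightarrow> fdq R N Z B"
proof -
 interpret N: module R N by fact
 let ?N = "N\<lparr>carrier := Z\<rparr>" and ?Q = "quot_module (N\<lparr>carrier := Z\<rparr>) B"
 have mN: "module R ?N" by (rule N.restrict_module[OF Z])
 interpret N': module R ?N by (rule mN)
 have B': "submodule B R ?N" using N.submodule_restrict_iff[OF Z] B BZ by blast
 have Q: "module R ?Q" by (rule N'.quot_module_module[OF B'])
 interpret Q: module R ?Q by (rule Q)
 let ?p = "%x. B +>\<^bsub>?N\<^esub> x"
 have p: "?p : mod_hom R ?N ?Q" by (rule N'.quot_proj_hom[OF B'])
 have psurj: "?p ` carrier ?N = carrier ?Q" by (rule N'.quot_proj_surj[OF B'])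
 have pker: "?p x = 0[?Q] \<longleftrightarrow> x : B" if "x : Z" for x using N'.quot_proj_kernel[OF B', of x] that by simp
 have gen0: "gen_submodule R ?Q (S \<union> {0[?Q]}) = gen_submodule R ?Q S" if S: "S <= carrier ?Q" for S
 proof (rule antisym)
  have "submodule (gen_submodule R ?Q S) R ?Q" by (rule Q.gen_sub[OF S])
  then show "gen_submodule R ?Q (S \<union> {0[?Q]}) <= gen_submodule R ?Q S"
   using Q.gen_incl[of S] Q.sub_zero by (intro Q.gen_submodule_minimal) auto
  show "gen_submodule R ?Q S <= gen_submodule R ?Q (S \<union> {0[?Q]})" by (rule Q.gen_submodule_mono) blast
 qed
 have "fin_gen_module R ?Q \<longleftrightarrow> fdq R ?Q (carrier ?Q) {0[?Q]}"
 proof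
  assume "fin_gen_module R ?Q"
  then obtain S where S: "S <= carrier ?Q" "finite S" "gen_submodule R ?Q S = carrier ?Q"
   unfolding fin_gen_module_def by blast
  then show "fdq R ?Q (carrier ?Q) {0[?Q]}" unfolding fdq_def using gen0[OF S(1)] by (intro exI[of _ S]) blast
 next
  assume "fdq R ?Q (carrier ?Q) {0[?Q]}"
  then obtain S where S: "S <= carrier ?Q" "finite S" "carrier ?Q <= gen_submodule R ?Q (S \<union> {0[?Q]})"
   unfolding fdq_def by blast
  then have "gen_submodule R ?Q S = carrier ?Q" using gen0[OF S(1)] Q.gen_submodule_carrier[OF S(1)] by blast
  then show "fin_gen_module R ?Q" unfolding fin_gen_module_def using Q S by blast
 qed
 also have "\<dots> \<longleftrightarrow> fdq R ?N Z B"
 proof (rule fdq_iff[OF mN Q p _ B' BZ _ Q.submodule_zero, symmetric])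
  show "submodule Z R ?N" using N'.carrier_is_submodule by simp
  show "?p ` Z <= carrier ?Q" using psurj by auto
  show "?p ` B <= {0[?Q]}" using pker BZ by blast
  show "z : B" if "z : Z" "?p z : {0[?Q]}" for z using pker that by blast
  show "\<exists>z\<in>Z. ?p z -[?Q] z' : {0[?Q]}" if z': "z' : carrier ?Q" for z'
  proof -
   have "z' : ?p ` carrier ?N" unfolding psurj by (rule z')
   then obtain z where "z : Z" "z' = ?p z" by auto
   then show ?thesis using Q.M.minus_self[OF z'] by blast
  qed
 qed (rule subset_refl)
 also have "\<dots> \<longleftrightarrow> fdq R N Z B"
 proof (rule fdq_iff[OF mN N _ _ B' BZ N.submoduleE(1)[OF Z] B, of "%x. x"])
  show "(%x. x) : mod_hom R ?N N" using N.submoduleE(1)[OF Z] by (intro mod_homI) auto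
  show "submodule Z R ?N" using N'.carrier_is_submodule by simp
  show "\<exists>z\<in>Z. z -[N] z' : B" if "z' : Z" for z'
  proof -
   have "z' -[N] z' = 0[N]" using that N.submoduleE(1)[OF Z] by auto
   then show ?thesis using that N.sub_zero[OF B] by (intro bexI[of _ z']) simp_all
  qed
 qed auto
 finally show ?thesis .
qed

section \<open>Torsion elements over an algebra of the form K + I\<close>

text \<open>Induction on the sum of exponents \<open>k z\<close> for which \<open>z^(k z)\<close>
  kills \<open>x\<close>: multiplication by one \<open>z\<close> lowers that sum by one, and an
  exponent zero means that \<open>x\<close> is zero.\<close>

lemma tors_induct [consumes 3, case_names zero step]:
 assumes M: "module R M" and zs: "set zs <= carrier R" and x: "x : tors R zs M" and z: "P 0[M]"
  and step: "!!x. x : tors R zs M ==> (!!z. z : set zs ==> P (z *[M] x)) ==> P x"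
 shows "P x"
proof -
 interpret M: module R M by fact
 have T: "submodule (tors R zs M) R M" by (rule M.tors_submodule[OF zs])
 obtain k where k: "!!z. z : set zs ==> (z [^]\<^bsub>R\<^esub> (k z :: nat)) *[M] x = 0[M]"
  using x unfolding tors_def by (simp, metis)
 have "P x" if "x : tors R zs M" "!!z. z : set zs ==> (z [^]\<^bsub>R\<^esub> (k z :: nat)) *[M] x = 0[M]" for x k
  using that
 proof (induction "\<Sum>z\<in>set zs. k z" arbitrary: x k rule: less_induct)
  case less
  have xc: "x : carrier M" by (rule tors_carrier[OF less.prems(1)])
  show "P x"
  proof (cases "\<exists>z\<in>set zs. k z = 0")
   case True
   then obtain w where "w : set zs" "k w = 0" by blast
   then have "x = 0[M]" using less.prems(2)[of w] xc by simp
   then show ?thesis using z by simp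
  next
   case False
   show ?thesis
   proof (rule step[OF less.prems(1)])
    fix w assume w: "w : set zs"
    have wR: "w : carrier R" using w zs by blast
    have kw: "k w = Suc (k w - 1)" using False w by auto
    show "P (w *[M] x)"
    proof (rule less.hyps[of "k(w := k w - 1)"])
     show "(\<Sum>z\<in>set zs. (k(w := k w - 1)) z) < (\<Sum>z\<in>set zs. k z)"
      by (rule sum_strict_mono_ex1) (use w kw in auto)
     show "w *[M] x : tors R zs M" by (rule M.submoduleE(4)[OF T wR less.prems(1)])
     fix v assume v: "v : set zs"
     have vR: "v : carrier R" using v zs by blast
     show "(v [^]\<^bsub>R\<^esub> (k(w := k w - 1)) v) *[M] (w *[M] x) = 0[M]"
     proof (cases "v = w")
      case True
      then show ?thesis using less.prems(2)[OF w] M.pow_Suc_smult[OF wR xc, of "k w - 1"] kw by simp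
     next
      case False
      then show ?thesis using less.prems(2)[OF v] M.smult_commute[of "v [^]\<^bsub>R\<^esub> k v" w x] vR wR xc by simp
     qed
    qed
   qed
  qed
 qed
 then show ?thesis using x k by blast
qed

lemma ideals_set_pow:
 "1[ideals_set R] = carrier R" "I \<otimes>[ideals_set R] J = ideal_prod R I J"
 by (simp_all add: ideals_set_def)

lemma (in ring) ideals_set_pow_ideal:
 assumes "ideal I R" shows "ideal (I [^]\<^bsub>ideals_set R\<^esub> (n::nat)) R"
 by (induction n) (simp_all add: ideals_set_pow oneideal ideal_prod_is_ideal assms)

lemma (in ring) ideals_set_pow_antimono:
 assumes "ideal I R" "n \<le> m" shows "I [^]\<^bsub>ideals_set R\<^esub> (m::nat) <= I [^]\<^bsub>ideals_set R\<^esub> n"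
 using assms(2)
proof (induction m rule: dec_induct)
 case (step m)
 have "I [^]\<^bsub>ideals_set R\<^esub> Suc m <= I [^]\<^bsub>ideals_set R\<^esub> m"
  using ideal_prod_inter[OF ideals_set_pow_ideal[OF assms(1)] assms(1)] by (auto simp: ideals_set_pow)
 then show ?case using step by blast
qed simp

text \<open>Powers of the generators lie in the powers of \<open>I\<close>, which gives one
  inclusion. For the other, if suitable powers of \<open>I\<close> kill all the products of
  \<open>x\<close> with generators, then one further factor from \<open>I\<close> kills
  \<open>x\<close>; \<open>tors_induct\<close> closes the argument.\<close>

lemma torsion_eq_tors:
 assumes M: "module R M" and zs: "set zs <= carrier R" and I: "I = gen_submodule R (ring_mod R) (set zs)"
 shows "torsion R I M = tors R zs M"
proof
 interpret M: module R M by fact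
 have RM: "module R (ring_mod R)" by (rule ring_mod_module[OF M.is_cring])
 interpret RM: module R "ring_mod R" by (rule RM)
 have idI: "ideal I R" unfolding I ideal_iff_submodule[OF M.is_cring] using zs by (intro RM.gen_sub) simp
 have zI: "set zs <= I" unfolding I by (rule RM.gen_incl)
 have IR: "I <= carrier R" using ideal.Icarr[OF idI] by blast
 show "torsion R I M <= tors R zs M"
 proof
  fix x assume "x : torsion R I M"
  then obtain n :: nat where x: "x : carrier M" "\<forall>r\<in>I [^]\<^bsub>ideals_set R\<^esub> n. r *[M] x = 0[M]" unfolding torsion_def by blast
  have "z [^]\<^bsub>R\<^esub> k : I [^]\<^bsub>ideals_set R\<^esub> k" if "z : set zs" for z and k :: nat
  proof (induction k)
   case 0
   then show ?case by (simp add: ideals_set_pow)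
  next
   case (Suc k)
   then show ?case using ideal_prod.prod[of "z [^]\<^bsub>R\<^esub> k" _ z I R] that zI by (auto simp: ideals_set_pow)
  qed
  then show "x : tors R zs M" using x unfolding tors_def by blast
 qed
 show "tors R zs M <= torsion R I M"
 proof
  fix x assume x: "x : tors R zs M"
  have "\<exists>n::nat. \<forall>r\<in>I [^]\<^bsub>ideals_set R\<^esub> n. r *[M] x = 0[M]"
   using M zs x
  proof (induction rule: tors_induct)
   case zero
   show ?case by (rule exI[of _ 0]) (simp add: ideals_set_pow)
  next
   case (step x)
   have xc: "x : carrier M" by (rule tors_carrier[OF step(1)])
   obtain n where n: "!!z. z : set zs ==> \<forall>r\<in>I [^]\<^bsub>ideals_set R\<^esub> (n z :: nat). r *[M] (z *[M] x) = 0[M]"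
    using step(2) by metis
   \<comment> \<open>The sum serves as a common upper bound of the exponents
     \<open>n z\<close>.\<close>
   define m where "m = (\<Sum>z\<in>set zs. n z)"
   let ?Im = "I [^]\<^bsub>ideals_set R\<^esub> m"
   have Im: "ideal ?Im R" by (rule M.ideals_set_pow_ideal[OF idI])
   have key: "j *[M] (i *[M] x) = 0[M]" if j: "j : ?Im" and i: "i : I" for i j
   proof -
    have jR: "j : carrier R" using ideal.Icarr[OF Im j] .
    have zsR: "set zs <= carrier (ring_mod R)" using zs by simp
    show ?thesis
    proof (rule gen_submodule_induct[OF i[unfolded I] RM zsR], goal_cases)
     case 1 show ?case using jR xc by simp
    next
     case (2 z)
     have "n z \<le> m" unfolding m_def using 2 by (intro member_le_sum) auto
     then show ?case using n[OF 2] M.ideals_set_pow_antimono[OF idI] j by blast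
    next
     case (3 a b)
     then show ?case using jR xc by (simp add: M.smult_l_distr M.smult_r_distr)
    next
     case (4 r a)
     then have "j *[M] (r \<otimes>[R] a *[M] x) = r *[M] (j *[M] (a *[M] x))"
      using jR xc by (simp add: M.smult_assoc1 M.smult_commute[of j r])
     then show ?case using 4 by simp
    qed
   qed
   have "r *[M] x = 0[M]" if "r : ideal_prod R ?Im I" for r
    using that
   proof induction
    case (prod i j)
    then show ?case using key[OF prod] ideal.Icarr[OF Im] IR xc by (simp add: M.smult_assoc1 subset_eq)
   next
    case (sum a b)
    have "a : carrier R" "b : carrier R" using M.ideal_prod_in_carrier[OF Im idI] sum by auto
    then show ?case using sum xc by (simp add: M.smult_l_distr)
   qed
   then show ?case by (intro exI[of _ "Suc m"]) (simp add: ideals_set_pow)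
  qed
  then show "x : torsion R I M" unfolding torsion_def using tors_carrier[OF x] by blast
 qed
qed

text \<open>Since \<open>R = K + I\<close>, every torsion element generates a finite-dimensional submodule.\<close>

lemma tors_cyclic_fd:
 assumes M: "module R M" and K: "cring K" and \<iota>: "\<iota> : ring_hom K R" and zs: "set zs <= carrier R"
  and res: "!!r. r : carrier R ==> \<exists>c\<in>carrier K. r -[R] \<iota> c : gen_submodule R (ring_mod R) (set zs)"
  and x: "x : tors R zs M"
 shows "\<exists>F. finite F \<and> F <= (%r. r *[M] x) ` carrier R \<and> (\<forall>r\<in>carrier R. r *[M] x : gen_submodule K (kmod \<iota> M) F)"
proof -
 interpret M: module R M by fact
 have RM: "module R (ring_mod R)" by (rule ring_mod_module[OF M.is_cring])
 interpret RM: module R "ring_mod R" by (rule RM)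
 interpret V: module K "kmod \<iota> M" by (rule kmod_module[OF K \<iota> M])
 show ?thesis
  using M zs x
 proof (induction rule: tors_induct)
  case zero
  have "submodule (gen_submodule K (kmod \<iota> M) {}) K (kmod \<iota> M)" by (rule V.gen_sub) simp
  from V.sub_zero[OF this] show ?case by (intro exI[of _ "{}"]) simp
 next
  case (step x)
  have xc: "x : carrier M" by (rule tors_carrier[OF step(1)])
  obtain F where F: "!!z. z : set zs ==> finite (F z) \<and> F z <= (%r. r *[M] (z *[M] x)) ` carrier R \<and>
    (\<forall>r\<in>carrier R. r *[M] (z *[M] x) : gen_submodule K (kmod \<iota> M) (F z))" using step(2) by metis
  define G where "G = insert x (\<Union>z\<in>set zs. F z)"
  have G1: "finite G" unfolding G_def using F by auto
  have Fx: "F z <= (%r. r *[M] x) ` carrier R" if z: "z : set zs" for z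
  proof
   fix y assume "y : F z"
   then obtain r where r: "r : carrier R" "y = r *[M] (z *[M] x)" using F[OF z] by blast
   have zR: "z : carrier R" using z zs by blast
   have "y = (r \<otimes>[R] z) *[M] x" using r zR xc by (simp add: M.smult_assoc1)
   then show "y : (%r. r *[M] x) ` carrier R" using r zR by blast
  qed
  have "x : (%r. r *[M] x) ` carrier R" using M.smult_one[OF xc] M.one_closed by (metis image_eqI)
  then have G2: "G <= (%r. r *[M] x) ` carrier R" unfolding G_def using Fx by blast
  have Gc: "G <= carrier (kmod \<iota> M)" using G2 xc by auto
  let ?H = "gen_submodule K (kmod \<iota> M) G"
  have H: "submodule ?H K (kmod \<iota> M)" by (rule V.gen_sub[OF Gc])
  have ix: "r *[M] (i *[M] x) : ?H" if i: "i : gen_submodule R (ring_mod R) (set zs)" and "r : carrier R" for i r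
  proof -
   have zsR: "set zs <= carrier (ring_mod R)" using zs by simp
   have "\<forall>r\<in>carrier R. r *[M] (i *[M] x) : ?H"
   proof (rule gen_submodule_induct[OF i RM zsR], goal_cases)
    case 1 show ?case using xc V.sub_zero[OF H] by simp
   next
    case (2 z)
    then have "gen_submodule K (kmod \<iota> M) (F z) <= ?H" unfolding G_def by (intro V.gen_submodule_mono) blast
    then show ?case using F[OF 2] by blast
   next
    case (3 a b)
    then show ?case using xc V.submoduleE(5)[OF H] by (simp add: M.smult_l_distr M.smult_r_distr)
   next
    case (4 s a)
    show ?case
    proof
     fix r assume r: "r : carrier R"
     have "r *[M] (s *[ring_mod R] a *[M] x) = (r \<otimes>[R] s) *[M] (a *[M] x)"
      using 4 xc r by (simp add: M.smult_assoc1)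
     then show "r *[M] (s *[ring_mod R] a *[M] x) : ?H" using 4 r by simp
    qed
   qed
   then show ?thesis using that by blast
  qed
  have "r *[M] x : ?H" if r: "r : carrier R" for r
  proof -
   obtain c where c: "c : carrier K" "r -[R] \<iota> c : gen_submodule R (ring_mod R) (set zs)" using res[OF r] by blast
   have \<iota>c: "\<iota> c : carrier R" using ring_hom_closed[OF \<iota> c(1)] .
   have "r = (r -[R] \<iota> c) +[R] \<iota> c" using r \<iota>c by (simp add: M.R.minus_add_cancel)
   then have e: "r *[M] x = (r -[R] \<iota> c) *[M] x +[M] \<iota> c *[M] x"
    using M.smult_l_distr[of "r -[R] \<iota> c" "\<iota> c" x] r \<iota>c xc by simp
   have "(r -[R] \<iota> c) *[M] x : ?H" using ix[OF c(2), of "1[R]"] r \<iota>c xc by simp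
   moreover have "x : ?H" using V.gen_incl[of G] unfolding G_def by blast
   then have "\<iota> c *[M] x : ?H" using V.submoduleE(4)[OF H c(1), of x] by simp
   ultimately show ?thesis unfolding e using V.submoduleE(5)[OF H] by simp
  qed
  then show ?case using G1 G2 by blast
 qed
qed

text \<open>Each of the finitely many \<open>R\<close>-generators \<open>s\<close> of
  \<open>Z\<close> modulo \<open>B\<close> is torsion, so \<open>R s\<close> has a finite spanning
  set over \<open>K\<close>, taken inside \<open>Z\<close>. The union of these sets generates
  \<open>Z\<close> modulo \<open>B\<close> over \<open>K\<close>.\<close>

lemma fdq_tors_iff:
 assumes M: "module R M" and K: "cring K" and \<iota>: "\<iota> : ring_hom K R" and zs: "set zs <= carrier R"
  and res: "!!r. r : carrier R ==> \<exists>c\<in>carrier K. r -[R] \<iota> c : gen_submodule R (ring_mod R) (set zs)"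
  and Z: "submodule Z R M" "Z <= tors R zs M" and B: "submodule B R M" "B <= Z"
 shows "fdq R M Z B \<longleftrightarrow> fdq K (kmod \<iota> M) Z B"
proof
 interpret M: module R M by fact
 have mV: "module K (kmod \<iota> M)" by (rule kmod_module[OF K \<iota> M])
 interpret V: module K "kmod \<iota> M" by (rule mV)
 have ZM: "Z <= carrier M" by (rule M.submoduleE(1)[OF Z(1)])
 {
  assume "fdq K (kmod \<iota> M) Z B"
  then obtain S where S: "finite S" "S <= Z" "Z <= gen_submodule K (kmod \<iota> M) (S \<union> B)" unfolding fdq_def by blast
  have "S \<union> B <= carrier M" using S(2) B(2) ZM by blast
  then have "submodule (gen_submodule R M (S \<union> B)) R M" by (rule M.gen_sub)
  from submodule_kmod[OF K \<iota> M this]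
  have "gen_submodule K (kmod \<iota> M) (S \<union> B) <= gen_submodule R M (S \<union> B)"
   by (rule V.gen_submodule_minimal) (rule M.gen_incl)
  then show "fdq R M Z B" unfolding fdq_def using S by blast
 }
 assume "fdq R M Z B"
 then obtain S where S: "finite S" "S <= Z" "Z <= gen_submodule R M (S \<union> B)" unfolding fdq_def by blast
 have "\<forall>s\<in>S. \<exists>F. finite F \<and> F <= (%r. r *[M] s) ` carrier R \<and> (\<forall>r\<in>carrier R. r *[M] s : gen_submodule K (kmod \<iota> M) F)"
  using tors_cyclic_fd[OF M K \<iota> zs res] S(2) Z(2) by blast
 then obtain F where F: "!!s. s : S ==> finite (F s) \<and> F s <= (%r. r *[M] s) ` carrier R \<and>
   (\<forall>r\<in>carrier R. r *[M] s : gen_submodule K (kmod \<iota> M) (F s))" by metis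
 define T where "T = (\<Union>s\<in>S. F s)"
 have T1: "finite T" unfolding T_def using F S(1) by auto
 have T2: "T <= Z"
 proof
  fix t assume "t : T"
  then obtain s r where "s : S" "r : carrier R" "t = r *[M] s" unfolding T_def using F by blast
  then show "t : Z" using M.submoduleE(4)[OF Z(1)] S(2) by blast
 qed
 have TB: "T \<union> B <= carrier (kmod \<iota> M)" using T2 B(2) ZM by auto
 let ?H = "gen_submodule K (kmod \<iota> M) (T \<union> B)"
 have H: "submodule ?H K (kmod \<iota> M)" by (rule V.gen_sub[OF TB])
 have SB: "S \<union> B <= carrier M" using S(2) B(2) ZM by blast
 have "Z <= ?H"
 proof
  fix z assume z: "z : Z"
  then have zg: "z : gen_submodule R M (S \<union> B)" using S(3) by blast
  have "\<forall>r\<in>carrier R. r *[M] z : ?H"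
  proof (rule gen_submodule_induct[OF zg M SB], goal_cases)
   case 1 show ?case using V.sub_zero[OF H] by simp
  next
   case (2 s)
   show ?case
   proof
    fix r assume r: "r : carrier R"
    show "r *[M] s : ?H"
    proof (cases "s : S")
     case True
     then have "gen_submodule K (kmod \<iota> M) (F s) <= ?H" unfolding T_def by (intro V.gen_submodule_mono) blast
     then show ?thesis using F[OF True] r by blast
    next
     case False
     then have "r *[M] s : B" using 2 M.submoduleE(4)[OF B(1) r] by blast
     then show ?thesis using V.gen_incl[of "T \<union> B"] by blast
    qed
   qed
  next
   case (3 a b) then show ?case using V.submoduleE(5)[OF H] by (simp add: M.smult_r_distr)
  next
   case (4 s a) then show ?case by (simp add: M.smult_assoc1[symmetric])
  qed
  then have "1[R] *[M] z : ?H" by blast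
  then show "z : ?H" using z ZM by auto
 qed
 then show "fdq K (kmod \<iota> M) Z B" unfolding fdq_def using T1 T2 by blast
qed

definition tors_cocycles :: "('a, 'r) ring_scheme => 'a list => (nat => ('a, 'm, 'x) module_scheme) => (nat => 'm => 'm) => nat => 'm set"
 where "tors_cocycles R zs E d n = {x : tors R zs (E n). d n x = 0[E (Suc n)]}"

definition tors_bdry :: "('a, 'r) ring_scheme => 'a list => (nat => ('a, 'm, 'x) module_scheme) => (nat => 'm => 'm) => nat => 'm set"
 where "tors_bdry R zs E d n = bdry E d (%n. tors R zs (E n)) n"

lemma (in module) submodule_inter:
 assumes "submodule G R M" "submodule H R M" shows "submodule (G \<inter> H) R M"
 using submoduleE(1,4,5)[OF assms(1)] submoduleE(1,4,5)[OF assms(2)]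
  sub_zero[OF assms(1)] sub_zero[OF assms(2)]
 by (intro submoduleI') auto

lemma tors_cocycles_submodule:
 assumes c: "cplx R E d" and zs: "set zs <= carrier R"
 shows "submodule (tors_cocycles R zs E d n) R (E n)"
  and "submodule (tors_bdry R zs E d n) R (E n)"
  and "tors_bdry R zs E d n <= tors_cocycles R zs E d n"
  and "tors_cocycles R zs E d n <= tors R zs (E n)"
proof -
 note m = cplxD(1)[OF c] and d = cplxD(2)[OF c] and dd = cplxD(3)[OF c]
 interpret E: module R "E n" by (rule m)
 have T: "submodule (tors R zs (E n)) R (E n)" for n by (rule module.tors_submodule[OF m zs])
 have "tors_cocycles R zs E d n = tors R zs (E n) \<inter> {x : carrier (E n). d n x = 0[E (Suc n)]}"
  unfolding tors_cocycles_def by (auto intro: tors_carrier)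
 then show "submodule (tors_cocycles R zs E d n) R (E n)"
  using E.submodule_inter[OF T submodule_mod_hom_kernel[OF d m m]] by simp
 show "tors_cocycles R zs E d n <= tors R zs (E n)" unfolding tors_cocycles_def by blast
 show "submodule (tors_bdry R zs E d n) R (E n)"
 proof (cases n)
  case 0
  then show ?thesis unfolding tors_bdry_def using E.submodule_zero by simp
 next
  case (Suc k)
  then show ?thesis unfolding tors_bdry_def using submodule_mod_hom_image[OF d m m T, of k] by simp
 qed
 show "tors_bdry R zs E d n <= tors_cocycles R zs E d n"
 proof (cases n)
  case 0
  then show ?thesis unfolding tors_bdry_def tors_cocycles_def
   using E.sub_zero[OF T] mod_hom_zero[OF d m m, of 0] by simp
 next
  case (Suc k)
  have "d k x : tors R zs (E (Suc k))" if "x : tors R zs (E k)" for x by (rule tors_mod_hom[OF d m m zs that])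
  then show ?thesis unfolding tors_bdry_def tors_cocycles_def Suc using dd[OF tors_carrier] by auto
 qed
qed

lemma injective_resolution_cplx:
 assumes "injective_resolution R M \<eta> E d"
 shows "cplx R E d" "baer R (E n)" "x : carrier (E (Suc n)) ==> d (Suc n) x = 0[E (Suc (Suc n))] ==> \<exists>y\<in>carrier (E n). d n y = x"
proof -
 note r = assms[unfolded injective_resolution_iff]
 have i: "injective_module R (E n)" for n using r by blast
 have im: "d n ` carrier (E n) = {x : carrier (E (Suc n)). d (Suc n) x = 0[E (Suc (Suc n))]}" for n using r by blast
 show "cplx R E d" unfolding cplx_def
 proof (intro allI conjI ballI)
  show "module R (E n)" for n using i[of n] unfolding injective_module_def by blast
  show "d n : mod_hom R (E n) (E (Suc n))" for n using r by blast
  show "d (Suc n) (d n x) = 0[E (Suc (Suc n))]" if "x : carrier (E n)" for n x using im[of n] that by blast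
 qed
 show "baer R (E n)" by (rule injective_imp_baer[OF i])
 show "\<exists>y\<in>carrier (E n). d n y = x" if "x : carrier (E (Suc n))" "d (Suc n) x = 0[E (Suc (Suc n))]"
 proof -
  have "x : d n ` carrier (E n)" unfolding im using that by simp
  then show ?thesis by auto
 qed
qed

text \<open>From here on local cohomology enters only as cocycles and boundaries of the torsion part
  of the chosen resolution, seen as vector spaces over \<open>K\<close>.\<close>

lemma local_cohomology_fin_gen_iff:
 assumes K: "field K" and \<iota>: "\<iota> : ring_hom K R" and N: "noetherian_ring R" and M: "module R M"
  and zs: "set zs <= carrier R" and I: "I = gen_submodule R (ring_mod R) (set zs)"
  and res: "!!r. r : carrier R ==> \<exists>c\<in>carrier K. r -[R] \<iota> c : I"
  and ch: "chosen_resolution R M = (E, d)"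
 shows "fin_gen_module R (local_cohomology R I M i) \<longleftrightarrow>
  fdq K (kmod \<iota> (E i)) (tors_cocycles R zs E d i) (tors_bdry R zs E d i)"
proof -
 obtain \<eta> where "injective_resolution R M \<eta> E d" using chosen_resolution_injective[OF K \<iota> N M ch] by blast
 note c = injective_resolution_cplx(1)[OF this]
 have m: "module R (E n)" for n by (rule cplxD(1)[OF c])
 have T: "torsion R I (E n) = tors R zs (E n)" for n by (rule torsion_eq_tors[OF m zs I])
 have "local_cohomology R I M i = quot_module ((E i)\<lparr>carrier := tors_cocycles R zs E d i\<rparr>) (tors_bdry R zs E d i)"
  unfolding local_cohomology_def ch Let_def prod.case T tors_cocycles_def tors_bdry_def bdry_def ..
 then have "fin_gen_module R (local_cohomology R I M i) \<longleftrightarrow> fdq R (E i) (tors_cocycles R zs E d i) (tors_bdry R zs E d i)"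
  using fin_gen_quot_iff[OF m tors_cocycles_submodule(1,2,3)[OF c zs]] by simp
 moreover have K': "cring K" using K by (simp add: field_def domain_def)
 ultimately show ?thesis
  using fdq_tors_iff[OF m K' \<iota> zs _ tors_cocycles_submodule(1,4,2,3)[OF c zs]] res I by blast
qed

section \<open>Noetherian and local rings: finite generation, regular elements, Nakayama\<close>

lemma (in noetherian_ring) ideal_family_maximal:
 assumes "\<A> \<noteq> {}" "!!I. I : \<A> ==> ideal I R"
 shows "\<exists>P\<in>\<A>. \<forall>Q\<in>\<A>. P <= Q --> Q = P"
proof (rule subset_Zorn_nonempty[OF assms(1)])
 fix \<C> assume C: "\<C> \<noteq> {}" "subset.chain \<A> \<C>"
 then have "subset.chain {I. ideal I R} \<C>" using assms(2) unfolding subset_chain_def by blast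
 then have "\<Union>\<C> : \<C>" by (rule ideal_chain_is_trivial[OF C(1)])
 then show "\<Union>\<C> : \<A>" using C(2) unfolding subset_chain_def by blast
qed

text \<open>If \<open>1 - x\<close> had no inverse, an ideal maximal among the proper ideals
  containing it would be \<open>m\<close>; then \<open>m\<close> would contain both \<open>x\<close>
  and \<open>1 - x\<close>.\<close>

lemma local_ring_unit:
 assumes N: "noetherian_ring R" and L: "local_ring R m" and x: "x : m"
 shows "\<exists>u\<in>carrier R. u \<otimes>[R] (1[R] -[R] x) = 1[R]"
proof (rule ccontr)
 interpret R: cring R using L unfolding local_ring_def by blast
 interpret N: noetherian_ring R by fact
 interpret m: maximalideal m R using L unfolding local_ring_def by blast
 assume no: "\<not> ?thesis"
 have xR: "x : carrier R" using m.Icarr[OF x] .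
 let ?a = "1[R] -[R] x"
 have aR: "?a : carrier R" using xR by simp
 let ?J = "PIdl\<^bsub>R\<^esub> ?a"
 have J: "ideal ?J R" by (rule R.cgenideal_ideal[OF aR])
 have J1: "1[R] \<notin> ?J"
 proof
  assume "1[R] : ?J"
  then obtain u where "u : carrier R" "u \<otimes>[R] ?a = 1[R]" unfolding cgenideal_def by force
  then show False using no by blast
 qed
 let ?\<A> = "{I. ideal I R \<and> 1[R] \<notin> I \<and> ?J <= I}"
 have "\<exists>P\<in>?\<A>. \<forall>Q\<in>?\<A>. P <= Q --> Q = P"
  by (rule N.ideal_family_maximal) (use J J1 in auto)
 then obtain P where P: "ideal P R" "1[R] \<notin> P" "?J <= P" and mx: "!!Q. Q : ?\<A> ==> P <= Q ==> Q = P" by auto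
 have "maximalideal P R"
 proof (rule maximalidealI[OF P(1)])
  show "carrier R \<noteq> P" using P(2) R.one_closed by blast
  fix Q assume Q: "ideal Q R" "P <= Q" "Q <= carrier R"
  show "Q = P \<or> Q = carrier R"
  proof (cases "1[R] : Q")
   case True
   then show ?thesis using ideal.one_imp_carrier[OF Q(1)] by blast
  next
   case False
   then have "Q : ?\<A>" using Q P(3) by blast
   then show ?thesis using mx Q(2) by blast
  qed
 qed
 then have Pm: "P = m" using L unfolding local_ring_def by blast
 have "?a : m" using R.cgenideal_self[OF aR] P(3) Pm by blast
 then have "?a +[R] x : m" using x m.a_closed by blast
 then have "1[R] : m" using R.minus_add_cancel[OF R.one_closed xR] by simp
 then show False using P(2) Pm by blast
qed

lemma gen_finite_support:
 assumes M: "module R M" and S: "S <= carrier M" and x: "x : gen_submodule R M S"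
 shows "\<exists>F. finite F \<and> F <= S \<and> x : gen_submodule R M F"
proof -
 interpret M: module R M by fact
 have sub: "submodule (gen_submodule R M F) R M" if "F <= S" for F
  by (rule M.gen_sub) (use that S in blast)
 show ?thesis
 proof (rule gen_submodule_induct[OF x M S], goal_cases)
  case 1 show ?case using M.sub_zero[OF sub[of "{}"]] by (intro exI[of _ "{}"]) simp
 next
  case (2 s) then show ?case using M.gen_incl[of "{s}"] by (intro exI[of _ "{s}"]) simp
 next
  case (3 x y)
  then obtain F G where FG: "finite F" "F <= S" "x : gen_submodule R M F" "finite G" "G <= S" "y : gen_submodule R M G" by (elim exE conjE)
  then have "x : gen_submodule R M (F \<union> G)" "y : gen_submodule R M (F \<union> G)"
   using M.gen_submodule_mono[of F "F \<union> G"] M.gen_submodule_mono[of G "F \<union> G"] by auto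
  moreover have "F \<union> G <= S" using FG by blast
  ultimately show ?case using M.submoduleE(5)[OF sub[of "F \<union> G"]] FG by (intro exI[of _ "F \<union> G"]) simp
 next
  case (4 r x)
  then obtain F where "finite F" "F <= S" "x : gen_submodule R M F" by (elim exE conjE)
  then show ?case using M.submoduleE(4)[OF sub[of F] 4(1)] by (intro exI[of _ F]) simp
 qed
qed

lemma gen_insert:
 assumes M: "module R M" and S: "S <= carrier M" and g: "g : carrier M" and x: "x : gen_submodule R M (insert g S)"
 shows "\<exists>r\<in>carrier R. x -[M] r *[M] g : gen_submodule R M S"
proof -
 interpret M: module R M by fact
 have G: "submodule (gen_submodule R M S) R M" by (rule M.gen_sub[OF S])
 have gS: "insert g S <= carrier M" using g S by blast
 show ?thesis
 proof (rule gen_submodule_induct[OF x M gS], goal_cases)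
  case 1 show ?case using M.sub_zero[OF G] g by (intro bexI[of _ "0[R]"]) simp_all
 next
  case (2 s)
  show ?case
  proof (cases "s = g")
   case True then show ?thesis using M.sub_zero[OF G] g by (intro bexI[of _ "1[R]"]) simp_all
  next
   case False
   then have "s : S" using 2 by blast
   moreover from this have "s : carrier M" using S by blast
   ultimately show ?thesis using M.gen_incl[of S] g by (intro bexI[of _ "0[R]"]) auto
  qed
 next
  case (3 x y)
  then obtain r s where rs: "r : carrier R" "x -[M] r *[M] g : gen_submodule R M S" "s : carrier R" "y -[M] s *[M] g : gen_submodule R M S"
   by (elim bexE)
  have "(x +[M] y) -[M] (r +[R] s) *[M] g = (x -[M] r *[M] g) +[M] (y -[M] s *[M] g)"
   using 3(1,2) rs g by (simp add: M.smult_l_distr M.M.minus_add_minus)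
  then show ?case using M.submoduleE(5)[OF G rs(2,4)] rs by (intro bexI[of _ "r +[R] s"]) simp_all
 next
  case (4 a x)
  then obtain r where r: "r : carrier R" "x -[M] r *[M] g : gen_submodule R M S" by (elim bexE)
  have "a *[M] x -[M] (a \<otimes>[R] r) *[M] g = a *[M] (x -[M] r *[M] g)"
   using 4(1,2) r g by (simp add: M.smult_assoc1 M.smult_minus)
  then show ?case using M.submoduleE(4)[OF G 4(1) r(2)] r 4 by (intro bexI[of _ "a \<otimes>[R] r"]) simp_all
 qed
qed

lemma genideal_eq_gen_submodule: "cring R ==> Idl\<^bsub>R\<^esub> S = gen_submodule R (ring_mod R) S"
 unfolding genideal_def gen_submodule_def by (simp add: ideal_iff_submodule)

text \<open>Induction on the number of generators. The coefficients of \<open>g\<close> in elements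
  of \<open>H\<close>, modulo the span of \<open>S\<close>, form an ideal \<open>J\<close>. Elements
  of \<open>H\<close> realizing generators of \<open>J\<close>, together with generators of the part
  of \<open>H\<close> in the span of \<open>S\<close>, generate \<open>H\<close>.\<close>

lemma submodule_finitely_generated:
 assumes N: "noetherian_ring R" and M: "module R M" and "finite S" "S <= carrier M"
  and H: "submodule H R M" "H <= gen_submodule R M S"
 shows "\<exists>F. finite F \<and> F <= H \<and> H <= gen_submodule R M F"
 using assms(3-)
proof (induction S arbitrary: H rule: finite_induct)
 case empty
 then show ?case by blast
next
 case (insert g S)
 interpret M: module R M by fact
 interpret N: noetherian_ring R by fact
 have RM: "module R (ring_mod R)" by (rule ring_mod_module[OF M.is_cring])
 interpret RM: module R "ring_mod R" by (rule RM)
 have g: "g : carrier M" and S: "S <= carrier M" using insert.prems(1) by auto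
 have G: "submodule (gen_submodule R M S) R M" by (rule M.gen_sub[OF S])
 have H: "submodule H R M" by (rule insert.prems(2))
 have Hc: "H <= carrier M" by (rule M.submoduleE(1)[OF H])
 define J where "J = {r : carrier R. \<exists>h\<in>H. h -[M] r *[M] g : gen_submodule R M S}"
 have "submodule J R (ring_mod R)"
 proof (rule RM.submoduleI', goal_cases)
  case 1 show ?case unfolding J_def by auto
 next
  case 2 show ?case unfolding J_def using M.sub_zero[OF H] M.sub_zero[OF G] g
   by (auto intro!: bexI[of _ "0[M]"])
 next
  case (3 a b)
  then obtain h k where hk: "a : carrier R" "b : carrier R" "h : H" "k : H" "h -[M] a *[M] g : gen_submodule R M S"
   "k -[M] b *[M] g : gen_submodule R M S" unfolding J_def by blast
  have "h : carrier M" "k : carrier M" using hk Hc by auto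
  then have "(h +[M] k) -[M] (a +[R] b) *[M] g = (h -[M] a *[M] g) +[M] (k -[M] b *[M] g)"
   using hk(1,2) g by (simp add: M.smult_l_distr M.M.minus_add_minus)
  then show ?case unfolding J_def using M.submoduleE(5)[OF G hk(5,6)] M.submoduleE(5)[OF H hk(3,4)] hk(1,2)
   by (auto intro!: bexI[of _ "h +[M] k"])
 next
  case (4 a b)
  then obtain h where h: "b : carrier R" "h : H" "h -[M] b *[M] g : gen_submodule R M S" unfolding J_def by blast
  have "h : carrier M" using h Hc by auto
  then have "a *[M] h -[M] (a \<otimes>[R] b) *[M] g = a *[M] (h -[M] b *[M] g)"
   using 4(1) h(1) g by (simp add: M.smult_assoc1 M.smult_minus)
  then show ?case unfolding J_def using M.submoduleE(4)[OF G 4(1) h(3)] M.submoduleE(4)[OF H 4(1) h(2)] h(1) 4(1)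
   by (auto intro!: bexI[of _ "a *[M] h"])
 qed
 then have J: "ideal J R" using ideal_iff_submodule[OF M.is_cring] by blast
 obtain A where A: "A <= carrier R" "finite A" "J = gen_submodule R (ring_mod R) A"
  using N.finetely_gen[OF J] genideal_eq_gen_submodule[OF M.is_cring] by metis
 have "\<forall>a\<in>A. \<exists>h\<in>H. h -[M] a *[M] g : gen_submodule R M S"
  using RM.gen_incl[of A] unfolding A(3)[symmetric] J_def by blast
 then obtain h where h: "!!a. a : A ==> h a : H \<and> h a -[M] a *[M] g : gen_submodule R M S" by metis
 have hA: "h ` A <= H" using h by blast
 then have hAc: "h ` A <= carrier M" using Hc by blast
 have K: "submodule (gen_submodule R M (h ` A)) R M" by (rule M.gen_sub[OF hAc])
 have Kc: "gen_submodule R M (h ` A) <= carrier M" by (rule M.submoduleE(1)[OF K])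
 have KH: "gen_submodule R M (h ` A) <= H" by (rule M.gen_submodule_minimal[OF H hA])
 have key: "\<exists>k\<in>gen_submodule R M (h ` A). k -[M] r *[M] g : gen_submodule R M S" if r: "r : gen_submodule R (ring_mod R) A" for r
 proof -
  have Ac: "A <= carrier (ring_mod R)" using A by simp
  show ?thesis
  proof (rule gen_submodule_induct[OF r RM Ac], goal_cases)
   case 1 show ?case using M.sub_zero[OF K] M.sub_zero[OF G] g by (intro bexI[of _ "0[M]"]) simp_all
  next
   case (2 s) then show ?case using h M.gen_incl[of "h ` A"] by blast
  next
   case (3 x y)
   then obtain k l where kl: "k : gen_submodule R M (h ` A)" "k -[M] x *[M] g : gen_submodule R M S"
    "l : gen_submodule R M (h ` A)" "l -[M] y *[M] g : gen_submodule R M S" by (elim bexE)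
   have "k : carrier M" "l : carrier M" using kl Kc by auto
   then have "(k +[M] l) -[M] (x +[R] y) *[M] g = (k -[M] x *[M] g) +[M] (l -[M] y *[M] g)"
    using 3(1,2) g by (simp add: M.smult_l_distr M.M.minus_add_minus)
   then show ?case using M.submoduleE(5)[OF G kl(2,4)] M.submoduleE(5)[OF K kl(1,3)] by (intro bexI[of _ "k +[M] l"]) simp_all
  next
   case (4 a x)
   then obtain k where k: "k : gen_submodule R M (h ` A)" "k -[M] x *[M] g : gen_submodule R M S" by (elim bexE)
   have "k : carrier M" using k Kc by auto
   then have "a *[M] k -[M] (a \<otimes>[R] x) *[M] g = a *[M] (k -[M] x *[M] g)"
    using 4(1,2) g by (simp add: M.smult_assoc1 M.smult_minus)
   then show ?case using M.submoduleE(4)[OF G 4(1) k(2)] M.submoduleE(4)[OF K 4(1) k(1)] by (intro bexI[of _ "a *[M] k"]) simp_all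
  qed
 qed
 have H': "submodule (H \<inter> gen_submodule R M S) R M" by (rule M.submodule_inter[OF H G])
 from insert.IH[OF S H']
 obtain F where F: "finite F" "F <= H \<inter> gen_submodule R M S" "H \<inter> gen_submodule R M S <= gen_submodule R M F" by auto
 let ?F = "F \<union> h ` A"
 have Fc: "?F <= carrier M" using F(2) hA Hc by blast
 have FF: "submodule (gen_submodule R M ?F) R M" by (rule M.gen_sub[OF Fc])
 have "H <= gen_submodule R M ?F"
 proof
  fix x assume x: "x : H"
  then have "x : gen_submodule R M (insert g S)" using insert.prems(3) by blast
  then obtain r where r: "r : carrier R" "x -[M] r *[M] g : gen_submodule R M S" using gen_insert[OF M S g] by blast
  then have "r : J" unfolding J_def using x by blast
  then obtain k where k: "k : gen_submodule R M (h ` A)" "k -[M] r *[M] g : gen_submodule R M S" using key A(3) by blast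
  have c: "x : carrier M" "k : carrier M" "r *[M] g : carrier M" using x k Kc Hc r g by auto
  have "(x -[M] r *[M] g) -[M] (k -[M] r *[M] g) : gen_submodule R M S"
   by (rule M.submodule_minus_closed[OF G r(2) k(2)])
  moreover have "(x -[M] r *[M] g) -[M] (k -[M] r *[M] g) = x -[M] k"
   using c by (simp add: M.M.minus_eq M.M.minus_add M.M.a_ac M.M.r_neg M.M.r_neg1 M.M.r_neg2)
  moreover have "x -[M] k : H" using M.submodule_minus_closed[OF H x] k(1) KH by blast
  ultimately have "x -[M] k : gen_submodule R M F" using F(3) by auto
  then have 1: "x -[M] k : gen_submodule R M ?F" using M.gen_submodule_mono[of F ?F] by blast
  have 2: "k : gen_submodule R M ?F" using k(1) M.gen_submodule_mono[of "h ` A" ?F] by blast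
  have "(x -[M] k) +[M] k : gen_submodule R M ?F" by (rule M.submoduleE(5)[OF FF 1 2])
  then show "x : gen_submodule R M ?F" using M.M.minus_add_cancel[OF c(1,2)] by simp
 qed
 moreover have "finite ?F" "?F <= H" using F A hA by auto
 ultimately show ?case by blast
qed

text \<open>The maximal annihilators of nonzero elements form a finite set of primes covering the zero divisors,
 so the element is found by prime avoidance.\<close>

lemma regular_element_exists:
 assumes N: "noetherian_ring R" and fg: "fin_gen_module R Q" and m: "ideal m R"
  and soc: "!!q. q : carrier Q ==> (!!r. r : m ==> r *[Q] q = 0[Q]) ==> q = 0[Q]"
 shows "\<exists>x\<in>m. \<forall>q\<in>carrier Q. x *[Q] q = 0[Q] --> q = 0[Q]"
proof -
 interpret N: noetherian_ring R by fact
 have Q: "module R Q" using fg unfolding fin_gen_module_def by blast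
 interpret Q: module R Q by (rule Q)
 define \<A> where "\<A> = {ann_ideal R Q q | q. q : carrier Q \<and> q \<noteq> 0[Q]}"
 define \<M> where "\<M> = {P : \<A>. \<forall>P'\<in>\<A>. P <= P' --> P' = P}"
 have idA: "!!P. P : \<A> ==> ideal P R" unfolding \<A>_def using Q.ann_ideal_ideal by blast
 have above: "\<exists>P\<in>\<M>. ann_ideal R Q q <= P" if q: "q : carrier Q" "q \<noteq> 0[Q]" for q
 proof -
  let ?B = "{P : \<A>. ann_ideal R Q q <= P}"
  have "\<exists>P\<in>?B. \<forall>P'\<in>?B. P <= P' --> P' = P"
   by (rule N.ideal_family_maximal) (use q idA in \<open>auto simp: \<A>_def\<close>)
  then obtain P where P: "P : \<A>" "ann_ideal R Q q <= P" "\<forall>P'\<in>?B. P <= P' --> P' = P" by auto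
  then have "P : \<M>" unfolding \<M>_def by blast
  then show ?thesis using P(2) by blast
 qed
 have idM: "!!P. P : \<M> ==> ideal P R" using idA unfolding \<M>_def by blast
 have "\<forall>P\<in>\<M>. \<exists>q. q : carrier Q \<and> q \<noteq> 0[Q] \<and> P = ann_ideal R Q q" unfolding \<M>_def \<A>_def by blast
 then obtain w where w: "!!P. P : \<M> ==> w P : carrier Q \<and> w P \<noteq> 0[Q] \<and> P = ann_ideal R Q (w P)" by metis
 have annD: "r : carrier R ==> r *[Q] w P = 0[Q] \<longleftrightarrow> r : P" if "P : \<M>" for P r
  using w[OF that] unfolding ann_ideal_def by blast
 \<comment> \<open>If \<open>b\<close> is not in \<open>P\<close>, then \<open>b\<close> times the
   witness of \<open>P\<close> is nonzero, and its annihilator contains \<open>P\<close>; by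
   maximality it equals \<open>P\<close>, and it contains \<open>a\<close>.\<close>
 have prime: "a : P" if P: "P : \<M>" and ab: "a : carrier R" "b : carrier R" "a \<otimes>[R] b : P" "b \<notin> P" for P a b
 proof -
  have bq: "b *[Q] w P : carrier Q" "b *[Q] w P \<noteq> 0[Q]" using annD[OF P] ab w[OF P] by auto
  have "P <= ann_ideal R Q (b *[Q] w P)"
  proof
   fix r assume r: "r : P"
   then have rR: "r : carrier R" using ideal.Icarr[OF idM[OF P]] by blast
   then have "r *[Q] (b *[Q] w P) = b *[Q] (r *[Q] w P)" using Q.smult_commute ab w[OF P] by blast
   then show "r : ann_ideal R Q (b *[Q] w P)" unfolding ann_ideal_def using annD[OF P rR] r rR ab by simp
  qed
  moreover have "ann_ideal R Q (b *[Q] w P) : \<A>" unfolding \<A>_def using bq by blast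
  ultimately have e: "ann_ideal R Q (b *[Q] w P) = P" using P unfolding \<M>_def by blast
  have "a *[Q] (b *[Q] w P) = 0[Q]" using annD[OF P, of "a \<otimes>[R] b"] ab w[OF P] by (simp add: Q.smult_assoc1)
  then have "a : ann_ideal R Q (b *[Q] w P)" unfolding ann_ideal_def using ab by blast
  then show ?thesis using e by simp
 qed
 have one: "1[R] \<notin> P" if P: "P : \<M>" for P
  using annD[OF P, of "1[R]"] w[OF P] by simp
 have avoid: "\<exists>a\<in>carrier R. a \<notin> P \<and> (\<forall>P'\<in>F. a : P')" if F: "finite F" "F <= \<M>" "P : \<M>" "P \<notin> F" for F P
  using F
 proof (induction F rule: finite_induct)
  case empty
  then show ?case using one by blast
 next
  case (insert P' F)
  then obtain a where a: "a : carrier R" "a \<notin> P" "!!P'. P' : F ==> a : P'" by auto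
  have P': "P' : \<M>" "P' \<noteq> P" using insert.prems by auto
  have "\<not> P' <= P" using P' insert.prems(2) unfolding \<M>_def by blast
  then obtain b where b: "b : P'" "b \<notin> P" by blast
  have bR: "b : carrier R" using ideal.Icarr[OF idM[OF P'(1)] b(1)] .
  have "a \<otimes>[R] b \<notin> P" using prime[OF insert.prems(2) a(1) bR] b(2) a(2) by blast
  moreover have "a \<otimes>[R] b : P'" by (rule ideal.I_l_closed[OF idM[OF P'(1)] b(1) a(1)])
  moreover have "a \<otimes>[R] b : P''" if "P'' : F" for P''
  proof -
   have "ideal P'' R" using idM insert.prems(1) that by blast
   then show ?thesis using ideal.I_r_closed a(3)[OF that] bR by fast
  qed
  ultimately show ?case using a(1) bR by (intro bexI[of _ "a \<otimes>[R] b"]) auto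
 qed
 \<comment> \<open>The witnesses generate a finitely generated submodule, so finitely many of them,
   indexed by \<open>D\<close>, already generate it. For a further \<open>P\<close> some
   \<open>a\<close> outside \<open>P\<close> lies in all members of \<open>D\<close>; it kills these
   witnesses, hence the witness of \<open>P\<close> as well, which contradicts
   \<open>a \<notin> P\<close>.\<close>
 have fin: "finite \<M>"
 proof -
  let ?G = "gen_submodule R Q (w ` \<M>)"
  have wc: "w ` \<M> <= carrier Q" using w by blast
  have G: "submodule ?G R Q" by (rule Q.gen_sub[OF wc])
  obtain S where S: "S <= carrier Q" "finite S" "gen_submodule R Q S = carrier Q" using fg unfolding fin_gen_module_def by blast
  obtain F where F: "finite F" "F <= ?G" "?G <= gen_submodule R Q F"
   using submodule_finitely_generated[OF N Q S(2,1) G] S(3) Q.submoduleE(1)[OF G] by auto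
  have "\<forall>x\<in>F. \<exists>T. finite T \<and> T <= w ` \<M> \<and> x : gen_submodule R Q T" using gen_finite_support[OF Q wc] F(2) by blast
  then obtain T where T: "!!x. x : F ==> finite (T x) \<and> T x <= w ` \<M> \<and> x : gen_submodule R Q (T x)" by metis
  let ?T = "\<Union>x\<in>F. T x"
  have T': "finite ?T" "?T <= w ` \<M>" using T F(1) by auto
  obtain D where D: "D <= \<M>" "finite D" "w ` D = ?T" using finite_subset_image[OF T'] by auto
  have Tc: "?T <= carrier Q" using T'(2) wc by blast
  have "F <= gen_submodule R Q ?T"
  proof
   fix x assume x: "x : F"
   then show "x : gen_submodule R Q ?T" using T[OF x] Q.gen_submodule_mono[of "T x" ?T] by blast
  qed
  then have GT: "?G <= gen_submodule R Q ?T"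
   using F(3) Q.gen_submodule_minimal[OF Q.gen_sub[OF Tc]] by blast
  have "\<M> <= D"
  proof
   fix P assume P: "P : \<M>"
   show "P : D"
   proof (rule ccontr)
    assume "P \<notin> D"
    then obtain a where a: "a : carrier R" "a \<notin> P" "!!P'. P' : D ==> a : P'" using avoid[OF D(2,1) P] by blast
    have "w P : gen_submodule R Q ?T" using P GT Q.gen_incl[of "w ` \<M>"] by blast
    then have "a *[Q] w P = 0[Q]"
    proof (rule gen_submodule_induct[OF _ Q Tc], goal_cases)
     case (2 s)
     then obtain P' where "P' : D" "s = w P'" unfolding D(3)[symmetric] by blast
     then show ?case using annD[of P' a] a D(1) by blast
    next
     case (4 r x) then show ?case using Q.smult_commute[OF a(1), of r x] by simp
    qed (use a in \<open>simp_all add: Q.smult_r_distr\<close>)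
    then show False using annD[OF P a(1)] a(2) by blast
   qed
  qed
  then show ?thesis using D(2) finite_subset by blast
 qed
 \<comment> \<open>If \<open>m\<close> were contained in \<open>P\<close>, the witness of
   \<open>P\<close> would be a nonzero element killed by \<open>m\<close>, against
   \<open>soc\<close>.\<close>
 have notsub: "\<exists>b\<in>m. b \<notin> P" if P: "P : \<M>" for P
 proof (rule ccontr)
  assume no: "\<not> (\<exists>b\<in>m. b \<notin> P)"
  have "w P = 0[Q]"
  proof (rule soc)
   show "w P : carrier Q" using w[OF P] by blast
   show "r *[Q] w P = 0[Q]" if r: "r : m" for r using annD[OF P ideal.Icarr[OF m r]] no r by blast
  qed
  then show False using w[OF P] by blast
 qed
 have "\<exists>x\<in>m. \<forall>P\<in>F. x \<notin> P" if "finite F" "F <= \<M>" for F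
  using that
 proof (induction F rule: finite_induct)
  case empty
  then show ?case using additive_subgroup.zero_closed[OF ideal.axioms(1)[OF m]] by blast
 next
  case (insert P F)
  then obtain x where x: "x : m" "!!P. P : F ==> x \<notin> P" by auto
  have P: "P : \<M>" using insert.prems by blast
  have xR: "x : carrier R" by (rule ideal.Icarr[OF m x(1)])
  show ?case
  proof (cases "x : P")
   case False then show ?thesis using x by blast
  next
   \<comment> \<open>Prime avoidance: add to \<open>x\<close> an element of \<open>m\<close> that
     lies in all the other primes but not in \<open>P\<close>.\<close>
   case True
   obtain a where a: "a : carrier R" "a \<notin> P" "!!P'. P' : F ==> a : P'"
    using avoid[OF insert.hyps(1) _ P insert.hyps(2)] insert.prems by blast
   obtain b where b: "b : m" "b \<notin> P" using notsub[OF P] by blast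
   have bR: "b : carrier R" by (rule ideal.Icarr[OF m b(1)])
   let ?y = "a \<otimes>[R] b"
   have yR: "?y : carrier R" using a bR by simp
   have ym: "?y : m" by (rule ideal.I_l_closed[OF m b(1) a(1)])
   have yP: "?y \<notin> P" using prime[OF P a(1) bR] a(2) b(2) by blast
   have yF: "?y : P'" if "P' : F" for P'
   proof -
    have "ideal P' R" using idM insert.prems that by blast
    then show ?thesis using ideal.I_r_closed a(3)[OF that] bR by fast
   qed
   have sub: "v : P'" if "ideal P' R" "u +[R] v : P'" "u : P'" "v : carrier R" for P' u v
   proof -
    interpret P': ideal P' R by fact
    have u: "u : carrier R" using that by simp
    have "(-[R] u) +[R] (u +[R] v) : P'" using that by simp
    then show ?thesis using u that(4) by (simp add: N.r_neg1)
   qed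
   have "x +[R] ?y : m" using additive_subgroup.a_closed[OF ideal.axioms(1)[OF m] x(1) ym] .
   moreover have "x +[R] ?y \<notin> P" using sub[OF idM[OF P] _ True yR] yP by blast
   moreover have "x +[R] ?y \<notin> P'" if P': "P' : F" for P'
   proof
    assume h: "x +[R] ?y : P'"
    have "ideal P' R" using idM insert.prems P' by blast
    moreover have "?y +[R] x : P'" using h N.a_comm[OF xR yR] by simp
    ultimately have "x : P'" using sub yF[OF P'] xR by blast
    then show False using x(2) P' by blast
   qed
   ultimately show ?thesis by blast
  qed
 qed
 from this[OF fin subset_refl] obtain x where x: "x : m" "!!P. P : \<M> ==> x \<notin> P" by blast
 have "q = 0[Q]" if q: "q : carrier Q" "x *[Q] q = 0[Q]" for q
 proof (rule ccontr)
  assume "q \<noteq> 0[Q]"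
  then obtain P where "P : \<M>" "ann_ideal R Q q <= P" using above[OF q(1)] by blast
  moreover have "x : ann_ideal R Q q" unfolding ann_ideal_def using q(2) ideal.Icarr[OF m x(1)] by blast
  ultimately show False using x(2) by blast
 qed
 then show ?thesis using x(1) by blast
qed

text \<open>Generators are removed one at a time. From \<open>g = h + x y\<close> and
  \<open>y = r g\<close> modulo the remaining generators and \<open>H\<close>, the element
  \<open>(1 - x r) g\<close> lies in their span, and \<open>1 - x r\<close> is a unit.\<close>

lemma nakayama:
 assumes N: "noetherian_ring R" and L: "local_ring R m" and x: "x : m" and fg: "fin_gen_module R M"
  and H: "submodule H R M" and ex: "!!y. y : carrier M ==> \<exists>h\<in>H. \<exists>y'\<in>carrier M. y = h +[M] x *[M] y'"
 shows "H = carrier M"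
proof -
 have M: "module R M" using fg unfolding fin_gen_module_def by blast
 interpret M: module R M by (rule M)
 interpret m: maximalideal m R using L unfolding local_ring_def by blast
 have xR: "x : carrier R" by (rule m.Icarr[OF x])
 have Hc: "H <= carrier M" by (rule M.submoduleE(1)[OF H])
 have "carrier M <= H" if "finite S" "S <= carrier M" "carrier M <= gen_submodule R M (S \<union> H)" for S
  using that
 proof (induction S rule: finite_induct)
  case empty
  then show ?case using M.gen_submodule_minimal[OF H, of H] by auto
 next
  case (insert g S)
  have g: "g : carrier M" and SH: "S \<union> H <= carrier M" using insert.prems Hc by auto
  let ?G = "gen_submodule R M (S \<union> H)"
  have G: "submodule ?G R M" by (rule M.gen_sub[OF SH])
  have Gc: "?G <= carrier M" by (rule M.submoduleE(1)[OF G])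
  obtain h y where hy: "h : H" "y : carrier M" "g = h +[M] x *[M] y" using ex[OF g] by blast
  have "y : gen_submodule R M (insert g (S \<union> H))" using insert.prems(2) hy(2) by auto
  then obtain r where r: "r : carrier R" "y -[M] r *[M] g : ?G" using gen_insert[OF M SH g] by blast
  have hG: "h : ?G" using M.gen_incl[of "S \<union> H"] hy(1) by blast
  have hc: "h : carrier M" using hy Hc by blast
  have "h +[M] x *[M] (y -[M] r *[M] g) : ?G" by (rule M.submoduleE(5)[OF G hG M.submoduleE(4)[OF G xR r(2)]])
  moreover have "h +[M] x *[M] (y -[M] r *[M] g) = (1[R] -[R] x \<otimes>[R] r) *[M] g"
  proof -
   have "h +[M] x *[M] (y -[M] r *[M] g) = h +[M] (x *[M] y -[M] (x \<otimes>[R] r) *[M] g)"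
    using xR r(1) g hy(2) by (simp add: M.smult_minus M.smult_assoc1)
   also have "\<dots> = g -[M] (x \<otimes>[R] r) *[M] g"
    using xR r(1) g hy(2) hc hy(3)[symmetric] by (simp add: M.M.minus_eq M.M.a_assoc[symmetric])
   also have "\<dots> = (1[R] -[R] x \<otimes>[R] r) *[M] g"
    using xR r(1) g by (simp add: M.R.minus_eq M.smult_l_distr M.smult_l_minus M.M.minus_eq)
   finally show ?thesis .
  qed
  ultimately have ag: "(1[R] -[R] x \<otimes>[R] r) *[M] g : ?G" by simp
  obtain u where u: "u : carrier R" "u \<otimes>[R] (1[R] -[R] x \<otimes>[R] r) = 1[R]"
   using local_ring_unit[OF N L m.I_r_closed[OF x r(1)]] by blast
  have "u *[M] ((1[R] -[R] x \<otimes>[R] r) *[M] g) : ?G" by (rule M.submoduleE(4)[OF G u(1) ag])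
  moreover have "u *[M] ((1[R] -[R] x \<otimes>[R] r) *[M] g) = g"
   using M.smult_assoc1[OF u(1), of "1[R] -[R] x \<otimes>[R] r" g] u(2) xR r(1) g by simp
  ultimately have "g : ?G" by simp
  then have "gen_submodule R M (insert g S \<union> H) <= ?G"
   using M.gen_incl[of "S \<union> H"] by (intro M.gen_submodule_minimal[OF G]) auto
  then show ?case using insert.IH insert.prems by blast
 qed
 moreover obtain S where "S <= carrier M" "finite S" "gen_submodule R M S = carrier M" using fg unfolding fin_gen_module_def by blast
 moreover have "gen_submodule R M S <= gen_submodule R M (S \<union> H)" for S by (rule M.gen_submodule_mono) blast
 ultimately show ?thesis using Hc by blast
qed

section \<open>Depth as the first degree with nonzero local cohomology\<close>

text \<open>Vanishing of the p-th cohomology of the torsion part of a complex; for an injective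
  resolution this is the p-th local cohomology.\<close>

definition van :: "('a, 'r) ring_scheme => 'a list => (nat => ('a, 'm, 'x) module_scheme) => (nat => 'm => 'm) => nat => bool"
 where "van R zs E d p \<longleftrightarrow> tors_cocycles R zs E d p <= tors_bdry R zs E d p"

definition lc_zero :: "('a, 'r) ring_scheme => 'a list => ('a, 'm, 'x) module_scheme => nat => bool"
 where "lc_zero R zs M p \<longleftrightarrow> (case chosen_resolution R M of (E, d) => van R zs E d p)"

text \<open>The two consequences of the comparison that are used: the one on vanishing for the cone
  of a regular element, the one on finite generation for the tensor complex.\<close>

lemma comparison_cohomology:
 assumes N: "noetherian_ring R" and zs: "set zs <= carrier R"
  and cU: "cplx R U d" and gU: "!!n. good_for R zs (U n)"
  and ex0: "!!u. u : carrier (U 0) ==> d 0 u = 0[U (Suc 0)] ==> u = 0[U 0]"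
  and ex2: "!!n u. u : carrier (U (Suc (Suc n))) ==> d (Suc (Suc n)) u = 0[U (Suc (Suc (Suc n)))] ==>
   \<exists>v\<in>carrier (U (Suc n)). d (Suc n) v = u"
  and cI: "cplx R I e" and bI: "!!n. baer R (I n)"
  and exact: "!!n i. i : carrier (I (Suc n)) ==> e (Suc n) i = 0[I (Suc (Suc n))] ==> \<exists>j\<in>carrier (I n). e n j = i"
  and \<theta>: "\<theta> : mod_hom R (U (Suc 0)\<lparr>carrier := {x : carrier (U (Suc 0)). d (Suc 0) x = 0[U (Suc (Suc 0))]}\<rparr>) (I 0)"
  and \<theta>ker: "!!x. x : carrier (U (Suc 0)) ==> d (Suc 0) x = 0[U (Suc (Suc 0))] ==> \<theta> x = 0[I 0] \<longleftrightarrow> x : d 0 ` carrier (U 0)"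
  and \<theta>im: "\<theta> ` {x : carrier (U (Suc 0)). d (Suc 0) x = 0[U (Suc (Suc 0))]} = {i : carrier (I 0). e 0 i = 0[I (Suc 0)]}"
  and K: "cring K" and \<iota>: "\<iota> : ring_hom K R"
 shows "van R zs U d (Suc p) \<longleftrightarrow> van R zs I e p"
  and "fdq K (kmod \<iota> (U (Suc p))) (tors_cocycles R zs U d (Suc p)) (tors_bdry R zs U d (Suc p)) \<longleftrightarrow>
   fdq K (kmod \<iota> (I p)) (tors_cocycles R zs I e p) (tors_bdry R zs I e p)"
proof -
 note mU = cplxD(1)[OF cU] and mI = cplxD(1)[OF cI]
 have "\<exists>\<phi>. (\<forall>n. \<phi> n : mod_hom R (U (Suc n)) (I n)) \<and>
   (\<forall>n. \<forall>c\<in>tors R zs (U (Suc n)). d (Suc n) c = 0[U (Suc (Suc n))] --> e n (\<phi> n c) = 0[I (Suc n)]) \<and>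
   (\<forall>n. \<forall>c\<in>tors R zs (U n). \<phi> n (d n c) : bdry I e (%n. tors R zs (I n)) n) \<and>
   (\<forall>n. \<forall>i\<in>tors R zs (I n). e n i = 0[I (Suc n)] -->
   (\<exists>c\<in>tors R zs (U (Suc n)). d (Suc n) c = 0[U (Suc (Suc n))] \<and> \<phi> n c -[I n] i : bdry I e (%n. tors R zs (I n)) n)) \<and>
   (\<forall>n. \<forall>c\<in>tors R zs (U (Suc n)). d (Suc n) c = 0[U (Suc (Suc n))] -->
   \<phi> n c : bdry I e (%n. tors R zs (I n)) n --> c : d n ` tors R zs (U n))"
  by (rule comparison[OF N zs cU gU ex0 ex2 cI bI exact \<theta> \<theta>ker \<theta>im])
 then obtain \<phi> where \<phi>: "\<forall>n. \<phi> n : mod_hom R (U (Suc n)) (I n)"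
  and p1: "\<forall>n. \<forall>c\<in>tors R zs (U (Suc n)). d (Suc n) c = 0[U (Suc (Suc n))] --> e n (\<phi> n c) = 0[I (Suc n)]"
  and p2: "\<forall>n. \<forall>c\<in>tors R zs (U n). \<phi> n (d n c) : bdry I e (%n. tors R zs (I n)) n"
  and p3: "\<forall>n. \<forall>i\<in>tors R zs (I n). e n i = 0[I (Suc n)] -->
   (\<exists>c\<in>tors R zs (U (Suc n)). d (Suc n) c = 0[U (Suc (Suc n))] \<and> \<phi> n c -[I n] i : bdry I e (%n. tors R zs (I n)) n)"
  and p4: "\<forall>n. \<forall>c\<in>tors R zs (U (Suc n)). d (Suc n) c = 0[U (Suc (Suc n))] -->
   \<phi> n c : bdry I e (%n. tors R zs (I n)) n --> c : d n ` tors R zs (U n)"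
  by (elim exE conjE)
 let ?Z = "tors_cocycles R zs U d (Suc p)" and ?B = "tors_bdry R zs U d (Suc p)"
 let ?Z' = "tors_cocycles R zs I e p" and ?B' = "tors_bdry R zs I e p"
 note sU = tors_cocycles_submodule[OF cU zs, of "Suc p"] and sI = tors_cocycles_submodule[OF cI zs, of p]
 have \<phi>p: "\<phi> p : mod_hom R (U (Suc p)) (I p)" using \<phi> by blast
 have fZ: "\<phi> p ` ?Z <= ?Z'"
  using p1 tors_mod_hom[OF \<phi>p mU mI zs] unfolding tors_cocycles_def by blast
 have fB: "\<phi> p ` ?B <= ?B'" using p2 unfolding tors_bdry_def by auto
 have inj: "!!z. z : ?Z ==> \<phi> p z : ?B' ==> z : ?B" using p4 unfolding tors_cocycles_def tors_bdry_def by simp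
 have surj: "!!z'. z' : ?Z' ==> \<exists>z\<in>?Z. \<phi> p z -[I p] z' : ?B'" using p3 unfolding tors_cocycles_def tors_bdry_def by blast
 have Z'c: "?Z' <= carrier (I p)" using module.submoduleE(1)[OF mI sI(1)] .
 show "van R zs U d (Suc p) \<longleftrightarrow> van R zs I e p"
  unfolding van_def by (rule vanish_iff[OF mI sI(2) fZ fB Z'c inj surj])
 show "fdq K (kmod \<iota> (U (Suc p))) ?Z ?B \<longleftrightarrow> fdq K (kmod \<iota> (I p)) ?Z' ?B'"
 proof (rule fdq_iff[where f = "\<phi> p"])
  show "module K (kmod \<iota> (U (Suc p)))" "module K (kmod \<iota> (I p))" by (rule kmod_module[OF K \<iota> mU], rule kmod_module[OF K \<iota> mI])
  show "\<phi> p : mod_hom K (kmod \<iota> (U (Suc p))) (kmod \<iota> (I p))" by (rule mod_hom_kmod[OF \<phi>p \<iota>])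
  show "submodule ?Z K (kmod \<iota> (U (Suc p)))" by (rule submodule_kmod[OF K \<iota> mU sU(1)])
  show "submodule ?B K (kmod \<iota> (U (Suc p)))" by (rule submodule_kmod[OF K \<iota> mU sU(2)])
  show "submodule ?B' K (kmod \<iota> (I p))" by (rule submodule_kmod[OF K \<iota> mI sI(2)])
  show "?B <= ?Z" by (rule sU(3))
  show "?Z' <= carrier (kmod \<iota> (I p))" using Z'c by simp
  show "\<exists>z\<in>?Z. \<phi> p z -[kmod \<iota> (I p)] z' : ?B'" if "z' : ?Z'" for z' using surj[OF that] by simp
 qed (use fZ fB inj in auto)
qed

lemma mod_hom_pair:
 "f : mod_hom R M A ==> g : mod_hom R M B ==> (%p. (f p, g p)) : mod_hom R M (prod_mod A B)"
 by (rule mod_homI) (auto simp: mod_homD)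

lemma mod_hom_fst: "fst : mod_hom R (prod_mod A B) A"
 by (rule mod_homI) auto

lemma mod_hom_snd: "snd : mod_hom R (prod_mod A B) B"
 by (rule mod_homI) auto

lemma mod_hom_diff:
 assumes N: "module R N" and f: "f : mod_hom R M N" and g: "g : mod_hom R M N"
 shows "(%x. f x -[N] g x) : mod_hom R M N"
proof -
 interpret N: module R N by fact
 note c = mod_homD(1)[OF f] mod_homD(1)[OF g]
 show ?thesis
 proof (rule mod_homI)
  fix x y assume "x : carrier M" "y : carrier M"
  then show "f (x +[M] y) -[N] g (x +[M] y) = (f x -[N] g x) +[N] (f y -[N] g y)"
   by (simp add: mod_homD(2)[OF f] mod_homD(2)[OF g] N.M.minus_add_minus c)
 next
  fix r x assume "r : carrier R" "x : carrier M"
  then show "f (r *[M] x) -[N] g (r *[M] x) = r *[N] (f x -[N] g x)"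
   by (simp add: mod_homD(3)[OF f] mod_homD(3)[OF g] N.smult_minus c)
 qed (simp add: c)
qed

lemma mod_hom_smult:
 assumes N: "module R N" and f: "f : mod_hom R M N" and a: "a : carrier R"
 shows "(%x. a *[N] f x) : mod_hom R M N"
proof -
 interpret N: module R N by fact
 note c = mod_homD(1)[OF f]
 show ?thesis
  by (rule mod_homI) (use a in \<open>simp_all add: mod_homD(2)[OF f] mod_homD(3)[OF f] N.smult_r_distr N.smult_commute c\<close>)
qed

lemma tors_pow_kill:
 assumes M: "module R M" and zs: "set zs <= carrier R" and x: "x : gen_submodule R (ring_mod R) (set zs)" and u: "u : tors R zs M"
 shows "\<exists>k::nat. (x [^]\<^bsub>R\<^esub> k) *[M] u = 0[M]"
proof -
 interpret M: module R M by fact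
 let ?I = "gen_submodule R (ring_mod R) (set zs)"
 obtain n :: nat where n: "\<forall>r\<in>?I [^]\<^bsub>ideals_set R\<^esub> n. r *[M] u = 0[M]"
  using u torsion_eq_tors[OF M zs refl] unfolding torsion_def by blast
 interpret RM: module R "ring_mod R" by (rule ring_mod_module[OF M.is_cring])
 have "?I <= carrier R" using RM.gen_submodule_carrier[of "set zs"] zs by simp
 then have xR: "x : carrier R" using x by blast
 have "x [^]\<^bsub>R\<^esub> k : ?I [^]\<^bsub>ideals_set R\<^esub> k" for k :: nat
 proof (induction k)
  case 0 then show ?case by (simp add: ideals_set_pow)
 next
  case (Suc k) then show ?case using ideal_prod.prod[of "x [^]\<^bsub>R\<^esub> k" _ x ?I R] x by (simp add: ideals_set_pow)
 qed
 then show ?thesis using n by blast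
qed

text \<open>The setting shared by \<open>A\<close>, \<open>B\<close> and their tensor product. The
  list \<open>zs\<close> of generators is fixed because goodness refers to it, and the algebra
  structure is a map \<open>\<iota>\<close> because the tensor product ring has no scalar action in
  its record.\<close>

locale aug_algebra =
 fixes K :: "('k, 'r) ring_scheme" and R :: "('a, 's) ring_scheme" and \<iota> :: "'k => 'a" and zs :: "'a list" and I :: "'a set"
 assumes field_K: "field K" and hom_\<iota>: "\<iota> : ring_hom K R" and noeth: "noetherian_ring R" and cring_R: "cring R"
  and zs_carrier: "set zs <= carrier R" and I_gen: "I = gen_submodule R (ring_mod R) (set zs)"
  and residue: "!!r. r : carrier R ==> \<exists>c\<in>carrier K. r -[R] \<iota> c : I"
begin

lemma cring_K: "cring K"
 using field_K by (simp add: field_def domain_def)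

lemma I_ideal: "ideal I R"
proof -
 interpret RM: module R "ring_mod R" by (rule ring_mod_module[OF cring_R])
 show ?thesis unfolding I_gen ideal_iff_submodule[OF cring_R] using zs_carrier by (intro RM.gen_sub) simp
qed

text \<open>\<open>Q'\<close> is \<open>Q\<close> modulo the regular element \<open>x\<close>. The
  cone of multiplication by \<open>x\<close> on a resolution of \<open>Q\<close> has its only
  cohomology, \<open>Q'\<close>, in degree 1. Its torsion cohomology vanishes up to degree
  \<open>n\<close> iff that of \<open>E\<close> does: forwards by a diagram chase; backwards because
  vanishing makes \<open>x\<close> injective on the cohomology of \<open>E\<close>, where every
  class is killed by a power of \<open>x\<close>.\<close>

lemma cone_step:
 assumes r: "injective_resolution R Q \<eta> E d" and r': "injective_resolution R Q' \<eta>' E' d'" and mQ: "module R Q" and mQ': "module R Q'"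
  and x: "x : I" and reg: "!!y. y : carrier Q ==> x *[Q] y = 0[Q] ==> y = 0[Q]"
  and q: "q : mod_hom R Q Q'" "q ` carrier Q = carrier Q'"
  and qker: "!!y. y : carrier Q ==> q y = 0[Q'] \<longleftrightarrow> (\<exists>w\<in>carrier Q. y = x *[Q] w)"
 shows "(\<forall>p\<le>n. van R zs E d p) \<longleftrightarrow> (\<forall>p<n. van R zs E' d' p)"
proof -
 note c = injective_resolution_cplx[OF r] and c' = injective_resolution_cplx[OF r']
 note m = cplxD(1)[OF c(1)] and m' = cplxD(1)[OF c'(1)] and d = cplxD(2)[OF c(1)] and dd = cplxD(3)[OF c(1)]
 note rr = r[unfolded injective_resolution_iff] and rr' = r'[unfolded injective_resolution_iff]
 interpret Q: module R Q by fact
 interpret Q': module R Q' by fact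
 interpret E: module R "E nn" for nn by (rule m)
 have xR: "x : carrier R" by (rule ideal.Icarr[OF I_ideal x])
 have \<eta>: "\<eta> : mod_hom R Q (E 0)" "inj_on \<eta> (carrier Q)" "\<eta> ` carrier Q = {x : carrier (E 0). d 0 x = 0[E (Suc 0)]}" using rr by auto
 have \<eta>': "\<eta>' : mod_hom R Q' (E' 0)" "inj_on \<eta>' (carrier Q')" "\<eta>' ` carrier Q' = {x : carrier (E' 0). d' 0 x = 0[E' (Suc 0)]}" using rr' by auto
 have \<eta>c: "!!y. y : carrier Q ==> \<eta> y : carrier (E 0)" using mod_homD(1)[OF \<eta>(1)] .
 have d\<eta>: "!!y. y : carrier Q ==> d 0 (\<eta> y) = 0[E (Suc 0)]" using \<eta>(3) by blast
 have \<eta>eq: "!!y w. y : carrier Q ==> w : carrier Q ==> \<eta> y = \<eta> w \<longleftrightarrow> y = w" using inj_on_eq_iff[OF \<eta>(2)] .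
 have \<eta>x: "!!w. w : carrier Q ==> \<eta> (x *[Q] w) = x *[E 0] \<eta> w" using mod_homD(3)[OF \<eta>(1) xR] .
 have dc: "!!n u. u : carrier (E n) ==> d n u : carrier (E (Suc n))" using mod_homD(1)[OF d] .
 have dx: "!!n u. u : carrier (E n) ==> d n (x *[E n] u) = x *[E (Suc n)] d n u" using mod_homD(3)[OF d xR] .
 have dm: "!!n u v. u : carrier (E n) ==> v : carrier (E n) ==> d n (u -[E n] v) = d n u -[E (Suc n)] d n v"
  using mod_hom_minus[OF d m m] .
 have dz: "!!n. d n 0[E n] = 0[E (Suc n)]" by (rule mod_hom_zero[OF d m m])
 have mm: "!!n u v. u : carrier (E n) ==> v : carrier (E n) ==> u -[E n] (u -[E n] v) = v"
  using E.M.minus_eq_iff E.M.add_minus_swap by simp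
 let ?E0 = "E 0\<lparr>carrier := {0[E 0]}\<rparr>"
 have mE0: "module R ?E0" by (rule E.restrict_module[OF E.submodule_zero])
 \<comment> \<open>The cone in degree \<open>n\<close> is \<open>E n\<close> times
   \<open>E (n - 1)\<close>, with a zero module in place of the missing term, and
   \<open>(a, b)\<close> goes to \<open>(d a, x a - d b)\<close>.\<close>
 define C where "C n = (case n of 0 => prod_mod (E 0) ?E0 | Suc k => prod_mod (E (Suc k)) (E k))" for n
 define D where "D n p = (case n of 0 => (d 0 (fst p), x *[E 0] fst p)
  | Suc k => (d (Suc k) (fst p), x *[E (Suc k)] fst p -[E (Suc k)] d k (snd p)))" for n p
 have C: "C 0 = prod_mod (E 0) ?E0" "!!n. C (Suc n) = prod_mod (E (Suc n)) (E n)"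
  and D: "!!p. D 0 p = (d 0 (fst p), x *[E 0] fst p)"
   "!!n p. D (Suc n) p = (d (Suc n) (fst p), x *[E (Suc n)] fst p -[E (Suc n)] d n (snd p))"
  unfolding C_def D_def by simp_all
 have mC: "module R (C n)" for n by (cases n) (simp_all add: C prod_mod_module m mE0)
 have DC: "D n : mod_hom R (C n) (C (Suc n))" for n
 proof (cases n)
  case 0
  show ?thesis unfolding 0 C D[abs_def]
   by (rule mod_hom_pair[OF mod_hom_compose[OF mod_hom_fst d] mod_hom_smult[OF m mod_hom_fst xR]])
 next
  case (Suc k)
  show ?thesis unfolding Suc C D[abs_def]
   by (rule mod_hom_pair[OF mod_hom_compose[OF mod_hom_fst d]
     mod_hom_diff[OF m mod_hom_smult[OF m mod_hom_fst xR] mod_hom_compose[OF mod_hom_snd d]]])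
 qed
 have cC: "cplx R C D"
  unfolding cplx_def
 proof (intro allI conjI ballI)
  show "D (Suc n) (D n u) = 0[C (Suc (Suc n))]" if u: "u : carrier (C n)" for n u
  proof (cases n)
   case 0
   then have "fst u : carrier (E 0)" using u by (auto simp: C)
   then show ?thesis unfolding 0 C D using dd[of "fst u" 0] dx dc[of "fst u" 0] xR by simp
  next
   case (Suc k)
   then have c: "fst u : carrier (E (Suc k))" "snd u : carrier (E k)" using u by (auto simp: C)
   have "d (Suc k) (x *[E (Suc k)] fst u -[E (Suc k)] d k (snd u)) = x *[E (Suc (Suc k))] d (Suc k) (fst u)"
    using dm[of "x *[E (Suc k)] fst u" "Suc k" "d k (snd u)"] c dc xR dd[OF c(2)] dx by simp
   then show ?thesis unfolding Suc C D using dd[OF c(1)] dc[OF c(1)] xR by simp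
  qed
 qed (rule mC, rule DC)
 have gE: "good_for R zs (E n)" for n by (rule baer_good_for[OF noeth m c(2) zs_carrier])
 have gC: "good_for R zs (C n)" for n
  using good_for_prod_mod[OF m mE0 zs_carrier gE E.good_for_zero[OF zs_carrier]] good_for_prod_mod[OF m m zs_carrier gE gE]
  by (cases n) (simp_all add: C)
 have ex0: "u = 0[C 0]" if u: "u : carrier (C 0)" and Du: "D 0 u = 0[C (Suc 0)]" for u
 proof -
  have u': "fst u : carrier (E 0)" "snd u = 0[E 0]" "d 0 (fst u) = 0[E (Suc 0)]" "x *[E 0] fst u = 0[E 0]"
   using u Du by (auto simp: C D)
  then have "fst u : \<eta> ` carrier Q" unfolding \<eta>(3) by simp
  then obtain y where y: "y : carrier Q" "fst u = \<eta> y" by blast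
  have "\<eta> (x *[Q] y) = \<eta> 0[Q]" using u'(4) y \<eta>x mod_hom_zero[OF \<eta>(1) mQ m] by simp
  then have "x *[Q] y = 0[Q]" using \<eta>eq y xR by simp
  then have "y = 0[Q]" using reg y by blast
  then show ?thesis using u'(2) y(2) mod_hom_zero[OF \<eta>(1) mQ m] by (simp add: C prod_eq_iff)
 qed
 have ex2: "\<exists>v\<in>carrier (C (Suc n)). D (Suc n) v = u"
  if u: "u : carrier (C (Suc (Suc n)))" and Du: "D (Suc (Suc n)) u = 0[C (Suc (Suc (Suc n)))]" for n u
 proof -
  have u': "fst u : carrier (E (Suc (Suc n)))" "snd u : carrier (E (Suc n))" "d (Suc (Suc n)) (fst u) = 0[E (Suc (Suc (Suc n)))]"
   "x *[E (Suc (Suc n))] fst u -[E (Suc (Suc n))] d (Suc n) (snd u) = 0[E (Suc (Suc n))]"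
   using u Du by (auto simp: C D)
  obtain a where a: "a : carrier (E (Suc n))" "d (Suc n) a = fst u" using c(3)[OF u'(1,3)] by blast
  have xa: "x *[E (Suc n)] a : carrier (E (Suc n))" using a xR by simp
  have "d (Suc n) (x *[E (Suc n)] a -[E (Suc n)] snd u) = 0[E (Suc (Suc n))]"
   using dm[OF xa u'(2)] dx[OF a(1)] a(2) u'(4) by simp
  then obtain b where b: "b : carrier (E n)" "d n b = x *[E (Suc n)] a -[E (Suc n)] snd u"
   using c(3)[of "x *[E (Suc n)] a -[E (Suc n)] snd u" n] xa u'(2) by auto
  have "x *[E (Suc n)] a -[E (Suc n)] d n b = snd u" unfolding b(2) by (rule mm[OF xa u'(2)])
  then show ?thesis using a b(1) by (intro bexI[of _ "(a, b)"]) (simp_all add: C D prod_eq_iff)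
 qed
 \<comment> \<open>The cocycles of the cone in degree 1 are parametrized by pairs
   \<open>(e, y)\<close> through \<open>?f\<close>, and such a cocycle is a boundary exactly if
   \<open>y\<close> lies in \<open>x Q\<close>. So \<open>?g\<close>, which forgets \<open>e\<close>
   and maps \<open>y\<close> to \<open>Q'\<close>, induces the identification
   \<open>\<theta>\<close>.\<close>
 let ?A = "prod_mod (E 0) Q"
 have mA: "module R ?A" by (rule prod_mod_module[OF m mQ])
 let ?f = "%p. (d 0 (fst p), x *[E 0] fst p -[E 0] \<eta> (snd p))"
 let ?g = "%p. \<eta>' (q (snd p))"
 have f: "?f : mod_hom R ?A (C (Suc 0))" unfolding C
  by (rule mod_hom_pair[OF mod_hom_compose[OF mod_hom_fst d]
    mod_hom_diff[OF m mod_hom_smult[OF m mod_hom_fst xR] mod_hom_compose[OF mod_hom_snd \<eta>(1)]]])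
 have g: "?g : mod_hom R ?A (E' 0)"
  by (rule mod_hom_compose[OF mod_hom_compose[OF mod_hom_snd q(1)] \<eta>'(1)])
 have qc: "!!y. y : carrier Q ==> q y : carrier Q'" using mod_homD(1)[OF q(1)] .
 have gz: "?g p = 0[E' 0] \<longleftrightarrow> (\<exists>w\<in>carrier Q. snd p = x *[Q] w)" if p: "p : carrier ?A" for p
 proof -
  have s: "snd p : carrier Q" using p by auto
  have "?g p = 0[E' 0] \<longleftrightarrow> \<eta>' (q (snd p)) = \<eta>' 0[Q']" using mod_hom_zero[OF \<eta>'(1) mQ' m'] by simp
  also have "\<dots> \<longleftrightarrow> q (snd p) = 0[Q']" by (rule inj_on_eq_iff[OF \<eta>'(2) qc[OF s]]) simp
  finally show ?thesis using qker[OF s] by simp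
 qed
 have fD: "(\<exists>w\<in>carrier Q. snd p = x *[Q] w) \<longleftrightarrow> ?f p : D 0 ` carrier (C 0)" if p: "p : carrier ?A" for p
 proof
  have pc: "fst p : carrier (E 0)" "snd p : carrier Q" using p by auto
  {
   assume "\<exists>w\<in>carrier Q. snd p = x *[Q] w"
   then obtain w where w: "w : carrier Q" "snd p = x *[Q] w" by blast
   have "D 0 (fst p -[E 0] \<eta> w, 0[E 0]) = ?f p"
    using dm[OF pc(1) \<eta>c[OF w(1)]] d\<eta>[OF w(1)] \<eta>x[OF w(1)] pc w dc[OF pc(1)] \<eta>c[OF w(1)] xR by (simp add: D E.smult_minus)
   moreover have "(fst p -[E 0] \<eta> w, 0[E 0]) : carrier (C 0)" using pc \<eta>c[OF w(1)] by (simp add: C)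
   ultimately show "?f p : D 0 ` carrier (C 0)" by (metis image_eqI)
  }
  assume "?f p : D 0 ` carrier (C 0)"
  then obtain e where e: "e : carrier (E 0)" "d 0 (fst p) = d 0 e" "x *[E 0] fst p -[E 0] \<eta> (snd p) = x *[E 0] e"
   by (auto simp: C D)
  have "d 0 (fst p -[E 0] e) = 0[E (Suc 0)]" using dm[OF pc(1) e(1)] e(2) dc[OF e(1)] by simp
  then have "fst p -[E 0] e : \<eta> ` carrier Q" unfolding \<eta>(3) using pc e by simp
  then obtain w where w: "w : carrier Q" "fst p -[E 0] e = \<eta> w" by blast
  have xp: "x *[E 0] fst p : carrier (E 0)" using pc xR by simp
  have "\<eta> (snd p) = x *[E 0] fst p -[E 0] x *[E 0] e" unfolding e(3)[symmetric] by (rule mm[OF xp \<eta>c[OF pc(2)], symmetric])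
  also have "\<dots> = \<eta> (x *[Q] w)" unfolding \<eta>x[OF w(1)] w(2)[symmetric] using pc e xR by (simp add: E.smult_minus)
  finally have "snd p = x *[Q] w" using \<eta>eq pc(2) w(1) xR by simp
  then show "\<exists>w\<in>carrier Q. snd p = x *[Q] w" using w(1) by blast
 qed
 let ?Z1 = "{u : carrier (C (Suc 0)). D (Suc 0) u = 0[C (Suc (Suc 0))]}"
 have fim: "?f ` carrier ?A = ?Z1"
 proof
  show "?f ` carrier ?A <= ?Z1"
  proof
   fix u assume "u : ?f ` carrier ?A"
   then obtain p where p: "p : carrier ?A" "u = ?f p" by blast
   have pc: "fst p : carrier (E 0)" "snd p : carrier Q" using p by auto
   have xp: "x *[E 0] fst p : carrier (E 0)" using pc xR by simp
   have "d 0 (x *[E 0] fst p -[E 0] \<eta> (snd p)) = x *[E (Suc 0)] d 0 (fst p)"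
    using dm[OF xp \<eta>c[OF pc(2)]] d\<eta>[OF pc(2)] dx[OF pc(1)] dc[OF pc(1)] xR by simp
   then have "D (Suc 0) u = 0[C (Suc (Suc 0))]" using p(2) dd[OF pc(1)] dc[OF pc(1)] xR by (simp add: D C)
   then show "u : ?Z1" using mod_homD(1)[OF f p(1)] p(2) by simp
  qed
  show "?Z1 <= ?f ` carrier ?A"
  proof
   fix u assume "u : ?Z1"
   then have u: "fst u : carrier (E (Suc 0))" "snd u : carrier (E 0)" "d (Suc 0) (fst u) = 0[E (Suc (Suc 0))]"
    "x *[E (Suc 0)] fst u -[E (Suc 0)] d 0 (snd u) = 0[E (Suc 0)]" by (auto simp: C D)
   obtain e where e: "e : carrier (E 0)" "d 0 e = fst u" using c(3)[OF u(1,3)] by blast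
   have xe: "x *[E 0] e : carrier (E 0)" using e xR by simp
   have "d 0 (x *[E 0] e -[E 0] snd u) = 0[E (Suc 0)]" using dm[OF xe u(2)] dx[OF e(1)] e(2) u(4) by simp
   then have "x *[E 0] e -[E 0] snd u : \<eta> ` carrier Q" unfolding \<eta>(3) using xe u(2) by simp
   then obtain y where y: "y : carrier Q" "x *[E 0] e -[E 0] snd u = \<eta> y" by blast
   have "x *[E 0] e -[E 0] \<eta> y = snd u" unfolding y(2)[symmetric] by (rule mm[OF xe u(2)])
   then have "u = ?f (e, y)" using e(2) by (simp add: prod_eq_iff)
   then show "u : ?f ` carrier ?A" using e(1) y(1) by (intro image_eqI[of _ _ "(e, y)"]) simp_all
  qed
 qed
 have "\<exists>h\<in>mod_hom R (C (Suc 0)\<lparr>carrier := ?f ` carrier ?A\<rparr>) (E' 0). \<forall>a\<in>carrier ?A. h (?f a) = ?g a"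
 proof (rule hom_factor[OF mA mC m' f g])
  fix a assume a: "a : carrier ?A" "?f a = 0[C (Suc 0)]"
  have "D 0 0[C 0] = 0[C (Suc 0)]" by (rule mod_hom_zero[OF DC mC mC])
  moreover have "0[C 0] : carrier (C 0)" by (simp add: C)
  ultimately have "?f a : D 0 ` carrier (C 0)" using a(2) by (metis image_eqI)
  then show "?g a = 0[E' 0]" using gz[OF a(1)] fD[OF a(1)] by blast
 qed
 then obtain \<theta> where \<theta>: "\<theta> : mod_hom R (C (Suc 0)\<lparr>carrier := ?Z1\<rparr>) (E' 0)" "\<forall>a\<in>carrier ?A. \<theta> (?f a) = ?g a"
  unfolding fim by (elim bexE)
 have cmp: "van R zs C D (Suc p) \<longleftrightarrow> van R zs E' d' p" for p
 proof (rule comparison_cohomology(1)[OF noeth zs_carrier cC gC ex0 ex2 c'(1) c'(2) c'(3) \<theta>(1) _ _ cring_K hom_\<iota>])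
  show "\<theta> u = 0[E' 0] \<longleftrightarrow> u : D 0 ` carrier (C 0)"
   if u: "u : carrier (C (Suc 0))" "D (Suc 0) u = 0[C (Suc (Suc 0))]" for u
  proof -
   have "u : ?f ` carrier ?A" unfolding fim using u by simp
   then obtain a where "a : carrier ?A" "u = ?f a" by blast
   then show ?thesis using bspec[OF \<theta>(2)] gz[of a] fD[of a] by (simp only:)
  qed
  have "\<theta> ` ?Z1 = ?g ` carrier ?A" unfolding fim[symmetric] image_image using \<theta>(2) by (intro image_cong) auto
  also have "\<dots> = \<eta>' ` carrier Q'"
  proof -
   have "snd ` carrier ?A = carrier Q" by (auto simp: image_iff intro!: bexI[of _ "0[E 0]"])
   then show ?thesis unfolding q(2)[symmetric] by (metis image_image)
  qed
  finally show "\<theta> ` ?Z1 = {i : carrier (E' 0). d' 0 i = 0[E' (Suc 0)]}" using \<eta>'(3) by simp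
 qed
 have TC: "tors R zs (C 0) = tors R zs (E 0) \<times> tors R zs ?E0" "!!n. tors R zs (C (Suc n)) = tors R zs (E (Suc n)) \<times> tors R zs (E n)"
  unfolding C by (rule tors_prod_mod[OF m mE0 zs_carrier], rule tors_prod_mod[OF m m zs_carrier])
 have TE: "submodule (tors R zs (E n)) R (E n)" for n by (rule E.tors_submodule[OF zs_carrier])
 have TE0: "tors R zs ?E0 = {0[E 0]}" using E.sub_zero[OF TE] by auto
 have C0: "van R zs C D 0"
  unfolding van_def tors_cocycles_def tors_bdry_def using ex0 tors_carrier by fastforce
 have "(\<forall>p\<le>n. van R zs E d p) \<longleftrightarrow> (\<forall>p\<le>n. van R zs C D p)"
 proof
  assume vE: "\<forall>p\<le>n. van R zs E d p"
  show "\<forall>p\<le>n. van R zs C D p"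
  proof (intro allI impI)
   fix p assume p: "p \<le> n"
   show "van R zs C D p"
   proof (cases p)
    case 0 then show ?thesis using C0 by simp
   next
    case (Suc k)
    have v1: "van R zs E d (Suc k)" and v0: "van R zs E d k" using vE p Suc by auto
    show ?thesis unfolding van_def
    proof
     fix u assume "u : tors_cocycles R zs C D p"
     then have u: "fst u : tors R zs (E (Suc k))" "snd u : tors R zs (E k)" "d (Suc k) (fst u) = 0[E (Suc (Suc k))]"
      "x *[E (Suc k)] fst u -[E (Suc k)] d k (snd u) = 0[E (Suc k)]"
      unfolding tors_cocycles_def Suc TC by (auto simp: C D)
     have "fst u : tors_bdry R zs E d (Suc k)" using v1 u unfolding van_def tors_cocycles_def by blast
     then obtain a where a: "a : tors R zs (E k)" "fst u = d k a" unfolding tors_bdry_def by auto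
     have xa: "x *[E k] a : tors R zs (E k)" by (rule E.submoduleE(4)[OF TE xR a(1)])
     have cc: "a : carrier (E k)" "snd u : carrier (E k)" "x *[E k] a : carrier (E k)" using a u xa by (auto intro: tors_carrier)
     have w: "x *[E k] a -[E k] snd u : tors R zs (E k)" by (rule E.submodule_minus_closed[OF TE xa u(2)])
     have "d k (x *[E k] a -[E k] snd u) = 0[E (Suc k)]" using dm[OF cc(3,2)] dx[OF cc(1)] a(2) u(4) by simp
     then have wb: "x *[E k] a -[E k] snd u : tors_bdry R zs E d k" using v0 w unfolding van_def tors_cocycles_def by blast
     show "u : tors_bdry R zs C D p"
     proof (cases k)
      case 0
      have "x *[E 0] a -[E 0] snd u = 0[E 0]" using wb unfolding tors_bdry_def 0 by simp
      then have "x *[E 0] a = snd u" using E.M.minus_eq_zero_iff[of "x *[E 0] a" 0 "snd u"] cc 0 by simp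
      then have "u = D 0 (a, 0[E 0])" using a(2) 0 by (simp add: D prod_eq_iff)
      moreover have "(a, 0[E 0]) : tors R zs (C 0)" unfolding TC TE0 using a(1) 0 by simp
      ultimately show ?thesis unfolding tors_bdry_def Suc 0 by simp
     next
      case (Suc j)
      then obtain b where b: "b : tors R zs (E j)" "x *[E k] a -[E k] snd u = d j b" using wb unfolding tors_bdry_def by auto
      have "x *[E k] a -[E k] d j b = snd u" unfolding b(2)[symmetric] by (rule mm[OF cc(3,2)])
      then have "u = D (Suc j) (a, b)" using a(2) Suc by (simp add: D prod_eq_iff)
      moreover have "(a, b) : tors R zs (C (Suc j))" unfolding TC using a(1) b(1) Suc by simp
      ultimately show ?thesis unfolding tors_bdry_def \<open>p = Suc k\<close> Suc by simp
     qed
    qed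
   qed
  qed
 next
  assume vC: "\<forall>p\<le>n. van R zs C D p"
  show "\<forall>p\<le>n. van R zs E d p"
  proof (intro allI impI)
   fix p assume p: "p \<le> n"
   have vp: "van R zs C D p" using vC p by blast
   have B: "submodule (tors_bdry R zs E d p) R (E p)" by (rule tors_cocycles_submodule(2)[OF c(1) zs_carrier])
   \<comment> \<open>If \<open>x u = d b\<close>, then \<open>(u, b)\<close> is a cocycle of the
     cone, hence a boundary, and its first component shows that \<open>u\<close> is a
     boundary.\<close>
   have step: "u : tors_bdry R zs E d p"
    if u: "u : tors R zs (E p)" "d p u = 0[E (Suc p)]" and xu: "x *[E p] u : tors_bdry R zs E d p" for u
   proof (cases p)
    case 0
    have "(u, 0[E 0]) : tors_cocycles R zs C D 0"
     unfolding tors_cocycles_def TC TE0 using u xu 0 by (simp add: C D tors_bdry_def)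
    then have "(u, 0[E 0]) = 0[C 0]" using C0 unfolding van_def tors_bdry_def by auto
    then show ?thesis unfolding tors_bdry_def 0 by (simp add: C)
   next
    case (Suc k)
    then obtain b where b: "b : tors R zs (E k)" "x *[E p] u = d k b" using xu unfolding tors_bdry_def by auto
    have "d k b : carrier (E (Suc k))" using dc tors_carrier[OF b(1)] by blast
    then have "(u, b) : tors_cocycles R zs C D (Suc k)"
     unfolding tors_cocycles_def TC using u b Suc by (simp add: C D)
    then have "(u, b) : D k ` tors R zs (C k)" using vp unfolding van_def tors_bdry_def Suc by auto
    then obtain v where v: "v : tors R zs (C k)" "(u, b) = D k v" by blast
    have "u = d k (fst v)" using v(2) by (cases k) (simp_all add: D)
    moreover have "fst v : tors R zs (E k)" using v(1) by (cases k) (auto simp: TC)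
    ultimately show ?thesis unfolding tors_bdry_def Suc by simp
   qed
   \<comment> \<open>Descent on the power of \<open>x\<close> that kills \<open>u\<close>; it ends
     at \<open>u = 0\<close>.\<close>
   have kill: "u : tors R zs (E p) ==> d p u = 0[E (Suc p)] ==> (x [^]\<^bsub>R\<^esub> k) *[E p] u = 0[E p] ==> u : tors_bdry R zs E d p" for u and k :: nat
   proof (induction k arbitrary: u)
    case 0
    then have "u = 0[E p]" using tors_carrier[OF 0(1)] by simp
    then show ?case using E.sub_zero[OF B] by simp
   next
    case (Suc k)
    have uc: "u : carrier (E p)" by (rule tors_carrier[OF Suc.prems(1)])
    have "x *[E p] u : tors_bdry R zs E d p"
    proof (rule Suc.IH)
     show "x *[E p] u : tors R zs (E p)" by (rule E.submoduleE(4)[OF TE xR Suc.prems(1)])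
     show "d p (x *[E p] u) = 0[E (Suc p)]" using dx[OF uc] Suc.prems(2) xR by simp
     show "(x [^]\<^bsub>R\<^esub> k) *[E p] (x *[E p] u) = 0[E p]" using Suc.prems(3) E.pow_Suc_smult[OF xR uc] by simp
    qed
    then show ?case using step Suc.prems(1,2) by blast
   qed
   show "van R zs E d p" unfolding van_def
   proof
    fix u assume "u : tors_cocycles R zs E d p"
    then have u: "u : tors R zs (E p)" "d p u = 0[E (Suc p)]" unfolding tors_cocycles_def by auto
    obtain k :: nat where "(x [^]\<^bsub>R\<^esub> k) *[E p] u = 0[E p]" using tors_pow_kill[OF m zs_carrier _ u(1)] x I_gen by blast
    then show "u : tors_bdry R zs E d p" using kill u by blast
   qed
  qed
 qed
 also have "\<dots> \<longleftrightarrow> (\<forall>p<n. van R zs E' d' p)"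
 proof
  assume "\<forall>p\<le>n. van R zs C D p"
  then show "\<forall>p<n. van R zs E' d' p" using cmp Suc_leI by blast
 next
  assume h: "\<forall>p<n. van R zs E' d' p"
  show "\<forall>p\<le>n. van R zs C D p"
  proof (intro allI impI)
   fix p assume "p \<le> n"
   then show "van R zs C D p" using h cmp C0 by (cases p) auto
  qed
 qed
 finally show ?thesis by blast
qed

end

lemma seq_submodule_snoc:
 assumes M: "module R M" and xs: "set xs <= carrier R" and x: "x : carrier R"
 shows "submodule (seq_submodule R M xs) R M"
  and "y : seq_submodule R M (xs @ [x]) \<longleftrightarrow> (\<exists>h\<in>seq_submodule R M xs. \<exists>w\<in>carrier M. y = h +[M] x *[M] w)"
proof -
 interpret M: module R M by fact
 let ?S = "%xs. {r *[M] y | r y. r : set xs \<and> y : carrier M}"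
 let ?H = "seq_submodule R M xs" and ?H' = "seq_submodule R M (xs @ [x])"
 have Sc: "?S xs <= carrier M" "?S (xs @ [x]) <= carrier M" using xs x by auto
 show H: "submodule ?H R M" unfolding seq_submodule_def by (rule M.gen_sub[OF Sc(1)])
 have H': "submodule ?H' R M" unfolding seq_submodule_def by (rule M.gen_sub[OF Sc(2)])
 have Hc: "?H <= carrier M" by (rule M.submoduleE(1)[OF H])
 let ?G = "{h +[M] x *[M] w | h w. h : ?H \<and> w : carrier M}"
 have G: "submodule ?G R M"
 proof (rule M.submoduleI', goal_cases)
  case 1 show ?case using Hc x by auto
 next
  case 2
  have "0[M] = 0[M] +[M] x *[M] 0[M]" using x by simp
  then show ?case using M.sub_zero[OF H] M.M.zero_closed by blast
 next
  case (3 a b)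
  then obtain h w h' w' where e: "h : ?H" "w : carrier M" "a = h +[M] x *[M] w" "h' : ?H" "w' : carrier M" "b = h' +[M] x *[M] w'" by blast
  have c: "h : carrier M" "h' : carrier M" using e Hc by auto
  have "a +[M] b = (h +[M] h') +[M] x *[M] (w +[M] w')"
   unfolding e(3,6) using c e(2,5) x by (simp add: M.M.add_add_swap M.smult_r_distr)
  then show ?case using M.submoduleE(5)[OF H e(1,4)] M.M.a_closed[OF e(2,5)] by blast
 next
  case (4 r a)
  then obtain h w where e: "h : ?H" "w : carrier M" "a = h +[M] x *[M] w" by blast
  have c: "h : carrier M" using e Hc by auto
  have "r *[M] a = r *[M] h +[M] x *[M] (r *[M] w)"
   unfolding e(3) using c e(2) x 4(1) M.smult_commute[OF 4(1) x e(2)] by (simp add: M.smult_r_distr)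
  then show ?case using M.submoduleE(4)[OF H 4(1) e(1)] M.smult_closed[OF 4(1) e(2)] by blast
 qed
 have "?S (xs @ [x]) <= ?G"
 proof
  fix y assume "y : ?S (xs @ [x])"
  then obtain r w where y: "y = r *[M] w" "r : set xs \<or> r = x" "w : carrier M" by auto
  show "y : ?G"
  proof (cases "r = x")
   case True
   then have "y = 0[M] +[M] x *[M] w" using y x by simp
   then show ?thesis using M.sub_zero[OF H] y(3) by blast
  next
   case False
   then have r: "r : set xs" using y(2) by blast
   then have "y : ?H" unfolding seq_submodule_def using M.gen_incl[of "?S xs"] y by blast
   moreover have "y = y +[M] x *[M] 0[M]" using y x r xs by auto
   ultimately show ?thesis using M.M.zero_closed by blast
  qed
 qed
 then have "?H' <= ?G" unfolding seq_submodule_def by (rule M.gen_submodule_minimal[OF G[unfolded seq_submodule_def]])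
 moreover have "?G <= ?H'"
 proof
  fix y assume "y : ?G"
  then obtain h w where e: "h : ?H" "w : carrier M" "y = h +[M] x *[M] w" by blast
  have "?H <= ?H'" unfolding seq_submodule_def by (rule M.gen_submodule_mono) auto
  moreover have "x *[M] w : ?H'" unfolding seq_submodule_def using M.gen_incl[of "?S (xs @ [x])"] e(2) by fastforce
  ultimately show "y : ?H'" unfolding e(3) using M.submoduleE(5)[OF H'] e(1) by blast
 qed
 ultimately show "y : ?H' \<longleftrightarrow> (\<exists>h\<in>?H. \<exists>w\<in>carrier M. y = h +[M] x *[M] w)" by blast
qed

lemma fin_gen_image:
 assumes fg: "fin_gen_module R M" and Q: "module R Q" and p: "p : mod_hom R M Q" "p ` carrier M = carrier Q"
 shows "fin_gen_module R Q"
proof -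
 have M: "module R M" using fg unfolding fin_gen_module_def by blast
 interpret Q: module R Q by fact
 obtain S where S: "S <= carrier M" "finite S" "gen_submodule R M S = carrier M" using fg unfolding fin_gen_module_def by blast
 have pS: "p ` S <= carrier Q" using S(1) p(2) by blast
 have "carrier Q <= gen_submodule R Q (p ` S)"
  unfolding p(2)[symmetric] using mod_hom_gen_submodule[OF p(1) M Q S(1)] S(3) by auto
 then have "gen_submodule R Q (p ` S) = carrier Q" using Q.gen_submodule_carrier[OF pS] by blast
 then show ?thesis unfolding fin_gen_module_def using Q pS S(2) by blast
qed

context aug_algebra
begin

lemma resolution_of:
 assumes "module R M"
 obtains E d \<eta> where "chosen_resolution R M = (E, d)" "injective_resolution R M \<eta> E d" "lc_zero R zs M = van R zs E d"
proof -
 obtain E d where e: "chosen_resolution R M = (E, d)" by (cases "chosen_resolution R M")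
 obtain \<eta> where "injective_resolution R M \<eta> E d" using chosen_resolution_injective[OF field_K hom_\<iota> noeth assms e] by blast
 then show thesis using that[OF e] by (simp add: lc_zero_def e fun_eq_iff)
qed

text \<open>An element killed by \<open>I\<close> is torsion, so its image in the resolution is a
  torsion cocycle of degree 0, and there the only boundary is zero.\<close>

lemma lc_zero_0_socle:
 assumes M: "module R M" and z: "lc_zero R zs M 0" and q: "q : carrier M" "!!r. r : I ==> r *[M] q = 0[M]"
 shows "q = 0[M]"
proof -
 obtain E d \<eta> where "chosen_resolution R M = (E, d)" and r: "injective_resolution R M \<eta> E d" and v: "lc_zero R zs M = van R zs E d"
  by (rule resolution_of[OF M])
 note c = injective_resolution_cplx[OF r] and rr = r[unfolded injective_resolution_iff]
 interpret M: module R M by fact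
 have m: "module R (E 0)" by (rule cplxD(1)[OF c(1)])
 have \<eta>: "\<eta> : mod_hom R M (E 0)" "inj_on \<eta> (carrier M)" "\<eta> ` carrier M = {x : carrier (E 0). d 0 x = 0[E (Suc 0)]}" using rr by auto
 have zI: "set zs <= I" unfolding I_gen gen_submodule_def by blast
 have "q : tors R zs M"
 proof -
  have "(z [^]\<^bsub>R\<^esub> (1::nat)) *[M] q = 0[M]" if "z : set zs" for z
  proof -
   have "z : carrier R" "z : I" using that zs_carrier zI by blast+
   then show ?thesis using q(2)[of z] by simp
  qed
  then show ?thesis unfolding tors_def using q(1) by blast
 qed
 then have "\<eta> q : tors R zs (E 0)" by (rule tors_mod_hom[OF \<eta>(1) M m zs_carrier])
 moreover have "d 0 (\<eta> q) = 0[E (Suc 0)]" using \<eta>(3) q(1) by blast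
 moreover have "van R zs E d 0" using z v by simp
 ultimately have "\<eta> q = 0[E 0]" unfolding van_def tors_cocycles_def tors_bdry_def by auto
 then have "\<eta> q = \<eta> 0[M]" using mod_hom_zero[OF \<eta>(1) M m] by simp
 then show ?thesis using inj_on_eq_iff[OF \<eta>(2) q(1)] by simp
qed

text \<open>\<open>Q\<close> stands for \<open>M\<close> modulo \<open>xs\<close>. It is a variable,
  since for the empty sequence \<open>M\<close> itself is used: its chosen resolution lies in
  another type than that of the quotient of \<open>M\<close> by zero.\<close>

lemma depth_step:
 assumes M: "module R M" and xs: "set xs <= carrier R" and x: "x : I" and mQ: "module R Q" and p: "p : mod_hom R M Q"
  and ps: "p ` carrier M = carrier Q" and pk: "!!a. a : carrier M ==> p a = 0[Q] \<longleftrightarrow> a : seq_submodule R M xs"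
  and reg: "!!y. y : carrier Q ==> x *[Q] y = 0[Q] ==> y = 0[Q]"
 shows "(\<forall>p\<le>n. lc_zero R zs Q p) \<longleftrightarrow> (\<forall>p<n. lc_zero R zs (quot_module M (seq_submodule R M (xs @ [x]))) p)"
proof -
 interpret M: module R M by fact
 have xR: "x : carrier R" by (rule ideal.Icarr[OF I_ideal x])
 let ?H = "seq_submodule R M xs" and ?H' = "seq_submodule R M (xs @ [x])"
 let ?Q' = "quot_module M ?H'"
 have H: "submodule ?H R M" by (rule seq_submodule_snoc(1)[OF M xs xR])
 have H': "submodule ?H' R M" by (rule seq_submodule_snoc(1)[OF M _ xR]) (use xs xR in auto)
 note H'iff = seq_submodule_snoc(2)[OF M xs xR]
 note mQ = mQ M.quot_module_module[OF H']
 interpret Q: module R Q by (rule mQ)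
 let ?p' = "%a. ?H' +>\<^bsub>M\<^esub> a"
 note p' = M.quot_proj_hom[OF H'] and ps' = M.quot_proj_surj[OF H']
 have pk': "!!a. a : carrier M ==> ?p' a = 0[?Q'] \<longleftrightarrow> a : ?H'" using M.quot_proj_kernel[OF H'] by simp
 have HH': "?H <= ?H'"
 proof
  fix h assume h: "h : ?H"
  then have "h = h +[M] x *[M] 0[M]" using M.submoduleE(1)[OF H] xR by auto
  then show "h : ?H'" unfolding H'iff using h M.M.zero_closed by blast
 qed
 have "\<exists>h\<in>mod_hom R (Q\<lparr>carrier := p ` carrier M\<rparr>) ?Q'. \<forall>a\<in>carrier M. h (p a) = ?p' a"
  by (rule hom_factor[OF M mQ p p']) (use pk pk' HH' in blast)
 then obtain q where q: "q : mod_hom R Q ?Q'" "!!a. a : carrier M ==> q (p a) = ?p' a"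
  unfolding ps by (auto simp: mod_hom_def hom_def)
 have qs: "q ` carrier Q = carrier ?Q'"
  unfolding ps[symmetric] ps'[symmetric] image_image by (rule image_cong[OF refl q(2)])
 have qker: "q y = 0[?Q'] \<longleftrightarrow> (\<exists>w\<in>carrier Q. y = x *[Q] w)" if y: "y : carrier Q" for y
 proof -
  have "y : p ` carrier M" unfolding ps by (rule y)
  then obtain a where a: "a : carrier M" "y = p a" by blast
  have "q y = 0[?Q'] \<longleftrightarrow> a : ?H'" unfolding a(2) q(2)[OF a(1)] by (rule pk'[OF a(1)])
  also have "\<dots> \<longleftrightarrow> (\<exists>w\<in>carrier M. a -[M] x *[M] w : ?H)"
  proof
   assume "a : ?H'"
   then obtain h w where hw: "h : ?H" "w : carrier M" "a = h +[M] x *[M] w" unfolding H'iff by blast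
   have "h : carrier M" using hw(1) M.submoduleE(1)[OF H] by blast
   then have "a -[M] x *[M] w = h" unfolding hw(3) using hw(2) xR by (simp add: M.M.add_minus_cancel)
   then show "\<exists>w\<in>carrier M. a -[M] x *[M] w : ?H" using hw by (intro bexI[of _ w]) simp_all
  next
   assume "\<exists>w\<in>carrier M. a -[M] x *[M] w : ?H"
   then obtain w where w: "w : carrier M" "a -[M] x *[M] w : ?H" by blast
   have "a = (a -[M] x *[M] w) +[M] x *[M] w" using a(1) w(1) xR by (simp add: M.M.minus_add_cancel)
   then show "a : ?H'" unfolding H'iff using w by blast
  qed
  also have "\<dots> \<longleftrightarrow> (\<exists>w\<in>carrier M. p a = x *[Q] p w)"
  proof -
   have "a -[M] x *[M] w : ?H \<longleftrightarrow> p a = x *[Q] p w" if w: "w : carrier M" for w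
   proof -
    have xw: "x *[M] w : carrier M" using xR w by simp
    have "a -[M] x *[M] w : ?H \<longleftrightarrow> p (a -[M] x *[M] w) = 0[Q]" using pk[of "a -[M] x *[M] w"] a(1) xw by blast
    also have "p (a -[M] x *[M] w) = p a -[Q] x *[Q] p w"
     unfolding mod_hom_minus[OF p M mQ(1) a(1) xw] mod_homD(3)[OF p xR w] ..
    also have "\<dots> = 0[Q] \<longleftrightarrow> p a = x *[Q] p w"
     by (rule Q.M.minus_eq_zero_iff[OF mod_homD(1)[OF p a(1)] Q.smult_closed[OF xR mod_homD(1)[OF p w]]])
    finally show ?thesis .
   qed
   then show ?thesis by blast
  qed
  also have "\<dots> \<longleftrightarrow> (\<exists>w\<in>carrier Q. y = x *[Q] w)" unfolding ps[symmetric] a(2) by blast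
  finally show ?thesis .
 qed
 obtain E d \<eta> where "chosen_resolution R Q = (E, d)" and r: "injective_resolution R Q \<eta> E d" and v: "lc_zero R zs Q = van R zs E d"
  by (rule resolution_of[OF mQ(1)])
 obtain E' d' \<eta>' where "chosen_resolution R ?Q' = (E', d')" and r': "injective_resolution R ?Q' \<eta>' E' d'" and v': "lc_zero R zs ?Q' = van R zs E' d'"
  by (rule resolution_of[OF mQ(2)])
 show ?thesis unfolding v v' by (rule cone_step[OF r r' mQ x reg q(1) qs qker])
qed

text \<open>Dividing by a regular element lowers the first nonvanishing degree by one, and as long
  as degree 0 vanishes there is a regular element in \<open>I\<close>. Nakayama's lemma keeps the
  quotients nonzero.\<close>

theorem depth_eq:
 assumes L: "local_ring R I" and fg: "fin_gen_module R M" and ne: "carrier M \<noteq> {0[M]}"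
 shows "depth R I M = Inf {enat p | p. \<not> lc_zero R zs M p}"
proof -
 have M: "module R M" using fg unfolding fin_gen_module_def by blast
 interpret M: module R M by (rule M)
 have IR: "I <= carrier R" using ideal.Icarr[OF I_ideal] by blast
 let ?H = "seq_submodule R M"
 have e: "?H [] = {0[M]}"
  unfolding seq_submodule_def using M.gen_submodule_minimal[OF M.submodule_zero, of "{}"]
   M.sub_zero[OF M.gen_sub[of "{}"]] by auto
 \<comment> \<open>For the empty sequence \<open>M\<close> replaces the isomorphic quotient by zero,
   so that the claim speaks of the resolution chosen for \<open>M\<close>.\<close>
 let ?lz = "%xs p. if xs = [] then lc_zero R zs M p else lc_zero R zs (quot_module M (?H xs)) p"
 let ?V = "%xs n. \<forall>p<n. ?lz xs p"
 have H: "submodule (?H xs) R M" if "set xs <= I" for xs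
  by (rule seq_submodule_snoc(1)[OF M subset_trans[OF that IR] M.R.zero_closed])
 note pker = M.quot_proj_kernel[OF H] and phom = M.quot_proj_hom[OF H] and psurj = M.quot_proj_surj[OF H]
 have smq: "x *[quot_module M (?H xs)] (?H xs +>\<^bsub>M\<^esub> a) = ?H xs \<longleftrightarrow> x *[M] a : ?H xs" if "set xs <= I" "x : I" "a : carrier M" for xs x a
  unfolding mod_homD(3)[OF phom[OF that(1)] subsetD[OF IR that(2)] that(3), symmetric] by (rule pker[OF that(1)]) (use IR that in auto)
 have step: "(\<forall>p\<le>n. ?lz xs p) \<longleftrightarrow> ?V (xs @ [x]) n" if xs: "set xs <= I" and x: "x : I"
  and reg: "!!a. a : carrier M ==> x *[M] a : ?H xs ==> a : ?H xs" for xs x n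
 proof (cases "xs = []")
  case True
  have "(\<forall>p\<le>n. lc_zero R zs M p) \<longleftrightarrow> (\<forall>p<n. lc_zero R zs (quot_module M (?H ([] @ [x]))) p)"
   by (rule depth_step[OF M _ x M, where p = "%a. a"]) (use reg True in \<open>auto simp: e intro: mod_homI\<close>)
  then show ?thesis using True by simp
 next
  case False
  have "(\<forall>p\<le>n. lc_zero R zs (quot_module M (?H xs)) p) \<longleftrightarrow> (\<forall>p<n. lc_zero R zs (quot_module M (?H (xs @ [x]))) p)"
  proof (rule depth_step[OF M subset_trans[OF xs IR] x M.quot_module_module[OF H[OF xs]] phom[OF xs] psurj[OF xs]])
   fix y assume y: "y : carrier (quot_module M (?H xs))" "x *[quot_module M (?H xs)] y = 0[quot_module M (?H xs)]"
   obtain a where a: "a : carrier M" "y = ?H xs +>\<^bsub>M\<^esub> a" using y(1) unfolding psurj[OF xs, symmetric] by blast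
   show "y = 0[quot_module M (?H xs)]"
    using y(2) smq[OF xs x a(1)] reg[OF a(1)] pker[OF xs a(1)] unfolding a(2) quot_module_simps by blast
  qed (use pker[OF xs] in simp)
  then show ?thesis using False by simp
 qed
 have rs: "regular_sequence R M xs \<longleftrightarrow> ?H xs \<noteq> carrier M \<and>
   (\<forall>i<length xs. \<forall>a\<in>carrier M. xs ! i *[M] a : ?H (take i xs) --> a : ?H (take i xs))" if xs: "set xs <= I" for xs
 proof -
  have "(\<forall>z\<in>carrier (quot_module M (?H (take i xs))). xs ! i *[quot_module M (?H (take i xs))] z = ?H (take i xs) --> z = ?H (take i xs)) \<longleftrightarrow>
    (\<forall>a\<in>carrier M. xs ! i *[M] a : ?H (take i xs) --> a : ?H (take i xs))" if i: "i < length xs" for i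
  proof -
   have t: "set (take i xs) <= I" using xs set_take_subset[of i xs] by blast
   have x: "xs ! i : I" using xs nth_mem[OF i] by blast
   let ?z = "?H (take i xs)"
   have f: "(xs ! i *[quot_module M ?z] (?z +>\<^bsub>M\<^esub> a) = ?z --> ?z +>\<^bsub>M\<^esub> a = ?z) \<longleftrightarrow>
     (xs ! i *[M] a : ?z --> a : ?z)" if "a : carrier M" for a
    unfolding smq[OF t x that] pker[OF t that] ..
   show ?thesis
   proof (intro iffI ballI)
    fix a assume h: "\<forall>z\<in>carrier (quot_module M ?z). xs ! i *[quot_module M ?z] z = ?z --> z = ?z" and a: "a : carrier M"
    from bspec[OF h mod_homD(1)[OF phom[OF t] a]] show "xs ! i *[M] a : ?z --> a : ?z" unfolding f[OF a] .
   next
    fix z assume h: "\<forall>a\<in>carrier M. xs ! i *[M] a : ?z --> a : ?z" and "z : carrier (quot_module M ?z)"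
    then obtain a where a: "a : carrier M" "z = ?z +>\<^bsub>M\<^esub> a" unfolding psurj[OF t, symmetric] by blast
    show "xs ! i *[quot_module M ?z] z = ?z --> z = ?z" unfolding a(2) f[OF a(1)] by (rule bspec[OF h a(1)])
   qed
  qed
  note g = this
  show ?thesis unfolding regular_sequence_def Let_def quot_module_simps(2)
   by (simp only: subset_trans[OF xs IR] simp_thms conj_commute[of "?H xs \<noteq> carrier M"])
    (intro arg_cong2[where f = "(\<and>)"] all_cong refl g)
 qed
 \<comment> \<open>Read from the end of the sequence: for all of \<open>xs\<close> nothing is
   claimed, and each element that is dropped gains one vanishing degree.\<close>
 have fwd: "\<forall>p<length xs. lc_zero R zs M p" if xs: "set xs <= I" "regular_sequence R M xs" for xs
 proof -
  have "j \<le> length xs ==> ?V (take (length xs - j) xs) j" for j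
  proof (induction j)
   case 0 then show ?case by simp
  next
   case (Suc j)
   let ?i = "length xs - Suc j"
   have i: "?i < length xs" "Suc ?i = length xs - j" using Suc.prems by auto
   have e': "take (length xs - j) xs = take ?i xs @ [xs ! ?i]" unfolding i(2)[symmetric] by (rule take_Suc_conv_app_nth[OF i(1)])
   have s: "set (take ?i xs) <= I" using xs(1) set_take_subset[of ?i xs] by blast
   have x: "xs ! ?i : I" using xs(1) i(1) nth_mem by blast
   have "?V (take ?i xs @ [xs ! ?i]) j" using Suc unfolding e' by simp
   then have "\<forall>p\<le>j. ?lz (take ?i xs) p" using step[OF s x, of j] xs(2) i(1) unfolding rs[OF xs(1)] by blast
   then show ?case by (simp add: less_Suc_eq_le)
  qed
  from this[of "length xs"] show ?thesis by simp
 qed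
 \<comment> \<open>The sequence is lengthened element by element, and each new element uses up one
   of the \<open>n\<close> vanishing degrees.\<close>
 have bwd: "\<exists>xs. length xs = n \<and> set xs <= I \<and> regular_sequence R M xs" if z: "\<forall>p<n. lc_zero R zs M p" for n
 proof -
  have "k \<le> n ==> \<exists>xs. length xs = k \<and> set xs <= I \<and> regular_sequence R M xs \<and> ?V xs (n - k)" for k
  proof (induction k)
   case 0
   have "regular_sequence R M []" unfolding regular_sequence_def using ne by (simp add: e)
   then show ?case using z by (intro exI[of _ "[]"]) simp
  next
   case (Suc k)
   then obtain xs where xs: "length xs = k" "set xs <= I" "regular_sequence R M xs" "?V xs (n - k)" by auto
   have sR: "set xs <= carrier R" using xs(2) IR by blast
   have l0: "?lz xs 0" using xs(4) Suc.prems by simp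
   \<comment> \<open>Vanishing in degree 0 leaves no nonzero element of the quotient killed by
     \<open>I\<close>, which is the condition for a regular element in \<open>I\<close>.\<close>
   have ex: "\<exists>x\<in>I. \<forall>a\<in>carrier M. x *[M] a : ?H xs --> a : ?H xs"
   proof (cases "xs = []")
    case True
    have "lc_zero R zs M 0" using l0 True by simp
    then show ?thesis using regular_element_exists[OF noeth fg I_ideal lc_zero_0_socle[OF M]] unfolding True e singleton_iff by blast
   next
    case False
    have Q: "module R (quot_module M (?H xs))" by (rule M.quot_module_module[OF H[OF xs(2)]])
    have fgQ: "fin_gen_module R (quot_module M (?H xs))" by (rule fin_gen_image[OF fg Q phom[OF xs(2)] psurj[OF xs(2)]])
    obtain x where x: "x : I" "\<forall>q\<in>carrier (quot_module M (?H xs)). x *[quot_module M (?H xs)] q = ?H xs --> q = ?H xs"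
     using regular_element_exists[OF noeth fgQ I_ideal lc_zero_0_socle[OF Q]] l0 False unfolding quot_module_simps(2) by auto
    have "a : ?H xs" if a: "a : carrier M" "x *[M] a : ?H xs" for a
     using x(2) smq[OF xs(2) x(1) a(1)] a pker[OF xs(2) a(1)] psurj[OF xs(2)] by blast
    then show ?thesis using x(1) by blast
   qed
   from ex obtain x where x: "x : I" "!!a. a : carrier M ==> x *[M] a : ?H xs ==> a : ?H xs" by blast
   have xR: "x : carrier R" using x(1) IR by blast
   \<comment> \<open>Otherwise the quotient by \<open>xs\<close> would equal its multiple by
     \<open>x\<close>, so it would be zero by Nakayama's lemma, against the regularity of
     \<open>xs\<close>.\<close>
   have "?H (xs @ [x]) \<noteq> carrier M"
   proof
    assume a: "?H (xs @ [x]) = carrier M"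
    have "?H xs = carrier M"
     by (rule nakayama[OF noeth L x(1) fg H[OF xs(2)]]) (use a seq_submodule_snoc(2)[OF M sR xR] in blast)
    then show False using xs(3) unfolding rs[OF xs(2)] by blast
   qed
   moreover have "\<forall>a\<in>carrier M. (xs @ [x]) ! i *[M] a : ?H (take i (xs @ [x])) --> a : ?H (take i (xs @ [x]))"
    if i: "i < length (xs @ [x])" for i
    using x(2) xs(3) i unfolding rs[OF xs(2)] by (cases "i < length xs") (auto simp: nth_append)
   ultimately have rx: "regular_sequence R M (xs @ [x])" using rs[of "xs @ [x]"] xs(2) x(1) by simp
   have nk: "n - k = Suc (n - Suc k)" using Suc.prems by simp
   have "\<forall>p\<le>n - Suc k. ?lz xs p" using xs(4) unfolding nk by (simp add: less_Suc_eq_le)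
   then have "?V (xs @ [x]) (n - Suc k)" using step[OF xs(2) x, of "n - Suc k"] by blast
   then show ?case using rx xs(1,2) x(1) by (intro exI[of _ "xs @ [x]"]) simp
  qed
  from this[of n] show ?thesis by auto
 qed
 show ?thesis
 proof (rule antisym)
  show "depth R I M \<le> Inf {enat p | p. \<not> lc_zero R zs M p}"
   unfolding depth_def
  proof (intro Sup_least Inf_greatest)
   fix a b assume "a : {enat (length xs) |xs. set xs <= I \<and> regular_sequence R M xs}" "b : {enat p | p. \<not> lc_zero R zs M p}"
   then obtain xs p where "a = enat (length xs)" "set xs <= I" "regular_sequence R M xs" "b = enat p" "\<not> lc_zero R zs M p" by blast
   then show "a \<le> b" using fwd[of xs] by (auto simp: not_less[symmetric])
  qed
  have ge: "enat n \<le> depth R I M" if "\<forall>p<n. lc_zero R zs M p" for n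
   using bwd[OF that] unfolding depth_def by (auto intro!: Sup_upper)
  show "Inf {enat p | p. \<not> lc_zero R zs M p} \<le> depth R I M"
  proof (cases "\<exists>p. \<not> lc_zero R zs M p")
   case True
   define p where "p = (LEAST p. \<not> lc_zero R zs M p)"
   have "\<not> lc_zero R zs M p" unfolding p_def using LeastI_ex[OF True] .
   then have "Inf {enat p | p. \<not> lc_zero R zs M p} \<le> enat p" by (intro Inf_lower) blast
   also have "\<dots> \<le> depth R I M" by (rule ge) (use not_less_Least p_def in blast)
   finally show ?thesis .
  next
   case False
   then have "enat n \<le> depth R I M" for n using ge by blast
   then have "depth R I M = \<infinity>" by (metis enat_ord_simps(1) not_infinity_eq Suc_n_not_le_n)
   then show ?thesis by simp
  qed
 qed
qed

end

section \<open>Tensor products and actions on them\<close>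

definition tns :: "('k, 'r) ring_scheme => ('k, 'x, 'xx) module_scheme => ('k, 'y, 'yy) module_scheme =>
  'x => 'y => ('x \<times> 'y \<Rightarrow>\<^sub>0 int) set"
 where "tns K P Q x y = tensor_class K P Q (frag_of (x, y))"

text \<open>\<open>Z\<close> stands for any structure whose additive group is \<open>P \<otimes>\<^sub>K Q\<close>, such as the tensor product ring
 or a tensor product module.\<close>

locale tensor_rep = P: module K P + Q: module K Q
 for K :: "('k, 'r) ring_scheme" and P :: "('k, 'x, 'xx) module_scheme" and Q :: "('k, 'y, 'yy) module_scheme" +
 fixes Z :: "(('x \<times> 'y \<Rightarrow>\<^sub>0 int) set, 'zz) ring_scheme"
 assumes carrier_Z: "carrier Z = carrier (tensor_group K P Q)" and add_Z: "ring.add Z = monoid.mult (tensor_group K P Q)"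
  and zero_Z: "0[Z] = 1[tensor_group K P Q]"
begin

abbreviation pure (infixl \<open>\<boxtimes>\<close> 75) where "x \<boxtimes> y \<equiv> tns K P Q x y"

lemma relators_carrier: "tensor_relators K P Q <= carrier (tensor_free P Q)"
proof
 have d: "Poly_Mapping.keys (u - v) <= carrier P \<times> carrier Q"
  if "Poly_Mapping.keys u <= carrier P \<times> carrier Q" "Poly_Mapping.keys v <= carrier P \<times> carrier Q" for u v :: "'x \<times> 'y \<Rightarrow>\<^sub>0 int"
  using that keys_diff[of u v] by blast
 have k: "Poly_Mapping.keys (frag_of (x, y)) <= carrier P \<times> carrier Q" if "x : carrier P" "y : carrier Q" for x y
  using that by simp
 fix w assume "w : tensor_relators K P Q"
 then show "w : carrier (tensor_free P Q)"
  unfolding tensor_relators_def carrier_free_Abelian_group_iff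
  by (elim UnE CollectE exE conjE; hypsubst; intro d k) simp_all
qed

lemma null_subgroup: "subgroup (tensor_null K P Q) (tensor_free P Q)"
 unfolding tensor_null_def by (rule group.generate_is_subgroup[OF group_free_Abelian_group relators_carrier])

lemma null_normal: "tensor_null K P Q \<lhd> tensor_free P Q"
 by (rule comm_group.normal_iff_subgroup[OF abelian_free_Abelian_group, THEN iffD2, OF null_subgroup])

lemma comm_tensor_group: "comm_group (tensor_group K P Q)"
 unfolding tensor_group_def by (rule comm_group.abelian_FactGroup[OF abelian_free_Abelian_group null_subgroup])

lemma Z_group: "abelian_group Z"
proof -
 interpret G: comm_group "tensor_group K P Q" by (rule comm_tensor_group)
 show ?thesis
 proof (rule abelian_groupI)
  show "x +[Z] y = y +[Z] x" if "x : carrier Z" "y : carrier Z" for x y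
   using that G.m_comm by (simp add: carrier_Z add_Z)
 qed (simp_all add: carrier_Z add_Z zero_Z G.m_assoc G.l_inv_ex)
qed

sublocale Z: abelian_group Z by (rule Z_group)

lemma class_surj: "carrier Z = tensor_class K P Q ` {u. Poly_Mapping.keys u <= carrier P \<times> carrier Q}"
 unfolding carrier_Z tensor_group_def carrier_FactGroup tensor_class_def by auto

lemma class_add:
 assumes "Poly_Mapping.keys u <= carrier P \<times> carrier Q" "Poly_Mapping.keys v <= carrier P \<times> carrier Q"
 shows "tensor_class K P Q (u + v) = tensor_class K P Q u +[Z] tensor_class K P Q v"
 using normal.rcos_sum[OF null_normal, of u v] assms by (simp add: add_Z tensor_group_def tensor_class_def)

lemma class_closed: "Poly_Mapping.keys u <= carrier P \<times> carrier Q ==> tensor_class K P Q u : carrier Z"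
 unfolding class_surj by blast

lemma class_self: "Poly_Mapping.keys u <= carrier P \<times> carrier Q ==> u : tensor_class K P Q u"
 unfolding tensor_class_def by (rule group.rcos_self[OF group_free_Abelian_group _ null_subgroup]) simp

lemma class_repr:
 assumes u: "Poly_Mapping.keys u <= carrier P \<times> carrier Q" and w: "w : tensor_class K P Q u"
 shows "Poly_Mapping.keys w <= carrier P \<times> carrier Q \<and> tensor_class K P Q w = tensor_class K P Q u"
proof
 have uF: "u : carrier (tensor_free P Q)" using u by simp
 have "w : carrier (tensor_free P Q)"
  using monoid.r_coset_subset_G[OF group.is_monoid[OF group_free_Abelian_group] subgroup.subset[OF null_subgroup] uF] w
  unfolding tensor_class_def by (rule subsetD)
 then show "Poly_Mapping.keys w <= carrier P \<times> carrier Q" by simp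
 show "tensor_class K P Q w = tensor_class K P Q u"
  using group.repr_independence[OF group_free_Abelian_group _ uF null_subgroup, of w] w unfolding tensor_class_def by simp
qed

lemma class_zero: "tensor_class K P Q 0 = 0[Z]"
proof -
 have "tensor_class K P Q 0 = tensor_class K P Q 0 +[Z] tensor_class K P Q 0" using class_add[of 0 0] by simp
 then show ?thesis using Z.r_zero Z.add.l_cancel_one' class_closed[of 0] by simp
qed

lemma class_minus:
 assumes "Poly_Mapping.keys u <= carrier P \<times> carrier Q" "Poly_Mapping.keys v <= carrier P \<times> carrier Q"
 shows "tensor_class K P Q (u - v) = tensor_class K P Q u -[Z] tensor_class K P Q v"
proof -
 have k: "Poly_Mapping.keys (u - v) <= carrier P \<times> carrier Q" using keys_diff[of u v] assms by blast
 have "tensor_class K P Q u = tensor_class K P Q (u - v) +[Z] tensor_class K P Q v"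
  using class_add[OF k assms(2)] by simp
 then show ?thesis using Z.add_minus_cancel[OF class_closed[OF k] class_closed[OF assms(2)]] by simp
qed

lemma class_null: assumes "u : tensor_relators K P Q" shows "tensor_class K P Q u = 0[Z]"
proof -
 have "u : tensor_null K P Q" unfolding tensor_null_def by (rule generate.incl[OF assms])
 then have "tensor_class K P Q u = tensor_null K P Q"
  unfolding tensor_class_def by (rule subgroup.rcos_const[OF null_subgroup group_free_Abelian_group])
 also have "\<dots> = 0[Z]" by (simp add: zero_Z tensor_group_def)
 finally show ?thesis .
qed

lemma keys_pure: "x : carrier P ==> y : carrier Q ==> Poly_Mapping.keys (frag_of (x, y)) <= carrier P \<times> carrier Q"
 by simp

lemma pure_closed [simp]: "x : carrier P ==> y : carrier Q ==> x \<boxtimes> y : carrier Z"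
 unfolding tns_def by (rule class_closed) simp

lemma pure_rel:
 assumes "frag_of (x, y) - frag_of (x', y') : tensor_relators K P Q"
  and "x : carrier P" "y : carrier Q" "x' : carrier P" "y' : carrier Q"
 shows "x \<boxtimes> y = x' \<boxtimes> y'"
 using class_null[OF assms(1)] class_minus[OF keys_pure keys_pure, of x y x' y'] assms(2-)
 by (simp add: Z.minus_eq_zero_iff tns_def[symmetric])

lemma pure_rel3:
 assumes "frag_of (x, y) - frag_of (x', y') - frag_of (x'', y'') : tensor_relators K P Q"
  and c: "x : carrier P" "y : carrier Q" "x' : carrier P" "y' : carrier Q" "x'' : carrier P" "y'' : carrier Q"
 shows "x \<boxtimes> y = x' \<boxtimes> y' +[Z] x'' \<boxtimes> y''"
proof -
 have e: "frag_of (x, y) - frag_of (x', y') - frag_of (x'', y'') = frag_of (x, y) - (frag_of (x', y') + frag_of (x'', y''))" by simp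
 have k: "Poly_Mapping.keys (frag_of (x', y') + frag_of (x'', y'')) <= carrier P \<times> carrier Q"
  using keys_add[of "frag_of (x', y')" "frag_of (x'', y'')"] c by auto
 show ?thesis
  using class_null[OF assms(1)] class_minus[OF keys_pure k, of x y] class_add[OF keys_pure keys_pure, of x' y' x'' y''] c
  unfolding e by (simp add: Z.minus_eq_zero_iff tns_def[symmetric])
qed

lemma pure_add_left: "x : carrier P ==> x' : carrier P ==> y : carrier Q ==> (x +[P] x') \<boxtimes> y = x \<boxtimes> y +[Z] x' \<boxtimes> y"
 by (rule pure_rel3) (auto simp: tensor_relators_def)

lemma pure_add_right: "x : carrier P ==> y : carrier Q ==> y' : carrier Q ==> x \<boxtimes> (y +[Q] y') = x \<boxtimes> y +[Z] x \<boxtimes> y'"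
 by (rule pure_rel3) (auto simp: tensor_relators_def)

lemma pure_balanced: "c : carrier K ==> x : carrier P ==> y : carrier Q ==> (c *[P] x) \<boxtimes> y = x \<boxtimes> (c *[Q] y)"
 by (rule pure_rel) (auto simp: tensor_relators_def)

lemma pure_zero_left [simp]: "y : carrier Q ==> 0[P] \<boxtimes> y = 0[Z]"
 using pure_add_left[of "0[P]" "0[P]" y] Z.add.l_cancel_one'[of "0[P] \<boxtimes> y" "0[P] \<boxtimes> y"] by simp

lemma pure_zero_right [simp]: "x : carrier P ==> x \<boxtimes> 0[Q] = 0[Z]"
 using pure_add_right[of x "0[Q]" "0[Q]"] Z.add.l_cancel_one'[of "x \<boxtimes> 0[Q]" "x \<boxtimes> 0[Q]"] by simp

lemma pure_minus_left: 
 assumes "x : carrier P" "x' : carrier P" "y : carrier Q" shows "(x -[P] x') \<boxtimes> y = x \<boxtimes> y -[Z] x' \<boxtimes> y"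
proof -
 have "x \<boxtimes> y = (x -[P] x') \<boxtimes> y +[Z] x' \<boxtimes> y"
  using pure_add_left[of "x -[P] x'" x' y] assms by (simp add: P.M.minus_add_cancel)
 then show ?thesis by (intro Z.minus_eq_iff[THEN iffD2, symmetric]) (use assms in simp_all)
qed

lemma pure_minus_right: 
 assumes "x : carrier P" "y : carrier Q" "y' : carrier Q" shows "x \<boxtimes> (y -[Q] y') = x \<boxtimes> y -[Z] x \<boxtimes> y'"
proof -
 have "x \<boxtimes> y = x \<boxtimes> (y -[Q] y') +[Z] x \<boxtimes> y'"
  using pure_add_right[of x "y -[Q] y'" y'] assms by (simp add: Q.M.minus_add_cancel)
 then show ?thesis by (intro Z.minus_eq_iff[THEN iffD2, symmetric]) (use assms in simp_all)
qed

text \<open>The negative of a pure tensor is pure, so sums of pure tensors are everything. The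
  induction over formal sums proceeds by differences and therefore carries both a class and its
  negative.\<close>

lemma tensor_induct [consumes 1, case_names pure add]:
 assumes z: "z : carrier Z" and pure: "!!x y. x : carrier P ==> y : carrier Q ==> C (x \<boxtimes> y)"
  and add: "!!z w. z : carrier Z ==> w : carrier Z ==> C z ==> C w ==> C (z +[Z] w)"
 shows "C z"
proof -
 let ?S = "carrier P \<times> carrier Q"
 obtain u where u: "Poly_Mapping.keys u <= ?S" "z = tensor_class K P Q u" using z unfolding class_surj by blast
 have C0: "C 0[Z]" using pure[of "0[P]" "0[Q]"] by simp
 have "Poly_Mapping.keys u <= ?S \<and> C (tensor_class K P Q u) \<and> C (-[Z] tensor_class K P Q u)"
  using u(1)
 proof (induction u rule: frag_induction)
  case zero
  have m: "-[Z] 0[Z] = 0[Z]" by (rule Z.minus_equality) simp_all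
  show ?case unfolding class_zero m using C0 by simp
 next
  case (one s)
  obtain x y where s: "s = (x, y)" "x : carrier P" "y : carrier Q" using one by (cases s) auto
  have "-[Z] (x \<boxtimes> y) = (-[P] x) \<boxtimes> y"
   using pure_minus_left[of "0[P]" x y] s by (simp add: a_minus_def)
  then have "C (-[Z] (x \<boxtimes> y))" using pure s by simp
  then show ?case using pure[OF s(2,3)] s unfolding tns_def by simp
 next
  case (diff a b)
  have k: "Poly_Mapping.keys (a - b) <= ?S" using keys_diff[of a b] diff by blast
  have c: "tensor_class K P Q a : carrier Z" "tensor_class K P Q b : carrier Z" using class_closed diff by blast+
  have e: "tensor_class K P Q (a - b) = tensor_class K P Q a +[Z] -[Z] tensor_class K P Q b"
   using class_minus diff by (simp add: a_minus_def)
  have "-[Z] (tensor_class K P Q a +[Z] -[Z] tensor_class K P Q b) = -[Z] tensor_class K P Q a +[Z] tensor_class K P Q b"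
   using c by (simp add: Z.minus_add)
  then show ?case using k diff c unfolding e by (simp add: add)
 qed
 then show ?thesis unfolding u(2) by blast
qed

text \<open>The universal property. A balanced map extends to formal sums, sends all relators to
  zero and so factors through the quotient.\<close>

lemma lift:
 assumes H: "abelian_group H" and cl: "!!x y. x : carrier P ==> y : carrier Q ==> \<beta> x y : carrier H"
  and l: "!!x x' y. x : carrier P ==> x' : carrier P ==> y : carrier Q ==> \<beta> (x +[P] x') y = \<beta> x y +[H] \<beta> x' y"
  and r: "!!x y y'. x : carrier P ==> y : carrier Q ==> y' : carrier Q ==> \<beta> x (y +[Q] y') = \<beta> x y +[H] \<beta> x y'"
  and b: "!!c x y. c : carrier K ==> x : carrier P ==> y : carrier Q ==> \<beta> (c *[P] x) y = \<beta> x (c *[Q] y)"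
 shows "\<exists>h\<in>hom (add_monoid Z) (add_monoid H). \<forall>x\<in>carrier P. \<forall>y\<in>carrier Q. h (x \<boxtimes> y) = \<beta> x y"
proof -
 interpret H: abelian_group H by (rule H)
 let ?S = "carrier P \<times> carrier Q" and ?F = "tensor_free P Q"
 have im: "(%(x, y). \<beta> x y) ` ?S <= carrier (add_monoid H)" using cl by auto
 obtain h where h: "h : hom ?F (add_monoid H)" and hf: "!!s. s : ?S ==> h (frag_of s) = (%(x, y). \<beta> x y) s"
  by (rule comm_group.free_Abelian_group_universal[OF H.a_comm_group im]) (erule that, blast)
 interpret h: group_hom ?F "add_monoid H" h
  by (rule group_hom.intro[OF group_free_Abelian_group H.a_group group_hom_axioms.intro[OF h]])
 have hd: "h (u - v) = h u -[H] h v" and hc: "h u : carrier H"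
  if "Poly_Mapping.keys u <= ?S" "Poly_Mapping.keys v <= ?S" for u v
 proof -
  have k: "Poly_Mapping.keys (u - v) <= ?S" using keys_diff[of u v] that by blast
  have c: "h u : carrier H" "h v : carrier H" "h (u - v) : carrier H" using h.hom_closed[of u] h.hom_closed[of v] h.hom_closed[of "u - v"] that k by auto
  have "h u = h (u - v) +[H] h v" using h.hom_mult[of "u - v" v] that k by simp
  then show "h (u - v) = h u -[H] h v" by (intro H.minus_eq_iff[THEN iffD2, symmetric]) (use c in simp_all)
  show "h u : carrier H" by (rule c)
 qed
 have fk: "Poly_Mapping.keys (frag_of (x, y)) <= ?S" if "x : carrier P" "y : carrier Q" for x y using that by simp
 have fd: "Poly_Mapping.keys (frag_of (x, y) - frag_of (x', y')) <= ?S" if "x : carrier P" "y : carrier Q" "x' : carrier P" "y' : carrier Q" for x y x' y'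
  using that keys_diff[of "frag_of (x, y)" "frag_of (x', y')"] by auto
 have "tensor_relators K P Q <= kernel ?F (add_monoid H) h"
 proof
  fix w assume w: "w : tensor_relators K P Q"
  have z: "(a +[H] a') -[H] a -[H] a' = 0[H]" if "a : carrier H" "a' : carrier H" for a a'
   using that H.add_minus_cancel[of a' a] by (simp add: H.a_comm)
  have "h w = 0[H]"
   using w unfolding tensor_relators_def
   by (elim UnE CollectE exE conjE) (simp_all add: hd fk fd hf l r b cl z)
  then show "w : kernel ?F (add_monoid H) h" using subsetD[OF relators_carrier w] unfolding kernel_def by (simp del: carrier_free_Abelian_group_iff)
 qed
 then have N: "tensor_null K P Q <= kernel ?F (add_monoid H) h"
  unfolding tensor_null_def by (rule group.generate_subgroup_incl[OF group_free_Abelian_group _ h.subgroup_kernel])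
 obtain g where g: "g : hom (?F Mod tensor_null K P Q) (add_monoid H)"
  and gh: "!!u. u : carrier ?F ==> g (tensor_null K P Q #>\<^bsub>?F\<^esub> u) = h u"
  by (rule h.FactGroup_universal_kernel[OF null_normal N]) (erule that, blast)
 have "g : hom (add_monoid Z) (add_monoid H)" using g unfolding hom_def by (simp add: carrier_Z add_Z tensor_group_def)
 moreover have "g (x \<boxtimes> y) = \<beta> x y" if "x : carrier P" "y : carrier Q" for x y
  unfolding tns_def tensor_class_def using gh[of "frag_of (x, y)"] hf that by simp
 ultimately show ?thesis by blast
qed

end

text \<open>Two additive maps that agree on pure tensors. This identifies formulas on formal sums
  with homomorphisms on classes, which yields independence of representatives.\<close>

lemma frag_additive_eq:
 assumes T: "tensor_rep K P Q Z" and H: "abelian_group H" and h: "h : hom (add_monoid Z) (add_monoid H)"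
  and k0: "k 0 = 0[H]" and kd: "!!u v. Poly_Mapping.keys u <= carrier P \<times> carrier Q ==> Poly_Mapping.keys v <= carrier P \<times> carrier Q ==> k (u - v) = k u -[H] k v"
  and k1: "!!x y. x : carrier P ==> y : carrier Q ==> k (frag_of (x, y)) = h (tns K P Q x y)"
  and u: "Poly_Mapping.keys u <= carrier P \<times> carrier Q"
 shows "k u = h (tensor_class K P Q u)"
proof -
 interpret T: tensor_rep K P Q Z by (rule T)
 interpret H: abelian_group H by (rule H)
 interpret h: group_hom "add_monoid Z" "add_monoid H" h
  by (rule group_hom.intro[OF T.Z.a_group H.a_group group_hom_axioms.intro[OF h]])
 let ?S = "carrier P \<times> carrier Q"
 have "Poly_Mapping.keys u <= ?S \<and> k u = h (tensor_class K P Q u)"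
  using u
 proof (induction u rule: frag_induction)
  case zero then show ?case using k0 h.hom_one by (simp add: T.class_zero)
 next
  case (one s) then show ?case by (cases s) (simp add: k1 tns_def)
 next
  case (diff a b)
  have c: "tensor_class K P Q a : carrier Z" "tensor_class K P Q b : carrier Z" using T.class_closed diff by blast+
  have "h (tensor_class K P Q a -[Z] tensor_class K P Q b) = h (tensor_class K P Q a) -[H] h (tensor_class K P Q b)"
   using c h.hom_mult[of "tensor_class K P Q a" "-[Z] tensor_class K P Q b"] h.hom_inv[of "tensor_class K P Q b"]
   by (simp add: a_minus_def a_inv_def)
  then show ?case using diff kd[of a b] keys_diff[of a b] T.class_minus[of a b] by auto
 qed
 then show ?thesis by blast
qed

text \<open>The common form of the product in \<open>tensor_ring\<close> and of the action in
  \<open>tensor_module\<close>: a union over all representatives, which is one class once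
  independence of representatives is known.\<close>

definition tensor_op where
 "tensor_op K P Q f g U V = (\<Union>u\<in>U. \<Union>v\<in>V. tensor_class K P Q (frag_biextend f g u v))"

text \<open>Treats the multiplication of the tensor ring and its action on tensor modules at once;
  for the former \<open>P\<close>, \<open>Q\<close> and \<open>Z\<close> are \<open>A\<close>,
  \<open>B\<close> and \<open>T\<close>.\<close>

locale tensor_action = T: tensor_rep K A B T + Z: tensor_rep K P Q Z
 for K :: "('k, 'r) ring_scheme" and A :: "('k, 'a, 'aa) module_scheme" and B :: "('k, 'b, 'bb) module_scheme" and T
  and P :: "('k, 'x, 'xx) module_scheme" and Q :: "('k, 'y, 'yy) module_scheme" and Z +
 fixes f :: "'a => 'x => 'x" and g :: "'b => 'y => 'y"
 assumes f_closed: "a : carrier A ==> x : carrier P ==> f a x : carrier P"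
  and f_add_left: "a : carrier A ==> a' : carrier A ==> x : carrier P ==> f (a +[A] a') x = f a x +[P] f a' x"
  and f_add_right: "a : carrier A ==> x : carrier P ==> x' : carrier P ==> f a (x +[P] x') = f a x +[P] f a x'"
  and f_smult_left: "c : carrier K ==> a : carrier A ==> x : carrier P ==> f (c *[A] a) x = c *[P] f a x"
  and f_smult_right: "c : carrier K ==> a : carrier A ==> x : carrier P ==> f a (c *[P] x) = c *[P] f a x"
  and g_closed: "b : carrier B ==> y : carrier Q ==> g b y : carrier Q"
  and g_add_left: "b : carrier B ==> b' : carrier B ==> y : carrier Q ==> g (b +[B] b') y = g b y +[Q] g b' y"
  and g_add_right: "b : carrier B ==> y : carrier Q ==> y' : carrier Q ==> g b (y +[Q] y') = g b y +[Q] g b y'"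
  and g_smult_left: "c : carrier K ==> b : carrier B ==> y : carrier Q ==> g (c *[B] b) y = c *[Q] g b y"
  and g_smult_right: "c : carrier K ==> b : carrier B ==> y : carrier Q ==> g b (c *[Q] y) = c *[Q] g b y"
begin

abbreviation act (infixl \<open>\<star>\<close> 72) where "U \<star> V \<equiv> tensor_op K P Q f g U V"

text \<open>The universal property is applied to the second argument for fixed \<open>a\<close> and
  \<open>b\<close>, then to the first argument for a fixed \<open>V\<close>. The biadditive map so
  obtained agrees with \<open>frag_biextend\<close> on all representatives, hence the union defining
  \<open>\<star>\<close> is a union of equal classes.\<close>

lemma act_hom:
 assumes V: "V : carrier Z"
 shows "\<exists>h\<in>hom (add_monoid T) (add_monoid Z). \<forall>U\<in>carrier T. U \<star> V = h U"
  and "!!a b x y. V = tns K P Q x y ==> a : carrier A ==> b : carrier B ==> x : carrier P ==> y : carrier Q ==>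
   tns K A B a b \<star> V = tns K P Q (f a x) (g b y)"
  and "!!a b W. a : carrier A ==> b : carrier B ==> W : carrier Z ==>
   tns K A B a b \<star> (V +[Z] W) = tns K A B a b \<star> V +[Z] tns K A B a b \<star> W"
proof -
 have "\<forall>a\<in>carrier A. \<forall>b\<in>carrier B. \<exists>h\<in>hom (add_monoid Z) (add_monoid Z).
   \<forall>x\<in>carrier P. \<forall>y\<in>carrier Q. h (tns K P Q x y) = tns K P Q (f a x) (g b y)"
  by (intro ballI Z.lift[OF Z.Z_group])
   (simp_all add: f_closed g_closed f_add_right g_add_right Z.pure_add_left Z.pure_add_right f_smult_right g_smult_right Z.pure_balanced)
 then obtain k where k: "!!a b. a : carrier A ==> b : carrier B ==> k a b : hom (add_monoid Z) (add_monoid Z)"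
  and kp: "!!a b x y. a : carrier A ==> b : carrier B ==> x : carrier P ==> y : carrier Q ==> k a b (tns K P Q x y) = tns K P Q (f a x) (g b y)"
  by metis
 have kc: "k a b V : carrier Z" if "a : carrier A" "b : carrier B" "V : carrier Z" for a b V
  using k[OF that(1,2)] that(3) unfolding hom_def by auto
 have ka: "k a b (V +[Z] W) = k a b V +[Z] k a b W" if "a : carrier A" "b : carrier B" "V : carrier Z" "W : carrier Z" for a b V W
  using k[OF that(1,2)] that(3,4) unfolding hom_def by auto
 have k1: "k (a +[A] a') b V = k a b V +[Z] k a' b V" if c: "a : carrier A" "a' : carrier A" "b : carrier B" and V: "V : carrier Z" for a a' b V
  using V by (induction V rule: Z.tensor_induct)
   (simp_all add: c kp f_add_left f_closed g_closed Z.pure_add_left ka kc Z.Z.add_add_swap)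
 have k2: "k a (b +[B] b') V = k a b V +[Z] k a b' V" if c: "a : carrier A" "b : carrier B" "b' : carrier B" and V: "V : carrier Z" for a b b' V
  using V by (induction V rule: Z.tensor_induct)
   (simp_all add: c kp g_add_left f_closed g_closed Z.pure_add_right ka kc Z.Z.add_add_swap)
 have k3: "k (c *[A] a) b V = k a (c *[B] b) V" if c: "c : carrier K" "a : carrier A" "b : carrier B" and V: "V : carrier Z" for a b c V
  using V by (induction V rule: Z.tensor_induct)
   (simp_all add: c kp f_smult_left g_smult_left f_closed g_closed Z.pure_balanced ka)
 have "\<forall>V\<in>carrier Z. \<exists>h\<in>hom (add_monoid T) (add_monoid Z). \<forall>a\<in>carrier A. \<forall>b\<in>carrier B. h (tns K A B a b) = k a b V"
  by (intro ballI T.lift[OF Z.Z_group]) (simp_all add: kc k1 k2 k3)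
 then obtain h where h: "!!V. V : carrier Z ==> h V : hom (add_monoid T) (add_monoid Z)"
  and hp: "!!V a b. V : carrier Z ==> a : carrier A ==> b : carrier B ==> h V (tns K A B a b) = k a b V"
  by metis
 let ?S = "carrier A \<times> carrier B" and ?S' = "carrier P \<times> carrier Q"
 let ?G = "%a b v. frag_extend (%(x, y). frag_of (f a x, g b y)) v"
 have Gk: "Poly_Mapping.keys (?G a b v) <= ?S'" if "a : carrier A" "b : carrier B" "Poly_Mapping.keys v <= ?S'" for a b v
 proof
  fix q assume "q : Poly_Mapping.keys (?G a b v)"
  then obtain s where "s : Poly_Mapping.keys v" "q : Poly_Mapping.keys (case s of (x, y) => frag_of (f a x, g b y))"
   using keys_frag_extend by fast
  then show "q : ?S'" using that f_closed g_closed by (cases s) auto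
 qed
 have G: "tensor_class K P Q (?G a b v) = k a b (tensor_class K P Q v)" if c: "a : carrier A" "b : carrier B" and v: "Poly_Mapping.keys v <= ?S'" for a b v
  by (rule frag_additive_eq[OF Z.tensor_rep_axioms Z.Z_group k[OF c] _ _ _ v])
   (simp_all add: Z.class_zero frag_extend_diff Z.class_minus Gk c kp tns_def[symmetric])
 have Bk: "Poly_Mapping.keys (frag_biextend f g u v) <= ?S'" if ku: "Poly_Mapping.keys u <= ?S" and kv: "Poly_Mapping.keys v <= ?S'" for u v
 proof
  fix q assume "q : Poly_Mapping.keys (frag_biextend f g u v)"
  then obtain s where s: "s : Poly_Mapping.keys u" "q : Poly_Mapping.keys (case s of (a, b) => ?G a b v)"
   unfolding frag_biextend_def using keys_frag_extend by fast
  obtain a b where "s = (a, b)" "a : carrier A" "b : carrier B" using s(1) ku by (cases s) auto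
  then show "q : ?S'" using Gk[OF _ _ kv] s(2) by auto
 qed
 have op: "tensor_class K P Q (frag_biextend f g u v) = h (tensor_class K P Q v) (tensor_class K A B u)"
  if u: "Poly_Mapping.keys u <= ?S" and v: "Poly_Mapping.keys v <= ?S'" for u v
  by (rule frag_additive_eq[OF T.tensor_rep_axioms Z.Z_group h[OF Z.class_closed[OF v]] _ _ _ u, of "%u. tensor_class K P Q (frag_biextend f g u v)"])
   (simp_all add: Z.class_zero frag_biextend_def frag_extend_diff Z.class_minus Bk[unfolded frag_biextend_def] v hp G Z.class_closed)
 have act: "U \<star> V = h V U" if U: "U : carrier T" and V: "V : carrier Z" for U V
 proof -
  obtain u v where u: "Poly_Mapping.keys u <= ?S" "U = tensor_class K A B u" and v: "Poly_Mapping.keys v <= ?S'" "V = tensor_class K P Q v"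
   using U V unfolding T.class_surj Z.class_surj by blast
  have "tensor_class K P Q (frag_biextend f g u' v') = h V U" if u': "u' : U" and v': "v' : V" for u' v'
   using op[of u' v'] Z.class_repr[OF v(1), of v'] T.class_repr[OF u(1), of u'] u' v' unfolding u(2) v(2) by simp
  moreover have "u : U" "v : V" unfolding u(2) v(2) by (rule T.class_self[OF u(1)], rule Z.class_self[OF v(1)])
  ultimately show ?thesis unfolding tensor_op_def by blast
 qed
 show "\<exists>h\<in>hom (add_monoid T) (add_monoid Z). \<forall>U\<in>carrier T. U \<star> V = h U" using h[OF V] act V by blast
 show "tns K A B a b \<star> V = tns K P Q (f a x) (g b y)"
  if "V = tns K P Q x y" "a : carrier A" "b : carrier B" "x : carrier P" "y : carrier Q" for a b x y
  using that V by (simp add: act hp kp)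
 show "tns K A B a b \<star> (V +[Z] W) = tns K A B a b \<star> V +[Z] tns K A B a b \<star> W"
  if "a : carrier A" "b : carrier B" "W : carrier Z" for a b W
  using that V by (simp add: act hp ka)
qed

lemma act_pure: "a : carrier A ==> b : carrier B ==> x : carrier P ==> y : carrier Q ==>
  tns K A B a b \<star> tns K P Q x y = tns K P Q (f a x) (g b y)"
 by (rule act_hom(2)[OF _ refl]) simp_all

lemma act_closed: "U : carrier T ==> V : carrier Z ==> U \<star> V : carrier Z"
 using act_hom(1)[of V] unfolding hom_def by auto

lemma act_add_left: "U : carrier T ==> U' : carrier T ==> V : carrier Z ==> (U +[T] U') \<star> V = U \<star> V +[Z] U' \<star> V"
 using act_hom(1)[of V] unfolding hom_def by auto

lemma act_add_right:
 assumes U: "U : carrier T" and V: "V : carrier Z" "V' : carrier Z"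
 shows "U \<star> (V +[Z] V') = U \<star> V +[Z] U \<star> V'"
 using U by (induction U rule: T.tensor_induct)
  (simp_all add: V act_hom(3) act_add_left act_closed Z.Z.add_add_swap)

end

locale tensor_lin = tensor_rep K P Q Z + Z: module K Z
 for K :: "('k, 'r) ring_scheme" and P :: "('k, 'x, 'xx) module_scheme" and Q :: "('k, 'y, 'yy) module_scheme"
  and Z :: "('k, ('x \<times> 'y \<Rightarrow>\<^sub>0 int) set, 'zz) module_scheme" +
 assumes smult_pure: "c : carrier K ==> x : carrier P ==> y : carrier Q ==> c *[Z] tns K P Q x y = tns K P Q (c *[P] x) y"
begin

lemma lin_lift:
 assumes W: "module K W" and cl: "!!x y. x : carrier P ==> y : carrier Q ==> \<beta> x y : carrier W"
  and "!!x x' y. x : carrier P ==> x' : carrier P ==> y : carrier Q ==> \<beta> (x +[P] x') y = \<beta> x y +[W] \<beta> x' y"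
  and "!!x y y'. x : carrier P ==> y : carrier Q ==> y' : carrier Q ==> \<beta> x (y +[Q] y') = \<beta> x y +[W] \<beta> x y'"
  and l: "!!c x y. c : carrier K ==> x : carrier P ==> y : carrier Q ==> \<beta> (c *[P] x) y = c *[W] \<beta> x y"
  and r: "!!c x y. c : carrier K ==> x : carrier P ==> y : carrier Q ==> \<beta> x (c *[Q] y) = c *[W] \<beta> x y"
 shows "\<exists>h\<in>mod_hom K Z W. \<forall>x\<in>carrier P. \<forall>y\<in>carrier Q. h (x \<boxtimes> y) = \<beta> x y"
proof -
 interpret W: module K W by (rule W)
 have "\<exists>h\<in>hom (add_monoid Z) (add_monoid W). \<forall>x\<in>carrier P. \<forall>y\<in>carrier Q. h (x \<boxtimes> y) = \<beta> x y"
  by (rule lift[OF W.abelian_group_axioms]) (simp_all add: assms)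
 then obtain h where h: "h : hom (add_monoid Z) (add_monoid W)" and hp: "\<forall>x\<in>carrier P. \<forall>y\<in>carrier Q. h (x \<boxtimes> y) = \<beta> x y" by blast
 have hc: "h z : carrier W" and ha: "w : carrier Z ==> h (z +[Z] w) = h z +[W] h w" if "z : carrier Z" for z w
  using h that unfolding hom_def by auto
 have "h : mod_hom K Z W"
 proof (rule mod_homI)
  fix c z assume c: "c : carrier K" and z: "z : carrier Z"
  show "h (c *[Z] z) = c *[W] h z"
   using z by (induction z rule: tensor_induct) (simp_all add: c hp l smult_pure Z.smult_r_distr W.smult_r_distr ha hc)
 qed (simp_all add: hc ha)
 then show ?thesis using hp by blast
qed

lemma lin_map:
 assumes "tensor_lin K P' Q' Z'" and f: "f : mod_hom K P P'" and g: "g : mod_hom K Q Q'"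
 shows "\<exists>h\<in>mod_hom K Z Z'. \<forall>x\<in>carrier P. \<forall>y\<in>carrier Q. h (x \<boxtimes> y) = tns K P' Q' (f x) (g y)"
proof -
 interpret Z': tensor_lin K P' Q' Z' by fact
 show ?thesis
  by (rule lin_lift[OF Z'.Z.module_axioms])
   (simp_all add: mod_homD[OF f] mod_homD[OF g] Z'.pure_add_left Z'.pure_add_right Z'.smult_pure Z'.pure_balanced)
qed

lemma smult_pure_right: "c : carrier K ==> x : carrier P ==> y : carrier Q ==> c *[Z] (x \<boxtimes> y) = x \<boxtimes> (c *[Q] y)"
 by (simp add: smult_pure pure_balanced)

end

lemma algebra_unit_hom:
 assumes "algebra K A" shows "(%c. c *[A] 1[A]) : ring_hom K A"
proof -
 interpret A: algebra K A by fact
 show ?thesis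
  by (rule ring_hom_memI) (simp_all add: A.smult_assoc1 A.smult_assoc2 A.smult_l_distr)
qed

lemma restrict_scalars_eq: "restrict_scalars A M = kmod (%c. c *[A] 1[A]) M"
 by (simp add: restrict_scalars_def kmod_def)

section \<open>The tensor product ring and its modules\<close>

text \<open>That the tensor product is a ring comes with the assumption that it is Noetherian. Its
  structure as an algebra over \<open>K\<close> is the map \<open>iT\<close>, through the left
  factor.\<close>

locale tensor_algebras =
 fixes K :: "('k, 'r) ring_scheme" and A :: "('k, 'a, 'aa) module_scheme" and B :: "('k, 'b, 'bb) module_scheme"
 assumes field_K: "field K" and alg_A: "algebra K A" and alg_B: "algebra K B" and ring_T: "ring (tensor_ring K A B)"
begin

abbreviation "TR \<equiv> tensor_ring K A B"
abbreviation "iA \<equiv> (%c. c *[A] 1[A])"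
abbreviation "iB \<equiv> (%c. c *[B] 1[B])"
abbreviation "iT \<equiv> (%c. tns K A B (iA c) 1[B])"
abbreviation "TM \<equiv> tensor_module K A B"

sublocale A: algebra K A by (rule alg_A)
sublocale B: algebra K B by (rule alg_B)
sublocale T: ring TR by (rule ring_T)

sublocale T: tensor_rep K A B TR
 by unfold_locales (simp_all add: tensor_ring_def)

lemma mult_T: "x \<otimes>[TR] y = tensor_op K A B (monoid.mult A) (monoid.mult B) x y"
 by (simp add: tensor_ring_def tensor_op_def)

sublocale TT: tensor_action K A B TR A B TR "monoid.mult A" "monoid.mult B"
proof unfold_locales
 show "a \<otimes>[A] (c *[A] x) = c *[A] (a \<otimes>[A] x)" if "c : carrier K" "a : carrier A" "x : carrier A" for c a x
  using A.smult_assoc2[of c x a] A.m_comm[of a "c *[A] x"] A.m_comm[of a x] that by simp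
 show "a \<otimes>[B] (c *[B] x) = c *[B] (a \<otimes>[B] x)" if "c : carrier K" "a : carrier B" "x : carrier B" for c a x
  using B.smult_assoc2[of c x a] B.m_comm[of a "c *[B] x"] B.m_comm[of a x] that by simp
qed (simp_all add: A.l_distr A.r_distr B.l_distr B.r_distr A.smult_assoc2 B.smult_assoc2)

lemma mult_pure: "a : carrier A ==> b : carrier B ==> a' : carrier A ==> b' : carrier B ==>
  tns K A B a b \<otimes>[TR] tns K A B a' b' = tns K A B (a \<otimes>[A] a') (b \<otimes>[B] b')"
 unfolding mult_T by (rule TT.act_pure)

lemma one_T: "1[TR] = tns K A B 1[A] 1[B]"
 by (simp add: tensor_ring_def tns_def)

lemma cring_T: "cring TR"
proof -
 have c1: "tns K A B a b \<otimes>[TR] y = y \<otimes>[TR] tns K A B a b" if "a : carrier A" "b : carrier B" "y : carrier TR" for a b y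
  using that(3) by (induction y rule: T.tensor_induct)
   (simp_all add: that(1,2) mult_pure A.m_comm B.m_comm T.l_distr T.r_distr)
 have "x \<otimes>[TR] y = y \<otimes>[TR] x" if "x : carrier TR" "y : carrier TR" for x y
  using that(1) by (induction x rule: T.tensor_induct) (simp_all add: that(2) c1 T.l_distr T.r_distr)
 then have "comm_monoid TR" by (intro T.monoid_comm_monoidI)
 then show ?thesis by (rule cring.intro[OF ring_T])
qed

lemma iT_hom: "iT : ring_hom K TR"
proof -
 note h = algebra_unit_hom[OF alg_A]
 show ?thesis
  by (rule ring_hom_memI)
   (simp_all add: ring_hom_closed[OF h] mult_pure one_T A.smult_l_distr T.pure_add_left A.smult_assoc1 A.smult_assoc2)
qed

lemma iT_pure: "c : carrier K ==> c' : carrier K ==> iT (c \<otimes>[K] c') = tns K A B (iA c) (iB c')"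
 using T.pure_balanced[of c' "iA c" "1[B]"] by (simp add: A.smult_assoc1[symmetric] A.R.m_comm)

context
 fixes L :: "('a, 'l, 'll) module_scheme" and N :: "('b, 'n, 'nn) module_scheme"
 assumes L: "module A L" and N: "module B N"
begin

lemma kmod_L: "module K (kmod iA L)" and kmod_N: "module K (kmod iB N)"
 by (rule kmod_module[OF A.R.is_cring algebra_unit_hom[OF alg_A] L], rule kmod_module[OF A.R.is_cring algebra_unit_hom[OF alg_B] N])

lemma TM_rep: "tensor_rep K (kmod iA L) (kmod iB N) (TM L N)"
 using kmod_L kmod_N unfolding tensor_rep_def tensor_rep_axioms_def
 by (simp add: tensor_module_def Let_def restrict_scalars_eq)

lemma TM_action: "tensor_action K A B TR (kmod iA L) (kmod iB N) (TM L N) (smult L) (smult N)"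
proof -
 interpret L: module A L by (rule L)
 interpret N: module B N by (rule N)
 interpret Z: tensor_rep K "kmod iA L" "kmod iB N" "TM L N" by (rule TM_rep)
 note hA = ring_hom_closed[OF algebra_unit_hom[OF alg_A]] and hB = ring_hom_closed[OF algebra_unit_hom[OF alg_B]]
 show ?thesis
 proof unfold_locales
  fix c a x assume c: "c : carrier K" "a : carrier A" "x : carrier (kmod iA L)"
  have "c *[A] a = iA c \<otimes>[A] a" using c by (simp add: A.smult_assoc2)
  then show "(c *[A] a) *[L] x = c *[kmod iA L] (a *[L] x)" using c by (simp add: L.smult_assoc1 hA)
  show "a *[L] (c *[kmod iA L] x) = c *[kmod iA L] (a *[L] x)" using c by (simp add: L.smult_commute hA)
 next
  fix c b x assume c: "c : carrier K" "b : carrier B" "x : carrier (kmod iB N)"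
  have "c *[B] b = iB c \<otimes>[B] b" using c by (simp add: B.smult_assoc2)
  then show "(c *[B] b) *[N] x = c *[kmod iB N] (b *[N] x)" using c by (simp add: N.smult_assoc1 hB)
  show "b *[N] (c *[kmod iB N] x) = c *[kmod iB N] (b *[N] x)" using c by (simp add: N.smult_commute hB)
 qed (simp_all add: L.smult_l_distr L.smult_r_distr N.smult_l_distr N.smult_r_distr)
qed

lemma smult_TM: "t *[TM L N] z = tensor_op K (kmod iA L) (kmod iB N) (smult L) (smult N) t z"
 by (simp add: tensor_module_def tensor_op_def Let_def restrict_scalars_eq)

lemma smult_TM_pure: "a : carrier A ==> b : carrier B ==> x : carrier L ==> y : carrier N ==>
  tns K A B a b *[TM L N] tns K (kmod iA L) (kmod iB N) x y = tns K (kmod iA L) (kmod iB N) (a *[L] x) (b *[N] y)"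
 using tensor_action.act_pure[OF TM_action, of a b x y] by (simp add: smult_TM)

lemma TM_module: "module TR (TM L N)"
proof -
 interpret L: module A L by (rule L)
 interpret N: module B N by (rule N)
 interpret Z: tensor_action K A B TR "kmod iA L" "kmod iB N" "TM L N" "smult L" "smult N" by (rule TM_action)
 note [simp] = smult_TM_pure
 have cl: "s *[TM L N] z : carrier (TM L N)" if "s : carrier TR" "z : carrier (TM L N)" for s z
  unfolding smult_TM by (rule Z.act_closed[OF that])
 have al: "(s +[TR] t) *[TM L N] z = s *[TM L N] z +[TM L N] t *[TM L N] z" if "s : carrier TR" "t : carrier TR" "z : carrier (TM L N)" for s t z
  unfolding smult_TM by (rule Z.act_add_left[OF that])
 have ar: "s *[TM L N] (z +[TM L N] w) = s *[TM L N] z +[TM L N] s *[TM L N] w" if "s : carrier TR" "z : carrier (TM L N)" "w : carrier (TM L N)" for s z w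
  unfolding smult_TM by (rule Z.act_add_right[OF that])
 have as1: "(tns K A B a b \<otimes>[TR] tns K A B a' b') *[TM L N] z = tns K A B a b *[TM L N] (tns K A B a' b' *[TM L N] z)"
  if "a : carrier A" "b : carrier B" "a' : carrier A" "b' : carrier B" "z : carrier (TM L N)" for a b a' b' z
  using that(5) by (induction z rule: Z.Z.tensor_induct) (simp_all add: that(1-4) mult_pure L.smult_assoc1 N.smult_assoc1 ar cl)
 have as2: "(tns K A B a b \<otimes>[TR] t) *[TM L N] z = tns K A B a b *[TM L N] (t *[TM L N] z)"
  if "a : carrier A" "b : carrier B" "t : carrier TR" "z : carrier (TM L N)" for a b t z
  using that(3) by (induction t rule: T.tensor_induct) (simp_all add: that as1 T.r_distr al ar cl)
 show ?thesis
 proof (rule moduleI)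
  show "cring TR" by (rule cring_T)
  show "abelian_group (TM L N)" by (rule Z.Z.Z_group)
  show "(s \<otimes>[TR] t) *[TM L N] z = s *[TM L N] (t *[TM L N] z)" if "s : carrier TR" "t : carrier TR" "z : carrier (TM L N)" for s t z
   using that(1) by (induction s rule: T.tensor_induct) (simp_all add: that as2 T.l_distr al cl)
  show "1[TR] *[TM L N] z = z" if "z : carrier (TM L N)" for z
   using that by (induction z rule: Z.Z.tensor_induct) (simp_all add: one_T ar)
 qed (simp_all add: cl al ar)
qed

lemma TM_lin: "tensor_lin K (kmod iA L) (kmod iB N) (kmod iT (TM L N))"
proof -
 interpret L: module A L by (rule L)
 interpret N: module B N by (rule N)
 interpret Z: tensor_rep K "kmod iA L" "kmod iB N" "TM L N" by (rule TM_rep)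
 interpret Zk: module K "kmod iT (TM L N)" by (rule kmod_module[OF A.R.is_cring iT_hom TM_module])
 have "tensor_rep K (kmod iA L) (kmod iB N) (kmod iT (TM L N))"
  using TM_rep unfolding tensor_rep_def tensor_rep_axioms_def by (simp add: kmod_def[of iT])
 then show ?thesis
  by (rule tensor_lin.intro[OF _ Zk.module_axioms tensor_lin_axioms.intro]) (simp add: smult_TM_pure)
qed

end

lemma TM_hom:
 assumes L: "module A L" and N: "module B N" and L': "module A L'" and N': "module B N'"
  and f: "f : mod_hom A L L'" and g: "g : mod_hom B N N'"
 shows "\<exists>h\<in>mod_hom TR (TM L N) (TM L' N'). \<forall>x\<in>carrier L. \<forall>y\<in>carrier N.
  h (tns K (kmod iA L) (kmod iB N) x y) = tns K (kmod iA L') (kmod iB N') (f x) (g y)"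
proof -
 interpret L: module A L by (rule L)
 interpret N: module B N by (rule N)
 interpret Z: tensor_lin K "kmod iA L" "kmod iB N" "kmod iT (TM L N)" by (rule TM_lin[OF L N])
 interpret M: module TR "TM L N" by (rule TM_module[OF L N])
 interpret M': module TR "TM L' N'" by (rule TM_module[OF L' N'])
 obtain h where h: "h : mod_hom K (kmod iT (TM L N)) (kmod iT (TM L' N'))"
  and hp: "!!x y. x : carrier L ==> y : carrier N ==> h (tns K (kmod iA L) (kmod iB N) x y) = tns K (kmod iA L') (kmod iB N') (f x) (g y)"
  using Z.lin_map[OF TM_lin[OF L' N'] mod_hom_kmod[OF f algebra_unit_hom[OF alg_A]] mod_hom_kmod[OF g algebra_unit_hom[OF alg_B]]] by auto
 have hc: "h z : carrier (TM L' N')" and ha: "w : carrier (TM L N) ==> h (z +[TM L N] w) = h z +[TM L' N'] h w" if "z : carrier (TM L N)" for z w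
  using mod_homD(1)[OF h, of z] mod_homD(2)[OF h, of z w] that by simp_all
 have h1: "h (tns K A B a b *[TM L N] z) = tns K A B a b *[TM L' N'] h z" if ab: "a : carrier A" "b : carrier B" and z: "z : carrier (TM L N)" for a b z
 proof -
  have "z : carrier (kmod iT (TM L N))" using z by simp
  then show ?thesis
   by (induction z rule: Z.tensor_induct)
    (simp_all add: ab smult_TM_pure[OF L N] smult_TM_pure[OF L' N'] hp mod_homD[OF f] mod_homD[OF g] M.smult_r_distr M'.smult_r_distr ha hc)
 qed
 have "h : mod_hom TR (TM L N) (TM L' N')"
 proof (rule mod_homI)
  fix t z assume t: "t : carrier TR" and z: "z : carrier (TM L N)"
  show "h (t *[TM L N] z) = t *[TM L' N'] h z"
   using t by (induction t rule: T.tensor_induct) (simp_all add: h1 z M.smult_l_distr M'.smult_l_distr ha hc)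
 qed (simp_all add: hc ha)
 then show ?thesis using hp by blast
qed

lemma tensor_image_submodule:
 assumes S: "submodule S A (ring_mod A)" and U: "submodule U B (ring_mod B)"
 shows "submodule (tensor_image K A B S U) TR (ring_mod TR)"
proof -
 interpret rA: module A "ring_mod A" by (rule ring_mod_module[OF A.is_cring])
 interpret rB: module B "ring_mod B" by (rule ring_mod_module[OF B.is_cring])
 interpret rT: module TR "ring_mod TR" by (rule ring_mod_module[OF cring_T])
 let ?G = "{tensor_class K A B (frag_of (s, t)) | s t. s : S \<and> t : U}" and ?H = "tensor_image K A B S U"
 have am: "add_monoid TR = tensor_group K A B" by (simp add: tensor_ring_def)
 have SA: "S <= carrier A" and UB: "U <= carrier B" using rA.submoduleE(1)[OF S] rB.submoduleE(1)[OF U] by simp_all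
 have Hd: "?H = generate (add_monoid TR) ?G" unfolding tensor_image_def am ..
 have G: "?G <= carrier TR" using subsetD[OF SA] subsetD[OF UB] unfolding tns_def[symmetric] by (auto intro!: T.pure_closed)
 have sub: "subgroup ?H (add_monoid TR)" unfolding Hd by (rule group.generate_is_subgroup[OF T.a_group]) (use G in simp)
 have Hc: "?H <= carrier TR" using subgroup.subset[OF sub] by simp
 have Ha: "x +[TR] y : ?H" if "x : ?H" "y : ?H" for x y using subgroup.m_closed[OF sub] that by simp
 have Hn: "-[TR] x : ?H" if "x : ?H" for x using subgroup.m_inv_closed[OF sub that] by (simp add: a_inv_def)
 have H0: "0[TR] : ?H" using subgroup.one_closed[OF sub] by simp
 have pg: "tns K A B a b \<otimes>[TR] g : ?G" if ab: "a : carrier A" "b : carrier B" and g: "g : ?G" for a b g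
 proof -
  obtain s t where st: "s : S" "t : U" "g = tns K A B s t" using g unfolding tns_def by blast
  have "tns K A B a b \<otimes>[TR] g = tns K A B (a \<otimes>[A] s) (b \<otimes>[B] t)" unfolding st(3) by (rule mult_pure) (use ab st SA UB in auto)
  moreover have "a \<otimes>[A] s : S" "b \<otimes>[B] t : U" using rA.submoduleE(4)[OF S ab(1) st(1)] rB.submoduleE(4)[OF U ab(2) st(2)] by simp_all
  ultimately show ?thesis unfolding tns_def by blast
 qed
 have p: "tns K A B a b \<otimes>[TR] x : ?H" if ab: "a : carrier A" "b : carrier B" and x: "x : ?H" for a b x
  using x unfolding Hd
 proof (induction rule: generate.induct)
  case one then show ?case using H0 ab unfolding Hd[symmetric] by simp
 next
  case (incl g) then show ?case by (rule generate.incl[OF pg[OF ab]])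
 next
  case (inv g)
  have gc: "g : carrier TR" using inv G by blast
  have "-[TR] (tns K A B a b \<otimes>[TR] g) : ?H" by (rule Hn) (unfold Hd, rule generate.incl[OF pg[OF ab inv]])
  also have "-[TR] (tns K A B a b \<otimes>[TR] g) = tns K A B a b \<otimes>[TR] inv\<^bsub>add_monoid TR\<^esub> g"
   using T.r_minus[of "tns K A B a b" g] ab gc by (simp add: a_inv_def)
  finally show ?case unfolding Hd .
 next
  case (eng g h)
  have "g : carrier TR" "h : carrier TR" using eng(1,2) Hc unfolding Hd by blast+
  then show ?case using Ha[unfolded Hd, OF eng(3,4)] ab by (simp add: T.r_distr)
 qed
 show ?thesis
 proof (rule rT.submoduleI')
  fix t x assume t: "t : carrier TR" and x: "x : ?H"
  have xT: "x : carrier TR" using x Hc by blast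
  show "t *[ring_mod TR] x : ?H"
   using t by (induction t rule: T.tensor_induct) (simp_all add: p x T.l_distr xT Ha)
 qed (use Hc H0 Ha in auto)
qed


text \<open>Each generator in this list acts on one tensor factor alone. This is what later allows
  torsion and goodness to be treated one factor at a time.\<close>

lemma tensor_ideal_gen:
 assumes xs: "set xs <= carrier A" and m: "m = gen_submodule A (ring_mod A) (set xs)"
  and ys: "set ys <= carrier B" and n: "n = gen_submodule B (ring_mod B) (set ys)"
 shows "tensor_image K A B m (carrier B) <+>\<^bsub>TR\<^esub> tensor_image K A B (carrier A) n =
  gen_submodule TR (ring_mod TR) (set (map (%x. tns K A B x 1[B]) xs @ map (%y. tns K A B 1[A] y) ys))"
  (is "?M = ?J")
proof -
 interpret rA: module A "ring_mod A" by (rule ring_mod_module[OF A.is_cring])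
 interpret rB: module B "ring_mod B" by (rule ring_mod_module[OF B.is_cring])
 interpret rT: module TR "ring_mod TR" by (rule ring_mod_module[OF cring_T])
 define S where "S = set (map (%x. tns K A B x 1[B]) xs @ map (%y. tns K A B 1[A] y) ys)"
 define J where "J = gen_submodule TR (ring_mod TR) S"
 have sm: "submodule m A (ring_mod A)" "submodule n B (ring_mod B)"
  unfolding m n by (rule rA.gen_sub, use xs in simp, rule rB.gen_sub, use ys in simp)
 have fA: "submodule (carrier A) A (ring_mod A)" by (rule rA.submoduleI') simp_all
 have fB: "submodule (carrier B) B (ring_mod B)" by (rule rB.submoduleI') simp_all
 let ?H1 = "tensor_image K A B m (carrier B)" and ?H2 = "tensor_image K A B (carrier A) n"
 have H1: "submodule ?H1 TR (ring_mod TR)" by (rule tensor_image_submodule[OF sm(1) fB])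
 have H2: "submodule ?H2 TR (ring_mod TR)" by (rule tensor_image_submodule[OF fA sm(2)])
 have mA: "m <= carrier A" "n <= carrier B" using rA.submoduleE(1)[OF sm(1)] rB.submoduleE(1)[OF sm(2)] by simp_all
 have SR: "S <= carrier (ring_mod TR)" unfolding S_def using xs ys by (auto intro!: T.pure_closed)
 have J: "submodule J TR (ring_mod TR)" unfolding J_def by (rule rT.gen_sub[OF SR])
 have Jm: "!!r x. r : carrier TR ==> x : J ==> r \<otimes>[TR] x : J" using rT.submoduleE(4)[OF J] by simp
 have Ja: "!!x y. x : J ==> y : J ==> x +[TR] y : J" using rT.submoduleE(5)[OF J] by simp
 have J0: "0[TR] : J" using rT.sub_zero[OF J] by simp
 have Jc: "J <= carrier TR" using rT.submoduleE(1)[OF J] by simp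
 have SJ: "!!x. x : set xs ==> tns K A B x 1[B] : J" "!!y. y : set ys ==> tns K A B 1[A] y : J"
  unfolding J_def using rT.gen_incl[of S] unfolding S_def by auto
 have mJ: "tns K A B s 1[B] : J" if "s : m" for s
 proof -
  have "s : gen_submodule A (ring_mod A) (set xs)" using that m by simp
  then show ?thesis
  proof (rule gen_submodule_induct[OF _ ring_mod_module[OF A.is_cring]])
   show "set xs <= carrier (ring_mod A)" using xs by simp
   fix r x assume "r : carrier A" "x : carrier (ring_mod A)" "tns K A B x 1[B] : J"
   then show "tns K A B (r *[ring_mod A] x) 1[B] : J"
    using Jm[of "tns K A B r 1[B]" "tns K A B x 1[B]"] by (simp add: mult_pure)
  qed (simp_all add: J0 SJ(1) T.pure_add_left Ja)
 qed
 have nJ: "tns K A B 1[A] s : J" if "s : n" for s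
 proof -
  have "s : gen_submodule B (ring_mod B) (set ys)" using that n by simp
  then show ?thesis
  proof (rule gen_submodule_induct[OF _ ring_mod_module[OF B.is_cring]])
   show "set ys <= carrier (ring_mod B)" using ys by simp
   fix r x assume "r : carrier B" "x : carrier (ring_mod B)" "tns K A B 1[A] x : J"
   then show "tns K A B 1[A] (r *[ring_mod B] x) : J"
    using Jm[of "tns K A B 1[A] r" "tns K A B 1[A] x"] by (simp add: mult_pure)
  qed (simp_all add: J0 SJ(2) T.pure_add_right Ja)
 qed
 have mbJ: "tns K A B s t : J" if "s : m" "t : carrier B" for s t
  using Jm[of "tns K A B 1[A] t", OF _ mJ[OF that(1)]] that mA by (auto simp: mult_pure subset_iff)
 have anJ: "tns K A B s t : J" if "s : carrier A" "t : n" for s t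
  using Jm[of "tns K A B s 1[B]", OF _ nJ[OF that(2)]] that mA by (auto simp: mult_pure subset_iff)
 have am: "add_monoid TR = tensor_group K A B" by (simp add: tensor_ring_def)
 have Jn: "-[TR] x : J" if "x : J" for x
  using Jm[of "-[TR] 1[TR]" x] that Jc T.l_minus[of "1[TR]" x] by auto
 have Jsub: "subgroup J (tensor_group K A B)" unfolding am[symmetric]
  by (rule T.add.subgroupI) (use Jc J0 Ja Jn in \<open>auto simp: a_inv_def\<close>)
 have TG: "group (tensor_group K A B)" using T.a_group unfolding am .
 have H1J: "?H1 <= J" unfolding tensor_image_def
  by (rule group.generate_subgroup_incl[OF TG _ Jsub]) (use mbJ in \<open>auto simp: tns_def\<close>)
 have H2J: "?H2 <= J" unfolding tensor_image_def
  by (rule group.generate_subgroup_incl[OF TG _ Jsub]) (use anJ in \<open>auto simp: tns_def\<close>)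
 have Md: "x : ?M \<longleftrightarrow> (\<exists>h\<in>?H1. \<exists>k\<in>?H2. x = h +[TR] k)" for x unfolding set_add_def' by blast
 have Hc: "?H1 <= carrier TR" "?H2 <= carrier TR" using H1J H2J Jc by blast+
 have "submodule ?M TR (ring_mod TR)"
 proof (rule rT.submoduleI')
  show "?M <= carrier (ring_mod TR)"
  proof
   fix x assume "x : ?M"
   then obtain h k where "h : ?H1" "k : ?H2" "x = h +[TR] k" unfolding Md by blast
   then show "x : carrier (ring_mod TR)" using Hc by auto
  qed
  have "0[TR] : ?H1" "0[TR] : ?H2" using rT.sub_zero[OF H1] rT.sub_zero[OF H2] by simp_all
  then show "0[ring_mod TR] : ?M" unfolding Md by (intro bexI[of _ "0[TR]"]) simp_all
 next
  fix a b assume "a : ?M" "b : ?M"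
  then obtain h k h' k' where c: "h : ?H1" "k : ?H2" "a = h +[TR] k" "h' : ?H1" "k' : ?H2" "b = h' +[TR] k'" unfolding Md by blast
  have "h +[TR] h' : ?H1" "k +[TR] k' : ?H2" using rT.submoduleE(5)[OF H1 c(1,4)] rT.submoduleE(5)[OF H2 c(2,5)] by simp_all
  moreover have "a +[TR] b = (h +[TR] h') +[TR] (k +[TR] k')" unfolding c(3,6) by (rule T.add_add_swap) (use c Hc in auto)
  ultimately show "a +[ring_mod TR] b : ?M" unfolding Md by auto
 next
  fix t a assume t: "t : carrier TR" and "a : ?M"
  then obtain h k where c: "h : ?H1" "k : ?H2" "a = h +[TR] k" unfolding Md by blast
  have "t \<otimes>[TR] h : ?H1" "t \<otimes>[TR] k : ?H2" using rT.submoduleE(4)[OF H1 t c(1)] rT.submoduleE(4)[OF H2 t c(2)] by simp_all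
  moreover have "t \<otimes>[TR] a = t \<otimes>[TR] h +[TR] t \<otimes>[TR] k" unfolding c(3) by (rule T.r_distr) (use c Hc t in auto)
  ultimately show "t *[ring_mod TR] a : ?M" unfolding Md by auto
 qed
 moreover have "S <= ?M"
 proof
  have z: "0[TR] : ?H1" "0[TR] : ?H2" using rT.sub_zero[OF H1] rT.sub_zero[OF H2] by simp_all
  have xm: "set xs <= m" "set ys <= n" unfolding m n by (rule rA.gen_incl, rule rB.gen_incl)
  fix s assume "s : S"
  then consider x where "x : m" "s = tns K A B x 1[B]" | y where "y : n" "s = tns K A B 1[A] y" using xm unfolding S_def by auto
  then show "s : ?M"
  proof cases
   case 1
   have "s : tensor_image K A B m (carrier B)" unfolding 1(2) tensor_image_def
    by (rule generate.incl) (use 1(1) in \<open>auto simp: tns_def\<close>)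
   moreover have "s = s +[TR] 0[TR]" unfolding 1(2) using 1(1) mA by auto
   ultimately show ?thesis unfolding Md using z(2) by blast
  next
   case 2
   have "s : tensor_image K A B (carrier A) n" unfolding 2(2) tensor_image_def
    by (rule generate.incl) (use 2(1) in \<open>auto simp: tns_def\<close>)
   moreover have "s = 0[TR] +[TR] s" unfolding 2(2) using 2(1) mA by auto
   ultimately show ?thesis unfolding Md using z(1) by blast
  qed
 qed
 ultimately have "J <= ?M" unfolding J_def by (rule rT.gen_submodule_minimal)
 moreover have "?M <= J"
 proof
  fix x assume "x : ?M"
  then obtain h k where "h : ?H1" "k : ?H2" "x = h +[TR] k" unfolding Md by blast
  then show "x : J" using Ja[of h k] H1J H2J by auto
 qed
 ultimately have "?M = J" by blast
 then show ?thesis unfolding J_def S_def .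
qed

text \<open>A pure tensor splits as
  \<open>(x - c) \<otimes> y + c \<otimes> (y - d) + c \<otimes> d\<close>, where the first two
  terms lie in the ideal and the last comes from \<open>K\<close>.\<close>

lemma tensor_residue:
 assumes a: "aug_algebra K A iA xs m" and b: "aug_algebra K B iB ys n" and N: "noetherian_ring TR"
 shows "aug_algebra K TR iT (map (%x. tns K A B x 1[B]) xs @ map (%y. tns K A B 1[A] y) ys)
  (tensor_image K A B m (carrier B) <+>\<^bsub>TR\<^esub> tensor_image K A B (carrier A) n)"
proof -
 interpret a: aug_algebra K A iA xs m by (rule a)
 interpret b: aug_algebra K B iB ys n by (rule b)
 interpret rT: module TR "ring_mod TR" by (rule ring_mod_module[OF cring_T])
 let ?zs = "map (%x. tns K A B x 1[B]) xs @ map (%y. tns K A B 1[A] y) ys"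
 let ?M = "tensor_image K A B m (carrier B) <+>\<^bsub>TR\<^esub> tensor_image K A B (carrier A) n"
 have g: "?M = gen_submodule TR (ring_mod TR) (set ?zs)" by (rule tensor_ideal_gen[OF a.zs_carrier a.I_gen b.zs_carrier b.I_gen])
 have zs: "set ?zs <= carrier TR" using a.zs_carrier b.zs_carrier by (auto intro!: T.pure_closed)
 have sM: "submodule ?M TR (ring_mod TR)" unfolding g by (rule rT.gen_sub) (use zs in simp)
 have Ma: "!!x y. x : ?M ==> y : ?M ==> x +[TR] y : ?M" using rT.submoduleE(5)[OF sM] by simp
 have Mc: "?M <= carrier TR" using rT.submoduleE(1)[OF sM] by simp
 have z: "0[TR] : tensor_image K A B S U" for S U
  unfolding tensor_image_def T.zero_Z by (rule generate.one)
 have mb: "tns K A B s t : ?M" if st: "s : m" "t : carrier B" for s t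
 proof -
  have "s : carrier A" using ideal.Icarr[OF a.I_ideal st(1)] .
  then have "tns K A B s t = tns K A B s t +[TR] 0[TR]" using st(2) by simp
  moreover have "tns K A B s t : tensor_image K A B m (carrier B)" unfolding tensor_image_def
   by (rule generate.incl) (use st in \<open>auto simp: tns_def\<close>)
  ultimately show ?thesis unfolding set_add_def' using z by blast
 qed
 have an: "tns K A B s t : ?M" if st: "s : carrier A" "t : n" for s t
 proof -
  have "t : carrier B" using ideal.Icarr[OF b.I_ideal st(2)] .
  then have "tns K A B s t = 0[TR] +[TR] tns K A B s t" using st(1) by simp
  moreover have "tns K A B s t : tensor_image K A B (carrier A) n" unfolding tensor_image_def
   by (rule generate.incl) (use st in \<open>auto simp: tns_def\<close>)
  ultimately show ?thesis unfolding set_add_def' using z by blast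
 qed
 have hA: "!!c. c : carrier K ==> iA c : carrier A" and hB: "!!c. c : carrier K ==> iB c : carrier B" by simp_all
 have res: "\<exists>c\<in>carrier K. r -[TR] iT c : ?M" if "r : carrier TR" for r
  using that
 proof (induction r rule: T.tensor_induct)
  case (pure x y)
  obtain c where c: "c : carrier K" "x -[A] iA c : m" using a.residue[OF pure(1)] by blast
  obtain d where d: "d : carrier K" "y -[B] iB d : n" using b.residue[OF pure(2)] by blast
  let ?u = "tns K A B (x -[A] iA c) y" and ?v = "tns K A B (iA c) (y -[B] iB d)"
  have uv: "?u : ?M" "?v : ?M" using mb[OF c(2) pure(2)] an[OF hA[OF c(1)] d(2)] by simp_all
  have e: "tns K A B x y = ?u +[TR] tns K A B (iA c) y" "tns K A B (iA c) y = ?v +[TR] tns K A B (iA c) (iB d)"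
   using T.pure_add_left[of "x -[A] iA c" "iA c" y] T.pure_add_right[of "iA c" "y -[B] iB d" "iB d"] pure c(1) d(1)
   by (simp_all add: A.minus_add_cancel B.minus_add_cancel)
  have "tns K A B x y = (?u +[TR] ?v) +[TR] iT (c \<otimes>[K] d)"
   unfolding iT_pure[OF c(1) d(1)] e(1) e(2)
   by (rule T.a_assoc[symmetric, OF subsetD[OF Mc uv(1)] subsetD[OF Mc uv(2)] T.pure_closed[OF hA[OF c(1)] hB[OF d(1)]]])
  then have "tns K A B x y -[TR] iT (c \<otimes>[K] d) = ?u +[TR] ?v"
   using T.add_minus_cancel[of "?u +[TR] ?v" "iT (c \<otimes>[K] d)"] uv Mc c(1) d(1) by (auto simp: subset_iff)
  then show ?case using Ma[OF uv] c(1) d(1) by (intro bexI[of _ "c \<otimes>[K] d"]) simp_all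
 next
  case (add x y)
  then obtain c d where c: "c : carrier K" "x -[TR] iT c : ?M" and d: "d : carrier K" "y -[TR] iT d : ?M" by blast
  have "(x +[TR] y) -[TR] iT (c +[K] d) = (x -[TR] iT c) +[TR] (y -[TR] iT d)"
   using T.minus_add_minus[OF add(1,2), of "iT c" "iT d"] c(1) d(1) by (simp add: A.smult_l_distr T.pure_add_left)
  then show ?case using Ma[OF c(2) d(2)] c(1) d(1) by (intro bexI[of _ "c +[K] d"]) simp_all
 qed
 show ?thesis
  by (rule aug_algebra.intro[OF field_K iT_hom N cring_T zs g res])
qed

end

text \<open>The generators \<open>xs\<close> come from the Noetherian condition; that
  \<open>K\<close> maps onto the residue field gives \<open>A = K + m\<close>.\<close>

lemma local_algebra_aug:
 assumes K: "field K" and A: "algebra K A" and N: "noetherian_ring A" and L: "local_ring A m" and r: "residue_field_is K A m"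
 shows "\<exists>xs. aug_algebra K A (%c. c *[A] 1[A]) xs m"
proof -
 interpret A: algebra K A by (rule A)
 interpret rA: module A "ring_mod A" by (rule ring_mod_module[OF A.is_cring])
 have m: "ideal m A" using L unfolding local_ring_def maximalideal_def by blast
 interpret m: ideal m A by (rule m)
 have sm: "submodule m A (ring_mod A)" using ideal_iff_submodule[OF A.is_cring] m by blast
 have one: "gen_submodule A (ring_mod A) {1[A]} = carrier A"
 proof
  show "gen_submodule A (ring_mod A) {1[A]} <= carrier A" using rA.gen_submodule_carrier[of "{1[A]}"] by simp
  have s: "submodule (gen_submodule A (ring_mod A) {1[A]}) A (ring_mod A)" by (rule rA.gen_sub) simp
  show "carrier A <= gen_submodule A (ring_mod A) {1[A]}"
   using rA.submoduleE(4)[OF s, of _ "1[A]"] rA.gen_incl[of "{1[A]}"] by auto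
 qed
 have "m <= gen_submodule A (ring_mod A) {1[A]}" unfolding one using m.a_subset .
 then obtain F where F: "finite F" "F <= m" "m <= gen_submodule A (ring_mod A) F"
  using submodule_finitely_generated[OF N rA.module_axioms, of "{1[A]}" m] sm by auto
 obtain xs where xs: "set xs = F" using F(1) finite_list by blast
 have g: "m = gen_submodule A (ring_mod A) (set xs)"
  unfolding xs using F(3) rA.gen_submodule_minimal[OF sm F(2)] by blast
 have "\<exists>c\<in>carrier K. x -[A] c *[A] 1[A] : m" if x: "x : carrier A" for x
 proof -
  have "m +>\<^bsub>A\<^esub> x : carrier (A Quot m)" using x by (auto simp: FactRing_def A_RCOSETS_def')
  moreover have "(%c. m +>\<^bsub>A\<^esub> (c *[A] 1[A])) ` carrier K = carrier (A Quot m)"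
   using r unfolding residue_field_is_def ring_iso_def bij_betw_def by blast
  ultimately obtain c where c: "c : carrier K" "m +>\<^bsub>A\<^esub> x = m +>\<^bsub>A\<^esub> (c *[A] 1[A])" by (metis (no_types, lifting) imageE)
  have "x : m +>\<^bsub>A\<^esub> (c *[A] 1[A])" using m.a_rcos_self[OF x] c(2) by simp
  then have "x -[A] c *[A] 1[A] : m" using m.a_rcos_module_minus[OF A.ring_axioms] x c(1) by simp
  then show ?thesis using c(1) by blast
 qed
 then show ?thesis
  using aug_algebra.intro[OF K algebra_unit_hom[OF A] N A.is_cring _ g] xs F(2) m.a_subset by blast
qed

section \<open>Graded vector spaces and split complexes\<close>

text \<open>All degrees of a complex are placed in one module, so that a single tensor product
  serves all pairs of degrees. The part of degree \<open>p\<close> is the image of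
  \<open>emb E p\<close>.\<close>

definition prodm :: "(nat => ('a, 'm, 'x) module_scheme) => ('a, nat => 'm) module"
 where "prodm E = \<lparr>carrier = {x. \<forall>n. x n : carrier (E n)}, monoid.mult = undefined, monoid.one = undefined,
  ring.zero = (%n. 0[E n]), ring.add = (%x y n. x n +[E n] y n), smult = (%r x n. r *[E n] x n)\<rparr>"

lemma prodm_simps [simp]:
 "x : carrier (prodm E) \<longleftrightarrow> (\<forall>n. x n : carrier (E n))" "0[prodm E] n = 0[E n]"
 "(x +[prodm E] y) n = x n +[E n] y n" "(r *[prodm E] x) n = r *[E n] x n"
 by (simp_all add: prodm_def)

lemma kmod_prodm: "kmod \<iota> (prodm E) = prodm (%n. kmod \<iota> (E n))"
 by (simp add: prodm_def kmod_def)

lemma prodm_module: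
 assumes "!!n. module R (E n)" shows "module R (prodm E)"
proof -
 interpret E: module R "E nn" for nn by (rule assms)
 show ?thesis
 proof (rule moduleI)
  show "cring R" by (rule E.R.is_cring)
  show "abelian_group (prodm E)"
  proof (rule abelian_groupI)
   fix x assume x: "x : carrier (prodm E)"
   show "\<exists>y\<in>carrier (prodm E). y +[prodm E] x = 0[prodm E]"
    by (rule bexI[of _ "%n. -[E n] x n"]) (use x in \<open>auto simp: E.M.l_neg intro!: ext\<close>)
  qed (auto simp: E.M.a_ac intro!: ext)
 qed (auto simp: E.smult_l_distr E.smult_r_distr E.smult_assoc1 intro!: ext)
qed

lemma prodm_minus:
 assumes "!!n. module R (E n)" and x: "x : carrier (prodm E)" "y : carrier (prodm E)"
 shows "(x -[prodm E] y) n = x n -[E n] y n"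
proof -
 interpret E: module R "E nn" for nn by (rule assms)
 interpret P: module R "prodm E" by (rule prodm_module[OF assms(1)])
 have c: "(%n. x n -[E n] y n) : carrier (prodm E)" using x by simp
 have "x = (%n. x n -[E n] y n) +[prodm E] y" using x by (intro ext) (simp add: E.M.minus_add_cancel)
 then have "x -[prodm E] y = (%n. x n -[E n] y n)" using P.M.minus_eq_iff[OF x c] by simp
 then show ?thesis by simp
qed

definition emb :: "(nat => ('a, 'm, 'x) module_scheme) => nat => 'm => nat => 'm"
 where "emb E p e = (%n. if n = p then e else 0[E n])"

lemma emb_kmod [simp]: "emb (%n. kmod \<iota> (E n)) = emb E"
 by (simp add: emb_def fun_eq_iff)

lemma emb_apply [simp]: "emb E p e p = e"
 by (simp add: emb_def)

lemma emb_hom: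
 assumes "!!n. module R (E n)" shows "emb E p : mod_hom R (E p) (prodm E)"
proof -
 interpret E: module R "E nn" for nn by (rule assms)
 show ?thesis by (rule mod_homI) (auto simp: emb_def intro!: ext)
qed

definition pmap :: "(nat => 'm => 'n) => (nat => 'm) => nat => 'n"
 where "pmap \<phi> x = (%n. \<phi> n (x n))"

definition pup :: "(nat => ('a, 'm, 'x) module_scheme) => (nat => 'm => 'm) => (nat => 'm) => nat => 'm"
 where "pup E d x = (%n. case n of 0 => 0[E 0] | Suc m => d m (x m))"

definition pdown :: "(nat => 'm => 'm) => (nat => 'm) => nat => 'm"
 where "pdown s x = (%n. s n (x (Suc n)))"

text \<open>The sign of Koszul's rule, needed for the differential of a tensor complex to have
  square zero.\<close>

definition psign :: "(nat => ('a, 'm, 'x) module_scheme) => (nat => 'm) => nat => 'm"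
 where "psign E = pmap (%n x. if even n then x else -[E n] x)"

definition pproj :: "(nat => ('a, 'm, 'x) module_scheme) => nat => (nat => 'm) => nat => 'm"
 where "pproj E q x = emb E q (x q)"

lemma pup_kmod [simp]: "pup (%n. kmod \<iota> (E n)) = pup E"
 by (simp add: pup_def fun_eq_iff split: nat.split)

lemma kmod_uminus [simp]: "-[kmod \<iota> M] x = -[M] x"
 by (simp add: a_inv_def m_inv_def kmod_def)

lemma psign_kmod [simp]: "psign (%n. kmod \<iota> (E n)) = psign E"
 by (simp add: psign_def cong: if_cong)

lemma pmap_hom: assumes "!!n. \<phi> n : mod_hom R (E n) (F n)" shows "pmap \<phi> : mod_hom R (prodm E) (prodm F)"
 by (rule mod_homI) (auto simp: pmap_def mod_homD[OF assms] intro!: ext)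

lemma pup_hom:
 assumes m: "!!n. module R (E n)" and d: "!!n. d n : mod_hom R (E n) (E (Suc n))"
 shows "pup E d : mod_hom R (prodm E) (prodm E)"
proof -
 interpret E: module R "E nn" for nn by (rule m)
 show ?thesis by (rule mod_homI) (auto simp: pup_def mod_homD[OF d] intro!: ext split: nat.split)
qed

lemma pdown_hom: assumes "!!n. s n : mod_hom R (E (Suc n)) (E n)" shows "pdown s : mod_hom R (prodm E) (prodm E)"
 by (rule mod_homI) (auto simp: pdown_def mod_homD[OF assms] intro!: ext)

lemma psign_hom: assumes m: "!!n. module R (E n)" shows "psign E : mod_hom R (prodm E) (prodm E)"
 unfolding psign_def
proof (rule pmap_hom)
 fix n
 interpret E: module R "E n" by (rule m)
 show "(%x. if even n then x else -[E n] x) : mod_hom R (E n) (E n)"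
  by (rule mod_homI) (auto simp: E.M.minus_add E.smult_r_minus)
qed

lemma pproj_hom:
 assumes m: "!!n. module R (E n)" shows "pproj E q : mod_hom R (prodm E) (prodm E)"
proof -
 interpret E: module R "E nn" for nn by (rule m)
 show ?thesis by (rule mod_homI) (auto simp: pproj_def emb_def intro!: ext)
qed

lemma pmap_emb:
 assumes "!!n. module R (E n)" "!!n. module R (F n)" "!!n. \<phi> n : mod_hom R (E n) (F n)"
 shows "pmap \<phi> (emb E p x) = emb F p (\<phi> p x)"
 using mod_hom_zero[OF assms(3,1,2)] by (auto simp: pmap_def emb_def intro!: ext)

lemma pup_emb:
 assumes "!!n. module R (E n)" "!!n. d n : mod_hom R (E n) (E (Suc n))"
 shows "pup E d (emb E p x) = emb E (Suc p) (d p x)"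
 using mod_hom_zero[OF assms(2,1,1)] by (auto simp: pup_def emb_def intro!: ext split: nat.split)

lemma pdown_emb:
 assumes "!!n. module R (E n)" "!!n. s n : mod_hom R (E (Suc n)) (E n)"
 shows "pdown s (emb E (Suc p) x) = emb E p (s p x)" "pdown s (emb E 0 x) = 0[prodm E]"
 using mod_hom_zero[OF assms(2) assms(1) assms(1)] by (auto simp: pdown_def emb_def intro!: ext)

lemma psign_emb: 
 assumes "!!n. module R (E n)" "x : carrier (E p)" shows "psign E (emb E p x) = (if even p then emb E p x else -[prodm E] emb E p x)"
proof -
 interpret E: module R "E nn" for nn by (rule assms(1))
 interpret P: module R "prodm E" by (rule prodm_module[OF assms(1)])
 have c: "emb E p x : carrier (prodm E)" using assms(2) by (simp add: emb_def)
 have m: "(-[prodm E] emb E p x) n = -[E n] emb E p x n" for n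
  using prodm_minus[OF assms(1) P.M.zero_closed c, of n] c by (simp add: a_minus_def del: prodm_simps(1,3)) (use assms(2) in \<open>simp add: emb_def\<close>)
 have z: "-[E n] 0[E n] = 0[E n]" for n by (rule E.M.minus_equality) simp_all
 have "psign E (emb E p x) n = (if even p then emb E p x else -[prodm E] emb E p x) n" for n
  by (cases "even p"; cases "n = p") (simp_all add: psign_def pmap_def m, simp_all add: emb_def z)
 then show ?thesis by (rule ext)
qed

lemma pproj_emb: "pproj E q (emb E p x) = (if p = q then emb E p x else 0[prodm E])"
 by (auto simp: pproj_def emb_def intro!: ext)

text \<open>A graded subcomplex \<open>Y\<close> of vector spaces with a homotopy \<open>s\<close> between the identity and a
 projection \<open>h\<close> onto a space of representatives of the cohomology.\<close>

locale gsplit = module K G for K :: "('k, 'r) ring_scheme" and G :: "('k, 'g, 'gg) module_scheme" +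
 fixes Y :: "nat => 'g set" and d h s e :: "'g => 'g" and pr :: "nat => 'g => 'g"
 assumes Y_sub: "submodule (Y p) K G"
  and d_hom: "d : mod_hom K G G" and h_hom: "h : mod_hom K G G" and s_hom: "s : mod_hom K G G"
  and e_hom: "e : mod_hom K G G" and pr_hom: "pr q : mod_hom K G G"
  and dY: "x : Y p ==> d x : Y (Suc p)" and hY: "x : Y p ==> h x : Y p"
  and sY: "x : Y (Suc p) ==> s x : Y p" and s0: "x : Y 0 ==> s x = 0[G]"
  and eY: "x : Y p ==> e x = (if even p then x else -[G] x)"
  and prY: "x : Y p ==> pr q x = (if p = q then x else 0[G])"
  and homotopy: "x : Y p ==> x = h x +[G] (d (s x) +[G] s (d x))"
  and dd: "x : Y p ==> d (d x) = 0[G]" and dh: "x : Y p ==> d (h x) = 0[G]"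
  and hd: "x : Y p ==> h (d x) = 0[G]" and hh: "x : Y p ==> h (h x) = h x"
begin

lemma Y_carrier: "x : Y p ==> x : carrier G"
 using submoduleE(1)[OF Y_sub] by blast

definition "cocyc p = {x : Y p. d x = 0[G]}"
definition "bdy p = (case p of 0 => {0[G]} | Suc q => d ` Y q)"

lemma h_bdy: "x : bdy p ==> h x = 0[G]"
 unfolding bdy_def using hd mod_hom_zero[OF h_hom module_axioms module_axioms] by (auto split: nat.splits)

lemma h_cocyc: "x : Y p ==> h x : cocyc p"
 unfolding cocyc_def using hY dh by blast

lemma cocyc_split:
 assumes "x : cocyc p" shows "\<exists>b\<in>bdy p. x = h x +[G] b"
proof -
 have x: "x : Y p" "d x = 0[G]" using assms unfolding cocyc_def by auto
 have z: "s 0[G] = 0[G]" "d 0[G] = 0[G]" by (rule mod_hom_zero[OF s_hom module_axioms module_axioms], rule mod_hom_zero[OF d_hom module_axioms module_axioms])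
 have c: "d (s x) : carrier G" by (rule mod_homD(1)[OF d_hom mod_homD(1)[OF s_hom Y_carrier[OF x(1)]]])
 have "x = h x +[G] d (s x)" using homotopy[OF x(1)] x(2) z c by simp
 moreover have "d (s x) : bdy p" using x(1) sY s0 z unfolding bdy_def by (cases p) auto
 ultimately show ?thesis by blast
qed

text \<open>On \<open>Y p\<close> the map \<open>h\<close> is idempotent, kills the boundaries, and
  every cocycle \<open>x\<close> equals \<open>h x\<close> up to a boundary; its image is a copy of
  the cohomology.\<close>

lemma vanish_iff_h: "cocyc p <= bdy p \<longleftrightarrow> (\<forall>x\<in>Y p. h x = 0[G])"
proof
 assume a: "cocyc p <= bdy p"
 show "\<forall>x\<in>Y p. h x = 0[G]" using h_bdy[OF subsetD[OF a h_cocyc]] hh by metis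
next
 assume a: "\<forall>x\<in>Y p. h x = 0[G]"
 show "cocyc p <= bdy p"
 proof
  fix x assume x: "x : cocyc p"
  then obtain b where b: "b : bdy p" "x = h x +[G] b" using cocyc_split by blast
  have "b : carrier G" using b(1) Y_carrier dY unfolding bdy_def by (auto split: nat.splits)
  then show "x : bdy p" using b a x unfolding cocyc_def by simp
 qed
qed

end

text \<open>In each degree \<open>p n\<close> projects onto the cocycles in \<open>W n\<close>,
  \<open>\<rho> n\<close> onto the boundaries, and \<open>\<sigma> n\<close> inverts the
  differential up to cocycles. All of them exist because subspaces split off over a field.\<close>

lemma gsplit_exists:
 assumes K: "field K" and V: "!!n. module K (V n)" and \<delta>: "!!n. \<delta> n : mod_hom K (V n) (V (Suc n))"
  and W: "!!n. submodule (W n) K (V n)" and \<delta>W: "!!n x. x : W n ==> \<delta> n x : W (Suc n)"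
  and \<delta>\<delta>: "!!n x. x : W n ==> \<delta> (Suc n) (\<delta> n x) = 0[V (Suc (Suc n))]"
 shows "\<exists>h s. gsplit K (prodm V) (%p. emb V p ` W p) (pup V \<delta>) h s (psign V) (pproj V)"
proof -
 interpret V: module K "V nn" for nn by (rule V)
 have WV: "x : W n ==> x : carrier (V n)" for n x using V.submoduleE(1)[OF W] by blast
 define Bd where "Bd n = (case n of 0 => {0[V 0]} | Suc m => \<delta> m ` W m)" for n
 have Bd: "submodule (Bd n) K (V n)" for n
  unfolding Bd_def using V.submodule_zero submodule_mod_hom_image[OF \<delta> V V W] by (cases n) auto
 have BdW: "b : W n" "\<delta> n b = 0[V (Suc n)]" if "b : Bd n" for b n
 proof -
  show "b : W n" using that \<delta>W V.sub_zero[OF W] unfolding Bd_def by (cases n) auto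
  show "\<delta> n b = 0[V (Suc n)]" using that \<delta>\<delta> mod_hom_zero[OF \<delta> V V] unfolding Bd_def by (cases n) auto
 qed
 define Qp where "Qp n p s \<longleftrightarrow> p : mod_hom K (V n) (V n) \<and> s : mod_hom K (V (Suc n)) (V n) \<and> (\<forall>x\<in>carrier (V n). p x : W n \<and> \<delta> n (p x) = 0[V (Suc n)]) \<and>
  (\<forall>x\<in>W n. \<delta> n x = 0[V (Suc n)] --> p x = x) \<and> (\<forall>w\<in>carrier (V (Suc n)). s w : W n) \<and> (\<forall>x\<in>W n. s (\<delta> n x) = x -[V n] p x)" for n p s
 have "\<forall>n. \<exists>p s. Qp n p s" unfolding Qp_def using linear_splitting[OF K V V \<delta> W] by blast
 then obtain p \<sigma> where Q: "!!n. Qp n (p n) (\<sigma> n)" by metis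
 have p: "p n : mod_hom K (V n) (V n)" and \<sigma>: "\<sigma> n : mod_hom K (V (Suc n)) (V n)" for n using Q[of n] unfolding Qp_def by auto
 have pW: "x : carrier (V n) ==> p n x : W n" and pk: "x : carrier (V n) ==> \<delta> n (p n x) = 0[V (Suc n)]"
  and pid: "x : W n ==> \<delta> n x = 0[V (Suc n)] ==> p n x = x" and \<sigma>W: "w : carrier (V (Suc n)) ==> \<sigma> n w : W n"
  and \<sigma>\<delta>: "x : W n ==> \<sigma> n (\<delta> n x) = x -[V n] p n x" for n x w
  using Q[of n] unfolding Qp_def by auto
 have "\<forall>n. \<exists>r. r : mod_hom K (V n) (V n) \<and> r ` carrier (V n) <= Bd n \<and> (\<forall>x\<in>Bd n. r x = x)"
  using linear_projection[OF K V Bd] by blast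
 then obtain \<rho> where R: "!!n. \<rho> n : mod_hom K (V n) (V n) \<and> \<rho> n ` carrier (V n) <= Bd n \<and> (\<forall>x\<in>Bd n. \<rho> n x = x)" by metis
 have \<rho>: "\<rho> n : mod_hom K (V n) (V n)" and \<rho>B: "x : carrier (V n) ==> \<rho> n x : Bd n" and \<rho>id: "x : Bd n ==> \<rho> n x = x" for n x
  using R[of n] by auto
 note cl = mod_homD(1)[OF p] mod_homD(1)[OF \<sigma>] mod_homD(1)[OF \<rho>] mod_homD(1)[OF \<delta>]
 \<comment> \<open>\<open>h\<close> takes the cocycle part of \<open>x\<close> and removes its
   boundary part, so it represents cohomology; \<open>s\<close> lifts the boundary part back along
   the differential.\<close>
 define h where "h n x = p n x -[V n] \<rho> n (p n x)" for n x
 define s where "s n x = \<sigma> n (\<rho> (Suc n) (p (Suc n) x))" for n x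
 have h: "h n : mod_hom K (V n) (V n)" for n unfolding h_def
 proof (rule mod_homI)
  fix x y assume c: "x : carrier (V n)" "y : carrier (V n)"
  show "p n (x +[V n] y) -[V n] \<rho> n (p n (x +[V n] y)) = (p n x -[V n] \<rho> n (p n x)) +[V n] (p n y -[V n] \<rho> n (p n y))"
   unfolding mod_homD(2)[OF p c] mod_homD(2)[OF \<rho> cl(1)[OF c(1)] cl(1)[OF c(2)]] by (rule V.M.minus_add_minus) (simp_all add: c cl)
 qed (simp_all add: cl mod_homD(3)[OF p] mod_homD(3)[OF \<rho>] V.smult_minus)
 have s: "s n : mod_hom K (V (Suc n)) (V n)" for n
  unfolding s_def by (rule mod_hom_compose[OF mod_hom_compose[OF p \<rho>] \<sigma>])
 have \<delta>\<rho>: "\<delta> n (\<rho> n (p n x)) = 0[V (Suc n)]" if "x : carrier (V n)" for n x by (rule BdW(2)[OF \<rho>B[OF cl(1)[OF that]]])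
 have hW: "h n x : W n" if "x : carrier (V n)" for n x
  unfolding h_def by (rule V.submodule_minus_closed[OF W pW[OF that] BdW(1)[OF \<rho>B[OF cl(1)[OF that]]]])
 have \<delta>h: "\<delta> n (h n x) = 0[V (Suc n)]" if "x : carrier (V n)" for n x
  unfolding h_def mod_hom_minus[OF \<delta> V V cl(1)[OF that] cl(3)[OF cl(1)[OF that]]] pk[OF that] \<delta>\<rho>[OF that] by simp
 have pB: "p n x = x" if "x : Bd n" for n x by (rule pid[OF BdW[OF that]])
 have h\<delta>: "h (Suc n) (\<delta> n x) = 0[V (Suc n)]" if "x : W n" for n x
 proof -
  have b: "\<delta> n x : Bd (Suc n)" using that unfolding Bd_def by simp
  show ?thesis unfolding h_def pB[OF b] \<rho>id[OF b] by (rule V.M.minus_self) (use that WV cl in blast)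
 qed
 have hh: "h n (h n x) = h n x" if x: "x : carrier (V n)" for n x
 proof -
  have "p n (h n x) = h n x" by (rule pid[OF hW[OF x] \<delta>h[OF x]])
  moreover have "\<rho> n (h n x) = \<rho> n (p n x) -[V n] \<rho> n (\<rho> n (p n x))" unfolding h_def
   by (rule mod_hom_minus[OF \<rho> V V cl(1)[OF x] cl(3)[OF cl(1)[OF x]]])
  then have "\<rho> n (h n x) = 0[V n]" unfolding \<rho>id[OF \<rho>B[OF cl(1)[OF x]]] using x cl by simp
  ultimately show ?thesis unfolding h_def[of n "h n x"] using mod_homD(1)[OF h x] by simp
 qed
 have s\<delta>: "s n (\<delta> n x) = x -[V n] p n x" if x: "x : W n" for n x
 proof -
  have b: "\<delta> n x : Bd (Suc n)" using that unfolding Bd_def by simp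
  show ?thesis unfolding s_def pB[OF b] \<rho>id[OF b] by (rule \<sigma>\<delta>[OF x])
 qed
 have \<delta>s: "\<delta> n (s n x) = \<rho> (Suc n) (p (Suc n) x)" if x: "x : carrier (V (Suc n))" for n x
 proof -
  obtain y where y: "y : W n" "\<rho> (Suc n) (p (Suc n) x) = \<delta> n y" using \<rho>B[OF cl(1)[OF x]] unfolding Bd_def by auto
  have yc: "y : carrier (V n)" by (rule WV[OF y(1)])
  have "\<delta> n (s n x) = \<delta> n y -[V (Suc n)] \<delta> n (p n y)" unfolding s_def y(2) \<sigma>\<delta>[OF y(1)] by (rule mod_hom_minus[OF \<delta> V V yc cl(1)[OF yc]])
  then show ?thesis unfolding y(2) pk[OF yc] using cl yc by simp
 qed
 \<comment> \<open>\<open>\<delta> s x\<close> is the boundary part \<open>\<rho> p x\<close>, and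
   \<open>s \<delta> x\<close> is \<open>x - p x\<close>; together with \<open>h x\<close> they add
   up to \<open>x\<close>. In degree 0 the boundary part is zero.\<close>
 have hom: "x = h n x +[V n] ((case n of 0 => 0[V 0] | Suc m => \<delta> m (s m x)) +[V n] s n (\<delta> n x))" if x: "x : W n" for n x
 proof -
  have c: "x : carrier (V n)" by (rule WV[OF x])
  have pc: "p n x : carrier (V n)" "\<rho> n (p n x) : carrier (V n)" using cl c by blast+
  have e: "(case n of 0 => 0[V 0] | Suc m => \<delta> m (s m x)) = \<rho> n (p n x)"
  proof (cases n)
   case 0 then show ?thesis using \<rho>B[OF pc(1)] unfolding Bd_def by simp
  next
   case (Suc m) then show ?thesis using \<delta>s[of x m] c by simp
  qed
  have "h n x +[V n] (\<rho> n (p n x) +[V n] (x -[V n] p n x)) = (h n x +[V n] \<rho> n (p n x)) +[V n] (x -[V n] p n x)"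
   unfolding h_def by (rule V.M.a_assoc[symmetric]) (use pc c in simp_all)
  also have "\<dots> = p n x +[V n] (x -[V n] p n x)" unfolding h_def using V.M.minus_add_cancel[OF pc] by simp
  also have "\<dots> = x" by (rule V.M.add_minus_swap[OF pc(1) c])
  finally show ?thesis unfolding e s\<delta>[OF x] by simp
 qed
 have PV: "module K (prodm V)" by (rule prodm_module[OF V])
 note eh = emb_hom[where E = V, OF V] and pue = pup_emb[where E = V and d = \<delta>, OF V \<delta>]
  and pme = pmap_emb[where E = V and F = V and \<phi> = h, OF V V h] and pde = pdown_emb[where E = V and s = s, OF V s]
 have e0: "emb V n 0[V n] = 0[prodm V]" for n by (rule mod_hom_zero[OF eh V PV])
 interpret P: module K "prodm V" by (rule PV)
 have "gsplit K (prodm V) (%p. emb V p ` W p) (pup V \<delta>) (pmap h) (pdown s) (psign V) (pproj V)"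
 proof (intro gsplit.intro[OF PV] gsplit_axioms.intro)
  show "submodule (emb V n ` W n) K (prodm V)" for n by (rule submodule_mod_hom_image[OF eh V PV W])
  show "pup V \<delta> : mod_hom K (prodm V) (prodm V)" by (rule pup_hom[where E = V, OF V \<delta>])
  show "pmap h : mod_hom K (prodm V) (prodm V)" by (rule pmap_hom[OF h])
  show "pdown s : mod_hom K (prodm V) (prodm V)" by (rule pdown_hom[where E = V and s = s, OF s])
  show "psign V : mod_hom K (prodm V) (prodm V)" by (rule psign_hom[OF V])
  show "pproj V q : mod_hom K (prodm V) (prodm V)" for q by (rule pproj_hom[OF V])
 next
  fix x n assume "x : emb V n ` W n"
  then obtain w where w: "w : W n" "x = emb V n w" by blast
  note wc = WV[OF w(1)]
  show "pup V \<delta> x : emb V (Suc n) ` W (Suc n)" unfolding w(2) pue using \<delta>W[OF w(1)] by blast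
  show "pmap h x : emb V n ` W n" unfolding w(2) pme using hW[OF wc] by blast
  show "psign V x = (if even n then x else -[prodm V] x)" unfolding w(2) by (rule psign_emb[where E = V, OF V wc])
  show "pproj V q x = (if n = q then x else 0[prodm V])" for q unfolding w(2) by (rule pproj_emb)
  show "pup V \<delta> (pup V \<delta> x) = 0[prodm V]" unfolding w(2) pue \<delta>\<delta>[OF w(1)] by (rule e0)
  show "pup V \<delta> (pmap h x) = 0[prodm V]" unfolding w(2) pme pue \<delta>h[OF wc] by (rule e0)
  show "pmap h (pup V \<delta> x) = 0[prodm V]" unfolding w(2) pue pme h\<delta>[OF w(1)] by (rule e0)
  show "pmap h (pmap h x) = pmap h x" unfolding w(2) pme hh[OF wc] ..
  have "pup V \<delta> (pdown s x) = emb V n (case n of 0 => 0[V 0] | Suc m => \<delta> m (s m w))"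
  proof (cases n)
   case 0
   then show ?thesis unfolding w(2) using pde(2) mod_hom_zero[OF pup_hom[where E = V, OF V \<delta>] PV PV] e0[of 0] by simp
  next
   case (Suc m) then show ?thesis unfolding w(2) using pde(1) pue by simp
  qed
  moreover have "pdown s (pup V \<delta> x) = emb V n (s n (\<delta> n w))" unfolding w(2) pue pde(1) ..
  moreover have "(case n of 0 => 0[V 0] | Suc m => \<delta> m (s m w)) : carrier (V n)" using wc mod_homD(1)[OF s] cl(4) by (cases n) auto
  ultimately show "x = pmap h x +[prodm V] (pup V \<delta> (pdown s x) +[prodm V] pdown s (pup V \<delta> x))"
   using hom[OF w(1)] mod_homD(2)[OF eh] mod_homD(1)[OF h wc] mod_homD(1)[OF s cl(4)[OF wc]]
   unfolding w(2) pme by (metis V.M.add.m_closed)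
 next
  fix x n assume "x : emb V (Suc n) ` W (Suc n)"
  then obtain w where w: "w : W (Suc n)" "x = emb V (Suc n) w" by blast
  have "s n w : W n" unfolding s_def using \<sigma>W cl WV[OF w(1)] by blast
  then show "pdown s x : emb V n ` W n" unfolding w(2) pde(1) by blast
 next
  fix x assume "x : emb V 0 ` W 0"
  then show "pdown s x = 0[prodm V]" using pde(2) by auto
 qed
 then show ?thesis by blast
qed

lemma (in abelian_group) cancel_middle:
 assumes "a : carrier G" "b : carrier G" "c : carrier G" "f : carrier G" "m : carrier G"
 shows "(a \<oplus> \<ominus> m \<oplus> b) \<oplus> (c \<oplus> (m \<oplus> f)) = (a \<oplus> c) \<oplus> (b \<oplus> f)"
proof -
 have "(a \<oplus> \<ominus> m \<oplus> b) \<oplus> (c \<oplus> (m \<oplus> f)) = (a \<oplus> c) \<oplus> (b \<oplus> (\<ominus> m \<oplus> (m \<oplus> f)))" using assms by (simp add: a_ac)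
 also have "\<ominus> m \<oplus> (m \<oplus> f) = f" using assms by (simp add: a_assoc[symmetric] l_neg)
 finally show ?thesis .
qed

context gsplit
begin

text \<open>A functional \<open>l\<close> with value 1 at a nonzero \<open>h y\<close> exists over a
  field. Preceded by \<open>h\<close> it vanishes on boundaries, and preceded by the projection on
  degree \<open>q\<close> it vanishes in all other degrees.\<close>

lemma functional:
 assumes K: "field K" and v: "\<not> cocyc q <= bdy q"
 obtains m y where "m : mod_hom K G (ring_mod K)" "y : cocyc q" "m y = 1[K]"
  "!!z j. z : Y j ==> j \<noteq> q ==> m z = 0[K]" "!!z j. z : Y j ==> m (d z) = 0[K]"
proof -
 obtain y where y: "y : Y q" "h y \<noteq> 0[G]" using v unfolding vanish_iff_h by blast
 have hyc: "h y : carrier G" by (rule mod_homD(1)[OF h_hom Y_carrier[OF y(1)]])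
 have kK: "module K (ring_mod K)" by (rule ring_mod_module[OF R.is_cring])
 have inj: "c = 0[K]" if c: "c : carrier K" "c *[G] h y = 0[G]" for c
 proof (rule ccontr)
  interpret K: field K by (rule K)
  assume "c \<noteq> 0[K]"
  then have u: "c : Units K" using c(1) K.field_Units by blast
  have "h y = (inv\<^bsub>K\<^esub> c \<otimes>[K] c) *[G] h y" using u hyc by simp
  also have "\<dots> = 0[G]" using smult_assoc1[of "inv\<^bsub>K\<^esub> c" c "h y"] c u hyc by (simp add: smult_r_null)
  finally show False using y(2) by simp
 qed
 have "\<exists>g\<in>mod_hom K G (ring_mod K). \<forall>c\<in>carrier (ring_mod K). g (c *[G] h y) = c"
  by (rule baer_factor[where g = "%c. c", OF kK module_axioms kK field_baer[OF K kK] smult_hom[OF hyc]])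
   (auto intro: mod_homI inj)
 then obtain l where l: "l : mod_hom K G (ring_mod K)" "!!c. c : carrier K ==> l (c *[G] h y) = c" by auto
 have l1: "l (h y) = 1[K]" using l(2)[OF R.one_closed] hyc by simp
 have l0: "l 0[G] = 0[K]" using mod_hom_zero[OF l(1) module_axioms kK] by simp
 note h0 = mod_hom_zero[OF h_hom module_axioms module_axioms]
 show thesis
 proof (rule that[of "%z. l (h (pr q z))" "h y"])
  show "(%z. l (h (pr q z))) : mod_hom K G (ring_mod K)" by (rule mod_hom_compose[OF mod_hom_compose[OF pr_hom h_hom] l(1)])
  show "h y : cocyc q" by (rule h_cocyc[OF y(1)])
  show "l (h (pr q (h y))) = 1[K]" using prY[OF hY[OF y(1)], of q] hh[OF y(1)] l1 by simp
  show "l (h (pr q z)) = 0[K]" if "z : Y j" "j \<noteq> q" for z j using prY[OF that(1), of q] that(2) h0 l0 by simp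
  show "l (h (pr q (d z))) = 0[K]" if "z : Y j" for z j using prY[OF dY[OF that], of q] hd[OF that] h0 l0 by simp
 qed
qed

lemma bdy_sub: "submodule (bdy p) K G"
 unfolding bdy_def using submodule_zero submodule_mod_hom_image[OF d_hom module_axioms module_axioms Y_sub] by (cases p) auto

text \<open>Applying \<open>h\<close> to generators of the cocycles modulo the boundaries removes
  the boundaries and leaves finitely many cocycles that span all values of \<open>h\<close>.\<close>

lemma h_gen:
 assumes "fdq K G (cocyc p) (bdy p)"
 shows "\<exists>S. finite S \<and> S <= cocyc p \<and> (\<forall>x\<in>Y p. h x : gen_submodule K G S)"
proof -
 obtain S where S: "finite S" "S <= cocyc p" "cocyc p <= gen_submodule K G (S \<union> bdy p)" using assms unfolding fdq_def by blast
 have Sc: "S <= carrier G" using S(2) Y_carrier unfolding cocyc_def by blast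
 have bc: "bdy p <= carrier G" unfolding bdy_def using Y_carrier mod_homD(1)[OF d_hom] by (auto split: nat.split)
 have hS: "h ` S <= carrier G" using Sc mod_homD(1)[OF h_hom] by blast
 have "h x : gen_submodule K G (h ` S)" if x: "x : Y p" for x
 proof -
  have "h x : gen_submodule K G (S \<union> bdy p)" using S(3) h_cocyc[OF x] by blast
  then have "h (h x) : gen_submodule K G (h ` (S \<union> bdy p))"
   by (rule mod_hom_gen_submodule[OF h_hom module_axioms module_axioms, rotated]) (use Sc bc in blast)
  also have "\<dots> <= gen_submodule K G (h ` S)"
  proof (rule gen_submodule_minimal[OF gen_sub[OF hS]])
   show "h ` (S \<union> bdy p) <= gen_submodule K G (h ` S)"
    using gen_incl[of "h ` S"] h_bdy sub_zero[OF gen_sub[OF hS]] by auto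
  qed
  finally show ?thesis unfolding hh[OF x] .
 qed
 moreover have "h ` S <= cocyc p"
 proof (rule image_subsetI)
  fix x assume "x : S"
  then have "x : Y p" using S(2) unfolding cocyc_def by blast
  then show "h x : cocyc p" by (rule h_cocyc)
 qed
 ultimately show ?thesis using S(1) by blast
qed

end

section \<open>The Kuenneth formula\<close>

locale kunneth = G: gsplit K G Y d h s e pr + H: gsplit K H Y' d' h' s' e' pr' + C: tensor_lin K G H C
 for K :: "('k, 'r) ring_scheme" and G :: "('k, 'g, 'gg) module_scheme" and Y d h s e pr
  and H :: "('k, 'h, 'hh) module_scheme" and Y' d' h' s' e' pr' and C :: "('k, ('g \<times> 'h \<Rightarrow>\<^sub>0 int) set, 'cc) module_scheme" +
 fixes D :: "('g \<times> 'h \<Rightarrow>\<^sub>0 int) set => ('g \<times> 'h \<Rightarrow>\<^sub>0 int) set"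
 assumes field_K: "field K" and D_hom: "D : mod_hom K C C"
  and D_pure: "x : carrier G ==> y : carrier H ==> D (tns K G H x y) = tns K G H (d x) y +[C] tns K G H (e x) (d' y)"
begin

abbreviation tens (infixl \<open>\<boxtimes>\<close> 75) where "x \<boxtimes> y \<equiv> tns K G H x y"

text \<open>Total degree is a family of subspaces of the one tensor product \<open>C\<close>:
  \<open>Cn n\<close> is spanned by the pure tensors of homogeneous elements whose degrees add up to
  \<open>n\<close>.\<close>

definition "gens n = {x \<boxtimes> y | x y p q. x : Y p \<and> y : Y' q \<and> p + q = n}"
definition "Cn n = gen_submodule K C (gens n)"

lemmas Gc = G.Y_carrier and Hc = H.Y_carrier
lemmas cl = mod_homD(1)[OF G.d_hom] mod_homD(1)[OF G.h_hom] mod_homD(1)[OF G.s_hom] mod_homD(1)[OF G.e_hom]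
 mod_homD(1)[OF H.d_hom] mod_homD(1)[OF H.h_hom] mod_homD(1)[OF H.s_hom] mod_homD(1)[OF D_hom]

lemma gens_carrier: "gens n <= carrier C"
 unfolding gens_def using Gc Hc by auto

lemma Cn_sub: "submodule (Cn n) K C"
 unfolding Cn_def by (rule C.Z.gen_sub[OF gens_carrier])

lemma Cn_carrier: "z : Cn n ==> z : carrier C"
 using C.Z.submoduleE(1)[OF Cn_sub] by blast

lemma Cn_pure: "x : Y p ==> y : Y' q ==> p + q = n ==> x \<boxtimes> y : Cn n"
 unfolding Cn_def using C.Z.gen_incl[of "gens n"] unfolding gens_def by blast

lemma Cn_induct [consumes 1, case_names zero pure add smult]:
 assumes "z : Cn n" "Q 0[C]" "!!x y p q. x : Y p ==> y : Y' q ==> p + q = n ==> Q (x \<boxtimes> y)"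
  and "!!z w. z : carrier C ==> w : carrier C ==> Q z ==> Q w ==> Q (z +[C] w)"
  and "!!c z. c : carrier K ==> z : carrier C ==> Q z ==> Q (c *[C] z)"
 shows "Q z"
 by (rule gen_submodule_induct[OF assms(1)[unfolded Cn_def] C.Z.module_axioms gens_carrier]) (use assms gens_def in auto)

lemma Cn_hom_eq:
 assumes z: "z : Cn n" and W: "module K W" and f: "f : mod_hom K C W" and g: "g : mod_hom K C W"
  and fg: "!!x y p q. x : Y p ==> y : Y' q ==> p + q = n ==> f (x \<boxtimes> y) = g (x \<boxtimes> y)"
 shows "f z = g z"
 using z by (induction z rule: Cn_induct) (simp_all add: fg mod_homD[OF f] mod_homD[OF g] mod_hom_zero[OF f C.Z.module_axioms W] mod_hom_zero[OF g C.Z.module_axioms W])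

lemma Cn_hom_in:
 assumes z: "z : Cn n" and W: "module K W" and f: "f : mod_hom K C W" and V: "submodule V K W"
  and fV: "!!x y p q. x : Y p ==> y : Y' q ==> p + q = n ==> f (x \<boxtimes> y) : V"
 shows "f z : V"
 using z by (induction z rule: Cn_induct)
  (simp_all add: fV mod_homD[OF f] mod_hom_zero[OF f C.Z.module_axioms W] module.submoduleE(4,5)[OF W V] module.sub_zero[OF W V])

lemma const_zero_hom: "module K W ==> (%_. 0[W]) : mod_hom K C W"
 by (rule mod_homI) (simp_all add: module.axioms(2) abelian_group.axioms(1) abelian_monoid.zero_closed abelian_monoid.l_zero module.smult_r_null)

lemma eY': "x : Y p ==> e x : Y p"
 using G.eY[of x p] G.submoduleE(3)[OF G.Y_sub, of x p] by simp

lemma D_Cn: assumes "z : Cn n" shows "D z : Cn (Suc n)"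
proof (rule Cn_hom_in[OF assms C.Z.module_axioms D_hom Cn_sub])
 fix x y p q assume c: "x : Y p" "y : Y' q" "p + q = n"
 show "D (x \<boxtimes> y) : Cn (Suc n)"
  unfolding D_pure[OF Gc[OF c(1)] Hc[OF c(2)]]
  by (intro C.Z.submoduleE(5)[OF Cn_sub] Cn_pure[OF G.dY[OF c(1)] c(2)] Cn_pure[OF eY'[OF c(1)] H.dY[OF c(2)]]) (use c(3) in simp_all)
qed

text \<open>On one degree the sign is a scalar whose square is one, and on the neighbouring degrees
  it is the opposite scalar. This replaces all case distinctions on parity.\<close>

lemma e_smult: 
 assumes "x : Y p" obtains c where "c : carrier K" "e x = c *[G] x" "c \<otimes>[K] c = 1[K]"
  "!!z. z : Y p ==> e z = c *[G] z" "!!z. z : Y (Suc p) ==> e z = -[G] (c *[G] z)"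
  "!!z q. z : Y q ==> p = Suc q ==> e z = -[G] (c *[G] z)"
proof (rule that[of "if even p then 1[K] else -[K] 1[K]"])
 show "(if even p then 1[K] else -[K] 1[K]) \<otimes>[K] (if even p then 1[K] else -[K] 1[K]) = 1[K]" by (simp add: G.R.l_minus G.R.r_minus)
qed (use assms in \<open>auto simp: G.eY G.neg_smult Gc\<close>)

text \<open>The two mixed terms, \<open>e (d x) \<otimes> d' y\<close> and
  \<open>d (e x) \<otimes> d' y\<close>, are opposite because \<open>d\<close> shifts the degree by
  one.\<close>

lemma DD: assumes "z : Cn n" shows "D (D z) = 0[C]"
proof (rule Cn_hom_eq[OF assms C.Z.module_axioms mod_hom_compose[OF D_hom D_hom] const_zero_hom[OF C.Z.module_axioms]])
 fix x y p q assume c: "x : Y p" "y : Y' q" "p + q = n"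
 obtain t where t: "t : carrier K" "e x = t *[G] x" "!!z. z : Y (Suc p) ==> e z = -[G] (t *[G] z)"
  using e_smult[OF c(1)] by metis
 note xc = Gc[OF c(1)] and yc = Hc[OF c(2)]
 let ?u = "(t *[G] d x) \<boxtimes> d' y"
 have "D (D (x \<boxtimes> y)) = e (d x) \<boxtimes> d' y +[C] d (e x) \<boxtimes> d' y"
  using xc yc cl G.dd[OF c(1)] H.dd[OF c(2)] by (simp add: D_pure mod_homD(2)[OF D_hom])
 also have "e (d x) \<boxtimes> d' y = -[C] ?u"
  using t(3)[OF G.dY[OF c(1)]] C.pure_minus_left[of "0[G]" "t *[G] d x" "d' y"] xc yc cl t(1) by (simp add: a_minus_def)
 also have "d (e x) \<boxtimes> d' y = ?u" unfolding t(2) using t(1) xc by (simp add: mod_homD(3)[OF G.d_hom])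
 finally show "D (D (x \<boxtimes> y)) = 0[C]" using xc yc cl t(1) by (simp add: C.Z.l_neg)
qed

text \<open>From \<open>1 - h \<otimes> h' = (1 - h) \<otimes> 1 + h \<otimes> (1 - h')\<close>: the
  homotopies of the two factors combine to \<open>S = s \<otimes> 1 + h e \<otimes> s'\<close>,
  where the sign \<open>e\<close> compensates the one in \<open>D\<close>.\<close>

lemma chain_homotopy:
 shows "\<exists>S P. S : mod_hom K C C \<and> P : mod_hom K C C \<and> (\<forall>n. \<forall>z\<in>Cn (Suc n). S z : Cn n) \<and> (\<forall>z\<in>Cn 0. S z = 0[C]) \<and>
  (\<forall>n. \<forall>z\<in>Cn n. z = P z +[C] (D (S z) +[C] S (D z))) \<and> (\<forall>x\<in>carrier G. \<forall>y\<in>carrier H. P (x \<boxtimes> y) = h x \<boxtimes> h' y)"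
proof -
 have idG: "(%x. x) : mod_hom K G G" and idH: "(%x. x) : mod_hom K H H" by (rule mod_homI; simp)+
 obtain P where P: "P : mod_hom K C C" "!!x y. x : carrier G ==> y : carrier H ==> P (x \<boxtimes> y) = h x \<boxtimes> h' y"
  using C.lin_map[OF C.tensor_lin_axioms G.h_hom H.h_hom] by blast
 have "\<exists>S\<in>mod_hom K C C. \<forall>x\<in>carrier G. \<forall>y\<in>carrier H. S (x \<boxtimes> y) = s x \<boxtimes> y +[C] h (e x) \<boxtimes> s' y"
  by (rule C.lin_lift[OF C.Z.module_axioms])
   (simp_all add: cl mod_homD(2,3)[OF G.s_hom] mod_homD(2,3)[OF G.h_hom] mod_homD(2,3)[OF G.e_hom] mod_homD(2,3)[OF H.s_hom]
    C.pure_add_left C.pure_add_right C.Z.add_add_swap C.smult_pure[symmetric] C.smult_pure_right[symmetric] C.Z.smult_r_distr)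
 then obtain S where S: "S : mod_hom K C C" "!!x y. x : carrier G ==> y : carrier H ==> S (x \<boxtimes> y) = s x \<boxtimes> y +[C] h (e x) \<boxtimes> s' y" by blast
 have S1: "S z : Cn n" if z: "z : Cn (Suc n)" for n z
 proof (rule Cn_hom_in[OF z C.Z.module_axioms S(1) Cn_sub])
  fix x y p q assume c: "x : Y p" "y : Y' q" "p + q = Suc n"
  have "s x \<boxtimes> y : Cn n"
  proof (cases p)
   case 0 then show ?thesis using c G.s0[of x] C.Z.sub_zero[OF Cn_sub] Hc by simp
  next
   case (Suc k) then show ?thesis using Cn_pure[OF G.sY c(2)] c by simp
  qed
  moreover have "h (e x) \<boxtimes> s' y : Cn n"
  proof (cases q)
   case 0 then show ?thesis using c H.s0[of y] C.Z.sub_zero[OF Cn_sub] Gc cl by simp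
  next
   case (Suc k) then show ?thesis using Cn_pure[OF G.hY[OF eY'[OF c(1)]] H.sY] c by simp
  qed
  ultimately show "S (x \<boxtimes> y) : Cn n" unfolding S(2)[OF Gc[OF c(1)] Hc[OF c(2)]] by (rule C.Z.submoduleE(5)[OF Cn_sub])
 qed
 have S0: "S z = 0[C]" if z: "z : Cn 0" for z
  by (rule Cn_hom_eq[OF z C.Z.module_axioms S(1) const_zero_hom[OF C.Z.module_axioms]])
   (use Gc Hc cl G.s0 H.s0 S(2) in auto)
 have ho: "z = P z +[C] (D (S z) +[C] S (D z))" if z: "z : Cn n" for n z
 proof (rule Cn_hom_eq[OF z C.Z.module_axioms, where f = "%z. z" and g = "%z. P z +[C] (D (S z) +[C] S (D z))"])
  show "(%z. z) : mod_hom K C C" by (rule mod_homI) simp_all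
  show "(%z. P z +[C] (D (S z) +[C] S (D z))) : mod_hom K C C"
   by (rule mod_homI)
    (simp_all add: mod_homD[OF P(1)] mod_homD[OF S(1)] mod_homD[OF D_hom] C.Z.add_add_swap C.Z.smult_r_distr)
 next
  fix x y p q assume c: "x : Y p" "y : Y' q" "p + q = n"
  note xc = Gc[OF c(1)] and yc = Hc[OF c(2)]
  obtain t where t: "t : carrier K" "t \<otimes>[K] t = 1[K]" "!!z. z : Y p ==> e z = t *[G] z"
   "!!z. z : Y (Suc p) ==> e z = -[G] (t *[G] z)" "!!z q. z : Y q ==> p = Suc q ==> e z = -[G] (t *[G] z)"
   by (rule e_smult[OF c(1)]) blast
  note ex = t(3)[OF c(1)]
  have he: "h (t *[G] x) = t *[G] h x" and hde: "d (t *[G] h x) = 0[G]" and se: "s (t *[G] x) = t *[G] s x"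
   using t(1) xc cl G.dh[OF c(1)] by (simp_all add: mod_homD(3)[OF G.h_hom] mod_homD(3)[OF G.s_hom] mod_homD(3)[OF G.d_hom] G.smult_r_null)
  have ehx: "e (t *[G] h x) = h x"
   using t(1-3) cl xc G.hY[OF c(1)] G.submoduleE(4)[OF G.Y_sub t(1) G.hY[OF c(1)]] by (simp add: G.smult_assoc1[symmetric])
  have hett: "h (e (t *[G] x)) = h x"
   using t(1-3) cl xc G.submoduleE(4)[OF G.Y_sub t(1) c(1)] by (simp add: G.smult_assoc1[symmetric])
  have hed: "h (e (d x)) = 0[G]"
   unfolding t(4)[OF G.dY[OF c(1)]] using G.hd[OF c(1)] t(1) cl xc mod_hom_minus[OF G.h_hom G.module_axioms G.module_axioms, of "0[G]" "t *[G] d x"]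
    mod_hom_zero[OF G.h_hom G.module_axioms G.module_axioms] by (simp add: a_minus_def mod_homD(3)[OF G.h_hom] G.smult_r_null)
  have es: "e (s x) = -[G] (t *[G] s x)"
  proof (cases p)
   case 0
   then have "s x = 0[G]" using G.s0[of x] c(1) by simp
   then have "e (s x) = 0[G]" "-[G] (t *[G] s x) = 0[G]"
    using t(1) mod_hom_zero[OF G.e_hom G.module_axioms G.module_axioms] by (simp_all add: G.smult_r_null)
   then show ?thesis by simp
  next
   case (Suc k) then show ?thesis using t(5)[OF G.sY] c(1) by simp
  qed
  \<comment> \<open>The mixed term \<open>s \<otimes> d'\<close> occurs in \<open>D S\<close> and in
    \<open>S D\<close> with opposite signs, since \<open>s\<close> shifts the degree by one, and
    cancels.\<close>
  define m where "m = (t *[G] s x) \<boxtimes> d' y"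
  have mc: "m : carrier C" unfolding m_def using t(1) cl xc yc by simp
  have "D (S (x \<boxtimes> y)) = (d (s x) \<boxtimes> y +[C] e (s x) \<boxtimes> d' y) +[C] h x \<boxtimes> d' (s' y)"
   using xc yc cl t(1) by (simp add: S(2) D_pure mod_homD(2)[OF D_hom] ex he hde ehx)
  also have "e (s x) \<boxtimes> d' y = -[C] m"
   unfolding es m_def using C.pure_minus_left[of "0[G]" "t *[G] s x" "d' y"] xc yc cl t(1) by (simp add: a_minus_def)
  finally have ds: "D (S (x \<boxtimes> y)) = (d (s x) \<boxtimes> y +[C] -[C] m) +[C] h x \<boxtimes> d' (s' y)" .
  have sd: "S (D (x \<boxtimes> y)) = s (d x) \<boxtimes> y +[C] (m +[C] h x \<boxtimes> s' (d' y))"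
   using xc yc cl t(1) by (simp add: S(2) D_pure mod_homD(2)[OF S(1)] hed hett[unfolded ex] ex se m_def)
  have "(d (s x) \<boxtimes> y +[C] -[C] m) +[C] h x \<boxtimes> d' (s' y) +[C] (s (d x) \<boxtimes> y +[C] (m +[C] h x \<boxtimes> s' (d' y)))
   = (d (s x) \<boxtimes> y +[C] s (d x) \<boxtimes> y) +[C] (h x \<boxtimes> d' (s' y) +[C] h x \<boxtimes> s' (d' y))"
   by (rule C.Z.cancel_middle) (use xc yc cl mc in simp_all)
  also have "d (s x) \<boxtimes> y +[C] s (d x) \<boxtimes> y = (d (s x) +[G] s (d x)) \<boxtimes> y" using xc yc cl by (simp add: C.pure_add_left)
  also have "h x \<boxtimes> d' (s' y) +[C] h x \<boxtimes> s' (d' y) = h x \<boxtimes> (d' (s' y) +[H] s' (d' y))" using xc yc cl by (simp add: C.pure_add_right)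
  finally have "P (x \<boxtimes> y) +[C] (D (S (x \<boxtimes> y)) +[C] S (D (x \<boxtimes> y)))
   = h x \<boxtimes> h' y +[C] ((d (s x) +[G] s (d x)) \<boxtimes> y +[C] h x \<boxtimes> (d' (s' y) +[H] s' (d' y)))"
   unfolding P(2)[OF xc yc] ds sd by simp
  also have "\<dots> = h x \<boxtimes> (h' y +[H] (d' (s' y) +[H] s' (d' y))) +[C] (d (s x) +[G] s (d x)) \<boxtimes> y"
   using xc yc cl by (simp add: C.pure_add_right[of "h x" "h' y"] C.Z.a_ac)
  also have "\<dots> = (h x +[G] (d (s x) +[G] s (d x))) \<boxtimes> y"
   unfolding H.homotopy[OF c(2), symmetric] using xc yc cl by (simp add: C.pure_add_left[of "h x"])
  also have "\<dots> = x \<boxtimes> y" unfolding G.homotopy[OF c(1), symmetric] ..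
  finally show "x \<boxtimes> y = P (x \<boxtimes> y) +[C] (D (S (x \<boxtimes> y)) +[C] S (D (x \<boxtimes> y)))" by simp
 qed
 show ?thesis by (intro exI[of _ S] exI[of _ P] conjI ballI allI impI S(1) P S1 S0 ho)
qed


definition "Zn n = {z : Cn n. D z = 0[C]}"
definition "Bn n = (case n of 0 => {0[C]} | Suc m => D ` Cn m)"

lemma Bn_sub: "submodule (Bn n) K C"
 unfolding Bn_def using C.Z.submodule_zero submodule_mod_hom_image[OF D_hom C.Z.module_axioms C.Z.module_axioms Cn_sub] by (cases n) auto

lemma pure_cocycle: "x : G.cocyc p ==> y : H.cocyc q ==> p + q = n ==> x \<boxtimes> y : Zn n"
 unfolding Zn_def G.cocyc_def H.cocyc_def using Cn_pure[of x p y q n] D_pure[of x y] Gc[of x p] Hc[of y q] cl(4)[of x] by auto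

lemma Zn_split:
 obtains P where "P : mod_hom K C C" "!!x y. x : carrier G ==> y : carrier H ==> P (x \<boxtimes> y) = h x \<boxtimes> h' y"
  "!!n z. z : Zn n ==> \<exists>b\<in>Bn n. z = P z +[C] b"
proof -
 obtain S P where c: "S : mod_hom K C C" "P : mod_hom K C C" "\<forall>n. \<forall>z\<in>Cn (Suc n). S z : Cn n" "\<forall>z\<in>Cn 0. S z = 0[C]"
  "\<forall>n. \<forall>z\<in>Cn n. z = P z +[C] (D (S z) +[C] S (D z))" "\<forall>x\<in>carrier G. \<forall>y\<in>carrier H. P (x \<boxtimes> y) = h x \<boxtimes> h' y"
  using chain_homotopy by (elim exE conjE)
 have b: "\<exists>b\<in>Bn n. z = P z +[C] b" if z: "z : Zn n" for n z
 proof
  have zC: "z : Cn n" "D z = 0[C]" using z unfolding Zn_def by auto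
  have "S z : carrier C" by (rule mod_homD(1)[OF c(1) Cn_carrier[OF zC(1)]])
  moreover have "z = P z +[C] (D (S z) +[C] S (D z))" using c(5) zC(1) by blast
  ultimately show "z = P z +[C] D (S z)"
   using zC(2) mod_hom_zero[OF c(1) C.Z.module_axioms C.Z.module_axioms] cl by simp
  show "D (S z) : Bn n"
   using zC(1) c(3,4) mod_hom_zero[OF D_hom C.Z.module_axioms C.Z.module_axioms] unfolding Bn_def by (cases n) auto
 qed
 show thesis by (rule that[OF c(2) _ b]) (use c(6) in blast)
qed

text \<open>\<open>F\<close> contracts one factor with a functional of degree \<open>q\<close>. It
  lowers the degree by \<open>q\<close> and commutes with the differentials up to the unit
  \<open>t\<close>, so it maps cocycles to cocycles and boundaries to boundaries, and it is onto
  cocycles. \<open>F0\<close> handles boundaries that arrive in degree 0.\<close>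

lemma fdq_push:
 assumes W: "gsplit K W Yw dw hw sw ew prw" and F: "F : mod_hom K C W" and t: "t : carrier K" "t \<otimes>[K] t = 1[K]"
  and FY: "!!p z. z : Cn (p + q) ==> F z : Yw p" and F0: "!!k z. z : Cn k ==> k < q ==> F z = 0[W]"
  and FD: "!!k z. z : Cn k ==> F (D z) = t *[W] dw (F z)"
  and surj: "!!x. x : gsplit.cocyc W Yw dw p ==> \<exists>z\<in>Zn (p + q). F z = x" and fd: "fdq K C (Zn (p + q)) (Bn (p + q))"
 shows "fdq K W (gsplit.cocyc W Yw dw p) (gsplit.bdy W Yw dw p)"
proof -
 interpret W: gsplit K W Yw dw hw sw ew prw by (rule W)
 have tt: "w = 0[W]" if "w : carrier W" "t *[W] w = 0[W]" for w
  using W.smult_assoc1[OF t(1) t(1) that(1)] that t by (simp add: W.smult_r_null)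
 note dw0 = mod_hom_zero[OF W.d_hom W.module_axioms W.module_axioms] and Fz = mod_hom_zero[OF F C.Z.module_axioms W.module_axioms]
 show ?thesis
 proof (rule fdq_onto[OF C.Z.module_axioms W.module_axioms F _ _ _ W.bdy_sub _ _ _ fd])
  show "Zn (p + q) <= carrier C" unfolding Zn_def using Cn_carrier by blast
  show "Bn (p + q) <= carrier C" by (rule C.Z.submoduleE(1)[OF Bn_sub])
  show "W.cocyc p <= carrier W" unfolding W.cocyc_def using W.Y_carrier by blast
  have "F z : W.cocyc p" if "z : Zn (p + q)" for z
  proof -
   have z: "z : Cn (p + q)" "D z = 0[C]" using that unfolding Zn_def by auto
   have "dw (F z) = 0[W]"
    by (rule tt[OF mod_homD(1)[OF W.d_hom mod_homD(1)[OF F Cn_carrier[OF z(1)]]]]) (use FD[OF z(1)] z(2) Fz in simp)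
   then show ?thesis unfolding W.cocyc_def using FY[OF z(1)] by simp
  qed
  then show "F ` Zn (p + q) <= W.cocyc p" by blast
  show "F ` Bn (p + q) <= W.bdy p"
  proof (cases "p + q")
   case 0 then show ?thesis using Fz unfolding Bn_def W.bdy_def by simp
  next
   case (Suc k)
   have "F (D z) : W.bdy p" if z: "z : Cn k" for z
   proof (cases p)
    case 0
    then show ?thesis using FD[OF z] F0[OF z] Suc dw0 t by (simp add: W.bdy_def W.smult_r_null)
   next
    case (Suc i)
    have "dw (F z) : W.bdy p" using FY[of z i] z Suc \<open>p + q = Suc k\<close> unfolding W.bdy_def by auto
    then show ?thesis unfolding FD[OF z] by (rule W.submoduleE(4)[OF W.bdy_sub t(1)])
   qed
   then show ?thesis unfolding Bn_def Suc by auto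
  qed
  show "\<exists>z\<in>Zn (p + q). F z -[W] x : W.bdy p" if x: "x : W.cocyc p" for x
  proof -
   have "x : carrier W" using x W.Y_carrier unfolding W.cocyc_def by blast
   then show ?thesis using surj[OF x] W.sub_zero[OF W.bdy_sub, of p] by (metis W.M.minus_self)
  qed
 qed
qed

text \<open>Contracting the right factor with a functional that is 1 on a cocycle \<open>y\<close>
  and 0 on boundaries returns \<open>x\<close> from \<open>x \<otimes> y\<close>. Finite dimension
  thus passes from the tensor complex to \<open>G\<close>.\<close>

lemma fdq_left:
 assumes fd: "fdq K C (Zn (p + q)) (Bn (p + q))" and v: "\<not> H.cocyc q <= H.bdy q"
 shows "fdq K G (G.cocyc p) (G.bdy p)"
proof -
 obtain m y where m: "m : mod_hom K H (ring_mod K)" and y: "y : H.cocyc q" "m y = 1[K]"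
  and m0: "!!z j. z : Y' j ==> j \<noteq> q ==> m z = 0[K]" and md: "!!z j. z : Y' j ==> m (d' z) = 0[K]"
  by (rule H.functional[OF field_K v]) blast
 note mD = mod_homD[OF m, simplified]
 have "\<exists>F\<in>mod_hom K C G. \<forall>x\<in>carrier G. \<forall>z\<in>carrier H. F (x \<boxtimes> z) = m z *[G] x"
  by (rule C.lin_lift[OF G.module_axioms]) (simp_all add: mD G.smult_l_distr G.smult_r_distr G.smult_assoc1 G.smult_commute)
 then obtain F where F: "F : mod_hom K C G" "!!x z. x : carrier G ==> z : carrier H ==> F (x \<boxtimes> z) = m z *[G] x" by blast
 show ?thesis
 proof (rule fdq_push[OF G.gsplit_axioms F(1) G.R.one_closed _ _ _ _ _ fd])
  fix p z assume z: "z : Cn (p + q)"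
  show "F z : Y p"
  proof (rule Cn_hom_in[OF z G.module_axioms F(1) G.Y_sub])
   fix x w i j assume c: "x : Y i" "w : Y' j" "i + j = p + q"
   show "F (x \<boxtimes> w) : Y p"
    using c G.submoduleE(4)[OF G.Y_sub, of "m w" x p] F(2)[OF Gc[OF c(1)] Hc[OF c(2)]] mD(1)[OF Hc[OF c(2)]]
     m0[OF c(2)] Gc[OF c(1)] G.sub_zero[OF G.Y_sub, of p] by (cases "j = q") (simp_all add: G.smult_l_null)
  qed
 next
  show "F z = 0[G]" if z: "z : Cn k" "k < q" for z k
   by (rule Cn_hom_eq[OF z(1) G.module_axioms F(1) const_zero_hom[OF G.module_axioms]])
    (use z(2) m0 Gc Hc F(2) in \<open>auto simp: G.smult_l_null\<close>)
 next
  fix k z assume z: "z : Cn k"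
  have "F (D z) = d (F z)"
  proof (rule Cn_hom_eq[OF z G.module_axioms mod_hom_compose[OF D_hom F(1)] mod_hom_compose[OF F(1) G.d_hom]])
   fix x w i j assume c: "x : Y i" "w : Y' j" "i + j = k"
   note xc = Gc[OF c(1)] and wc = Hc[OF c(2)]
   show "F (D (x \<boxtimes> w)) = d (F (x \<boxtimes> w))"
    using xc wc cl md[OF c(2)] mD(1)[OF wc] by (simp add: D_pure mod_homD(2)[OF F(1)] F(2) mod_homD(3)[OF G.d_hom] G.smult_l_null)
  qed
  then show "F (D z) = 1[K] *[G] d (F z)" using Cn_carrier[OF z] mod_homD(1)[OF F(1)] cl by simp
 next
  fix x assume x: "x : G.cocyc p"
  have "x : carrier G" "y : carrier H" using x y Gc Hc unfolding G.cocyc_def H.cocyc_def by auto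
  then show "\<exists>z\<in>Zn (p + q). F z = x" using pure_cocycle[OF x y(1) refl] F(2)[of x y] y(2) by force
 qed simp
qed

lemma fdq_right:
 assumes fd: "fdq K C (Zn (p + q)) (Bn (p + q))" and v: "\<not> G.cocyc p <= G.bdy p"
 shows "fdq K H (H.cocyc q) (H.bdy q)"
proof -
 obtain m y where m: "m : mod_hom K G (ring_mod K)" and y: "y : G.cocyc p" "m y = 1[K]"
  and m0: "!!z j. z : Y j ==> j \<noteq> p ==> m z = 0[K]" and md: "!!z j. z : Y j ==> m (d z) = 0[K]"
  by (rule G.functional[OF field_K v]) blast
 note mD = mod_homD[OF m, simplified]
 have "y : Y p" using y(1) unfolding G.cocyc_def by simp
 then obtain t where t: "t : carrier K" "t \<otimes>[K] t = 1[K]" "!!z. z : Y p ==> e z = t *[G] z" by (rule e_smult) blast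
 have "\<exists>F\<in>mod_hom K C H. \<forall>x\<in>carrier G. \<forall>z\<in>carrier H. F (x \<boxtimes> z) = m x *[H] z"
  by (rule C.lin_lift[OF H.module_axioms]) (simp_all add: mD H.smult_l_distr H.smult_r_distr H.smult_assoc1 H.smult_commute)
 then obtain F where F: "F : mod_hom K C H" "!!x z. x : carrier G ==> z : carrier H ==> F (x \<boxtimes> z) = m x *[H] z" by blast
 show ?thesis
 proof (rule fdq_push[OF H.gsplit_axioms F(1) t(1,2) _ _ _ _ fd[unfolded add.commute[of p]]])
  fix q z assume z: "z : Cn (q + p)"
  show "F z : Y' q"
  proof (rule Cn_hom_in[OF z H.module_axioms F(1) H.Y_sub])
   fix x w i j assume c: "x : Y i" "w : Y' j" "i + j = q + p"
   show "F (x \<boxtimes> w) : Y' q"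
    using c H.submoduleE(4)[OF H.Y_sub, of "m x" w q] F(2)[OF Gc[OF c(1)] Hc[OF c(2)]] mD(1)[OF Gc[OF c(1)]]
     m0[OF c(1)] Hc[OF c(2)] H.sub_zero[OF H.Y_sub, of q] by (cases "i = p") (simp_all add: H.smult_l_null)
  qed
 next
  show "F z = 0[H]" if z: "z : Cn k" "k < p" for z k
   by (rule Cn_hom_eq[OF z(1) H.module_axioms F(1) const_zero_hom[OF H.module_axioms]])
    (use z(2) m0 Gc Hc F(2) in \<open>auto simp: H.smult_l_null\<close>)
 next
  fix k z assume z: "z : Cn k"
  have td: "(%z. t *[H] d' z) : mod_hom K H H"
   by (rule mod_homI) (simp_all add: t(1) mod_homD[OF H.d_hom] H.smult_r_distr H.smult_commute)
  show "F (D z) = t *[H] d' (F z)"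
  proof (rule Cn_hom_eq[OF z H.module_axioms mod_hom_compose[OF D_hom F(1)] mod_hom_compose[OF F(1) td]])
   fix x w i j assume c: "x : Y i" "w : Y' j" "i + j = k"
   note xc = Gc[OF c(1)] and wc = Hc[OF c(2)]
   \<comment> \<open>The sign passes the contraction as the constant \<open>t\<close>: in degree
     \<open>p\<close> it is \<open>t\<close> by definition, and in other degrees both sides
     vanish.\<close>
   have "m (e x) = t \<otimes>[K] m x"
    using m0[OF c(1)] m0[OF eY'[OF c(1)]] t(1,3) mD(3)[OF t(1) xc] c(1) by (cases "i = p") simp_all
   then show "F (D (x \<boxtimes> w)) = t *[H] d' (F (x \<boxtimes> w))"
    using xc wc cl md[OF c(1)] mD(1)[OF xc] t(1)
    by (simp add: D_pure mod_homD(2)[OF F(1)] F(2) mod_homD(3)[OF H.d_hom] H.smult_l_null H.smult_assoc1)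
  qed
 next
  fix x assume x: "x : H.cocyc q"
  have "x : carrier H" "y : carrier G" using x y Gc Hc unfolding G.cocyc_def H.cocyc_def by auto
  then show "\<exists>z\<in>Zn (q + p). F z = x" using pure_cocycle[OF y(1) x, of "q + p"] F(2)[of y x] y(2) by force
 qed
qed

text \<open>Up to boundaries a cocycle \<open>z\<close> is \<open>P z\<close>, a combination of
  tensors \<open>h x \<otimes> h' y\<close>. These are nonzero only when both cohomologies are
  nonzero, and then the hypotheses make both of them finite dimensional.\<close>

lemma fdq_tensor:
 assumes l: "!!p q. p + q = n ==> \<not> H.cocyc q <= H.bdy q ==> fdq K G (G.cocyc p) (G.bdy p)"
  and r: "!!p q. p + q = n ==> \<not> G.cocyc p <= G.bdy p ==> fdq K H (H.cocyc q) (H.bdy q)"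
 shows "fdq K C (Zn n) (Bn n)"
proof -
 obtain P where P: "P : mod_hom K C C" "!!x y. x : carrier G ==> y : carrier H ==> P (x \<boxtimes> y) = h x \<boxtimes> h' y"
  "!!n z. z : Zn n ==> \<exists>b\<in>Bn n. z = P z +[C] b" by (rule Zn_split) blast
 \<comment> \<open>For \<open>p\<close> outside this finite set one of the factors
   \<open>h x\<close>, \<open>h' y\<close> is zero.\<close>
 define I where "I = {p. p \<le> n \<and> \<not> G.cocyc p <= G.bdy p \<and> \<not> H.cocyc (n - p) <= H.bdy (n - p)}"
 have "\<forall>p\<in>I. \<exists>S. finite S \<and> S <= G.cocyc p \<and> (\<forall>x\<in>Y p. h x : gen_submodule K G S)"
 proof
  fix p assume "p : I"
  then have "p + (n - p) = n" "\<not> H.cocyc (n - p) <= H.bdy (n - p)" unfolding I_def by auto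
  then show "\<exists>S. finite S \<and> S <= G.cocyc p \<and> (\<forall>x\<in>Y p. h x : gen_submodule K G S)" by (intro G.h_gen l)
 qed
 from bchoice[OF this] obtain S where S: "!!p. p : I ==> finite (S p) \<and> S p <= G.cocyc p \<and> (\<forall>x\<in>Y p. h x : gen_submodule K G (S p))" by blast
 have "\<forall>p\<in>I. \<exists>S. finite S \<and> S <= H.cocyc (n - p) \<and> (\<forall>x\<in>Y' (n - p). h' x : gen_submodule K H S)"
 proof
  fix p assume "p : I"
  then have "p + (n - p) = n" "\<not> G.cocyc p <= G.bdy p" unfolding I_def by auto
  then show "\<exists>S. finite S \<and> S <= H.cocyc (n - p) \<and> (\<forall>x\<in>Y' (n - p). h' x : gen_submodule K H S)" by (intro H.h_gen r)
 qed
 from bchoice[OF this] obtain S' where S': "!!p. p : I ==> finite (S' p) \<and> S' p <= H.cocyc (n - p) \<and> (\<forall>x\<in>Y' (n - p). h' x : gen_submodule K H (S' p))" by blast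
 define U where "U = (\<Union>p\<in>I. (%(x, y). x \<boxtimes> y) ` (S p \<times> S' p))"
 have fI: "finite I" unfolding I_def by simp
 have fU: "finite U" unfolding U_def using S S' fI by auto
 have UZ: "U <= Zn n"
 proof
  fix u assume "u : U"
  then obtain p x y where u: "p : I" "x : S p" "y : S' p" "u = x \<boxtimes> y" unfolding U_def by auto
  have "p + (n - p) = n" using u(1) unfolding I_def by simp
  then show "u : Zn n" unfolding u(4) using pure_cocycle S[OF u(1)] S'[OF u(1)] u(2,3) by blast
 qed
 have ZC: "Zn n <= carrier C" unfolding Zn_def using Cn_carrier by blast
 have BC: "Bn n <= carrier C" by (rule C.Z.submoduleE(1)[OF Bn_sub])
 let ?J = "gen_submodule K C (U \<union> Bn n)"
 have J: "submodule ?J K C" by (rule C.Z.gen_sub) (use UZ ZC BC in blast)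
 have PJ: "P z : ?J" if z: "z : Cn n" for z
 proof (rule Cn_hom_in[OF z C.Z.module_axioms P(1) J])
  fix x y p q assume c: "x : Y p" "y : Y' q" "p + q = n"
  have xc: "h x : carrier G" "h' y : carrier H" using cl Gc[OF c(1)] Hc[OF c(2)] by simp_all
  show "P (x \<boxtimes> y) : ?J" unfolding P(2)[OF Gc[OF c(1)] Hc[OF c(2)]]
  proof (cases "h x = 0[G] \<or> h' y = 0[H]")
   case True
   then show "h x \<boxtimes> h' y : ?J" using xc C.Z.sub_zero[OF J] by auto
  next
   case False
   have q: "n - p = q" using c(3) by simp
   have pI: "p : I" unfolding I_def q G.vanish_iff_h H.vanish_iff_h using False c by auto
   note Sp = S[OF pI] and Sp' = S'[OF pI, unfolded q]
   have Sc: "S p <= carrier G" "S' p <= carrier H" using Sp Sp' Gc Hc unfolding G.cocyc_def H.cocyc_def by auto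
   have UJ: "a \<boxtimes> b : ?J" if "a : S p" "b : S' p" for a b
    using C.Z.gen_incl[of "U \<union> Bn n"] that pI unfolding U_def by auto
   have 1: "a \<boxtimes> b : ?J" if a: "a : gen_submodule K G (S p)" and b: "b : S' p" for a b
    using a
   proof (rule gen_submodule_induct[OF _ G.module_axioms Sc(1)])
    fix c a assume "c : carrier K" "a : carrier G" "a \<boxtimes> b : ?J"
    then show "(c *[G] a) \<boxtimes> b : ?J" using C.smult_pure[of c a b] C.Z.submoduleE(4)[OF J, of c "a \<boxtimes> b"] subsetD[OF Sc(2) b] by simp
   qed (use subsetD[OF Sc(2) b] UJ b C.Z.sub_zero[OF J] C.Z.submoduleE(5)[OF J] in \<open>simp_all add: C.pure_add_left\<close>)
   have bc: "gen_submodule K G (S p) <= carrier G" by (rule G.gen_submodule_carrier[OF Sc(1)])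
   have "a \<boxtimes> b : ?J" if a: "a : gen_submodule K G (S p)" and b: "b : gen_submodule K H (S' p)" for a b
    using b
   proof (rule gen_submodule_induct[OF _ H.module_axioms Sc(2)])
    fix c b assume "c : carrier K" "b : carrier H" "a \<boxtimes> b : ?J"
    then show "a \<boxtimes> (c *[H] b) : ?J" using C.smult_pure_right[of c a b] C.Z.submoduleE(4)[OF J, of c "a \<boxtimes> b"] subsetD[OF bc a] by simp
   qed (use subsetD[OF bc a] 1[OF a] C.Z.sub_zero[OF J] C.Z.submoduleE(5)[OF J] in \<open>simp_all add: C.pure_add_right\<close>)
   then show "h x \<boxtimes> h' y : ?J" using Sp Sp' c by blast
  qed
 qed
 have "Zn n <= ?J"
 proof
  fix z assume z: "z : Zn n"
  then obtain b where b: "b : Bn n" "z = P z +[C] b" using P(3) by blast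
  have "b : ?J" using b(1) C.Z.gen_incl[of "U \<union> Bn n"] by blast
  moreover have "P z : ?J" using z PJ unfolding Zn_def by blast
  ultimately show "z : ?J" using C.Z.submoduleE(5)[OF J] b(2) by metis
 qed
 then show ?thesis unfolding fdq_def using fU UZ by blast
qed

theorem kunneth_fdq:
 "fdq K C (Zn n) (Bn n) \<longleftrightarrow> (\<forall>p q. p + q = n -->
  (\<not> H.cocyc q <= H.bdy q --> fdq K G (G.cocyc p) (G.bdy p)) \<and> (\<not> G.cocyc p <= G.bdy p --> fdq K H (H.cocyc q) (H.bdy q)))"
 using fdq_left fdq_right fdq_tensor[of n] by blast

text \<open>The case of two resolutions. In positive total degree one of the two degrees is
  positive, so \<open>h \<otimes> h'\<close> vanishes; in degree 0 there are no boundaries and every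
  cocycle equals its image under \<open>h \<otimes> h'\<close>.\<close>

theorem kunneth_exact:
 assumes l: "!!p. G.cocyc (Suc p) <= G.bdy (Suc p)" and r: "!!p. H.cocyc (Suc p) <= H.bdy (Suc p)"
 shows "Zn (Suc n) <= Bn (Suc n)" and "z : Zn 0 ==> z : gen_submodule K C {x \<boxtimes> y | x y. x : G.cocyc 0 \<and> y : H.cocyc 0}"
proof -
 obtain P where P: "P : mod_hom K C C" "!!x y. x : carrier G ==> y : carrier H ==> P (x \<boxtimes> y) = h x \<boxtimes> h' y"
  "!!n z. z : Zn n ==> \<exists>b\<in>Bn n. z = P z +[C] b" by (rule Zn_split) blast
 show "Zn (Suc n) <= Bn (Suc n)"
 proof
  fix z assume z: "z : Zn (Suc n)"
  have "z : Cn (Suc n)" using z unfolding Zn_def by blast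
  then have "P z = 0[C]"
  proof (rule Cn_hom_eq[OF _ C.Z.module_axioms P(1) const_zero_hom[OF C.Z.module_axioms]])
   fix x y p q assume c: "x : Y p" "y : Y' q" "p + q = Suc n"
   have "h x = 0[G] \<or> h' y = 0[H]" using l[unfolded G.vanish_iff_h] r[unfolded H.vanish_iff_h] c by (cases p; cases q) auto
   then show "P (x \<boxtimes> y) = 0[C]" using P(2)[OF Gc[OF c(1)] Hc[OF c(2)]] cl Gc[OF c(1)] Hc[OF c(2)] by auto
  qed
  moreover obtain b where "b : Bn (Suc n)" "z = P z +[C] b" using P(3)[OF z] by blast
  ultimately show "z : Bn (Suc n)" using C.Z.submoduleE(1)[OF Bn_sub, of "Suc n"] by auto
 qed
 let ?T = "{x \<boxtimes> y | x y. x : G.cocyc 0 \<and> y : H.cocyc 0}"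
 assume z: "z : Zn 0"
 have T: "?T <= carrier C" unfolding G.cocyc_def H.cocyc_def using Gc Hc by auto
 have "P z : gen_submodule K C ?T"
 proof (rule Cn_hom_in[OF _ C.Z.module_axioms P(1) C.Z.gen_sub[OF T]])
  show "z : Cn 0" using z unfolding Zn_def by blast
  fix x y and p q :: nat assume c: "x : Y p" "y : Y' q" "p + q = 0"
  have "h x \<boxtimes> h' y : ?T" using G.h_cocyc[of x 0] H.h_cocyc[of y 0] c by auto
  then show "P (x \<boxtimes> y) : gen_submodule K C ?T"
   unfolding P(2)[OF Gc[OF c(1)] Hc[OF c(2)]] using C.Z.gen_incl[of ?T] by blast
 qed
 moreover have "P z = z" using P(3)[OF z] mod_homD(1)[OF P(1)] z Cn_carrier unfolding Bn_def Zn_def by auto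
 ultimately show "z : gen_submodule K C ?T" by simp
qed

end

section \<open>Torsion and goodness of the tensor complex\<close>

lemma fdq_restrict:
 assumes V: "module K V" and U: "submodule U K V" and Z: "Z <= U" and B: "B <= U"
 shows "fdq K (V\<lparr>carrier := U\<rparr>) Z B \<longleftrightarrow> fdq K V Z B"
proof -
 interpret V: module K V by (rule V)
 have "gen_submodule K (V\<lparr>carrier := U\<rparr>) S = gen_submodule K V S" if S: "S <= U" for S
 proof -
  interpret U: module K "V\<lparr>carrier := U\<rparr>" by (rule V.restrict_module[OF U])
  have SV: "S <= carrier V" using S V.submoduleE(1)[OF U] by blast
  have "submodule (gen_submodule K (V\<lparr>carrier := U\<rparr>) S) K V"
   using U.gen_sub[of S] S V.submodule_restrict_iff[OF U] by simp
  moreover have "submodule (gen_submodule K V S) K (V\<lparr>carrier := U\<rparr>)"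
   using V.gen_sub[OF SV] V.gen_submodule_minimal[OF U S] V.submodule_restrict_iff[OF U] by blast
  ultimately show ?thesis
   by (intro subset_antisym U.gen_submodule_minimal[OF _ V.gen_incl] V.gen_submodule_minimal[OF _ U.gen_incl])
 qed
 note e = this
 show ?thesis unfolding fdq_def by (intro iff_exI conj_cong refl arg_cong[where f = "%W. Z <= W"] e) (use Z B in blast)
qed

lemma gsplit_graded:
 assumes V: "!!n. module K (V n)" and \<delta>: "!!n. \<delta> n : mod_hom K (V n) (V (Suc n))"
  and g: "gsplit K (prodm V) (%p. emb V p ` W p) (pup V \<delta>) h s e pr"
 shows "gsplit.cocyc (prodm V) (%p. emb V p ` W p) (pup V \<delta>) p = emb V p ` {w : W p. \<delta> p w = 0[V (Suc p)]}"
  and "gsplit.bdy (prodm V) (%p. emb V p ` W p) (pup V \<delta>) p = emb V p ` bdry V \<delta> W p"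
proof -
 interpret g: gsplit K "prodm V" "%p. emb V p ` W p" "pup V \<delta>" h s e pr by (rule g)
 have pue: "pup V \<delta> (emb V p x) = emb V (Suc p) (\<delta> p x)" for p x by (rule pup_emb[where E = V and d = \<delta>, OF V \<delta>])
 have e0: "emb V n 0[V n] = 0[prodm V]" for n by (auto simp: emb_def intro!: ext)
 have inj: "emb V n a = 0[prodm V] \<longleftrightarrow> a = 0[V n]" for n a using e0 by (metis emb_apply)
 show "g.cocyc p = emb V p ` {w : W p. \<delta> p w = 0[V (Suc p)]}" unfolding g.cocyc_def by (auto simp: pue inj)
 show "g.bdy p = emb V p ` bdry V \<delta> W p" unfolding g.bdy_def by (cases p) (simp_all add: e0 image_image pue)
qed

lemma inj_emb: "inj (emb V p)"
 by (rule injI) (metis emb_apply)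

lemma fdq_emb:
 assumes V: "!!n. module K (V n)" and Z: "submodule Z K (V p)" and B: "submodule B K (V p)" "B <= Z"
 shows "fdq K (V p) Z B \<longleftrightarrow> fdq K (prodm V) (emb V p ` Z) (emb V p ` B)"
proof -
 interpret P: module K "prodm V" by (rule prodm_module[OF V])
 note eh = emb_hom[where E = V, OF V]
 have sub: "submodule (emb V p ` H) K (prodm V)" if "submodule H K (V p)" for H by (rule submodule_mod_hom_image[OF eh V P.module_axioms that])
 show ?thesis
 proof (rule fdq_iff[OF V P.module_axioms eh Z B _ sub[OF B(1)]])
  show c: "emb V p ` Z <= carrier (prodm V)" by (rule P.submoduleE(1)[OF sub[OF Z]])
  show "z : B" if "emb V p z : emb V p ` B" for z using that inj_emb[of V p] by (simp add: inj_image_mem_iff)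
  show "\<exists>z\<in>Z. emb V p z -[prodm V] z' : emb V p ` B" if z': "z' : emb V p ` Z" for z'
  proof -
   obtain z where z: "z : Z" "z' = emb V p z" using z' by blast
   have "emb V p z -[prodm V] z' = 0[prodm V]" unfolding z(2) by (rule P.M.minus_self) (use z(1) c in blast)
   then show ?thesis using z(1) P.sub_zero[OF sub[OF B(1)]] by (intro bexI[of _ z]) simp_all
  qed
 qed simp_all
qed

text \<open>Multiplication by a power of \<open>x\<close> is split on the \<open>ps\<close>-torsion
  in every degree at once: \<open>u = p u + s (x^k u)\<close>, where \<open>p u\<close> is also
  torsion for \<open>x\<close>. Being \<open>K\<close>-linear on the product module,
  \<open>p\<close> and \<open>s\<close> can be tensored with the identity.\<close>

lemma tors_splitting:
 assumes K: "field K" and \<iota>: "\<iota> : ring_hom K R" and E: "!!n. module R (E n)" and ps: "set ps <= carrier R" and x: "x : carrier R"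
 shows "\<exists>p s. p : mod_hom K (kmod \<iota> (prodm E)) (kmod \<iota> (prodm E)) \<and> s : mod_hom K (kmod \<iota> (prodm E)) (kmod \<iota> (prodm E)) \<and>
  (\<forall>i. \<forall>u\<in>tors R ps (E i). \<exists>u'\<in>tors R (ps @ [x]) (E i). p (emb E i u) = emb E i u' \<and>
   emb E i u = p (emb E i u) +[prodm E] s (emb E i ((x [^]\<^bsub>R\<^esub> (k::nat)) *[E i] u)))"
proof -
 interpret E: module R "E nn" for nn by (rule E)
 have cK: "cring K" using K by (simp add: field_def domain_def)
 note m = kmod_module[OF cK \<iota> E] and ce = mod_homD[OF emb_hom[where E = E, OF E]]
 define f where "f i u = (x [^]\<^bsub>R\<^esub> k) *[E i] u" for i u
 have fh: "f i : mod_hom K (kmod \<iota> (E i)) (kmod \<iota> (E i))" for i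
  unfolding f_def by (rule mod_homI) (use x ring_hom_closed[OF \<iota>] in \<open>simp_all add: E.smult_r_distr E.smult_commute\<close>)
 define Q where "Q i p s \<longleftrightarrow> p : mod_hom K (kmod \<iota> (E i)) (kmod \<iota> (E i)) \<and> s : mod_hom K (kmod \<iota> (E i)) (kmod \<iota> (E i)) \<and>
  (\<forall>u\<in>carrier (E i). p u : tors R ps (E i) \<and> f i (p u) = 0[E i]) \<and> (\<forall>u\<in>tors R ps (E i). s (f i u) = u -[E i] p u)" for i p s
 have "\<exists>p s. Q i p s" for i
  using linear_splitting[OF K m m fh submodule_kmod[OF cK \<iota> E E.tors_submodule[OF ps]], simplified] unfolding Q_def by blast
 then obtain p s where Q: "!!i. Q i (p i) (s i)" by metis
 have p: "!!i. p i : mod_hom K (kmod \<iota> (E i)) (kmod \<iota> (E i))" and s: "!!i. s i : mod_hom K (kmod \<iota> (E i)) (kmod \<iota> (E i))" using Q unfolding Q_def by auto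
 note pm = pmap_hom[where E = "%n. kmod \<iota> (E n)" and F = "%n. kmod \<iota> (E n)", folded kmod_prodm]
  and pe = pmap_emb[where E = "%n. kmod \<iota> (E n)" and F = "%n. kmod \<iota> (E n)", OF m m, unfolded emb_kmod]
 have "\<exists>u'\<in>tors R (ps @ [x]) (E i). pmap p (emb E i u) = emb E i u' \<and> emb E i u = pmap p (emb E i u) +[prodm E] pmap s (emb E i (f i u))"
  if u: "u : tors R ps (E i)" for i u
 proof (intro bexI conjI)
  have uc: "u : carrier (E i)" by (rule tors_carrier[OF u])
  then have pt: "p i u : tors R ps (E i)" "f i (p i u) = 0[E i]" and sf: "s i (f i u) = u -[E i] p i u" using Q[of i] u unfolding Q_def by auto
  show "p i u : tors R (ps @ [x]) (E i)" using pt unfolding tors_append f_def by (auto simp: tors_def)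
  show "pmap p (emb E i u) = emb E i (p i u)" by (rule pe[OF p])
  have pc: "p i u : carrier (E i)" by (rule tors_carrier[OF pt(1)])
  have "emb E i u = emb E i (p i u +[E i] (u -[E i] p i u))" unfolding E.M.add_minus_swap[OF pc uc] ..
  also have "\<dots> = emb E i (p i u) +[prodm E] emb E i (u -[E i] p i u)" by (rule ce(2)) (use pc uc in simp_all)
  finally show "emb E i u = pmap p (emb E i u) +[prodm E] pmap s (emb E i (f i u))" unfolding pe[OF p] pe[OF s] sf .
 qed
 then show ?thesis unfolding f_def[symmetric] by (intro exI[of _ "pmap p"] exI[of _ "pmap s"] conjI pm p s allI ballI)
qed

locale tensor_res = tensor_algebras K A B
 for K :: "('k, 'r) ring_scheme" and A :: "('k, 'a, 'aa) module_scheme" and B :: "('k, 'b, 'bb) module_scheme" +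
 fixes E :: "nat => ('a, 'e, 'ee) module_scheme" and dE and F :: "nat => ('b, 'f, 'ff) module_scheme" and dF and D
 assumes cE: "cplx A E dE" and cF: "cplx B F dF"
  and D_homT: "D : mod_hom TR (TM (prodm E) (prodm F)) (TM (prodm E) (prodm F))"
  and D_pureT: "x : carrier (prodm E) ==> y : carrier (prodm F) ==>
   D (tns K (kmod iA (prodm E)) (kmod iB (prodm F)) x y) =
   tns K (kmod iA (prodm E)) (kmod iB (prodm F)) (pup E dE x) y +[TM (prodm E) (prodm F)]
   tns K (kmod iA (prodm E)) (kmod iB (prodm F)) (psign E x) (pup F dF y)"
begin

abbreviation "C \<equiv> TM (prodm E) (prodm F)"
abbreviation tens (infixl \<open>\<boxtimes>\<close> 75) where "x \<boxtimes> y \<equiv> tns K (kmod iA (prodm E)) (kmod iB (prodm F)) x y"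
abbreviation "lt x \<equiv> tns K A B x 1[B]"
abbreviation "rt y \<equiv> tns K A B 1[A] y"

lemmas mE = cplxD(1)[OF cE] and mF = cplxD(1)[OF cF] and dE = cplxD(2)[OF cE] and dF = cplxD(2)[OF cF]
lemmas hA = algebra_unit_hom[OF alg_A] and hB = algebra_unit_hom[OF alg_B]

sublocale E: module A "E nn" for nn by (rule mE)
sublocale F: module B "F nn" for nn by (rule mF)
sublocale PE: module A "prodm E" by (rule prodm_module[OF mE])
sublocale PF: module B "prodm F" by (rule prodm_module[OF mF])
sublocale C: module TR C by (rule TM_module[OF PE.module_axioms PF.module_axioms])
sublocale Ck: tensor_lin K "kmod iA (prodm E)" "kmod iB (prodm F)" "kmod iT C" by (rule TM_lin[OF PE.module_axioms PF.module_axioms])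

lemmas smult_C = smult_TM_pure[OF PE.module_axioms PF.module_axioms]

text \<open>The part of total degree \<open>n\<close> of the tensor product of the
  \<open>ps\<close>-torsion of \<open>E\<close> with the \<open>qs\<close>-torsion of
  \<open>F\<close>, inside the one module \<open>C\<close>. With empty lists this is the whole
  tensor complex.\<close>

definition "CC ps qs n = gen_submodule K (kmod iT C)
 {x \<boxtimes> y | x y p q. x : emb E p ` tors A ps (E p) \<and> y : emb F q ` tors B qs (F q) \<and> p + q = n}"

lemma kun:
 assumes ps: "set ps <= carrier A" and qs: "set qs <= carrier B"
 obtains h s h' s' where "kunneth K (kmod iA (prodm E)) (%p. emb E p ` tors A ps (E p)) (pup E dE) h s (psign E) (pproj E)
  (kmod iB (prodm F)) (%p. emb F p ` tors B qs (F p)) (pup F dF) h' s' (psign F) (pproj F) (kmod iT C) D"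
proof -
 have pp: "pproj (%n. kmod \<iota> (M n)) = pproj M" for \<iota> and M :: "nat => ('p, 'q, 's) module_scheme" by (simp add: pproj_def fun_eq_iff)
 have "\<exists>h s. gsplit K (prodm (%n. kmod iA (E n))) (%p. emb (%n. kmod iA (E n)) p ` tors A ps (E p)) (pup (%n. kmod iA (E n)) dE) h s (psign (%n. kmod iA (E n))) (pproj (%n. kmod iA (E n)))"
  by (rule gsplit_exists[OF field_K])
   (simp_all add: kmod_module[OF A.R.is_cring hA mE] mod_hom_kmod[OF dE hA] submodule_kmod[OF A.R.is_cring hA mE E.tors_submodule[OF ps]]
    tors_mod_hom[OF dE mE mE ps] cplxD(3)[OF cE tors_carrier])
 then obtain h s where g: "gsplit K (kmod iA (prodm E)) (%p. emb E p ` tors A ps (E p)) (pup E dE) h s (psign E) (pproj E)"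
  by (auto simp: kmod_prodm pp)
 have "\<exists>h s. gsplit K (prodm (%n. kmod iB (F n))) (%p. emb (%n. kmod iB (F n)) p ` tors B qs (F p)) (pup (%n. kmod iB (F n)) dF) h s (psign (%n. kmod iB (F n))) (pproj (%n. kmod iB (F n)))"
  by (rule gsplit_exists[OF field_K])
   (simp_all add: kmod_module[OF A.R.is_cring hB mF] mod_hom_kmod[OF dF hB] submodule_kmod[OF A.R.is_cring hB mF F.tors_submodule[OF qs]]
    tors_mod_hom[OF dF mF mF qs] cplxD(3)[OF cF tors_carrier])
 then obtain h' s' where g': "gsplit K (kmod iB (prodm F)) (%p. emb F p ` tors B qs (F p)) (pup F dF) h' s' (psign F) (pproj F)"
  by (auto simp: kmod_prodm pp)
 show thesis
  by (rule that[OF kunneth.intro[OF g g' Ck.tensor_lin_axioms kunneth_axioms.intro[OF field_K mod_hom_kmod[OF D_homT iT_hom]]]])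
   (use D_pureT in simp)
qed

lemma CC_kun:
 assumes "kunneth K (kmod iA (prodm E)) (%p. emb E p ` tors A ps (E p)) d h s e pr
  (kmod iB (prodm F)) (%p. emb F p ` tors B qs (F p)) d' h' s' e' pr' (kmod iT C) D"
 shows "kunneth.Cn K (kmod iA (prodm E)) (%p. emb E p ` tors A ps (E p)) (kmod iB (prodm F)) (%p. emb F p ` tors B qs (F p)) (kmod iT C) n = CC ps qs n"
 unfolding kunneth.Cn_def[OF assms] kunneth.gens_def[OF assms] CC_def ..

context
 fixes ps qs assumes ps: "set ps <= carrier A" and qs: "set qs <= carrier B"
begin

lemma tors_gr: "u : tors A ps (E p) ==> emb E p u : carrier (prodm E)" "v : tors B qs (F q) ==> emb F q v : carrier (prodm F)"
 by (rule mod_homD(1)[OF emb_hom[where E = E, OF mE] tors_carrier], assumption)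
  (rule mod_homD(1)[OF emb_hom[where E = F, OF mF] tors_carrier])

lemma CC_induct [consumes 1, case_names zero pure add smult]:
 assumes z: "z : CC ps qs n" and "Q 0[C]" and p: "!!u v p q. u : tors A ps (E p) ==> v : tors B qs (F q) ==> p + q = n ==> Q (emb E p u \<boxtimes> emb F q v)"
  and "!!z w. z : CC ps qs n ==> w : CC ps qs n ==> Q z ==> Q w ==> Q (z +[C] w)"
  and "!!c z. c : carrier K ==> z : CC ps qs n ==> Q z ==> Q (iT c *[C] z)"
 shows "Q z"
proof -
 obtain h s h' s' where k: "kunneth K (kmod iA (prodm E)) (%p. emb E p ` tors A ps (E p)) (pup E dE) h s (psign E) (pproj E)
  (kmod iB (prodm F)) (%p. emb F p ` tors B qs (F p)) (pup F dF) h' s' (psign F) (pproj F) (kmod iT C) D" using kun[OF ps qs] .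
 interpret k: kunneth K "kmod iA (prodm E)" "%p. emb E p ` tors A ps (E p)" "pup E dE" h s "psign E" "pproj E"
  "kmod iB (prodm F)" "%p. emb F p ` tors B qs (F p)" "pup F dF" h' s' "psign F" "pproj F" "kmod iT C" D by (rule k)
 note CS = k.Cn_sub[of n, unfolded CC_kun[OF k]]
 have "z : k.Cn n" using z unfolding CC_kun[OF k] .
 then have "z : CC ps qs n \<and> Q z"
 proof (induction z rule: k.Cn_induct)
  case (pure x y p q)
  have "x \<boxtimes> y : CC ps qs n" unfolding CC_kun[OF k, symmetric] by (rule k.Cn_pure[OF pure])
  then show ?case using pure assms(3) by auto
 qed (use assms(2,4,5) Ck.Z.sub_zero[OF CS] Ck.Z.submoduleE(4,5)[OF CS] in auto)
 then show ?thesis ..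
qed

lemma CC_ksub: "submodule (CC ps qs n) K (kmod iT C)"
 unfolding CC_def by (rule Ck.Z.gen_sub) (use tors_gr in \<open>auto intro!: Ck.pure_closed[simplified]\<close>)

lemma CC_pure: "u : tors A ps (E p) ==> v : tors B qs (F q) ==> p + q = n ==> emb E p u \<boxtimes> emb F q v : CC ps qs n"
 unfolding CC_def by (rule subsetD[OF Ck.Z.gen_incl]) blast

lemma CC_add: "z : CC ps qs n ==> w : CC ps qs n ==> z +[C] w : CC ps qs n" and CC_carrier: "CC ps qs n <= carrier C"
 and CC_zero: "0[C] : CC ps qs n" and CC_smult: "c : carrier K ==> z : CC ps qs n ==> iT c *[C] z : CC ps qs n"
 using Ck.Z.submoduleE(1,4,5)[OF CC_ksub] Ck.Z.sub_zero[OF CC_ksub] by simp_all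

lemma emb_smult: "a : carrier A ==> u : tors A ps (E p) ==> a *[prodm E] emb E p u = emb E p (a *[E p] u)"
 "b : carrier B ==> v : tors B qs (F q) ==> b *[prodm F] emb F q v = emb F q (b *[F q] v)"
 using mod_homD(3)[OF emb_hom[where E = E, OF mE]] mod_homD(3)[OF emb_hom[where E = F, OF mF]] tors_carrier by metis+

lemma smult_emb: "a : carrier A ==> b : carrier B ==> u : tors A ps (E p) ==> v : tors B qs (F q) ==>
  tns K A B a b *[C] (emb E p u \<boxtimes> emb F q v) = emb E p (a *[E p] u) \<boxtimes> emb F q (b *[F q] v)"
 using smult_C[of a b "emb E p u" "emb F q v"] tors_gr emb_smult by simp

lemma CC_submodule: "submodule (CC ps qs n) TR C"
proof (rule C.submoduleI')
 have p: "tns K A B a b *[C] z : CC ps qs n" if ab: "a : carrier A" "b : carrier B" and z: "z : CC ps qs n" for a b z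
  using z
 proof (induction z rule: CC_induct)
  case zero then show ?case using CC_zero ab by (simp add: C.smult_r_null)
 next
  case (pure u v p q)
  show ?case unfolding smult_emb[OF ab pure(1,2)]
   by (rule CC_pure[OF E.submoduleE(4)[OF E.tors_submodule[OF ps] ab(1) pure(1)] F.submoduleE(4)[OF F.tors_submodule[OF qs] ab(2) pure(2)] pure(3)])
 next
  case (add z w) then show ?case using CC_add CC_carrier ab by (auto simp: C.smult_r_distr subset_iff)
 next
  case (smult c z)
  have "tns K A B a b *[C] (iT c *[C] z) = iT c *[C] (tns K A B a b *[C] z)"
   by (rule C.smult_commute) (use ab smult(1,2) CC_carrier in auto)
  then show ?case using CC_smult[OF smult(1,3)] by simp
 qed
 fix t z assume t: "t : carrier TR" and z: "z : CC ps qs n"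
 show "t *[C] z : CC ps qs n"
  using t by (induction t rule: T.tensor_induct) (use z CC_carrier p CC_add in \<open>auto simp: C.smult_l_distr subset_iff\<close>)
qed (use CC_carrier CC_zero CC_add in auto)

end

lemma pow_lt: "x : carrier A ==> lt x [^]\<^bsub>TR\<^esub> (k::nat) = lt (x [^]\<^bsub>A\<^esub> k)"
 by (induction k) (simp_all add: one_T mult_pure)

lemma pow_rt: "y : carrier B ==> rt y [^]\<^bsub>TR\<^esub> (k::nat) = rt (y [^]\<^bsub>B\<^esub> k)"
 by (induction k) (simp_all add: one_T mult_pure)

lemma smult_khom: 
 assumes "t : carrier TR" shows "(%z. t *[C] z) : mod_hom K (kmod iT C) (kmod iT C)"
 by (rule mod_homI) (use assms in \<open>simp_all add: C.smult_r_distr C.smult_commute\<close>)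

text \<open>Tensoring the splitting of one factor with the identity gives
  \<open>z = P z + S (t z)\<close> for \<open>t\<close> a power of \<open>x \<otimes> 1\<close> or
  \<open>1 \<otimes> y\<close>. If \<open>t z\<close> is zero, then \<open>z = P z\<close>, which
  lies in the smaller space.\<close>

lemma tors_step:
 assumes ps: "set ps <= carrier A" and qs: "set qs <= carrier B" and z: "z : CC ps qs n"
 shows "x : carrier A ==> (lt x [^]\<^bsub>TR\<^esub> (k::nat)) *[C] z = 0[C] ==> z : CC (ps @ [x]) qs n"
  and "y : carrier B ==> (rt y [^]\<^bsub>TR\<^esub> (k::nat)) *[C] z = 0[C] ==> z : CC ps (qs @ [y]) n"
proof -
 have id: "(%x. x) : mod_hom K M M" for M :: "('k, 'p) module" by (rule mod_homI) simp_all
 \<comment> \<open>Common to both factors. The decomposition is checked on pure tensors and extends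
   by linearity.\<close>
 have core: "z : CC ps' qs' n"
  if P: "P : mod_hom K (kmod iT C) (kmod iT C)" and S: "S : mod_hom K (kmod iT C) (kmod iT C)" and t: "t : carrier TR" "t *[C] z = 0[C]"
   and ps': "set ps' <= carrier A" and qs': "set qs' <= carrier B"
   and PS: "!!u v p q. u : tors A ps (E p) ==> v : tors B qs (F q) ==> p + q = n ==> P (emb E p u \<boxtimes> emb F q v) : CC ps' qs' n \<and>
    emb E p u \<boxtimes> emb F q v = P (emb E p u \<boxtimes> emb F q v) +[C] S (t *[C] (emb E p u \<boxtimes> emb F q v))" for P S t ps' qs'
 proof -
  note PD = mod_homD[OF P, simplified] and SD = mod_homD[OF mod_hom_compose[OF smult_khom[OF t(1)] S], simplified]
  note z0 = mod_hom_zero[OF P Ck.Z.module_axioms Ck.Z.module_axioms, simplified] mod_hom_zero[OF mod_hom_compose[OF smult_khom[OF t(1)] S] Ck.Z.module_axioms Ck.Z.module_axioms, simplified]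
  note iTc = ring_hom_closed[OF iT_hom]
  have "z = P z +[C] S (t *[C] z) \<and> P z : CC ps' qs' n"
   using z
  proof (induction z rule: CC_induct[OF ps qs, consumes 1, case_names zero pure add smult])
   case zero then show ?case using z0 CC_zero[OF ps' qs'] by simp
  next
   case (pure u v p q) then show ?case using PS by blast
  next
   case (add z w)
   have c: "z : carrier C" "w : carrier C" using add(1,2) CC_carrier[OF ps qs] by auto
   have "z +[C] w = (P z +[C] S (t *[C] z)) +[C] (P w +[C] S (t *[C] w))" using add(3,4) by simp
   also have "\<dots> = P (z +[C] w) +[C] S (t *[C] (z +[C] w))" unfolding PD(2)[OF c] SD(2)[OF c] by (rule C.M.add_add_swap) (use c PD SD in simp_all)
   finally show ?case using add(3,4) CC_add[OF ps' qs'] unfolding PD(2)[OF c] by simp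
  next
   case (smult c z)
   have zc: "z : carrier C" using smult(2) CC_carrier[OF ps qs] by auto
   have "iT c *[C] z = iT c *[C] (P z +[C] S (t *[C] z))" using smult(3) by simp
   also have "\<dots> = P (iT c *[C] z) +[C] S (t *[C] (iT c *[C] z))" unfolding PD(3)[OF smult(1) zc] SD(3)[OF smult(1) zc]
    by (rule C.smult_r_distr) (use iTc[OF smult(1)] zc PD SD in simp_all)
   finally show ?case using smult(3) CC_smult[OF ps' qs' smult(1)] unfolding PD(3)[OF smult(1) zc] by simp
  qed
  then show ?thesis using z0(2) t(2) mod_hom_zero[OF S Ck.Z.module_axioms Ck.Z.module_axioms] CC_carrier[OF ps' qs'] by (auto simp: subset_iff)
 qed
 note g = tors_gr[OF ps qs]
 show "z : CC (ps @ [x]) qs n" if x: "x : carrier A" and k0: "(lt x [^]\<^bsub>TR\<^esub> k) *[C] z = 0[C]"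
 proof -
  obtain p s where p: "p : mod_hom K (kmod iA (prodm E)) (kmod iA (prodm E))" and s: "s : mod_hom K (kmod iA (prodm E)) (kmod iA (prodm E))"
   and ps': "!!i u. u : tors A ps (E i) ==> \<exists>u'\<in>tors A (ps @ [x]) (E i). p (emb E i u) = emb E i u' \<and>
    emb E i u = p (emb E i u) +[prodm E] s (emb E i ((x [^]\<^bsub>A\<^esub> k) *[E i] u))"
   using tors_splitting[where E = E, OF field_K hA mE ps x, of k] by blast
  obtain P where P: "P : mod_hom K (kmod iT C) (kmod iT C)" "!!x y. x : carrier (prodm E) ==> y : carrier (prodm F) ==> P (x \<boxtimes> y) = p x \<boxtimes> y"
   using Ck.lin_map[OF Ck.tensor_lin_axioms p id[of "kmod iB (prodm F)"], unfolded kmod_simps] by blast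
  obtain S where S: "S : mod_hom K (kmod iT C) (kmod iT C)" "!!x y. x : carrier (prodm E) ==> y : carrier (prodm F) ==> S (x \<boxtimes> y) = s x \<boxtimes> y"
   using Ck.lin_map[OF Ck.tensor_lin_axioms s id[of "kmod iB (prodm F)"], unfolded kmod_simps] by blast
  have xk: "x [^]\<^bsub>A\<^esub> k : carrier A" and psx: "set (ps @ [x]) <= carrier A" using ps x by simp_all
  show ?thesis
  proof (rule core[OF P(1) S(1) _ k0[unfolded pow_lt[OF x]] psx qs])
   fix u v i j assume c: "u : tors A ps (E i)" "v : tors B qs (F j)" "i + j = n"
   obtain u' where u': "u' : tors A (ps @ [x]) (E i)" "p (emb E i u) = emb E i u'"
    "emb E i u = p (emb E i u) +[prodm E] s (emb E i ((x [^]\<^bsub>A\<^esub> k) *[E i] u))" using ps'[OF c(1)] by blast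
   have xu: "(x [^]\<^bsub>A\<^esub> k) *[E i] u : tors A ps (E i)" by (rule E.submoduleE(4)[OF E.tors_submodule[OF ps] xk c(1)])
   have Sp: "S (lt (x [^]\<^bsub>A\<^esub> k) *[C] (emb E i u \<boxtimes> emb F j v)) = s (emb E i ((x [^]\<^bsub>A\<^esub> k) *[E i] u)) \<boxtimes> emb F j v"
    unfolding smult_emb[OF ps qs xk B.one_closed c(1,2)] F.smult_one[OF tors_carrier[OF c(2)]] by (rule S(2)[OF g(1)[OF xu] g(2)[OF c(2)]])
   have "p (emb E i u) : carrier (prodm E)" "s (emb E i ((x [^]\<^bsub>A\<^esub> k) *[E i] u)) : carrier (prodm E)"
    using mod_homD(1)[OF p, unfolded kmod_simps, OF g(1)[OF c(1)]] mod_homD(1)[OF s, unfolded kmod_simps, OF g(1)[OF xu]] .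
   from Ck.pure_add_left[unfolded kmod_simps, OF this g(2)[OF c(2)]]
   show "P (emb E i u \<boxtimes> emb F j v) : CC (ps @ [x]) qs n \<and>
    emb E i u \<boxtimes> emb F j v = P (emb E i u \<boxtimes> emb F j v) +[C] S (lt (x [^]\<^bsub>A\<^esub> k) *[C] (emb E i u \<boxtimes> emb F j v))"
    unfolding Sp P(2)[OF g(1)[OF c(1)] g(2)[OF c(2)]] u'(3)[symmetric] unfolding u'(2) using CC_pure[OF psx qs u'(1) c(2,3)] by simp
  qed (use xk in simp)
 qed
 show "z : CC ps (qs @ [y]) n" if y: "y : carrier B" and k0: "(rt y [^]\<^bsub>TR\<^esub> k) *[C] z = 0[C]"
 proof -
  obtain p s where p: "p : mod_hom K (kmod iB (prodm F)) (kmod iB (prodm F))" and s: "s : mod_hom K (kmod iB (prodm F)) (kmod iB (prodm F))"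
   and qs': "!!i u. u : tors B qs (F i) ==> \<exists>u'\<in>tors B (qs @ [y]) (F i). p (emb F i u) = emb F i u' \<and>
    emb F i u = p (emb F i u) +[prodm F] s (emb F i ((y [^]\<^bsub>B\<^esub> k) *[F i] u))"
   using tors_splitting[where E = F, OF field_K hB mF qs y, of k] by blast
  obtain P where P: "P : mod_hom K (kmod iT C) (kmod iT C)" "!!x y. x : carrier (prodm E) ==> y : carrier (prodm F) ==> P (x \<boxtimes> y) = x \<boxtimes> p y"
   using Ck.lin_map[OF Ck.tensor_lin_axioms id[of "kmod iA (prodm E)"] p, unfolded kmod_simps] by blast
  obtain S where S: "S : mod_hom K (kmod iT C) (kmod iT C)" "!!x y. x : carrier (prodm E) ==> y : carrier (prodm F) ==> S (x \<boxtimes> y) = x \<boxtimes> s y"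
   using Ck.lin_map[OF Ck.tensor_lin_axioms id[of "kmod iA (prodm E)"] s, unfolded kmod_simps] by blast
  have yk: "y [^]\<^bsub>B\<^esub> k : carrier B" and qsy: "set (qs @ [y]) <= carrier B" using qs y by simp_all
  show ?thesis
  proof (rule core[OF P(1) S(1) _ k0[unfolded pow_rt[OF y]] ps qsy])
   fix u v i j assume c: "u : tors A ps (E i)" "v : tors B qs (F j)" "i + j = n"
   obtain v' where v': "v' : tors B (qs @ [y]) (F j)" "p (emb F j v) = emb F j v'"
    "emb F j v = p (emb F j v) +[prodm F] s (emb F j ((y [^]\<^bsub>B\<^esub> k) *[F j] v))" using qs'[OF c(2)] by blast
   have yv: "(y [^]\<^bsub>B\<^esub> k) *[F j] v : tors B qs (F j)" by (rule F.submoduleE(4)[OF F.tors_submodule[OF qs] yk c(2)])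
   have Sp: "S (rt (y [^]\<^bsub>B\<^esub> k) *[C] (emb E i u \<boxtimes> emb F j v)) = emb E i u \<boxtimes> s (emb F j ((y [^]\<^bsub>B\<^esub> k) *[F j] v))"
    unfolding smult_emb[OF ps qs A.one_closed yk c(1,2)] E.smult_one[OF tors_carrier[OF c(1)]] by (rule S(2)[OF g(1)[OF c(1)] g(2)[OF yv]])
   have "p (emb F j v) : carrier (prodm F)" "s (emb F j ((y [^]\<^bsub>B\<^esub> k) *[F j] v)) : carrier (prodm F)"
    using mod_homD(1)[OF p, unfolded kmod_simps, OF g(2)[OF c(2)]] mod_homD(1)[OF s, unfolded kmod_simps, OF g(2)[OF yv]] .
   from Ck.pure_add_right[unfolded kmod_simps, OF g(1)[OF c(1)] this]
   show "P (emb E i u \<boxtimes> emb F j v) : CC ps (qs @ [y]) n \<and>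
    emb E i u \<boxtimes> emb F j v = P (emb E i u \<boxtimes> emb F j v) +[C] S (rt (y [^]\<^bsub>B\<^esub> k) *[C] (emb E i u \<boxtimes> emb F j v))"
    unfolding Sp P(2)[OF g(1)[OF c(1)] g(2)[OF c(2)]] v'(3)[symmetric] unfolding v'(2) using CC_pure[OF ps qsy c(1) v'(1) c(3)] by simp
  qed (use yk in simp)
 qed
qed

text \<open>Generators are taken in one at a time, those of the left factor first. The list order is
  that of \<open>tensor_ideal_gen\<close>, and every prefix of the list leads to a space
  \<open>CC ps qs n\<close>.\<close>

lemma tors_CC:
 assumes xs: "set xs <= carrier A" and ys: "set ys <= carrier B"
 shows "tors TR (map lt xs @ map rt ys) C \<inter> CC [] [] n = CC xs ys n"
proof (intro subset_antisym subsetI)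
 fix z assume z: "z : tors TR (map lt xs @ map rt ys) C \<inter> CC [] [] n"
 have tz: "t : set (map lt xs @ map rt ys) ==> \<exists>k::nat. (t [^]\<^bsub>TR\<^esub> k) *[C] z = 0[C]" for t using z unfolding tors_def by blast
 have l: "set ps <= set xs ==> z : CC ps [] n" for ps
 proof (induction ps rule: rev_induct)
  case (snoc x ps)
  then obtain k :: nat where "(lt x [^]\<^bsub>TR\<^esub> k) *[C] z = 0[C]" using tz[of "lt x"] by auto
  then show ?case using tors_step(1)[of ps "[]" z n x k] snoc xs by auto
 qed (use z in simp)
 have "set qs <= set ys ==> z : CC xs qs n" for qs
 proof (induction qs rule: rev_induct)
  case (snoc y qs)
  then obtain k :: nat where "(rt y [^]\<^bsub>TR\<^esub> k) *[C] z = 0[C]" using tz[of "rt y"] by auto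
  then show ?case using tors_step(2)[of xs qs z n y k] snoc xs ys by auto
 qed (use l in simp)
 then show "z : CC xs ys n" by simp
next
 fix z assume "z : CC xs ys n"
 note sub = C.submodule_inter[OF C.tors_submodule[of "map lt xs @ map rt ys"] CC_submodule[of "[]" "[]" n]]
 have zs: "set (map lt xs @ map rt ys) <= carrier TR" using xs ys by (auto intro!: T.pure_closed)
 have Z: "submodule (tors TR (map lt xs @ map rt ys) C \<inter> CC [] [] n) TR C" by (rule sub[OF zs]) simp_all
 show "z : tors TR (map lt xs @ map rt ys) C \<inter> CC [] [] n"
  using \<open>z : CC xs ys n\<close>
 proof (induction z rule: CC_induct[OF xs ys, consumes 1, case_names zero pure add smult])
  case zero show ?case by (rule C.sub_zero[OF Z])
 next
  case (add z w) then show ?case using C.submoduleE(5)[OF Z] by blast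
 next
  case (smult c z) then show ?case using C.submoduleE(4)[OF Z ring_hom_closed[OF iT_hom]] by blast
 next
  case (pure u v p q)
  have c: "u : carrier (E p)" "v : carrier (F q)" by (rule tors_carrier[OF pure(1)], rule tors_carrier[OF pure(2)])
  have e0: "emb M i 0[M i] = 0[prodm M]" for M :: "nat => ('p, 'q, 's) module_scheme" and i by (auto simp: emb_def intro!: ext)
  note g = tors_gr[OF xs ys]
  have "\<exists>k::nat. (lt x [^]\<^bsub>TR\<^esub> k) *[C] (emb E p u \<boxtimes> emb F q v) = 0[C]" if x: "x : set xs" for x
  proof -
   have xA: "x : carrier A" using x xs by blast
   obtain k :: nat where k: "(x [^]\<^bsub>A\<^esub> k) *[E p] u = 0[E p]" using pure(1) x unfolding tors_def by blast
   have "(lt x [^]\<^bsub>TR\<^esub> k) *[C] (emb E p u \<boxtimes> emb F q v) = 0[prodm E] \<boxtimes> emb F q v"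
    unfolding pow_lt[OF xA] using smult_emb[OF xs ys _ B.one_closed pure(1,2), of "x [^]\<^bsub>A\<^esub> k"] xA k c by (simp add: e0)
   also have "\<dots> = 0[C]" using Ck.pure_zero_left[unfolded kmod_simps, OF g(2)[OF pure(2)]] .
   finally show ?thesis by blast
  qed
  moreover have "\<exists>k::nat. (rt y [^]\<^bsub>TR\<^esub> k) *[C] (emb E p u \<boxtimes> emb F q v) = 0[C]" if y: "y : set ys" for y
  proof -
   have yB: "y : carrier B" using y ys by blast
   obtain k :: nat where k: "(y [^]\<^bsub>B\<^esub> k) *[F q] v = 0[F q]" using pure(2) y unfolding tors_def by blast
   have "(rt y [^]\<^bsub>TR\<^esub> k) *[C] (emb E p u \<boxtimes> emb F q v) = emb E p u \<boxtimes> 0[prodm F]"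
    unfolding pow_rt[OF yB] using smult_emb[OF xs ys A.one_closed _ pure(1,2), of "y [^]\<^bsub>B\<^esub> k"] yB k c by (simp add: e0)
   also have "\<dots> = 0[C]" using Ck.pure_zero_right[unfolded kmod_simps, OF g(1)[OF pure(1)]] .
   finally show ?thesis by blast
  qed
  moreover have "emb E p u \<boxtimes> emb F q v : CC [] [] n" by (rule CC_pure) (use c pure(3) in simp_all)
  ultimately show ?case using subsetD[OF CC_carrier[of "[]" "[]" n]] unfolding tors_def by auto
 qed
qed

text \<open>The condition is stable under sums, with the larger of the two exponents, and under
  scalars from \<open>K\<close>, so it has to be verified for pure tensors only.\<close>

lemma good_step:
 assumes ps: "set ps <= carrier A" and qs: "set qs <= carrier B" and t: "t : carrier TR"
  and p: "!!u v p q. u : tors A ps (E p) ==> v : tors B qs (F q) ==> p + q = n ==>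
   \<exists>c'\<in>CC ps qs n. \<exists>k::nat. (t [^]\<^bsub>TR\<^esub> k) *[C] (emb E p u \<boxtimes> emb F q v -[C] t *[C] c') = 0[C]"
  and c: "c : CC ps qs n"
 shows "\<exists>c'\<in>CC ps qs n. \<exists>k::nat. (t [^]\<^bsub>TR\<^esub> k) *[C] (c -[C] t *[C] c') = 0[C]"
 using c
proof (induction c rule: CC_induct[OF ps qs, consumes 1, case_names zero pure add smult])
 case zero
 show ?case by (intro bexI[OF _ CC_zero[OF ps qs]] exI[of _ 0]) (use t in \<open>simp add: C.smult_r_null\<close>)
next
 case (pure u v p q) then show ?case by (rule p)
next
 case (add z w)
 then obtain z' w' and k l :: nat where c: "z' : CC ps qs n" "w' : CC ps qs n"
  "(t [^]\<^bsub>TR\<^esub> k) *[C] (z -[C] t *[C] z') = 0[C]" "(t [^]\<^bsub>TR\<^esub> l) *[C] (w -[C] t *[C] w') = 0[C]" by blast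
 have cc: "z : carrier C" "w : carrier C" "z' : carrier C" "w' : carrier C" using c(1,2) add(1,2) CC_carrier[OF ps qs] by auto
 have e: "(z +[C] w) -[C] t *[C] (z' +[C] w') = (z -[C] t *[C] z') +[C] (w -[C] t *[C] w')"
  unfolding C.smult_r_distr[OF t cc(3,4)] by (rule C.M.minus_add_minus) (use cc t in simp_all)
 have "(t [^]\<^bsub>TR\<^esub> (max k l)) *[C] (z -[C] t *[C] z') = 0[C]" "(t [^]\<^bsub>TR\<^esub> (max k l)) *[C] (w -[C] t *[C] w') = 0[C]"
  by (rule C.pow_kill_mono[OF t _ c(3)], use cc t in simp_all)(rule C.pow_kill_mono[OF t _ c(4)], use cc t in simp_all)
 then have "(t [^]\<^bsub>TR\<^esub> (max k l)) *[C] ((z +[C] w) -[C] t *[C] (z' +[C] w')) = 0[C]"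
  unfolding e using cc t by (simp add: C.smult_r_distr)
 then show ?case using CC_add[OF ps qs c(1,2)] by blast
next
 case (smult a z)
 then obtain z' and k :: nat where c: "z' : CC ps qs n" "(t [^]\<^bsub>TR\<^esub> k) *[C] (z -[C] t *[C] z') = 0[C]" by blast
 have cc: "z : carrier C" "z' : carrier C" and a: "iT a : carrier TR" using c(1) smult(1,2) CC_carrier[OF ps qs] by auto
 have "iT a *[C] z -[C] t *[C] (iT a *[C] z') = iT a *[C] (z -[C] t *[C] z')"
  using cc a t C.smult_minus[OF a cc(1), of "t *[C] z'"] C.smult_commute[OF t a cc(2)] by simp
 then have "(t [^]\<^bsub>TR\<^esub> k) *[C] (iT a *[C] z -[C] t *[C] (iT a *[C] z')) = iT a *[C] 0[C]"
  using C.smult_commute[of "t [^]\<^bsub>TR\<^esub> k" "iT a" "z -[C] t *[C] z'"] cc a t c(2) by simp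
 then show ?case using CC_smult[OF ps qs smult(1) c(1)] C.smult_r_null[OF a] by auto
qed


text \<open>The generator \<open>t\<close> acts on one factor, and by \<open>tors_CC\<close> the
  torsion for its predecessors is spanned by tensors of torsion elements. Division by
  \<open>t\<close> up to torsion is then performed in the factor on which \<open>t\<close>
  acts.\<close>

lemma good_CC:
 assumes xs: "set xs <= carrier A" and ys: "set ys <= carrier B" and gE: "!!p. good_for A xs (E p)" and gF: "!!q. good_for B ys (F q)"
 shows "good_for TR (map lt xs @ map rt ys) (C\<lparr>carrier := CC [] [] n\<rparr>)"
 unfolding good_for_def
proof (intro allI impI ballI)
 let ?zs = "map lt xs @ map rt ys" and ?C = "C\<lparr>carrier := CC [] [] n\<rparr>"
 fix ts t us c assume e: "?zs = ts @ t # us" and c: "c : tors TR ts ?C"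
 have sub: "submodule (CC [] [] n) TR C" by (rule CC_submodule) simp_all
 have zs: "set ?zs <= carrier TR" using xs ys by (auto intro!: T.pure_closed)
 then have t: "t : carrier TR" unfolding e by simp
 have CCc: "CC [] [] n <= carrier C" by (rule CC_carrier) simp_all
 have ct: "c : tors TR ts C \<inter> CC [] [] n" using c CCc by simp
 have "\<exists>y\<in>tors TR ts C \<inter> CC [] [] n. \<exists>k::nat. (t [^]\<^bsub>TR\<^esub> k) *[C] (c -[C] t *[C] y) = 0[C]"
 \<comment> \<open>The position of \<open>t\<close> decides on which factor it acts. In the second
   case all of \<open>xs\<close> precedes it, so the left factor is already restricted to its full
   torsion.\<close>
 proof (cases "length ts < length xs")
  case True
  define ps x where "ps = take (length ts) xs" and "x = xs ! length ts"
  have ex: "xs = ps @ x # drop (Suc (length ts)) xs" unfolding ps_def x_def by (rule id_take_nth_drop[OF True])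
  have ts: "ts = map lt ps @ map rt []" using arg_cong[OF e, of "take (length ts)"] True by (simp add: ps_def take_map)
  have tx: "t = lt x" using arg_cong[OF e, of "%l. l ! length ts"] True by (simp add: x_def nth_append)
  have px: "set ps <= carrier A" "x : carrier A" using xs set_take_subset[of "length ts" xs] nth_mem[OF True] unfolding ps_def x_def by blast+
  have nil: "set [] <= carrier B" by simp
  note tors = tors_CC[OF px(1) nil, folded ts]
  show ?thesis unfolding tors
  proof (rule good_step[OF px(1) nil t _ ct[unfolded tors]])
   fix u v p q assume u: "u : tors A ps (E p)" and v: "v : tors B [] (F q)" and pq: "p + q = n"
   obtain u' and k :: nat where u': "u' : tors A ps (E p)" "(x [^]\<^bsub>A\<^esub> k) *[E p] (u -[E p] x *[E p] u') = 0[E p]"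
    using good_forD[OF gE ex u] by blast
   note s = E.tors_submodule[OF px(1), of p] and g = tors_gr[OF px(1) nil]
   have xu: "x *[E p] u' : tors A ps (E p)" by (rule E.submoduleE(4)[OF s px(2) u'(1)])
   have d: "u -[E p] x *[E p] u' : tors A ps (E p)" by (rule E.submodule_minus_closed[OF s u xu])
   have "emb E p u \<boxtimes> emb F q v -[C] t *[C] (emb E p u' \<boxtimes> emb F q v) = emb E p (u -[E p] x *[E p] u') \<boxtimes> emb F q v"
    unfolding tx smult_emb[OF px(1) nil px(2) B.one_closed u'(1) v] F.smult_one[OF tors_carrier[OF v]]
     mod_hom_minus[OF emb_hom[where E = E, OF mE] mE PE.module_axioms tors_carrier[OF u] tors_carrier[OF xu]]
    using Ck.pure_minus_left[unfolded kmod_simps kmod_minus, OF g(1)[OF u] g(1)[OF xu] g(2)[OF v]] by simp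
   moreover have "(t [^]\<^bsub>TR\<^esub> k) *[C] (emb E p (u -[E p] x *[E p] u') \<boxtimes> emb F q v) = emb E p 0[E p] \<boxtimes> emb F q v"
    unfolding tx pow_lt[OF px(2)] smult_emb[OF px(1) nil A.nat_pow_closed[OF px(2)] B.one_closed d v] u'(2) F.smult_one[OF tors_carrier[OF v]] ..
   moreover have "emb E p 0[E p] \<boxtimes> emb F q v = 0[C]"
    unfolding mod_hom_zero[OF emb_hom[where E = E, OF mE] mE PE.module_axioms] by (rule Ck.pure_zero_left[unfolded kmod_simps, OF g(2)[OF v]])
   ultimately show "\<exists>c'\<in>CC ps [] n. \<exists>k::nat. (t [^]\<^bsub>TR\<^esub> k) *[C] (emb E p u \<boxtimes> emb F q v -[C] t *[C] c') = 0[C]"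
    using CC_pure[OF px(1) nil u'(1) v pq] by metis
  qed
 next
  case False
  define j where "j = length ts - length xs"
  define qs y where "qs = take j ys" and "y = ys ! j"
  have jl: "j < length ys" using arg_cong[OF e, of length] False by (simp add: j_def)
  have ey: "ys = qs @ y # drop (Suc j) ys" unfolding qs_def y_def by (rule id_take_nth_drop[OF jl])
  have ts: "ts = map lt xs @ map rt qs" using arg_cong[OF e, of "take (length ts)"] False by (simp add: qs_def take_map j_def)
  have ty: "t = rt y" using arg_cong[OF e, of "%l. l ! length ts"] False jl by (simp add: y_def nth_append j_def)
  have qy: "set qs <= carrier B" "y : carrier B" using ys set_take_subset[of j ys] nth_mem[OF jl] unfolding qs_def y_def by blast+
  note tors = tors_CC[OF xs qy(1), folded ts]
  show ?thesis unfolding tors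
  proof (rule good_step[OF xs qy(1) t _ ct[unfolded tors]])
   fix u v p q assume u: "u : tors A xs (E p)" and v: "v : tors B qs (F q)" and pq: "p + q = n"
   obtain v' and k :: nat where v': "v' : tors B qs (F q)" "(y [^]\<^bsub>B\<^esub> k) *[F q] (v -[F q] y *[F q] v') = 0[F q]"
    using good_forD[OF gF ey v] by blast
   note s = F.tors_submodule[OF qy(1), of q] and g = tors_gr[OF xs qy(1)]
   have yv: "y *[F q] v' : tors B qs (F q)" by (rule F.submoduleE(4)[OF s qy(2) v'(1)])
   have d: "v -[F q] y *[F q] v' : tors B qs (F q)" by (rule F.submodule_minus_closed[OF s v yv])
   have "emb E p u \<boxtimes> emb F q v -[C] t *[C] (emb E p u \<boxtimes> emb F q v') = emb E p u \<boxtimes> emb F q (v -[F q] y *[F q] v')"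
    unfolding ty smult_emb[OF xs qy(1) A.one_closed qy(2) u v'(1)] E.smult_one[OF tors_carrier[OF u]]
     mod_hom_minus[OF emb_hom[where E = F, OF mF] mF PF.module_axioms tors_carrier[OF v] tors_carrier[OF yv]]
    using Ck.pure_minus_right[unfolded kmod_simps kmod_minus, OF g(1)[OF u] g(2)[OF v] g(2)[OF yv]] by simp
   moreover have "(t [^]\<^bsub>TR\<^esub> k) *[C] (emb E p u \<boxtimes> emb F q (v -[F q] y *[F q] v')) = emb E p u \<boxtimes> emb F q 0[F q]"
    unfolding ty pow_rt[OF qy(2)] smult_emb[OF xs qy(1) A.one_closed B.nat_pow_closed[OF qy(2)] u d] v'(2) E.smult_one[OF tors_carrier[OF u]] ..
   moreover have "emb E p u \<boxtimes> emb F q 0[F q] = 0[C]"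
    unfolding mod_hom_zero[OF emb_hom[where E = F, OF mF] mF PF.module_axioms] by (rule Ck.pure_zero_right[unfolded kmod_simps, OF g(1)[OF u]])
   ultimately show "\<exists>c'\<in>CC xs qs n. \<exists>k::nat. (t [^]\<^bsub>TR\<^esub> k) *[C] (emb E p u \<boxtimes> emb F q v -[C] t *[C] c') = 0[C]"
    using CC_pure[OF xs qy(1) u v'(1) pq] by metis
  qed
 qed
 then obtain y and k :: nat where y: "y : tors TR ts C \<inter> CC [] [] n" "(t [^]\<^bsub>TR\<^esub> k) *[C] (c -[C] t *[C] y) = 0[C]" by blast
 have "c -[?C] t *[C] y = c -[C] t *[C] y"
  by (rule C.restrict_minus[OF sub]) (use ct y(1) C.submoduleE(4)[OF sub t] in auto)
 then show "\<exists>y\<in>tors TR ts ?C. \<exists>k::nat. (t [^]\<^bsub>TR\<^esub> k) *[?C] (c -[?C] t *[?C] y) = 0[?C]"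
  using y CCc by (intro bexI[of _ y] exI[of _ k]) simp_all
qed

end

section \<open>Local cohomology of a tensor product\<close>

lemma graded_kmod:
 assumes K: "cring K" and \<iota>: "\<iota> : ring_hom K R" and E: "!!n. module R (E n)" and d: "!!n. d n : mod_hom R (E n) (E (Suc n))"
  and g: "gsplit K (kmod \<iota> (prodm E)) (%p. emb E p ` tors R zs (E p)) (pup E d) h s e pr"
 shows "gsplit.cocyc (kmod \<iota> (prodm E)) (%p. emb E p ` tors R zs (E p)) (pup E d) p = emb E p ` tors_cocycles R zs E d p"
  and "gsplit.bdy (kmod \<iota> (prodm E)) (%p. emb E p ` tors R zs (E p)) (pup E d) p = emb E p ` tors_bdry R zs E d p"
proof -
 have b: "bdry (%n. kmod \<iota> (E n)) d W p = bdry E d W p" for W by (cases p) simp_all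
 note l = gsplit_graded[where V = "%n. kmod \<iota> (E n)", OF kmod_module[OF K \<iota> E] mod_hom_kmod[OF d \<iota>], folded kmod_prodm, unfolded emb_kmod pup_kmod, OF g]
 show "gsplit.cocyc (kmod \<iota> (prodm E)) (%p. emb E p ` tors R zs (E p)) (pup E d) p = emb E p ` tors_cocycles R zs E d p"
  unfolding l(1) tors_cocycles_def by simp
 show "gsplit.bdy (kmod \<iota> (prodm E)) (%p. emb E p ` tors R zs (E p)) (pup E d) p = emb E p ` tors_bdry R zs E d p"
  unfolding l(2) tors_bdry_def b ..
qed

lemma (in aug_algebra) graded_invariants:
 assumes c: "cplx R E d" and g: "gsplit K (kmod \<iota> (prodm E)) (%p. emb E p ` tors R zs (E p)) (pup E d) h s e pr"
 shows "gsplit.cocyc (kmod \<iota> (prodm E)) (%p. emb E p ` tors R zs (E p)) (pup E d) p <= gsplit.bdy (kmod \<iota> (prodm E)) (%p. emb E p ` tors R zs (E p)) (pup E d) p \<longleftrightarrow> van R zs E d p"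
  and "fdq K (kmod \<iota> (prodm E)) (gsplit.cocyc (kmod \<iota> (prodm E)) (%p. emb E p ` tors R zs (E p)) (pup E d) p)
   (gsplit.bdy (kmod \<iota> (prodm E)) (%p. emb E p ` tors R zs (E p)) (pup E d) p) \<longleftrightarrow>
   fdq K (kmod \<iota> (E p)) (tors_cocycles R zs E d p) (tors_bdry R zs E d p)"
proof -
 note l = graded_kmod[OF cring_K hom_\<iota> cplxD(1,2)[OF c] g]
 note sub = tors_cocycles_submodule[OF c zs_carrier, of p] and sk = submodule_kmod[OF cring_K hom_\<iota> cplxD(1)[OF c, of p]]
 show "gsplit.cocyc (kmod \<iota> (prodm E)) (%p. emb E p ` tors R zs (E p)) (pup E d) p <= gsplit.bdy (kmod \<iota> (prodm E)) (%p. emb E p ` tors R zs (E p)) (pup E d) p \<longleftrightarrow> van R zs E d p"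
  unfolding l van_def by (rule inj_image_subset_iff[OF inj_emb])
 show "fdq K (kmod \<iota> (prodm E)) (gsplit.cocyc (kmod \<iota> (prodm E)) (%p. emb E p ` tors R zs (E p)) (pup E d) p)
   (gsplit.bdy (kmod \<iota> (prodm E)) (%p. emb E p ` tors R zs (E p)) (pup E d) p) \<longleftrightarrow>
   fdq K (kmod \<iota> (E p)) (tors_cocycles R zs E d p) (tors_bdry R zs E d p)"
  unfolding l
  using fdq_emb[where V = "%n. kmod \<iota> (E n)", OF kmod_module[OF cring_K hom_\<iota> cplxD(1)[OF c]] sk[OF sub(1)] sk[OF sub(2)] sub(3)]
  by (simp add: kmod_prodm)
qed

text \<open>The final chain of equivalences leads from the resolution chosen for the tensor module
  to the tensor complex, and by the Kuenneth formula to the resolutions chosen for \<open>L\<close>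
  and \<open>N\<close>. What precedes it verifies that the tensor complex may be compared with a
  resolution.\<close>

lemma (in tensor_algebras) local_cohomology_tensor:
 assumes a: "aug_algebra K A iA xs m" and b: "aug_algebra K B iB ys n" and NT: "noetherian_ring TR"
  and L: "module A L" and N: "module B N"
 shows "fin_gen_module TR (local_cohomology TR (tensor_image K A B m (carrier B) <+>\<^bsub>TR\<^esub> tensor_image K A B (carrier A) n) (TM L N) i) \<longleftrightarrow>
  (\<forall>p q. p + q = i --> (\<not> lc_zero B ys N q --> fin_gen_module A (local_cohomology A m L p)) \<and>
   (\<not> lc_zero A xs L p --> fin_gen_module B (local_cohomology B n N q)))"
proof -
 interpret a: aug_algebra K A iA xs m by (rule a)
 interpret b: aug_algebra K B iB ys n by (rule b)
 define M where "M = tensor_image K A B m (carrier B) <+>\<^bsub>TR\<^esub> tensor_image K A B (carrier A) n"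
 define zs where "zs = map (%x. tns K A B x 1[B]) xs @ map (%y. tns K A B 1[A] y) ys"
 interpret t: aug_algebra K TR iT zs M unfolding M_def zs_def by (rule tensor_residue[OF a b NT])
 interpret L: module A L by (rule L)
 interpret N: module B N by (rule N)
 have mLN: "module TR (TM L N)" by (rule TM_module[OF L N])
 obtain E dE \<eta> where eE: "chosen_resolution A L = (E, dE)" and rE: "injective_resolution A L \<eta> E dE" and vE: "lc_zero A xs L = van A xs E dE" by (rule a.resolution_of[OF L])
 obtain F dF \<eta>' where eF: "chosen_resolution B N = (F, dF)" and rF: "injective_resolution B N \<eta>' F dF" and vF: "lc_zero B ys N = van B ys F dF" by (rule b.resolution_of[OF N])
 obtain I dI \<eta>I where eI: "chosen_resolution TR (TM L N) = (I, dI)" and rI: "injective_resolution TR (TM L N) \<eta>I I dI" and vI: "lc_zero TR zs (TM L N) = van TR zs I dI" by (rule t.resolution_of[OF mLN])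
 note cE = injective_resolution_cplx[OF rE] and cF = injective_resolution_cplx[OF rF] and cI = injective_resolution_cplx[OF rI]
 note mE = cplxD(1)[OF cE(1)] and mF = cplxD(1)[OF cF(1)] and dE = cplxD(2)[OF cE(1)] and dF = cplxD(2)[OF cF(1)]
 have PE: "module A (prodm E)" and PF: "module B (prodm F)" by (rule prodm_module[OF mE], rule prodm_module[OF mF])
 let ?C = "TM (prodm E) (prodm F)" and ?t = "%x y. tns K (kmod iA (prodm E)) (kmod iB (prodm F)) x y"
 interpret C: module TR ?C by (rule TM_module[OF PE PF])
 have idF: "(%y. y) : mod_hom B (prodm F) (prodm F)" by (rule mod_homI) simp_all
 obtain D1 where D1: "D1 : mod_hom TR ?C ?C" "!!x y. x : carrier (prodm E) ==> y : carrier (prodm F) ==> D1 (?t x y) = ?t (pup E dE x) y"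
  using TM_hom[OF PE PF PE PF pup_hom[where E = E, OF mE dE] idF] by blast
 obtain D2 where D2: "D2 : mod_hom TR ?C ?C" "!!x y. x : carrier (prodm E) ==> y : carrier (prodm F) ==> D2 (?t x y) = ?t (psign E x) (pup F dF y)"
  using TM_hom[OF PE PF PE PF psign_hom[where E = E, OF mE] pup_hom[where E = F, OF mF dF]] by blast
 \<comment> \<open>The differential is assembled from two homomorphisms over the tensor ring, so it
   is linear over that ring and can be used for torsion as well as for the Kuenneth formula over
   \<open>K\<close>.\<close>
 define D where "D z = D1 z +[?C] D2 z" for z
 have D: "D : mod_hom TR ?C ?C" unfolding D_def
  by (rule mod_homI) (simp_all add: mod_homD[OF D1(1)] mod_homD[OF D2(1)] C.M.add_add_swap C.smult_r_distr)
 interpret r: tensor_res K A B E dE F dF D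
  by (intro tensor_res.intro tensor_res_axioms.intro tensor_algebras_axioms cE(1) cF(1) D) (simp add: D_def D1(2) D2(2))
 have nil: "set [] <= carrier A" "set [] <= carrier B" by simp_all
 \<comment> \<open>The Kuenneth formula is used twice on the same complex: with empty lists, to see
   that the whole complex is a resolution, and with \<open>xs\<close> and \<open>ys\<close>, to
   compute its torsion part.\<close>
 obtain h0 s0 h0' s0' where k0: "kunneth K (kmod iA (prodm E)) (%p. emb E p ` tors A [] (E p)) (pup E dE) h0 s0 (psign E) (pproj E)
  (kmod iB (prodm F)) (%p. emb F p ` tors B [] (F p)) (pup F dF) h0' s0' (psign F) (pproj F) (kmod iT ?C) D" by (rule r.kun[OF nil]) blast
 interpret k0: kunneth K "kmod iA (prodm E)" "%p. emb E p ` tors A [] (E p)" "pup E dE" h0 s0 "psign E" "pproj E"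
  "kmod iB (prodm F)" "%p. emb F p ` tors B [] (F p)" "pup F dF" h0' s0' "psign F" "pproj F" "kmod iT ?C" D by (rule k0)
 obtain h s h' s' where k: "kunneth K (kmod iA (prodm E)) (%p. emb E p ` tors A xs (E p)) (pup E dE) h s (psign E) (pproj E)
  (kmod iB (prodm F)) (%p. emb F p ` tors B ys (F p)) (pup F dF) h' s' (psign F) (pproj F) (kmod iT ?C) D" by (rule r.kun[OF a.zs_carrier b.zs_carrier]) blast
 interpret k: kunneth K "kmod iA (prodm E)" "%p. emb E p ` tors A xs (E p)" "pup E dE" h s "psign E" "pproj E"
  "kmod iB (prodm F)" "%p. emb F p ` tors B ys (F p)" "pup F dF" h' s' "psign F" "pproj F" "kmod iT ?C" D by (rule k)
 note C0 = r.CC_kun[OF k0] and C1 = r.CC_kun[OF k]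
 note sub = r.CC_submodule[OF nil] and CCc = r.CC_carrier[OF nil]
 \<comment> \<open>The tensor complex is moved up by one degree, with a zero module in front, as
   \<open>comparison_cohomology\<close> expects.\<close>
 define U where "U n = ?C\<lparr>carrier := (case n of 0 => {0[?C]} | Suc k => r.CC [] [] k)\<rparr>" for n
 define du where "du n = (case n of 0 => (%_. 0[?C]) | Suc k => D)" for n :: nat
 have U0: "U 0 = ?C\<lparr>carrier := {0[?C]}\<rparr>" and US: "U (Suc k) = ?C\<lparr>carrier := r.CC [] [] k\<rparr>" for k by (simp_all add: U_def)
 have d0: "du 0 = (%_. 0[?C])" and dS: "du (Suc k) = D" for k by (simp_all add: du_def)
 have Dz: "D 0[?C] = 0[?C]" by (rule mod_hom_zero[OF D C.module_axioms C.module_axioms])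
 have DC: "z : r.CC [] [] k ==> D z : r.CC [] [] (Suc k)" and DD: "z : r.CC [] [] k ==> D (D z) = 0[?C]" for k z
  using k0.D_Cn[of z k] k0.DD[of z k] unfolding C0 by simp_all
 have cU: "cplx TR U du" unfolding cplx_def
 proof (intro allI conjI ballI)
  fix j
  show "module TR (U j)" by (cases j) (simp_all add: U0 US C.restrict_module[OF C.submodule_zero] C.restrict_module[OF sub])
  show "du j : mod_hom TR (U j) (U (Suc j))"
  proof (cases j)
   case 0 then show ?thesis unfolding 0 d0 U0 US by (intro mod_homI) (simp_all add: r.CC_zero[OF nil] C.smult_r_null)
  next
   case (Suc k) then show ?thesis unfolding Suc dS US using CCc by (intro mod_homI) (auto simp: DC subset_iff mod_homD[OF D])
  qed
  show "du (Suc j) (du j z) = 0[U (Suc (Suc j))]" if "z : carrier (U j)" for z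
   using that Dz DD by (cases j) (auto simp: U0 US d0 dS)
 qed
 have gU: "good_for TR zs (U j)" for j
 proof (cases j)
  case 0 show ?thesis unfolding 0 U0 by (rule C.good_for_zero[OF t.zs_carrier])
 next
  case (Suc k)
  show ?thesis unfolding Suc US zs_def
   by (rule r.good_CC[OF a.zs_carrier b.zs_carrier baer_good_for[OF a.noeth mE cE(2) a.zs_carrier] baer_good_for[OF b.noeth mF cF(2) b.zs_carrier]])
 qed
 note grE = graded_kmod[OF a.cring_K a.hom_\<iota> mE dE k0.G.gsplit_axioms] and grF = graded_kmod[OF a.cring_K b.hom_\<iota> mF dF k0.H.gsplit_axioms]
 \<comment> \<open>With the empty list torsion is no restriction, so this is the exactness of the
   resolution in positive degrees.\<close>
 have l: "k0.G.cocyc (Suc p) <= k0.G.bdy (Suc p)" for p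
  unfolding grE inj_image_subset_iff[OF inj_emb] tors_cocycles_def tors_bdry_def using cE(3) by force
 have l': "k0.H.cocyc (Suc p) <= k0.H.bdy (Suc p)" for p
  unfolding grF inj_image_subset_iff[OF inj_emb] tors_cocycles_def tors_bdry_def using cF(3) by force
 note Zn0 = k0.Zn_def[unfolded C0] and Bn0 = k0.Bn_def[unfolded C0]
 have ex2: "\<exists>v\<in>carrier (U (Suc j)). du (Suc j) v = u"
  if "u : carrier (U (Suc (Suc j)))" "du (Suc (Suc j)) u = 0[U (Suc (Suc (Suc j)))]" for j u
  using k0.kunneth_exact(1)[OF l l', of j] that unfolding Zn0 Bn0 by (auto simp: US dS)
 note rr = rE[unfolded injective_resolution_iff] and rr' = rF[unfolded injective_resolution_iff] and rrI = rI[unfolded injective_resolution_iff]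
 have \<eta>: "\<eta> : mod_hom A L (E 0)" "inj_on \<eta> (carrier L)" "\<eta> ` carrier L = {x : carrier (E 0). dE 0 x = 0[E (Suc 0)]}" using rr by auto
 have \<eta>': "\<eta>' : mod_hom B N (F 0)" "inj_on \<eta>' (carrier N)" "\<eta>' ` carrier N = {x : carrier (F 0). dF 0 x = 0[F (Suc 0)]}" using rr' by auto
 have \<eta>I: "\<eta>I : mod_hom TR (TM L N) (I 0)" "inj_on \<eta>I (carrier (TM L N))" "\<eta>I ` carrier (TM L N) = {x : carrier (I 0). dI 0 x = 0[I (Suc 0)]}" using rrI by auto
 define f g where "f = (%x. emb E 0 (\<eta> x))" and "g = (%y. emb F 0 (\<eta>' y))"
 have f: "f : mod_hom A L (prodm E)" and g: "g : mod_hom B N (prodm F)" unfolding f_def g_def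
  by (rule mod_hom_compose[OF \<eta>(1) emb_hom[where E = E, OF mE]], rule mod_hom_compose[OF \<eta>'(1) emb_hom[where E = F, OF mF]])
 have finj: "inj_on f (carrier L)" and ginj: "inj_on g (carrier N)" unfolding f_def g_def
  using \<eta>(2) \<eta>'(2) inj_emb[of E 0] inj_emb[of F 0] by (simp_all add: inj_on_def)
 have fim: "k0.G.cocyc 0 = f ` carrier L" unfolding grE unfolding f_def tors_cocycles_def tors_Nil \<eta>(3)[symmetric] image_image ..
 have gim: "k0.H.cocyc 0 = g ` carrier N" unfolding grF unfolding g_def tors_cocycles_def tors_Nil \<eta>'(3)[symmetric] image_image ..
 interpret Zk: tensor_lin K "kmod iA L" "kmod iB N" "kmod iT (TM L N)" by (rule TM_lin[OF L N])
 obtain j where j: "j : mod_hom TR (TM L N) ?C" "!!x y. x : carrier L ==> y : carrier N ==> j (tns K (kmod iA L) (kmod iB N) x y) = ?t (f x) (g y)"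
  using TM_hom[OF L N PE PF f g] by blast
 have jk: "j : mod_hom K (kmod iT (TM L N)) (kmod iT ?C)" by (rule mod_hom_kmod[OF j(1) iT_hom])
 \<comment> \<open>Over a field the embeddings \<open>f\<close> and \<open>g\<close> have linear
   retractions \<open>u\<close> and \<open>w\<close>. Then \<open>u \<otimes> w\<close> is a left
   inverse of \<open>j = f \<otimes> g\<close>, so \<open>j\<close> is injective.\<close>
 have retr: "\<exists>h\<in>mod_hom K W V. \<forall>x\<in>carrier V. h (u x) = x" if "module K V" "module K W" "u : mod_hom K V W" "inj_on u (carrier V)"
  for V :: "('k, 'p) module" and W :: "('k, 'q) module" and u
 proof (rule baer_factor[where g = "%x. x", OF that(1,2,1) field_baer[OF field_K that(1)] that(3)])
  show "x = 0[V]" if x: "x : carrier V" "u x = 0[W]" for x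
   using inj_onD[OF \<open>inj_on u (carrier V)\<close> _ x(1), of "0[V]"] x(2) mod_hom_zero[OF \<open>u : mod_hom K V W\<close> \<open>module K V\<close> \<open>module K W\<close>]
    abelian_monoid.zero_closed[OF abelian_group.axioms(1)[OF module.axioms(2)[OF \<open>module K V\<close>]]] by simp
 qed (rule mod_homI; simp)
 obtain u where u: "u : mod_hom K (kmod iA (prodm E)) (kmod iA L)" "!!x. x : carrier L ==> u (f x) = x"
  using retr[OF kmod_module[OF a.cring_K a.hom_\<iota> L] kmod_module[OF a.cring_K a.hom_\<iota> PE] mod_hom_kmod[OF f a.hom_\<iota>]] finj by auto
 obtain w where w: "w : mod_hom K (kmod iB (prodm F)) (kmod iB N)" "!!y. y : carrier N ==> w (g y) = y"
  using retr[OF kmod_module[OF a.cring_K b.hom_\<iota> N] kmod_module[OF a.cring_K b.hom_\<iota> PF] mod_hom_kmod[OF g b.hom_\<iota>]] ginj by auto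
 obtain J where J: "J : mod_hom K (kmod iT ?C) (kmod iT (TM L N))"
  "!!x y. x : carrier (prodm E) ==> y : carrier (prodm F) ==> J (?t x y) = tns K (kmod iA L) (kmod iB N) (u x) (w y)"
  using r.Ck.lin_map[OF Zk.tensor_lin_axioms u(1) w(1), unfolded kmod_simps] by blast
 have Jj: "J (j z) = z" if "z : carrier (TM L N)" for z
 proof -
  have "z : carrier (kmod iT (TM L N))" using that by simp
  then show ?thesis
  proof (induction z rule: Zk.tensor_induct)
   case (pure x y) then show ?case using j(2) J(2) mod_homD(1)[OF f] mod_homD(1)[OF g] u(2) w(2) by simp
  next
   case (add z z') then show ?case using mod_homD(2)[OF jk, of z z'] mod_homD(2)[OF J(1), of "j z" "j z'"] mod_homD(1)[OF jk] by simp
  qed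
 qed
 have j0: "z = 0[TM L N]" if "z : carrier (TM L N)" "j z = 0[?C]" for z
  using Jj[OF that(1)] that(2) mod_hom_zero[OF J(1) r.Ck.Z.module_axioms Zk.Z.module_axioms] by simp
 \<comment> \<open>The cocycles of degree 0 are spanned by tensors of cocycles of degree 0, and
   those are the images of \<open>L\<close> and \<open>N\<close>.\<close>
 have jim: "j ` carrier (TM L N) = k0.Zn 0"
 proof
  have "j z : k0.Zn 0" if "z : carrier (TM L N)" for z
  proof -
   have "z : carrier (kmod iT (TM L N))" using that by simp
   then show ?thesis
   proof (induction z rule: Zk.tensor_induct)
    case (pure x y) then show ?case using j(2) k0.pure_cocycle[of "f x" 0 "g y" 0 0] fim gim by simp
   next
    case (add z z')
    then have "j (z +[kmod iT (TM L N)] z') = j z +[?C] j z'" "D (j z +[?C] j z') = D (j z) +[?C] D (j z')"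
     using mod_homD(2)[OF jk] mod_homD(1)[OF jk] mod_homD(2)[OF D] by simp_all
    then show ?case using add(3,4) r.CC_add[OF nil, of "j z" 0 "j z'"] unfolding Zn0 by simp
   qed
  qed
  then show "j ` carrier (TM L N) <= k0.Zn 0" by blast
  have "submodule (carrier (kmod iT (TM L N))) K (kmod iT (TM L N))"
   by (rule Zk.Z.submoduleI'[OF subset_refl Zk.Z.zero_closed Zk.Z.add.m_closed Zk.Z.smult_closed])
  from submodule_mod_hom_image[OF jk Zk.Z.module_axioms r.Ck.Z.module_axioms this]
  have sj: "submodule (j ` carrier (TM L N)) K (kmod iT ?C)" by simp
  have "?t x y : j ` carrier (TM L N)" if "x : f ` carrier L" "y : g ` carrier N" for x y
  proof -
   obtain l n where ln: "l : carrier L" "n : carrier N" "x = f l" "y = g n" using \<open>x : f ` carrier L\<close> \<open>y : g ` carrier N\<close> by blast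
   show ?thesis unfolding ln(3,4) j(2)[OF ln(1,2), symmetric] using Zk.pure_closed[unfolded kmod_simps, OF ln(1,2)] by (rule imageI)
  qed
  then show "k0.Zn 0 <= j ` carrier (TM L N)"
   using k0.kunneth_exact(2)[OF l l'] r.Ck.Z.gen_submodule_minimal[OF sj, of "{?t x y | x y. x : f ` carrier L \<and> y : g ` carrier N}"]
   unfolding fim gim by blast
 qed
 have Z0: "{x : carrier (U (Suc 0)). du (Suc 0) x = 0[U (Suc (Suc 0))]} = j ` carrier (TM L N)"
  unfolding jim Zn0 by (simp add: US dS)
 \<comment> \<open>\<open>\<theta>\<close> undoes \<open>j\<close> and then applies the augmentation
   of the resolution chosen for the tensor module.\<close>
 obtain \<theta> where \<theta>: "\<theta> : mod_hom TR (?C\<lparr>carrier := j ` carrier (TM L N)\<rparr>) (I 0)" "!!z. z : carrier (TM L N) ==> \<theta> (j z) = \<eta>I z"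
  using hom_factor[OF mLN C.module_axioms cplxD(1)[OF cI(1), of 0] j(1) \<eta>I(1)] j0 mod_hom_zero[OF \<eta>I(1) mLN cplxD(1)[OF cI(1)]] by blast
 have \<theta>k: "\<theta> x = 0[I 0] \<longleftrightarrow> x : du 0 ` carrier (U 0)" if x: "x : carrier (U (Suc 0))" "du (Suc 0) x = 0[U (Suc (Suc 0))]" for x
 proof -
  have "x : j ` carrier (TM L N)" unfolding Z0[symmetric] by (rule CollectI) (rule conjI x)+
  then obtain z where z: "z : carrier (TM L N)" "x = j z" by blast
  have "\<theta> x = 0[I 0] \<longleftrightarrow> z = 0[TM L N]"
   using inj_on_eq_iff[OF \<eta>I(2) z(1) Zk.Z.zero_closed[unfolded kmod_simps]] unfolding mod_hom_zero[OF \<eta>I(1) mLN cplxD(1)[OF cI(1)]] z(2) \<theta>(2)[OF z(1)] .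
  also have "\<dots> \<longleftrightarrow> x = 0[?C]" unfolding z(2) by (rule iffI, simp add: mod_hom_zero[OF j(1) mLN C.module_axioms], rule j0[OF z(1)])
  finally show ?thesis by (simp add: d0 U0)
 qed
 have \<theta>im: "\<theta> ` {x : carrier (U (Suc 0)). du (Suc 0) x = 0[U (Suc (Suc 0))]} = {x : carrier (I 0). dI 0 x = 0[I (Suc 0)]}"
  unfolding Z0 \<eta>I(3)[symmetric] image_image by (rule image_cong[OF refl \<theta>(2)])
 have \<theta>h: "\<theta> : mod_hom TR (U (Suc 0)\<lparr>carrier := {x : carrier (U (Suc 0)). du (Suc 0) x = 0[U (Suc (Suc 0))]}\<rparr>) (I 0)"
  unfolding Z0 unfolding US using \<theta>(1) by simp
 have torsU: "tors TR zs (U (Suc k)) = r.CC xs ys k" for k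
  unfolding US zs_def tors_restrict[OF CCc] by (rule r.tors_CC[OF a.zs_carrier b.zs_carrier])
 have Zk': "tors_cocycles TR zs U du (Suc i) = k.Zn i"
  unfolding tors_cocycles_def torsU k.Zn_def C1 by (simp add: US dS)
 \<comment> \<open>In degree 0 of the tensor complex the boundaries are the image of the zero module
   in front, which agrees with the convention \<open>{0}\<close>.\<close>
 have Bk: "tors_bdry TR zs U du (Suc i) = k.Bn i"
 proof (cases i)
  case 0
  have "0[?C] : tors TR zs (U 0)" unfolding U0 using C.sub_zero[OF C.tors_submodule[OF t.zs_carrier]] by simp
  then show ?thesis unfolding tors_bdry_def k.Bn_def 0 by (auto simp: d0)
 next
  case (Suc j) then show ?thesis unfolding tors_bdry_def k.Bn_def C1 by (simp add: torsU dS)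
 qed
 have ZB: "k.Zn i <= r.CC [] [] i" "k.Bn i <= r.CC [] [] i"
 proof -
  have c: "r.CC xs ys k <= r.CC [] [] k" for k using r.tors_CC[OF a.zs_carrier b.zs_carrier, of k] by blast
  then show "k.Zn i <= r.CC [] [] i" unfolding k.Zn_def C1 by blast
  show "k.Bn i <= r.CC [] [] i" unfolding k.Bn_def C1 using c DC r.CC_zero[OF nil] by (cases i) auto
 qed
 have lA: "fin_gen_module A (local_cohomology A m L p) \<longleftrightarrow> fdq K (kmod iA (E p)) (tors_cocycles A xs E dE p) (tors_bdry A xs E dE p)" for p
  by (rule local_cohomology_fin_gen_iff[OF field_K a.hom_\<iota> a.noeth L a.zs_carrier a.I_gen a.residue eE])
 have lB: "fin_gen_module B (local_cohomology B n N q) \<longleftrightarrow> fdq K (kmod iB (F q)) (tors_cocycles B ys F dF q) (tors_bdry B ys F dF q)" for q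
  by (rule local_cohomology_fin_gen_iff[OF field_K b.hom_\<iota> b.noeth N b.zs_carrier b.I_gen b.residue eF])
 have "fin_gen_module TR (local_cohomology TR M (TM L N) i) \<longleftrightarrow> fdq K (kmod iT (I i)) (tors_cocycles TR zs I dI i) (tors_bdry TR zs I dI i)"
  by (rule local_cohomology_fin_gen_iff[OF field_K iT_hom NT mLN t.zs_carrier t.I_gen t.residue eI])
 also have "\<dots> \<longleftrightarrow> fdq K (kmod iT (U (Suc i))) (tors_cocycles TR zs U du (Suc i)) (tors_bdry TR zs U du (Suc i))"
  by (rule comparison_cohomology(2)[OF NT t.zs_carrier cU gU _ ex2 cI(1,2,3) \<theta>h \<theta>k \<theta>im a.cring_K iT_hom, symmetric]) (simp_all add: U0)
 also have "\<dots> \<longleftrightarrow> fdq K (kmod iT ?C) (k.Zn i) (k.Bn i)"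
  unfolding Zk' Bk US kmod_simps by (rule fdq_restrict[OF r.Ck.Z.module_axioms r.CC_ksub[OF nil] ZB])
 also have "\<dots> \<longleftrightarrow> (\<forall>p q. p + q = i --> (\<not> lc_zero B ys N q --> fin_gen_module A (local_cohomology A m L p)) \<and>
   (\<not> lc_zero A xs L p --> fin_gen_module B (local_cohomology B n N q)))"
  unfolding k.kunneth_fdq a.graded_invariants[OF cE(1) k.G.gsplit_axioms] b.graded_invariants[OF cF(1) k.H.gsplit_axioms] vE vF lA lB ..
 finally show ?thesis unfolding M_def .
qed

section \<open>The finiteness dimension of a tensor product\<close>

text \<open>Least elements add up. If one of the two sets is empty, so is the set of sums, and both
  sides are infinite.\<close>

lemma enat_Inf_add:
 "Inf {enat i | i. P i} + Inf {enat j | j. Q j} = Inf {enat k | k. \<exists>i j. i + j = k \<and> P i \<and> Q j}" (is "?p + ?q = ?r")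
proof (cases "(\<exists>i. P i) \<and> (\<exists>j. Q j)")
 case True
 then obtain i0 j0 where "enat i0 : {enat i | i. P i}" "enat j0 : {enat j | j. Q j}" by blast
 from wellorder_InfI[OF this(1)] wellorder_InfI[OF this(2)] obtain i j where ij: "P i" "?p = enat i" "Q j" "?q = enat j" by blast
 show ?thesis
 proof (rule antisym)
  show "?p + ?q \<le> ?r"
  proof (rule Inf_greatest)
   fix x assume "x : {enat k | k. \<exists>i j. i + j = k \<and> P i \<and> Q j}"
   then obtain a b where ab: "x = enat a + enat b" "P a" "Q b" by auto
   have "?p \<le> enat a" "?q \<le> enat b" using ab by (auto intro!: Inf_lower)
   then show "?p + ?q \<le> x" unfolding ab(1) by (rule add_mono)
  qed
  have "enat (i + j) : {enat k | k. \<exists>i j. i + j = k \<and> P i \<and> Q j}" using ij by blast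
  then show "?r \<le> ?p + ?q" unfolding ij(2,4) plus_enat_simps by (rule Inf_lower)
 qed
next
 case False
 then have "?p = \<infinity> \<or> ?q = \<infinity>" "?r = \<infinity>" by (auto simp: Inf_enat_def)
 then show ?thesis by auto
qed

theorem corollary3p3:
  fixes K :: "('k, 'r) ring_scheme"
    and A :: "('k, 'a, 'x) module_scheme"
    and B :: "('k, 'b, 'y) module_scheme"
    and L :: "('a, 'l, 'v) module_scheme"
    and N :: "('b, 'n, 'w) module_scheme"
    and \<mm> :: "'a set" and \<nn> :: "'b set"
  assumes "field K"
    and "algebra K A" and "algebra K B"
    and "noetherian_ring A" and "local_ring A \<mm>"
    and "noetherian_ring B" and "local_ring B \<nn>"
    and "noetherian_ring (tensor_ring K A B)"
    and "residue_field_is K A \<mm>" and "residue_field_is K B \<nn>"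
    and "algebraic_algebra K A \<or> algebraic_algebra K B"
    and "fin_gen_module A L" and "carrier L \<noteq> {\<zero>\<^bsub>L\<^esub>}"
    and "fin_gen_module B N" and "carrier N \<noteq> {\<zero>\<^bsub>N\<^esub>}"
  defines "\<MM> \<equiv> tensor_image K A B \<mm> (carrier B) <+>\<^bsub>tensor_ring K A B\<^esub> tensor_image K A B (carrier A) \<nn>"
  shows "finiteness_dim (tensor_ring K A B) \<MM> (tensor_module K A B L N) =
    min (depth A \<mm> L + finiteness_dim B \<nn> N) (finiteness_dim A \<mm> L + depth B \<nn> N)"
proof -
 interpret tensor_algebras K A B
  using assms(1-3,8) by (intro tensor_algebras.intro) (simp_all add: noetherian_ring_def)
 obtain xs where a: "aug_algebra K A iA xs \<mm>" using local_algebra_aug[OF assms(1,2,4,5,9)] by blast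
 obtain ys where b: "aug_algebra K B iB ys \<nn>" using local_algebra_aug[OF assms(1,3,6,7,10)] by blast
 have m: "module A L" "module B N" using assms(12,14) unfolding fin_gen_module_def by auto
 define fL fN zL zN where "fL p = fin_gen_module A (local_cohomology A \<mm> L p)" and "fN q = fin_gen_module B (local_cohomology B \<nn> N q)"
  and "zL = lc_zero A xs L" and "zN = lc_zero B ys N" for p q
 \<comment> \<open>Negating the criterion of \<open>local_cohomology_tensor\<close>: degree
   \<open>i\<close> belongs to the set iff \<open>i = p + q\<close>, where one module has infinite
   and the other nonzero local cohomology. The infimum of the union is the minimum of two infima,
   each of which splits into a finiteness dimension and, by \<open>depth_eq\<close>, a
   depth.\<close>
 have "{enat i | i. \<not> fin_gen_module TR (local_cohomology TR \<MM> (TM L N) i)} =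
   {enat i | i. \<exists>p q. p + q = i \<and> \<not> zL p \<and> \<not> fN q} \<union> {enat i | i. \<exists>p q. p + q = i \<and> \<not> fL p \<and> \<not> zN q}"
  unfolding \<MM>_def local_cohomology_tensor[OF a b assms(8) m] fL_def[symmetric] fN_def[symmetric] zL_def[symmetric] zN_def[symmetric] by blast
 then have "finiteness_dim TR \<MM> (TM L N) = min (Inf {enat i | i. \<exists>p q. p + q = i \<and> \<not> zL p \<and> \<not> fN q}) (Inf {enat i | i. \<exists>p q. p + q = i \<and> \<not> fL p \<and> \<not> zN q})"
  unfolding finiteness_dim_def by (simp only: Inf_union_distrib inf_min)
 then show ?thesis
  unfolding enat_Inf_add[symmetric] aug_algebra.depth_eq[OF a assms(5,12,13)] aug_algebra.depth_eq[OF b assms(7,14,15)]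
   finiteness_dim_def[of A] finiteness_dim_def[of B] zL_def zN_def fL_def fN_def .
qed

end
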